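(* Let $\mathfrak{g}$ be a diconnected, non-circular finite oriented graph, let $Y \subset X_{\mathfrak{g}}$ be a non-empty clopen subset, and let $P$ be a finite set of primes. Then there exists a t.d.l.c. completion $\varphi \colon \mathcal{F}(\mathcal{G}_{\mathfrak{g}}|_Y) \to G$ of the topological full group $\mathcal{F}(\mathcal{G}_{\mathfrak{g}}|_Y)$ such that for every compact open subgroup $U \leq G$ one has $\operatorname{lpc}(G)=\operatorname{lpc}([\varphi^{-1}(U)])=P$. More precisely, there exist a tree $\mathcal{T}$ with a colouring structure $\mathscr{C}=(L,\ell,\mathcal{D},\operatorname{ccol})$ such that $\mathcal{F}(\mathcal{G}_{\mathfrak{g}}|_Y)\cong V_{\mathscr{C}}$, and a patterning $\mathscr{P}=(L,\ell,\mathcal{D},\operatorname{ccol},\mathscr{F})$, $\mathscr{F}=\{F_l \mid l\in L\}$, such that $P$ is the set of prime divisors of $\prod_{l\in L} |F_l|$.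
   Context: **Graphs and shifts.** A graph is a pair $\mathfrak{g}=(\mathfrak{v},\mathfrak{e})$ with maps $o,t\colon \mathfrak{e}\to\mathfrak{v}$ (origin, terminus); all graphs are oriented, and multiple edges and loops are allowed. The adjacency matrix $M_{\mathfrak{g}}$ has entries $M_{\mathfrak g}(v,w)=|\{e\in\mathfrak{e}\mid o(e)=v,\ t(e)=w\}|$. A finite graph is diconnected if for all $v,w\in\mathfrak{v}$ there is $n>0$ with $M_{\mathfrak{g}}^n(v,w)\neq 0$; it is non-circular if $M_{\mathfrak{g}}$ is not a permutation matrix. Let $X_{\mathfrak{g}}=\{(e_k)\in\mathfrak{e}^{\mathbb{N}}\mid \forall k\colon o(e_{k+1})=t(e_k)\}$, a closed subset of $\mathfrak{e}^{\mathbb N}$ (product topology), and $\sigma\colon X_{\mathfrak{g}}\to X_{\mathfrak{g}}$, $\sigma(e)_k=e_{k+1}$ (the one-sided irreducible shift of finite type). **Groupoid.** The groupoid $\mathcal{G}_{\mathfrak{g}}$ has object space $X_{\mathfrak{g}}$ and morphism space $\{(x,n-m,y)\in X_{\mathfrak g}\times\mathbb{Z}\times X_{\mathfrak g}\mid n,m\ge 0,\ \sigma^n(x)=\sigma^m(y)\}$, with topology generated by the sets $\{(x,n-m,y)\mid x\in U,\,y\in V,\,\sigma^n(x)=\sigma^m(y)\}$ for $U,V$ clopen and fixed $n,m$. Source $s$ is projection to the last factor, range $r$ projection to the first factor, and the product is $(x,a,y)(y,b,z)=(x,a+b,z)$. For clopen $Y\subset X_{\mathfrak{g}}$, $\mathcal{G}_{\mathfrak{g}}|_Y$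 is the full subgroupoid with object set $Y$ (subspace topologies). A bisection of an étale groupoid $\mathcal{G}$ is a clopen set $U$ of morphisms such that $s|_U$ and $r|_U$ are homeomorphisms onto the object space $\mathcal{G}^{(0)}$. The topological full group is $\mathcal{F}(\mathcal{G})=\{r\circ(s|_U)^{-1}\in\operatorname{Homeo}(\mathcal{G}^{(0)})\mid U \text{ bisection}\}$, here regarded as a discrete group. **Completions.** A completion of a (topological) group $H$ is a locally compact group $G$ together with a (continuous) homomorphism $f\colon H\to G$ with dense image. It is t.d.l.c. if $G$ is a totally disconnected locally compact group. **Local prime content.** Two subgroups of a group are commensurate if their intersection has finite index in both; $[K]$ is the set of all subgroups commensurate to $K$; $K$ is commensurated in $H$ if it is commensurate to each of its $H$-conjugates. For a t.d.l.c. group $G$, $\operatorname{lpc}(G)$ is the set of primes $p$ such that every compact open $U\le G$ has an open subgroup $V\le U$ with $p\mid [U:V]$. For a commensurated subgroup $K$ of $H$, $\operatorname{lpc}([K])$ is the set of primes $p$ such that for every $L\in[K]$ there is $L'\in[K]$ with $L'\le L$ and $p\mid[L:L']$. **Trees and almost automorphisms.** Let $\mathcal{T}=(\mathcal{V},\mathcal{E})$ be a locally finite tree with root $v_0$, edges oriented away from the root (so $t(e)$ is a child of $o(e)$). A finite subtree $T$ is complete if it contains $v_0$ and for each of its vertices contains all or none of its children. $\mathcal{L}T$ denotes the set of leaves (vertices without children in $T$), $\mathcal{T}_v$ the subtree of all descendants of $v$ (rooted at $v$), and $\mathcal{T}\setminus T:=\bigsqcup_{v\in\mathcal{L}T}\mathcal{T}_v$.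 An honest almost automorphism is a forest isomorphism $\varphi\colon\mathcal{T}\setminus T_1\to\mathcal{T}\setminus T_2$ with $T_1,T_2$ finite complete. Two of them, with domains $\mathcal{T}\setminus T_1$ and $\mathcal{T}\setminus T_1'$, are equivalent if they coincide on $\mathcal{T}\setminus T$ for some finite complete $T\supset T_1\cup T_1'$. The equivalence classes are the almost automorphisms; they form a group $\operatorname{AAut}(\mathcal{T})$ under composition of suitable representatives. **Colouring structures.** A colouring structure $\mathscr{C}=(L,\ell,\mathcal{D},\operatorname{ccol})$ on $\mathcal{T}$ consists of: a finite set $L$ of labels; a labelling $\ell\colon\mathcal{V}\setminus\{v_0\}\to L$ such that for $\ell(v)=\ell(w)$ there is a label-preserving bijection between the children of $v$ and the children of $w$, and such that for each $l\in L$ the set $\ell^{-1}(l)$ is not contained in any proper subtree of $\mathcal{T}$; a family $\mathcal{D}=\{D_{l,l'}\mid l,l'\in L\}$ of pairwise disjoint finite sets (colours), $|D_{l,l'}|$ being the number of children with label $l'$ of any vertex with label $l$; and a map $\operatorname{ccol}\colon\mathcal{E}\setminus o^{-1}(v_0)\to\bigsqcup_{l,l'}D_{l,l'}$ which for every $v\neq v_0$ with $\ell(v)=l$ and every $l'$ restricts to a bijection $\{e\in\mathcal{E}\mid o(e)=v,\ \ell(t(e))=l'\}\to D_{l,l'}$. Put $D_l=\bigsqcup_{l'}D_{l,l'}$. $V_{\mathscr{C}}\le\operatorname{AAut}(\mathcal{T})$ is the group of almost automorphisms having a representative $\varphi\colon\mathcal{T}\setminus T_1\to\mathcal{T}\setminus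 T_2$ (with $T_1,T_2\neq\{v_0\}$) with $\operatorname{ccol}(\varphi(e))=\operatorname{ccol}(e)$ for every edge $e$ of $\mathcal{T}\setminus T_1$. A patterning $\mathscr{P}=(L,\ell,\mathcal{D},\operatorname{ccol},\mathscr{F})$ is a colouring structure together with permutation groups $\mathscr{F}=\{F_l\le\operatorname{Sym}(D_l)\mid l\in L\}$, each $F_l$ preserving every part $D_{l,l'}$ of $D_l$. *)

theory Defs
  imports
    "HOL-Analysis.Analysis"
    "HOL-Algebra.Bij"
    "HOL-Algebra.Coset"
    "HOL-Computational_Algebra.Primes"
    "Graph_Theory.Digraph"
    "Graph_Theory.Digraph_Component"
    "Graph_Theory.Pair_Digraph"
begin

text \<open>
  A finite oriented graph is an \<open>('v, 'e) pre_digraph\<close> satisfying the locale predicate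
  \<open>fin_digraph\<close>: parallel arcs and loops are allowed, \<open>tail\<close> is the origin and \<open>head\<close> the
  terminus.
\<close>

section \<open>Graphs and their shifts\<close>

definition adj :: "('v, 'e) pre_digraph \<Rightarrow> 'v \<Rightarrow> 'v \<Rightarrow> nat" where
  "adj g v w = card {e \<in> arcs g. tail g e = v \<and> head g e = w}"

text \<open>The powers of the \<open>verts g\<close>-indexed matrix \<open>adj g\<close>.\<close>

primrec adj_pow :: "('v, 'e) pre_digraph \<Rightarrow> nat \<Rightarrow> 'v \<Rightarrow> 'v \<Rightarrow> nat" where
  "adj_pow g 0 v w = (if v = w then 1 else 0)"
| "adj_pow g (Suc n) v w = (\<Sum>u\<in>verts g. adj_pow g n v u * adj g u w)"

definition diconnected :: "('v, 'e) pre_digraph \<Rightarrow> bool" where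
  "diconnected g \<longleftrightarrow> (\<forall>v\<in>verts g. \<forall>w\<in>verts g. \<exists>n>0. adj_pow g n v w \<noteq> 0)"

definition permutation_matrix_on :: "'v set \<Rightarrow> ('v \<Rightarrow> 'v \<Rightarrow> nat) \<Rightarrow> bool" where
  "permutation_matrix_on I M \<longleftrightarrow>
    (\<exists>\<pi>. bij_betw \<pi> I I \<and> (\<forall>v\<in>I. \<forall>w\<in>I. M v w = (if w = \<pi> v then 1 else 0)))"

definition non_circular :: "('v, 'e) pre_digraph \<Rightarrow> bool" where
  "non_circular g \<longleftrightarrow> \<not> permutation_matrix_on (verts g) (adj g)"

definition shift_space :: "('v, 'e) pre_digraph \<Rightarrow> (nat \<Rightarrow> 'e) set" where
  "shift_space g = {x. (\<forall>k. x k \<in> arcs g) \<and> (\<forall>k. tail g (x (Suc k)) = head g (x k))}"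

definition shift_top :: "('v, 'e) pre_digraph \<Rightarrow> (nat \<Rightarrow> 'e) topology" where
  "shift_top g =
    subtopology (product_topology (\<lambda>_. discrete_topology (arcs g)) UNIV) (shift_space g)"

definition shift :: "(nat \<Rightarrow> 'e) \<Rightarrow> nat \<Rightarrow> 'e" where
  "shift x = (\<lambda>k. x (Suc k))"

definition clopenin :: "'a topology \<Rightarrow> 'a set \<Rightarrow> bool" where
  "clopenin X S \<longleftrightarrow> openin X S \<and> closedin X S"


section \<open>Topological groupoids and topological full groups\<close>

text \<open>
  The product is only meaningful on composable pairs, that is on pairs \<open>(a, b)\<close> with
  \<open>gsource a = grange b\<close>.
\<close>

record ('o, 'm) top_groupoid =
  obj_top :: "'o topology"
  mor_top :: "'m topology"
  gsource :: "'m \<Rightarrow> 'o"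
  grange :: "'m \<Rightarrow> 'o"
  gprod :: "'m \<Rightarrow> 'm \<Rightarrow> 'm"

definition shift_groupoid_basic_open ::
  "(nat \<Rightarrow> 'e) set \<Rightarrow> nat \<Rightarrow> nat \<Rightarrow> (nat \<Rightarrow> 'e) set \<Rightarrow>
     ((nat \<Rightarrow> 'e) \<times> int \<times> (nat \<Rightarrow> 'e)) set" where
  "shift_groupoid_basic_open U n m V =
    {(x, int n - int m, y) | x y. x \<in> U \<and> y \<in> V \<and> (shift ^^ n) x = (shift ^^ m) y}"

text \<open>
  The underlying set of morphisms is \<open>topspace (mor_top _)\<close>, the union of the generating sets;
  taking \<open>U = V = shift_space g\<close> shows that it is the set of all \<open>(x, n - m, y)\<close> with
  \<open>\<sigma>\<^sup>n x = \<sigma>\<^sup>m y\<close>.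
\<close>

definition shift_groupoid ::
  "('v, 'e) pre_digraph \<Rightarrow> (nat \<Rightarrow> 'e, (nat \<Rightarrow> 'e) \<times> int \<times> (nat \<Rightarrow> 'e)) top_groupoid" where
  "shift_groupoid g =
    \<lparr> obj_top = shift_top g,
      mor_top = topology_generated_by
        {shift_groupoid_basic_open U n m V | U n m V.
           clopenin (shift_top g) U \<and> clopenin (shift_top g) V},
      gsource = (\<lambda>(x, a, y). y),
      grange = (\<lambda>(x, a, y). x),
      gprod = (\<lambda>(x, a, y) (y', b, z). (x, a + b, z)) \<rparr>"

definition groupoid_restrict :: "('o, 'm) top_groupoid \<Rightarrow> 'o set \<Rightarrow> ('o, 'm) top_groupoid" where
  "groupoid_restrict \<G> Y =
    \<G>\<lparr> obj_top := subtopology (obj_top \<G>) Y,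
       mor_top := subtopology (mor_top \<G>) {a. gsource \<G> a \<in> Y \<and> grange \<G> a \<in> Y} \<rparr>"

definition bisection :: "('o, 'm) top_groupoid \<Rightarrow> 'm set \<Rightarrow> bool" where
  "bisection \<G> U \<longleftrightarrow>
    clopenin (mor_top \<G>) U \<and>
    homeomorphic_map (subtopology (mor_top \<G>) U) (obj_top \<G>) (gsource \<G>) \<and>
    homeomorphic_map (subtopology (mor_top \<G>) U) (obj_top \<G>) (grange \<G>)"

text \<open>
  Homeomorphisms of the object space are represented as extensional functions, as in
  \<open>BijGroup\<close>, from which the group operation (composition) is inherited.
\<close>

definition full_group :: "('o, 'm) top_groupoid \<Rightarrow> ('o \<Rightarrow> 'o) monoid" where
  "full_group \<G> =
    (BijGroup (topspace (obj_top \<G>)))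
      \<lparr>carrier := {restrict (grange \<G> \<circ> inv_into U (gsource \<G>)) (topspace (obj_top \<G>)) | U.
                    bisection \<G> U}\<rparr>"


section \<open>Topological groups and completions\<close>

definition topological_group :: "('a, 'b) monoid_scheme \<Rightarrow> 'a topology \<Rightarrow> bool" where
  "topological_group G T \<longleftrightarrow>
    group G \<and> topspace T = carrier G \<and>
    continuous_map (prod_topology T T) T (\<lambda>(x, y). x \<otimes>\<^bsub>G\<^esub> y) \<and>
    continuous_map T T (\<lambda>x. inv\<^bsub>G\<^esub> x)"

definition locally_compact_group :: "('a, 'b) monoid_scheme \<Rightarrow> 'a topology \<Rightarrow> bool" where
  "locally_compact_group G T \<longleftrightarrow>
    topological_group G T \<and> Hausdorff_space T \<and> locally_compact_space T"

definition totally_disconnected_space :: "'a topology \<Rightarrow> bool" where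
  "totally_disconnected_space T \<longleftrightarrow> (\<forall>S. connectedin T S \<longrightarrow> (\<exists>x. S \<subseteq> {x}))"

definition tdlc_group :: "('a, 'b) monoid_scheme \<Rightarrow> 'a topology \<Rightarrow> bool" where
  "tdlc_group G T \<longleftrightarrow> locally_compact_group G T \<and> totally_disconnected_space T"

definition completion ::
  "('h, 'c) monoid_scheme \<Rightarrow> 'h topology \<Rightarrow> ('g, 'd) monoid_scheme \<Rightarrow> 'g topology \<Rightarrow>
     ('h \<Rightarrow> 'g) \<Rightarrow> bool" where
  "completion H TH G TG f \<longleftrightarrow>
    topological_group H TH \<and> locally_compact_group G TG \<and>
    f \<in> hom H G \<and> continuous_map TH TG f \<and>
    TG closure_of (f ` carrier H) = carrier G"

definition tdlc_completion ::
  "('h, 'c) monoid_scheme \<Rightarrow> 'h topology \<Rightarrow> ('g, 'd) monoid_scheme \<Rightarrow> 'g topology \<Rightarrow>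
     ('h \<Rightarrow> 'g) \<Rightarrow> bool" where
  "tdlc_completion H TH G TG f \<longleftrightarrow> completion H TH G TG f \<and> tdlc_group G TG"


section \<open>Local prime content\<close>

definition cosets_in :: "('a, 'b) monoid_scheme \<Rightarrow> 'a set \<Rightarrow> 'a set \<Rightarrow> 'a set set" where
  "cosets_in G K L = rcosets\<^bsub>G\<lparr>carrier := K\<rparr>\<^esub> L"

text \<open>
  The index \<open>[K : L]\<close> of a subgroup \<open>L \<le> K\<close>, with value 0 if it is infinite. It is only used
  below where it is finite: for open subgroups of compact groups and for nested commensurate
  subgroups.
\<close>

definition index :: "('a, 'b) monoid_scheme \<Rightarrow> 'a set \<Rightarrow> 'a set \<Rightarrow> nat" where
  "index G K L = card (cosets_in G K L)"

definition commensurate :: "('a, 'b) monoid_scheme \<Rightarrow> 'a set \<Rightarrow> 'a set \<Rightarrow> bool" where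
  "commensurate H K L \<longleftrightarrow> finite (cosets_in H K (K \<inter> L)) \<and> finite (cosets_in H L (K \<inter> L))"

definition commens_class :: "('a, 'b) monoid_scheme \<Rightarrow> 'a set \<Rightarrow> 'a set set" where
  "commens_class H K = {L. subgroup L H \<and> commensurate H K L}"

definition commensurated :: "('a, 'b) monoid_scheme \<Rightarrow> 'a set \<Rightarrow> bool" where
  "commensurated H K \<longleftrightarrow>
    subgroup K H \<and> (\<forall>h\<in>carrier H. commensurate H K (h <#\<^bsub>H\<^esub> K #>\<^bsub>H\<^esub> inv\<^bsub>H\<^esub> h))"

definition compact_open_subgroup ::
  "('a, 'b) monoid_scheme \<Rightarrow> 'a topology \<Rightarrow> 'a set \<Rightarrow> bool" where
  "compact_open_subgroup G T U \<longleftrightarrow> subgroup U G \<and> compactin T U \<and> openin T U"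

definition lpc :: "('a, 'b) monoid_scheme \<Rightarrow> 'a topology \<Rightarrow> nat set" where
  "lpc G T = {p. prime p \<and>
    (\<forall>U. compact_open_subgroup G T U \<longrightarrow>
      (\<exists>V. subgroup V G \<and> openin T V \<and> V \<subseteq> U \<and> p dvd index G U V))}"

definition lpc_class :: "('a, 'b) monoid_scheme \<Rightarrow> 'a set set \<Rightarrow> nat set" where
  "lpc_class H \<K> = {p. prime p \<and>
    (\<forall>L\<in>\<K>. \<exists>L'\<in>\<K>. L' \<subseteq> L \<and> p dvd index H L L')}"


section \<open>Rooted trees and almost automorphisms\<close>

text \<open>
  A tree whose edges are oriented away from its root, as a digraph without parallel arcs: every
  vertex is the endpoint of exactly one directed walk starting at the root.
\<close>

definition rooted_tree :: "'n pair_pre_digraph \<Rightarrow> 'n \<Rightarrow> bool" where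
  "rooted_tree T v0 \<longleftrightarrow>
    wf_digraph (with_proj T) \<and> v0 \<in> pverts T \<and>
    (\<forall>v\<in>pverts T. \<exists>!p. pre_digraph.awalk (with_proj T) v0 p v)"

definition children :: "'n pair_pre_digraph \<Rightarrow> 'n \<Rightarrow> 'n set" where
  "children T v = {w. (v, w) \<in> parcs T}"

definition locally_finite_tree :: "'n pair_pre_digraph \<Rightarrow> 'n \<Rightarrow> bool" where
  "locally_finite_tree T v0 \<longleftrightarrow> rooted_tree T v0 \<and> (\<forall>v\<in>pverts T. finite (children T v))"

text \<open>
  A subtree is given by its vertex set, which is non-empty and spans a connected subgraph of the
  underlying unoriented graph; it need not contain the root.
\<close>

definition subtree :: "'n pair_pre_digraph \<Rightarrow> 'n set \<Rightarrow> bool" where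
  "subtree T S \<longleftrightarrow> S \<subseteq> pverts T \<and> Digraph_Component.connected (with_proj T \<restriction> S)"

definition complete_subtree :: "'n pair_pre_digraph \<Rightarrow> 'n \<Rightarrow> 'n set \<Rightarrow> bool" where
  "complete_subtree T v0 S \<longleftrightarrow>
    subtree T S \<and> finite S \<and> v0 \<in> S \<and>
    (\<forall>v\<in>S. children T v \<subseteq> S \<or> children T v \<inter> S = {})"

definition leaves :: "'n pair_pre_digraph \<Rightarrow> 'n set \<Rightarrow> 'n set" where
  "leaves T S = {v \<in> S. children T v \<inter> S = {}}"

definition descendants :: "'n pair_pre_digraph \<Rightarrow> 'n \<Rightarrow> 'n set" where
  "descendants T v = {w. v \<rightarrow>\<^sup>*\<^bsub>with_proj T\<^esub> w}"

text \<open>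
  The vertex set of the forest \<open>\<T> \<setminus> S\<close>, which contains the leaves of \<open>S\<close>. Its edges are the
  edges of \<open>\<T>\<close> between these vertices, since the trees below distinct leaves are disjoint and
  closed under passing to children.
\<close>

definition forest_verts :: "'n pair_pre_digraph \<Rightarrow> 'n set \<Rightarrow> 'n set" where
  "forest_verts T S = (\<Union>v\<in>leaves T S. descendants T v)"

definition forest_edges :: "'n pair_pre_digraph \<Rightarrow> 'n set \<Rightarrow> ('n \<times> 'n) set" where
  "forest_edges T S = {(u, v) \<in> parcs T. u \<in> forest_verts T S \<and> v \<in> forest_verts T S}"

definition honest_aaut ::
  "'n pair_pre_digraph \<Rightarrow> 'n \<Rightarrow> 'n set \<Rightarrow> 'n set \<Rightarrow> ('n \<rightharpoonup> 'n) \<Rightarrow> bool" where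
  "honest_aaut T v0 S1 S2 \<phi> \<longleftrightarrow>
    complete_subtree T v0 S1 \<and> complete_subtree T v0 S2 \<and>
    dom \<phi> = forest_verts T S1 \<and>
    bij_betw (the \<circ> \<phi>) (forest_verts T S1) (forest_verts T S2) \<and>
    (\<forall>u\<in>forest_verts T S1. \<forall>v\<in>forest_verts T S1.
       (u, v) \<in> forest_edges T S1 \<longleftrightarrow> (the (\<phi> u), the (\<phi> v)) \<in> forest_edges T S2)"

definition aaut_rel :: "'n pair_pre_digraph \<Rightarrow> 'n \<Rightarrow> ('n \<rightharpoonup> 'n) rel" where
  "aaut_rel T v0 = {(\<phi>, \<psi>). \<exists>S1 S2 S1' S2' S.
     honest_aaut T v0 S1 S2 \<phi> \<and> honest_aaut T v0 S1' S2' \<psi> \<and>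
     complete_subtree T v0 S \<and> S1 \<union> S1' \<subseteq> S \<and>
     (\<forall>v\<in>forest_verts T S. \<phi> v = \<psi> v)}"

text \<open>
  Classes are multiplied by composing representatives whose domain and image match; \<open>A\<close> is
  applied after \<open>B\<close>. The union collects the classes of all such composites, which coincide.
\<close>

definition AAut :: "'n pair_pre_digraph \<Rightarrow> 'n \<Rightarrow> ('n \<rightharpoonup> 'n) set monoid" where
  "AAut T v0 =
    \<lparr> carrier = {\<phi>. \<exists>S1 S2. honest_aaut T v0 S1 S2 \<phi>} // aaut_rel T v0,
      mult = (\<lambda>A B. \<Union> {aaut_rel T v0 `` {\<phi> \<circ>\<^sub>m \<psi>} | \<phi> \<psi>.
                         \<phi> \<in> A \<and> \<psi> \<in> B \<and> ran \<psi> = dom \<phi>}),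
      one = aaut_rel T v0 `` {Some |` pverts T} \<rparr>"


section \<open>Colouring structures and patternings\<close>

record ('n, 'l, 'c) colouring =
  labels :: "'l set"
  lab :: "'n \<Rightarrow> 'l"
  colours :: "'l \<Rightarrow> 'l \<Rightarrow> 'c set"
  ccol :: "'n \<times> 'n \<Rightarrow> 'c"

definition colouring_structure ::
  "'n pair_pre_digraph \<Rightarrow> 'n \<Rightarrow> ('n, 'l, 'c) colouring \<Rightarrow> bool" where
  "colouring_structure T v0 C \<longleftrightarrow>
    finite (labels C) \<and>
    lab C ` (pverts T - {v0}) \<subseteq> labels C \<and>
    (\<forall>v\<in>pverts T - {v0}. \<forall>w\<in>pverts T - {v0}. lab C v = lab C w \<longrightarrow>
       (\<exists>f. bij_betw f (children T v) (children T w) \<and>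
            (\<forall>x\<in>children T v. lab C (f x) = lab C x))) \<and>
    (\<forall>l\<in>labels C. \<nexists>S. subtree T S \<and> S \<noteq> pverts T \<and>
       {v \<in> pverts T - {v0}. lab C v = l} \<subseteq> S) \<and>
    (\<forall>l\<in>labels C. \<forall>l'\<in>labels C. finite (colours C l l')) \<and>
    disjoint_family_on (\<lambda>(l, l'). colours C l l') (labels C \<times> labels C) \<and>
    (\<forall>v\<in>pverts T - {v0}. \<forall>l'\<in>labels C.
       card (colours C (lab C v) l') = card {w \<in> children T v. lab C w = l'}) \<and>
    (\<forall>v\<in>pverts T - {v0}. \<forall>l'\<in>labels C.
       bij_betw (ccol C) {(u, w) \<in> parcs T. u = v \<and> lab C w = l'} (colours C (lab C v) l'))"

definition V_group ::
  "'n pair_pre_digraph \<Rightarrow> 'n \<Rightarrow> ('n, 'l, 'c) colouring \<Rightarrow> ('n \<rightharpoonup> 'n) set monoid" where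
  "V_group T v0 C =
    (AAut T v0)\<lparr>carrier := {A \<in> carrier (AAut T v0).
       \<exists>\<phi>\<in>A. \<exists>S1 S2. S1 \<noteq> {v0} \<and> S2 \<noteq> {v0} \<and> honest_aaut T v0 S1 S2 \<phi> \<and>
         (\<forall>(u, v)\<in>forest_edges T S1. ccol C (the (\<phi> u), the (\<phi> v)) = ccol C (u, v))}\<rparr>"

definition label_colours :: "('n, 'l, 'c) colouring \<Rightarrow> 'l \<Rightarrow> 'c set" where
  "label_colours C l = (\<Union>l'\<in>labels C. colours C l l')"

definition patterning ::
  "'n pair_pre_digraph \<Rightarrow> 'n \<Rightarrow> ('n, 'l, 'c) colouring \<Rightarrow> ('l \<Rightarrow> ('c \<Rightarrow> 'c) set) \<Rightarrow> bool" where
  "patterning T v0 C F \<longleftrightarrow>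
    colouring_structure T v0 C \<and>
    (\<forall>l\<in>labels C. subgroup (F l) (BijGroup (label_colours C l)) \<and>
       (\<forall>\<pi>\<in>F l. \<forall>l'\<in>labels C. \<pi> ` colours C l l' = colours C l l'))"

end

theory Submission
  imports Defs "HOL-Algebra.Sylow" "HOL-Algebra.Group_Action" "HOL-Algebra.Multiplicative_Group"
    "HOL-Library.Sublist" "HOL-Library.Countable_Set"
begin

text \<open>
  Let \<open>H\<close> be the topological full group and \<open>m\<close> the product of the primes in \<open>P\<close>.

  \<^emph>\<open>The group.\<close> A bisection moves a point \<open>x\<close> to a point with the same tail, and by continuity it
  does so in the same way near \<open>x\<close>. So \<open>H\<close> consists of the bijections \<open>h\<close> of \<open>Y\<close> that are prefix
  replacements near every point: \<open>h (u z) = v z\<close> for all \<open>z\<close> with \<open>u z \<in> Y\<close> (\<open>full_group_eq\<close>). By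
  compactness finitely many pairs \<open>(u, v)\<close> describe \<open>h\<close>, whence \<open>H\<close> is countable and the lengths
  of \<open>u\<close> and \<open>v\<close> are bounded (\<open>uniform_lp\<close>).

  \<^emph>\<open>Digits.\<close> A diconnected non-circular graph has two different cycles through some vertex. They
  provide \<open>m\<close> closed walks of the same length, the digits, with a common initial segment \<open>\<mu>\<close>, the
  marker, and a common final segment of the same length; moreover \<open>\<mu>\<close> does not occur in a point at
  any place inside a digit except at its start (\<open>digit_words\<close>). Therefore digits never overlap,
  and replacing a digit by another one changes no other digit.

  \<^emph>\<open>The completion.\<close> Let \<open>K \<le> H\<close> be the group of all maps that only change digits, that change
  only finitely many positions, and that change the digit at a given position by the addition of a
  residue modulo \<open>m\<close> that depends only on the preceding letters. Let \<open>K\<^sub>n \<le> K\<close> be the subgroup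
  that fixes the first \<open>n\<close> letters. Then \<open>K\<^sub>n\<close> has finite index in \<open>K\<close> (\<open>covers_Kn\<close>), and a given
  element of \<open>H\<close> conjugates \<open>K\<^sub>n\<close> into \<open>K\<close> as soon as \<open>n\<close> is large (\<open>conj_K\<close>). So \<open>K\<close> has finite
  orbits on the set of all cosets \<open>h K\<^sub>n\<close>. The closure of \<open>H\<close> in the permutation group of this
  set, with the topology of pointwise convergence, is a t.d.l.c. group in which the closure of \<open>K\<close>
  is compact and open. Its local prime content can be read off from \<open>K\<close>: the order of every
  element of \<open>K\<close> divides a power of \<open>m\<close>, so no other prime divides an index (Cauchy); and for
  \<open>p \<in> P\<close> the digit changes by multiples of \<open>m / p\<close> form an infinite group of \<open>p\<close>-power torsion,
  so every subgroup of finite index contains an element of order \<open>p\<close>, and the kernel of the action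
  of this subgroup on the finite orbit of a point that the element moves has an index divisible by
  \<open>p\<close> (\<open>lpc_completion\<close>).

  \<^emph>\<open>The tree.\<close> Besides the root, the vertices are the sufficiently long prefixes of points of \<open>Y\<close>
  that do not end with a proper initial segment of a digit that is longer than the marker. The
  label of a vertex consists of its last letters, as many as \<open>\<mu>\<close> has, and the colour of an edge
  consists of the label of its origin and of the word that is appended along the edge. As a vertex
  does not end far inside a digit, its label determines which words can be appended to it
  (\<open>sync_S\<close>), so this is a colouring structure. The colour preserving almost automorphisms are
  those that, far from the root, replace prefixes by prefixes of the same label; these are the
  elements of \<open>H\<close> (\<open>full_group_iso\<close>). Finally, a vertex that ends with the marker has the \<open>m\<close>
  remainders of the digits among its children, all with the same label. The cyclic rotations of
  their colours form a group of order \<open>m\<close>, and together with trivial groups for all other labels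
  they form the patterning (\<open>pat_card\<close>).
\<close>

section \<open>Commensuration and divisibility of indices\<close>

text \<open>
  Finitely many right cosets of \<open>M\<close> cover \<open>K\<close>. In contrast to the index this makes sense when
  neither set contains the other, it is transitive, and for subgroups it means that \<open>K \<inter> M\<close> has
  finite index in \<open>K\<close>. So it is the convenient one-sided version of commensurability.
\<close>

definition covers :: "('a, 'b) monoid_scheme \<Rightarrow> 'a set \<Rightarrow> 'a set \<Rightarrow> bool" where
  "covers G M K \<longleftrightarrow> (\<exists>R. finite R \<and> R \<subseteq> carrier G \<and> K \<subseteq> (\<Union>r\<in>R. M #>\<^bsub>G\<^esub> r))"

lemma covers_mono: "covers G M K \<Longrightarrow> M \<subseteq> M' \<Longrightarrow> K' \<subseteq> K \<Longrightarrow> covers G M' K'"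
  unfolding covers_def r_coset_def by (elim exE, rule exI) (auto, blast)

lemma cosets_in_eq: "cosets_in G K L = (\<lambda>k. L #>\<^bsub>G\<^esub> k) ` K"
  unfolding cosets_in_def RCOSETS_def r_coset_def by auto

context group
begin

lemma mult_inv_cancel:
  "x \<in> carrier G \<Longrightarrow> y \<in> carrier G \<Longrightarrow> x \<otimes> (inv x \<otimes> y) = y"
  "x \<in> carrier G \<Longrightarrow> y \<in> carrier G \<Longrightarrow> inv x \<otimes> (x \<otimes> y) = y"
  by (simp_all flip: m_assoc)

lemma covers_trans:
  assumes "covers G M K" "covers G K L" "M \<subseteq> carrier G"
  shows "covers G M L"
proof -
  obtain R S where R: "finite R" "R \<subseteq> carrier G" "K \<subseteq> (\<Union>r\<in>R. M #> r)"
    and S: "finite S" "S \<subseteq> carrier G" "L \<subseteq> (\<Union>r\<in>S. K #> r)"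
    using assms unfolding covers_def by blast
  let ?T = "(\<lambda>(r, s). r \<otimes> s) ` (R \<times> S)"
  have "L \<subseteq> (\<Union>t\<in>?T. M #> t)"
  proof
    fix l assume "l \<in> L"
    then obtain s k where s: "s \<in> S" "k \<in> K" "l = k \<otimes> s" using S(3) by (auto simp: r_coset_def)
    then obtain r m where r: "r \<in> R" "m \<in> M" "k = m \<otimes> r" using R(3) by (auto simp: r_coset_def)
    have "l = m \<otimes> (r \<otimes> s)" using s r R(2) S(2) assms(3) by (simp add: m_assoc subset_iff)
    then show "l \<in> (\<Union>t\<in>?T. M #> t)" using r s by (auto simp: r_coset_def)
  qed
  moreover have "?T \<subseteq> carrier G" using R S by auto
  ultimately show ?thesis unfolding covers_def using R(1) S(1) by (intro exI[of _ ?T]) auto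
qed

text \<open>
  If \<open>R\<close> represents the cosets, then the conjugates of the elements of \<open>R\<close> represent the
  conjugated cosets.
\<close>

lemma covers_conjugate:
  assumes "covers G M K" "M \<subseteq> carrier G" "h \<in> carrier G"
  shows "covers G (h <# M #> inv h) (h <# K #> inv h)"
proof -
  obtain R where R: "finite R" "R \<subseteq> carrier G" "K \<subseteq> (\<Union>r\<in>R. M #> r)"
    using assms unfolding covers_def by blast
  let ?R = "(\<lambda>r. h \<otimes> r \<otimes> inv h) ` R"
  have "h <# K #> inv h \<subseteq> (\<Union>t\<in>?R. (h <# M #> inv h) #> t)"
  proof
    fix l assume "l \<in> h <# K #> inv h"
    then obtain k where k: "k \<in> K" "l = h \<otimes> k \<otimes> inv h" by (auto simp: r_coset_def l_coset_def)
    then obtain r m where r: "r \<in> R" "m \<in> M" "k = m \<otimes> r" using R(3) by (auto simp: r_coset_def)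
    have mc: "m \<in> carrier G" "r \<in> carrier G" using r R(2) assms(2) by auto
    have "l = (h \<otimes> m \<otimes> inv h) \<otimes> (h \<otimes> r \<otimes> inv h)"
      using k r mc assms(3) by (simp add: m_assoc mult_inv_cancel)
    then show "l \<in> (\<Union>t\<in>?R. (h <# M #> inv h) #> t)"
      using r by (auto simp: r_coset_def l_coset_def)
  qed
  moreover have "?R \<subseteq> carrier G" using R(2) assms(3) by auto
  ultimately show ?thesis unfolding covers_def using R(1) by (intro exI[of _ ?R]) auto
qed

text \<open>
  If \<open>k\<close> and \<open>k'\<close> lie in \<open>K\<close> and in the same coset of \<open>M\<close>, then their quotient lies in
  \<open>K \<inter> M\<close>. So the elements of \<open>K\<close> in one coset of \<open>M\<close> form a coset of \<open>K \<inter> M\<close>.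
\<close>

lemma covers_iff_finite_cosets:
  assumes K: "subgroup K G" and M: "subgroup M G"
  shows "covers G M K \<longleftrightarrow> finite (cosets_in G K (K \<inter> M))"
proof
  interpret M: subgroup M G by fact
  interpret K: subgroup K G by fact
  have I: "subgroup (K \<inter> M) G" using K M subgroups_Inter_pair by blast
  assume "covers G M K"
  then obtain R where R: "finite R" "R \<subseteq> carrier G" "K \<subseteq> (\<Union>r\<in>R. M #> r)"
    unfolding covers_def by blast
  let ?c = "\<lambda>r. (K \<inter> M) #> (SOME k. k \<in> K \<and> k \<in> M #> r)"
  have "cosets_in G K (K \<inter> M) \<subseteq> ?c ` R"
  proof
    fix c assume "c \<in> cosets_in G K (K \<inter> M)"
    then obtain k where k: "k \<in> K" "c = (K \<inter> M) #> k" by (auto simp: cosets_in_eq)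
    then obtain r where r: "r \<in> R" "k \<in> M #> r" using R(3) by auto
    define k' where "k' = (SOME k. k \<in> K \<and> k \<in> M #> r)"
    have k': "k' \<in> K" "k' \<in> M #> r"
      unfolding k'_def using someI_ex[of "\<lambda>k. k \<in> K \<and> k \<in> M #> r"] k r by blast+
    have rc: "r \<in> carrier G" using r R by auto
    obtain m m' where m: "m \<in> M" "k = m \<otimes> r" "m' \<in> M" "k' = m' \<otimes> r"
      using r k' by (auto simp: r_coset_def)
    have "k \<otimes> inv k' = m \<otimes> inv m'" using m rc by (simp add: m_assoc inv_mult_group mult_inv_cancel)
    then have "k \<otimes> inv k' \<in> K \<inter> M" using k k' m by (metis IntI K.m_closed K.m_inv_closed M.m_closed M.m_inv_closed)
    moreover have "k \<otimes> inv k' \<otimes> k' = k" using k k' K.mem_carrier by (simp add: m_assoc)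
    ultimately have "k \<in> (K \<inter> M) #> k'" unfolding r_coset_def by force
    then have "c = (K \<inter> M) #> k'" using repr_independence[OF _ _ I, of k k'] k k' by simp
    then show "c \<in> ?c ` R" unfolding k'_def using r by blast
  qed
  then show "finite (cosets_in G K (K \<inter> M))" using R(1) finite_surj by blast
next
  interpret K: subgroup K G by fact
  assume "finite (cosets_in G K (K \<inter> M))"
  then obtain R where R: "finite R" "R \<subseteq> K" "cosets_in G K (K \<inter> M) = (\<lambda>k. (K \<inter> M) #> k) ` R"
    unfolding cosets_in_eq by (meson finite_subset_image order_refl)
  have "K \<subseteq> (\<Union>r\<in>R. M #> r)"
  proof
    fix k assume k: "k \<in> K"
    then have "(K \<inter> M) #> k \<in> (\<lambda>k. (K \<inter> M) #> k) ` R" using R(3) by (auto simp: cosets_in_eq)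
    moreover have "k \<in> (K \<inter> M) #> k" using k K M subgroups_Inter_pair rcos_self by simp
    ultimately obtain r where "r \<in> R" "k \<in> (K \<inter> M) #> r" by auto
    then show "k \<in> (\<Union>r\<in>R. M #> r)" by (auto simp: r_coset_def)
  qed
  then show "covers G M K" unfolding covers_def using R K.subset by (intro exI[of _ R]) auto
qed

lemma covers_refl: "subgroup K G \<Longrightarrow> covers G K K"
  unfolding covers_def by (rule exI[of _ "{\<one>}"]) (auto simp: subgroup.subset coset_mult_one)

lemma commensurate_iff_covers:
  assumes "subgroup K G" "subgroup L G"
  shows "commensurate G K L \<longleftrightarrow> covers G L K \<and> covers G K L"
  unfolding commensurate_def using covers_iff_finite_cosets[OF assms] covers_iff_finite_cosets[OF assms(2,1)]
  by (simp add: Int_commute)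

text \<open>
  Commensurability is an equivalence relation, by the transitivity of \<open>covers\<close>.
\<close>

lemma commens_class_cong:
  assumes "subgroup K G" "subgroup K' G" "covers G K K'" "covers G K' K"
  shows "commens_class G K = commens_class G K'"
proof -
  have "commensurate G K L \<longleftrightarrow> commensurate G K' L" if L: "subgroup L G" for L
    unfolding commensurate_iff_covers[OF assms(1) L] commensurate_iff_covers[OF assms(2) L]
    using covers_trans[OF _ _ subgroup.subset[OF L], of K K'] covers_trans[OF _ _ subgroup.subset[OF L], of K' K]
      covers_trans[OF assms(3) _ subgroup.subset[OF assms(1)], of L]
      covers_trans[OF assms(4) _ subgroup.subset[OF assms(2)], of L] assms(3,4)
    by blast
  then show ?thesis unfolding commens_class_def by blast
qed

text \<open>
  The element \<open>k\<close> has order exactly \<open>p\<close> in the quotient group. This is the source of all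
  divisibility statements about indices.
\<close>

lemma prime_dvd_card_rcosets_normal:
  fixes p :: nat
  assumes "N \<lhd> G" "finite (rcosets N)" "k \<in> carrier G" "k [^] p \<in> N" "k \<notin> N" "prime p"
  shows "p dvd card (rcosets N)"
proof -
  interpret N: normal N G by fact
  interpret Q: group "G Mod N" by (rule N.factorgroup_is_group)
  have h: "(\<lambda>a. N #> a) \<in> hom G (G Mod N)" by (rule N.r_coset_hom_Mod)
  have kQ: "N #> k \<in> carrier (G Mod N)" using assms by (auto simp: FactGroup_def RCOSETS_def)
  have "(N #> k) [^]\<^bsub>G Mod N\<^esub> p = N #> (k [^] p)"
    using hom_nat_pow[OF h _ is_group Q.is_group, of k p] assms by simp
  also have "\<dots> = \<one>\<^bsub>G Mod N\<^esub>"
    using assms(4) by (simp add: FactGroup_def N.rcos_const)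
  finally have "Q.ord (N #> k) dvd p" using Q.pow_eq_id[OF kQ] by simp
  moreover have "Q.ord (N #> k) \<noteq> 1"
    using Q.ord_eq_1[OF kQ] rcos_self[OF assms(3) N.subgroup_axioms] assms(5) by (auto simp: FactGroup_def)
  ultimately have "Q.ord (N #> k) = p" using assms(6) by (metis prime_nat_iff)
  then show ?thesis using Q.ord_dvd_group_order[OF kQ] by (simp add: order_def FactGroup_def)
qed

text \<open>
  The permutation group \<open>Q\<close> induced on the cosets is finite and transitive, so the prime \<open>q\<close> would
  divide its order. By Sylow's theorem it would contain an element of order \<open>q\<close>, which is the
  image of some \<open>k\<close>; but a power of \<open>k\<close> with an exponent prime to \<open>q\<close> is trivial.
\<close>

lemma index_coprime_of_torsion:
  fixes q :: nat
  assumes M: "subgroup M G" and fin: "finite (rcosets M)" and q: "prime q"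
    and tor: "\<And>k. k \<in> carrier G \<Longrightarrow> \<exists>s::nat. k [^] s = \<one> \<and> \<not> q dvd s"
  shows "\<not> q dvd card (rcosets M)"
proof
  assume qd: "q dvd card (rcosets M)"
  interpret M: subgroup M G by fact
  define act where "act k = (\<lambda>c\<in>rcosets M. c #> inv k)" for k
  have cl: "c #> k \<in> rcosets M" if "c \<in> rcosets M" "k \<in> carrier G" for c k
    using that M.subset by (auto simp: RCOSETS_def coset_mult_assoc)
  have sub: "c \<subseteq> carrier G" if "c \<in> rcosets M" for c
    using that M.rcosets_carrier is_group by blast
  have comp: "act k (act l c) = act (k \<otimes> l) c" if "c \<in> rcosets M" "k \<in> carrier G" "l \<in> carrier G" for c k l
    using that cl sub by (simp add: act_def coset_mult_assoc inv_mult_group)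
  have one: "act \<one> c = c" if "c \<in> rcosets M" for c
    using that sub by (simp add: act_def)
  have clo: "act k c \<in> rcosets M" if "c \<in> rcosets M" "k \<in> carrier G" for c k
    using that cl by (simp add: act_def)
  have bij: "act k \<in> Bij (rcosets M)" if k: "k \<in> carrier G" for k
  proof -
    have "bij_betw (act k) (rcosets M) (rcosets M)"
      by (rule bij_betw_byWitness[of _ "act (inv k)"])
         (use k clo comp one in auto)
    then show ?thesis by (simp add: Bij_def act_def)
  qed
  have hom: "act \<in> hom G (BijGroup (rcosets M))"
  proof (rule homI)
    fix k l assume kl: "k \<in> carrier G" "l \<in> carrier G"
    show "act (k \<otimes> l) = act k \<otimes>\<^bsub>BijGroup (rcosets M)\<^esub> act l"
    proof
      fix c
      show "act (k \<otimes> l) c = (act k \<otimes>\<^bsub>BijGroup (rcosets M)\<^esub> act l) c"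
      proof (cases "c \<in> rcosets M")
        case True
        then show ?thesis using kl bij comp by (simp add: BijGroup_def compose_eq)
      next
        case False
        then show ?thesis using kl bij by (simp add: BijGroup_def compose_def act_def[of "k \<otimes> l"])
      qed
    qed
  qed (use bij in \<open>auto simp: BijGroup_def\<close>)
  interpret B: group "BijGroup (rcosets M)" by (rule group_BijGroup)
  interpret gh: group_hom G "BijGroup (rcosets M)" act
    by unfold_locales (rule hom)
  have sQ: "subgroup (act ` carrier G) (BijGroup (rcosets M))"
    by (rule gh.img_is_subgroup)
  define Q where "Q = (BijGroup (rcosets M))\<lparr>carrier := act ` carrier G\<rparr>"
  interpret Q: group Q unfolding Q_def using sQ by (rule B.subgroup_imp_group)
  have finB: "finite (Bij (rcosets M))"
    by (rule finite_subset[OF _ finite_PiE[OF fin, of "\<lambda>_. rcosets M"]])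
       (use fin in \<open>auto simp: Bij_def bij_betw_def PiE_def extensional_funcset_def\<close>)
  have finQ: "finite (carrier Q)"
    using finB bij by (auto simp: Q_def intro: finite_subset)
  have idh: "id \<in> hom Q (BijGroup (rcosets M))"
    using sQ bij by (auto simp: hom_def Q_def subgroup.mem_carrier)
  interpret ga: group_action Q "rcosets M" id
    unfolding group_action_def group_hom_def group_hom_axioms_def using idh Q.is_group B.is_group by simp
  have Mr: "M \<in> rcosets M" using M.subgroup_in_rcosets is_group by blast
  have "orbit Q id M = rcosets M"
  proof
    show "orbit Q id M \<subseteq> rcosets M"
      using bij Mr by (auto simp: orbit_def Q_def Bij_def bij_betw_def)
    show "rcosets M \<subseteq> orbit Q id M"
    proof
      fix c assume "c \<in> rcosets M"
      then obtain k where k: "k \<in> carrier G" "c = M #> k" by (auto simp: RCOSETS_def)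
      then have "act (inv k) M = c" using Mr by (simp add: act_def)
      moreover have "act (inv k) \<in> carrier Q"
        using imageI[of "inv k" "carrier G" act] k by (simp add: Q_def del: gh.hom_inv)
      ultimately show "c \<in> orbit Q id M" unfolding orbit_def by (metis (mono_tags, lifting) id_apply mem_Collect_eq)
    qed
  qed
  then have "q dvd order Q" using ga.orbit_stabilizer_theorem[OF Mr] qd by (metis dvd_mult2)
  then obtain m where m: "order Q = q ^ 1 * m" by auto
  obtain S where S: "subgroup S Q" "card S = q ^ 1"
    using sylow_thm[OF q Q.is_group m finQ] by blast
  have "card S > 1" using S(2) q prime_gt_1_nat by simp
  then obtain a where a: "a \<in> S" "a \<noteq> \<one>\<^bsub>Q\<^esub>"
    by (metis One_nat_def card_le_Suc0_iff_eq card.infinite less_le_not_le not_less_eq linorder_not_le zero_less_one)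
  have aQ: "a \<in> carrier Q" using a S subgroup.mem_carrier by metis
  interpret SG: group "Q\<lparr>carrier := S\<rparr>" using S(1) by (rule Q.subgroup_imp_group)
  have "a [^]\<^bsub>Q\<lparr>carrier := S\<rparr>\<^esub> order (Q\<lparr>carrier := S\<rparr>) = \<one>\<^bsub>Q\<lparr>carrier := S\<rparr>\<^esub>"
    by (rule SG.pow_order_eq_1) (use a in simp)
  then have "a [^]\<^bsub>Q\<^esub> q = \<one>\<^bsub>Q\<^esub>" using S(2) by (simp add: order_def nat_pow_def)
  then have d1: "Q.ord a dvd q" using Q.pow_eq_id[OF aQ] by simp
  obtain k where k: "k \<in> carrier G" "a = act k" using aQ by (auto simp: Q_def)
  obtain s where s: "k [^] s = \<one>" "\<not> q dvd s" using tor[OF k(1)] by blast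
  have "act k [^]\<^bsub>BijGroup (rcosets M)\<^esub> s = \<one>\<^bsub>BijGroup (rcosets M)\<^esub>"
    using gh.hom_nat_pow[OF k(1), of s] s by simp
  then have "a [^]\<^bsub>Q\<^esub> s = \<one>\<^bsub>Q\<^esub>" using k by (simp add: Q_def nat_pow_def)
  then have d2: "Q.ord a dvd s" using Q.pow_eq_id[OF aQ] by simp
  have "Q.ord a = 1" using d1 d2 q s(2) by (metis prime_nat_iff)
  then show False using Q.ord_eq_1[OF aQ] a by simp
qed

text \<open>
  A map with finite image whose fibres lie in single cosets of \<open>M\<close> witnesses a finite covering.
\<close>

lemma covers_fiber:
  assumes "finite (f ` K)" "K \<subseteq> carrier G" "M \<subseteq> carrier G"
    and "\<And>k l. k \<in> K \<Longrightarrow> l \<in> K \<Longrightarrow> f k = f l \<Longrightarrow> k \<otimes> inv l \<in> M"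
  shows "covers G M K"
proof -
  obtain R where R: "finite R" "R \<subseteq> K" "f ` K = f ` R"
    using assms(1) by (metis finite_subset_image order_refl)
  have "K \<subseteq> (\<Union>r\<in>R. M #> r)"
  proof
    fix k assume k: "k \<in> K"
    then obtain r where r: "r \<in> R" "f k = f r" using R(3) by (metis imageE imageI)
    have "k \<otimes> inv r \<in> M" using assms(4) k r R(2) by blast
    moreover have "k = k \<otimes> inv r \<otimes> r" using k r R(2) assms(2) by (auto simp: m_assoc subset_iff)
    ultimately show "k \<in> (\<Union>r\<in>R. M #> r)" using r(1) unfolding r_coset_def by blast
  qed
  then show ?thesis unfolding covers_def using R assms(2) by blast
qed

lemma subgroup_nat_pow: "subgroup L G \<Longrightarrow> k \<in> L \<Longrightarrow> k [^] (n::nat) \<in> L"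
  by (induction n) (auto simp: subgroup.one_closed subgroup.m_closed)

text \<open>
  Let \<open>M\<close> be the kernel of the action of \<open>L\<close> on the finite orbit \<open>E\<close> of \<open>x\<close>. It is normal of
  finite index, and an element of order \<open>p\<close> that moves \<open>x\<close> has order \<open>p\<close> modulo \<open>M\<close>.
\<close>

lemma orbit_kernel_index:
  fixes p :: nat
  assumes hom: "act \<in> hom G (BijGroup X)" and L: "subgroup L G" and x: "x \<in> X"
    and E: "finite E" "E = (\<lambda>l. act l x) ` L"
    and k: "k \<in> L" "k [^] p = \<one>" "act k x \<noteq> x" "prime p"
    and M: "M = {l \<in> L. \<forall>y\<in>E. act l y = y}"
  shows "subgroup M G" "covers G M L" "p dvd index G L M"
proof -
  interpret L: subgroup L G by fact
  have bij: "act h \<in> Bij X" if "h \<in> carrier G" for h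
    using that hom by (auto simp: hom_def BijGroup_def)
  have mem: "act h y \<in> X" if "h \<in> carrier G" "y \<in> X" for h y
    using bij[OF that(1)] that(2) by (auto simp: Bij_def bij_betw_def)
  have mult: "act (h \<otimes> l) y = act h (act l y)" if "h \<in> carrier G" "l \<in> carrier G" "y \<in> X" for h l y
    using that hom bij by (simp add: hom_def BijGroup_def compose_eq)
  have one: "act \<one> y = y" if "y \<in> X" for y
  proof -
    have "act \<one> (act \<one> y) = act \<one> y" using mult[of \<one> \<one> y] that by simp
    then show ?thesis using bij[of \<one>] that mem[of \<one> y] by (auto simp: Bij_def bij_betw_def dest: inj_onD)
  qed
  have inv: "act (inv h) (act h y) = y" "act h (act (inv h) y) = y" if "h \<in> carrier G" "y \<in> X" for h y
    using that mult[of "inv h" h y] mult[of h "inv h" y] one by simp_all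
  have EX: "E \<subseteq> X" using E(2) mem x by auto
  have Einv: "act l y \<in> E" if l: "l \<in> L" and y: "y \<in> E" for l y
  proof -
    obtain l' where l': "l' \<in> L" "y = act l' x" using y E(2) by auto
    then have "act l y = act (l \<otimes> l') x" using mult[of l l' x] l x by simp
    then show ?thesis using E(2) l l' by auto
  qed
  show sM: "subgroup M G"
  proof
    show "M \<subseteq> carrier G" using M L.subset by auto
    show "\<one> \<in> M" using M one EX by auto
    fix h l assume "h \<in> M" "l \<in> M"
    then show "h \<otimes> l \<in> M" using M mult EX by (auto simp: subset_iff)
  next
    fix h assume "h \<in> M"
    then show "inv h \<in> M" using M inv(1)[of h] EX by (auto simp: subset_iff) (metis L.mem_carrier)
  qed
  have key: "h \<otimes> inv l \<in> M"
    if hl: "h \<in> L" "l \<in> L" "restrict (act (inv h)) E = restrict (act (inv l)) E" for h l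
  proof -
    have "act (h \<otimes> inv l) y = y" if y: "y \<in> E" for y
    proof -
      have "act (inv l) y = act (inv h) y" using fun_cong[OF hl(3), of y] y by simp
      moreover have "y \<in> X" using EX y by auto
      ultimately show ?thesis using mult[of h "inv l" y] inv(2)[of h y] hl by simp
    qed
    then show ?thesis using M hl by auto
  qed
  have finf: "finite ((\<lambda>l. restrict (act (inv l)) E) ` L)"
    by (rule finite_subset[OF _ finite_PiE[OF E(1), of "\<lambda>_. E"]]) (use E Einv in auto)
  show cov: "covers G M L"
    by (rule covers_fiber[where f = "\<lambda>l. restrict (act (inv l)) E", OF finf])
       (use L.subset key subgroup.subset[OF sM] in auto)
  let ?L = "G\<lparr>carrier := L\<rparr>"
  interpret GL: group ?L using L by (rule subgroup_imp_group)
  have msubL: "M \<subseteq> L" using M by auto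
  have msgL: "subgroup M ?L" using subgroup_incl[OF sM L msubL] .
  have nM: "M \<lhd> ?L"
    unfolding GL.normal_inv_iff
  proof (intro conjI ballI)
    fix l m assume l: "l \<in> carrier ?L" and m: "m \<in> M"
    have li: "inv\<^bsub>?L\<^esub> l = inv l" using l L by (simp add: m_inv_consistent)
    have "act (l \<otimes> m \<otimes> inv l) y = y" if y: "y \<in> E" for y
    proof -
      have yX: "y \<in> X" using EX y by auto
      have "act (inv l) y \<in> E" using Einv[of "inv l" y] l y by simp
      then have "act m (act (inv l) y) = act (inv l) y" using m M by auto
      then show ?thesis using l m msubL yX mult[of "l \<otimes> m" "inv l" y] mult[of l m "act (inv l) y"]
        mem[of "inv l" y] inv(2)[of l y] by (auto simp: subset_iff)
    qed
    then show "l \<otimes>\<^bsub>?L\<^esub> m \<otimes>\<^bsub>?L\<^esub> inv\<^bsub>?L\<^esub> l \<in> M"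
      using l m msubL M li by auto
  qed (rule msgL)
  have "finite (cosets_in G L (L \<inter> M))" using covers_iff_finite_cosets[OF L sM] cov by simp
  then have fin: "finite (rcosets\<^bsub>?L\<^esub> M)" using msubL by (simp add: cosets_in_def Int_absorb1)
  have "x \<in> E" using imageI[OF L.one_closed, of "\<lambda>l. act l x"] one[OF x] E(2) by simp
  then have kM: "k \<notin> M" using k(3) M by blast
  have "k [^]\<^bsub>?L\<^esub> p \<in> M" using k(2) sM by (simp add: nat_pow_def subgroup.one_closed)
  then show "p dvd index G L M"
    unfolding index_def cosets_in_def
    using GL.prime_dvd_card_rcosets_normal[OF nM fin _ _ kM k(4)] k(1) by simp
qed

end

section \<open>Completion along a permutation action\<close>

text \<open>
  A group \<open>H\<close> acting on a set \<open>X\<close> such that the stabiliser of one point has finite orbits. The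
  closure of the image of \<open>H\<close> in the group of permutations of \<open>X\<close> is then a t.d.l.c. group. The
  injection \<open>j\<close> transports this closure to an arbitrary type \<open>'x\<close>.
\<close>

locale completion_action = H: group H for H :: "('h, 'b) monoid_scheme" (structure) +
  fixes X :: "'a set" and act :: "'h \<Rightarrow> 'a \<Rightarrow> 'a" and x0 :: 'a and j :: "('a \<Rightarrow> 'a) \<Rightarrow> 'x"
  assumes act_hom: "act \<in> hom H (BijGroup X)"
    and x0: "x0 \<in> X"
    and finite_orbits: "\<And>x. x \<in> X \<Longrightarrow> finite {act k x | k. k \<in> carrier H \<and> act k x0 = x0}"
    and inj_j: "inj_on j (Bij X)"
begin

definition stab :: "'h set" where "stab = {k \<in> carrier H. act k x0 = x0}"

text \<open>
  The closure of the image of \<open>H\<close> in the topology of pointwise convergence.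
\<close>

definition Gc :: "('a \<Rightarrow> 'a) set" where
  "Gc = {f \<in> Bij X. \<forall>F. finite F \<and> F \<subseteq> X \<longrightarrow> (\<exists>h\<in>carrier H. \<forall>x\<in>F. act h x = f x)}"

text \<open>
  The permutation that an element of the transported group stands for.
\<close>

definition ev :: "'x \<Rightarrow> 'a \<Rightarrow> 'a" where "ev = inv_into (Bij X) j"

definition G :: "'x monoid" where
  "G = \<lparr>carrier = j ` Gc, mult = (\<lambda>a b. j (compose X (ev a) (ev b))), one = j (\<lambda>x\<in>X. x)\<rparr>"

text \<open>
  These sets are cosets of pointwise stabilisers of finite sets \<open>F\<close>; they form a base of the
  topology of pointwise convergence.
\<close>

definition nb :: "'x \<Rightarrow> 'a set \<Rightarrow> 'x set" where
  "nb a F = {b \<in> carrier G. \<forall>x\<in>F. ev b x = ev a x}"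

definition TG :: "'x topology" where
  "TG = topology (\<lambda>W. W \<subseteq> carrier G \<and> (\<forall>a\<in>W. \<exists>F. finite F \<and> F \<subseteq> X \<and> nb a F \<subseteq> W))"

definition emb :: "'h \<Rightarrow> 'x" where "emb h = j (act h)"

subsection \<open>The group\<close>

lemma act_Bij: "h \<in> carrier H \<Longrightarrow> act h \<in> Bij X"
  using act_hom by (auto simp: hom_def BijGroup_def)

lemma act_mem: "h \<in> carrier H \<Longrightarrow> x \<in> X \<Longrightarrow> act h x \<in> X"
  using act_Bij[of h] by (auto simp: Bij_def bij_betw_def)

lemma act_comp: "h \<in> carrier H \<Longrightarrow> k \<in> carrier H \<Longrightarrow> act (h \<otimes> k) = compose X (act h) (act k)"
  using act_hom act_Bij by (simp add: hom_def BijGroup_def)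

lemma act_mult: "h \<in> carrier H \<Longrightarrow> k \<in> carrier H \<Longrightarrow> x \<in> X \<Longrightarrow> act (h \<otimes> k) x = act h (act k x)"
  by (simp add: act_comp compose_eq)

lemma act_one: "x \<in> X \<Longrightarrow> act \<one> x = x"
proof -
  assume x: "x \<in> X"
  have "act \<one> (act \<one> x) = act \<one> x" using act_mult[of \<one> \<one> x] x by simp
  then show ?thesis using act_Bij[of \<one>] x act_mem[of \<one> x] by (auto simp: Bij_def bij_betw_def dest: inj_onD)
qed

lemma act_one': "act \<one> = (\<lambda>x\<in>X. x)"
  using act_one act_Bij[of \<one>] by (auto simp: Bij_def extensional_def fun_eq_iff)

lemma act_inv: "h \<in> carrier H \<Longrightarrow> x \<in> X \<Longrightarrow> act (inv h) (act h x) = x"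
  "h \<in> carrier H \<Longrightarrow> x \<in> X \<Longrightarrow> act h (act (inv h) x) = x"
  using act_mult[of "inv h" h x] act_mult[of h "inv h" x] act_one by simp_all

lemma ev_j: "f \<in> Bij X \<Longrightarrow> ev (j f) = f"
  unfolding ev_def using inj_j by simp

lemma Gc_Bij: "f \<in> Gc \<Longrightarrow> f \<in> Bij X" by (simp add: Gc_def)

lemma Gc_approx:
  "f \<in> Gc \<Longrightarrow> finite F \<Longrightarrow> F \<subseteq> X \<Longrightarrow> \<exists>h\<in>carrier H. \<forall>x\<in>F. act h x = f x"
  by (simp add: Gc_def)

lemma act_Gc: "h \<in> carrier H \<Longrightarrow> act h \<in> Gc"
  using act_Bij by (auto simp: Gc_def)

lemma ev_Gc: "a \<in> carrier G \<Longrightarrow> ev a \<in> Gc"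
  using ev_j Gc_Bij by (auto simp: G_def)

lemma ev_Bij: "a \<in> carrier G \<Longrightarrow> ev a \<in> Bij X"
  using ev_Gc Gc_Bij by blast

lemma j_ev: "a \<in> carrier G \<Longrightarrow> j (ev a) = a"
  using ev_j Gc_Bij by (auto simp: G_def)

lemma j_carrier: "f \<in> Gc \<Longrightarrow> j f \<in> carrier G" by (simp add: G_def)

lemma ev_mem: "a \<in> carrier G \<Longrightarrow> x \<in> X \<Longrightarrow> ev a x \<in> X"
  using ev_Bij[of a] by (auto simp: Bij_def bij_betw_def)

lemma ev_eqI: "a \<in> carrier G \<Longrightarrow> b \<in> carrier G \<Longrightarrow> (\<And>x. x \<in> X \<Longrightarrow> ev a x = ev b x) \<Longrightarrow> a = b"
  by (metis Bij_imp_extensional ev_Bij extensionalityI j_ev)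

lemma Gc_comp:
  assumes "f \<in> Gc" "g \<in> Gc" shows "compose X f g \<in> Gc"
  unfolding Gc_def
proof (intro CollectI conjI allI impI)
  show "compose X f g \<in> Bij X" using assms Gc_Bij compose_Bij by blast
  fix F assume F: "finite F \<and> F \<subseteq> X"
  obtain k where k: "k \<in> carrier H" "\<forall>x\<in>F. act k x = g x" using Gc_approx[OF assms(2)] F by blast
  have "g ` F \<subseteq> X" using F Gc_Bij[OF assms(2)] by (auto simp: Bij_def bij_betw_def)
  then obtain h where h: "h \<in> carrier H" "\<forall>x\<in>g ` F. act h x = f x"
    using Gc_approx[OF assms(1), of "g ` F"] F by blast
  have "\<forall>x\<in>F. act (h \<otimes> k) x = compose X f g x"
    using h k F by (auto simp: act_mult compose_eq subset_iff)
  then show "\<exists>h\<in>carrier H. \<forall>x\<in>F. act h x = compose X f g x" using h k by blast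
qed

text \<open>
  To approximate the inverse of \<open>f\<close> on \<open>F\<close>, approximate \<open>f\<close> on the preimage of \<open>F\<close> and invert.
\<close>

lemma Gc_inv:
  assumes "f \<in> Gc" shows "restrict (inv_into X f) X \<in> Gc"
  unfolding Gc_def
proof (intro CollectI conjI allI impI)
  have B: "f \<in> Bij X" using assms Gc_Bij by blast
  then have surj: "f ` X = X" by (simp add: Bij_def bij_betw_def)
  show "restrict (inv_into X f) X \<in> Bij X" using B by (rule restrict_inv_into_Bij)
  fix F assume F: "finite F \<and> F \<subseteq> X"
  let ?F = "inv_into X f ` F"
  have sub: "?F \<subseteq> X" using F B by (auto simp: Bij_inv_into_mem)
  then obtain h where h: "h \<in> carrier H" "\<forall>x\<in>?F. act h x = f x"
    using Gc_approx[OF assms, of ?F] F by blast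
  have "\<forall>y\<in>F. act (inv h) y = inv_into X f y"
  proof
    fix y assume y: "y \<in> F"
    then have "act h (inv_into X f y) = y" using h F surj by (auto simp: f_inv_into_f subset_iff)
    then show "act (inv h) y = inv_into X f y" using act_inv(1)[OF h(1), of "inv_into X f y"] sub y by auto
  qed
  then show "\<exists>h\<in>carrier H. \<forall>x\<in>F. act h x = restrict (inv_into X f) X x"
    using F h by (auto intro!: bexI[of _ "inv h"])
qed

lemma id_Gc: "(\<lambda>x\<in>X. x) \<in> Gc"
  using act_Gc[of \<one>] act_one' by simp

lemma G_mult: "a \<otimes>\<^bsub>G\<^esub> b = j (compose X (ev a) (ev b))"
  by (simp add: G_def)

lemma ev_mult:
  "a \<in> carrier G \<Longrightarrow> b \<in> carrier G \<Longrightarrow> ev (a \<otimes>\<^bsub>G\<^esub> b) = compose X (ev a) (ev b)"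
  using ev_j[OF Gc_Bij[OF Gc_comp[OF ev_Gc ev_Gc]]] by (simp add: G_mult)

lemma ev_one: "ev \<one>\<^bsub>G\<^esub> = (\<lambda>x\<in>X. x)"
  by (simp add: G_def ev_j id_Bij)

lemma G_group: "group G"
proof (rule groupI)
  fix a b c assume a: "a \<in> carrier G" and b: "b \<in> carrier G" and c: "c \<in> carrier G"
  show m: "a \<otimes>\<^bsub>G\<^esub> b \<in> carrier G"
    using Gc_comp[OF ev_Gc[OF a] ev_Gc[OF b]] by (simp add: G_def)
  have "b \<otimes>\<^bsub>G\<^esub> c \<in> carrier G"
    using Gc_comp[OF ev_Gc[OF b] ev_Gc[OF c]] by (simp add: G_def)
  then have "compose X (ev (a \<otimes>\<^bsub>G\<^esub> b)) (ev c) = compose X (ev a) (ev (b \<otimes>\<^bsub>G\<^esub> c))"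
    using a b c compose_assoc[of "ev c" X X "ev a" "ev b"] ev_mem[OF c] by (simp add: ev_mult Pi_I)
  then show "a \<otimes>\<^bsub>G\<^esub> b \<otimes>\<^bsub>G\<^esub> c = a \<otimes>\<^bsub>G\<^esub> (b \<otimes>\<^bsub>G\<^esub> c)" by (simp only: G_mult)
next
  show "\<one>\<^bsub>G\<^esub> \<in> carrier G" using id_Gc by (simp add: G_def)
next
  fix a assume a: "a \<in> carrier G"
  have "compose X (\<lambda>x\<in>X. x) (ev a) = ev a"
    using ev_Bij[OF a] by (simp add: Bij_imp_funcset Bij_imp_extensional)
  then show "\<one>\<^bsub>G\<^esub> \<otimes>\<^bsub>G\<^esub> a = a" using ev_one j_ev[OF a] by (simp add: G_def)
  let ?b = "j (restrict (inv_into X (ev a)) X)"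
  have "?b \<in> carrier G" using Gc_inv[OF ev_Gc[OF a]] by (rule j_carrier)
  moreover have "?b \<otimes>\<^bsub>G\<^esub> a = \<one>\<^bsub>G\<^esub>"
    using ev_j[OF restrict_inv_into_Bij[OF ev_Bij[OF a]]] Bij_compose_restrict_eq[OF ev_Bij[OF a]]
    by (simp add: G_def)
  ultimately show "\<exists>b\<in>carrier G. b \<otimes>\<^bsub>G\<^esub> a = \<one>\<^bsub>G\<^esub>" by blast
qed

interpretation GG: group G by (rule G_group)

lemma ev_mult_eq: "a \<in> carrier G \<Longrightarrow> b \<in> carrier G \<Longrightarrow> x \<in> X \<Longrightarrow> ev (a \<otimes>\<^bsub>G\<^esub> b) x = ev a (ev b x)"
  by (simp add: ev_mult compose_eq)

lemma ev_one_eq: "x \<in> X \<Longrightarrow> ev \<one>\<^bsub>G\<^esub> x = x" by (simp add: ev_one)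

lemma ev_inv_eq:
  assumes "a \<in> carrier G" "x \<in> X"
  shows "ev (inv\<^bsub>G\<^esub> a) (ev a x) = x" "ev a (ev (inv\<^bsub>G\<^esub> a) x) = x"
  using ev_mult_eq[of "inv\<^bsub>G\<^esub> a" a x] ev_mult_eq[of a "inv\<^bsub>G\<^esub> a" x] assms ev_one_eq by simp_all

lemma emb_carrier: "h \<in> carrier H \<Longrightarrow> emb h \<in> carrier G"
  by (simp add: emb_def act_Gc j_carrier)

lemma ev_emb: "h \<in> carrier H \<Longrightarrow> ev (emb h) = act h"
  by (simp add: emb_def ev_j act_Bij)

lemma emb_hom: "emb \<in> hom H G"
proof (rule homI)
  fix h k assume hk: "h \<in> carrier H" "k \<in> carrier H"
  show "emb (h \<otimes> k) = emb h \<otimes>\<^bsub>G\<^esub> emb k"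
    using hk act_comp[OF hk] by (simp add: G_def ev_emb) (simp add: emb_def)
qed (rule emb_carrier)

interpretation eh: group_hom H G emb
  by unfold_locales (rule emb_hom)

subsection \<open>The topology\<close>

lemma nb_anti: "F \<subseteq> F' \<Longrightarrow> nb a F' \<subseteq> nb a F" by (auto simp: nb_def)

lemma openin_TG:
  "openin TG W \<longleftrightarrow> W \<subseteq> carrier G \<and> (\<forall>a\<in>W. \<exists>F. finite F \<and> F \<subseteq> X \<and> nb a F \<subseteq> W)"
proof -
  have "istopology (\<lambda>W. W \<subseteq> carrier G \<and> (\<forall>a\<in>W. \<exists>F. finite F \<and> F \<subseteq> X \<and> nb a F \<subseteq> W))"
    unfolding istopology_def
  proof (intro conjI allI impI)
    fix S T a
    assume S: "S \<subseteq> carrier G \<and> (\<forall>a\<in>S. \<exists>F. finite F \<and> F \<subseteq> X \<and> nb a F \<subseteq> S)"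
      and T: "T \<subseteq> carrier G \<and> (\<forall>a\<in>T. \<exists>F. finite F \<and> F \<subseteq> X \<and> nb a F \<subseteq> T)"
    show "S \<inter> T \<subseteq> carrier G" using S by blast
    show "\<forall>a\<in>S \<inter> T. \<exists>F. finite F \<and> F \<subseteq> X \<and> nb a F \<subseteq> S \<inter> T"
    proof
      fix a assume "a \<in> S \<inter> T"
      then obtain F F' where F: "finite F" "F \<subseteq> X" "nb a F \<subseteq> S" "finite F'" "F' \<subseteq> X" "nb a F' \<subseteq> T"
        using S T by (metis IntD1 IntD2)
      then have "nb a (F \<union> F') \<subseteq> S \<inter> T" using nb_anti[of F "F \<union> F'"] nb_anti[of F' "F \<union> F'"] by blast
      then show "\<exists>F. finite F \<and> F \<subseteq> X \<and> nb a F \<subseteq> S \<inter> T" using F by (intro exI[of _ "F \<union> F'"]) auto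
    qed
  next
    fix \<K> assume K: "\<forall>K\<in>\<K>. K \<subseteq> carrier G \<and> (\<forall>a\<in>K. \<exists>F. finite F \<and> F \<subseteq> X \<and> nb a F \<subseteq> K)"
    show "\<Union> \<K> \<subseteq> carrier G" using K by blast
    show "\<forall>a\<in>\<Union> \<K>. \<exists>F. finite F \<and> F \<subseteq> X \<and> nb a F \<subseteq> \<Union> \<K>"
      using K by (meson UnionE Union_upper order_trans)
  qed
  then show ?thesis unfolding TG_def by (simp add: topology_inverse')
qed

lemma nb_self: "a \<in> carrier G \<Longrightarrow> a \<in> nb a F" by (simp add: nb_def)

lemma nb_open: "finite F \<Longrightarrow> F \<subseteq> X \<Longrightarrow> openin TG (nb a F)"
  unfolding openin_TG
proof (intro conjI ballI)
  show "nb a F \<subseteq> carrier G" by (auto simp: nb_def)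
  fix b assume "finite F" "F \<subseteq> X" "b \<in> nb a F"
  then show "\<exists>F'. finite F' \<and> F' \<subseteq> X \<and> nb b F' \<subseteq> nb a F"
    by (intro exI[of _ F]) (auto simp: nb_def)
qed

lemma topspace_TG: "topspace TG = carrier G"
proof
  show "topspace TG \<subseteq> carrier G" using openin_topspace[of TG] by (simp only: openin_TG)
  have "openin TG (carrier G)" unfolding openin_TG by (auto simp: nb_def)
  then show "carrier G \<subseteq> topspace TG" by (rule openin_subset)
qed

lemma openin_TG_nb: "openin TG W \<Longrightarrow> a \<in> W \<Longrightarrow> \<exists>F. finite F \<and> F \<subseteq> X \<and> nb a F \<subseteq> W"
  by (simp add: openin_TG)

text \<open>
  The value of \<open>a b\<close> at \<open>x\<close> is determined by the values of \<open>b\<close> at \<open>x\<close> and of \<open>a\<close> at \<open>b x\<close>; and a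
  permutation that agrees with \<open>a\<close> on the preimage of \<open>F\<close> under \<open>a\<close> has an inverse that agrees
  with that of \<open>a\<close> on \<open>F\<close>.
\<close>

lemma topological_group_G: "topological_group G TG"
  unfolding topological_group_def
proof (intro conjI)
  show "continuous_map (prod_topology TG TG) TG (\<lambda>(x, y). x \<otimes>\<^bsub>G\<^esub> y)"
    unfolding continuous_map_def
  proof (intro conjI allI impI)
    show "(\<lambda>(x, y). x \<otimes>\<^bsub>G\<^esub> y) \<in> topspace (prod_topology TG TG) \<rightarrow> topspace TG"
      by (auto simp: topspace_TG)
    fix W assume W: "openin TG W"
    let ?S = "{z \<in> topspace (prod_topology TG TG). (case z of (x, y) \<Rightarrow> x \<otimes>\<^bsub>G\<^esub> y) \<in> W}"
    show "openin (prod_topology TG TG) ?S"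
      unfolding openin_prod_topology_alt
    proof (intro allI impI)
      fix a b assume ab: "(a, b) \<in> ?S"
      then have c: "a \<in> carrier G" "b \<in> carrier G" "a \<otimes>\<^bsub>G\<^esub> b \<in> W" by (auto simp: topspace_TG)
      obtain F where F: "finite F" "F \<subseteq> X" "nb (a \<otimes>\<^bsub>G\<^esub> b) F \<subseteq> W" using openin_TG_nb[OF W c(3)] by blast
      have bF: "ev b ` F \<subseteq> X" using F c ev_mem by auto
      have "nb a (ev b ` F) \<times> nb b F \<subseteq> ?S"
      proof
        fix z assume "z \<in> nb a (ev b ` F) \<times> nb b F"
        then obtain a' b' where z: "z = (a', b')" "a' \<in> nb a (ev b ` F)" "b' \<in> nb b F" by auto
        then have "a' \<otimes>\<^bsub>G\<^esub> b' \<in> nb (a \<otimes>\<^bsub>G\<^esub> b) F"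
          using c F(2) by (auto simp: nb_def ev_mult_eq subset_iff)
        then show "z \<in> ?S" using z F(3) by (auto simp: nb_def topspace_TG)
      qed
      then show "\<exists>U V. openin TG U \<and> openin TG V \<and> a \<in> U \<and> b \<in> V \<and> U \<times> V \<subseteq> ?S"
        using nb_open F bF nb_self c
        by (intro exI[of _ "nb a (ev b ` F)"] exI[of _ "nb b F"]) auto
    qed
  qed
  show "continuous_map TG TG (\<lambda>x. inv\<^bsub>G\<^esub> x)"
    unfolding continuous_map_def
  proof (intro conjI allI impI)
    show "m_inv G \<in> topspace TG \<rightarrow> topspace TG" by (auto simp: topspace_TG)
    fix W assume W: "openin TG W"
    show "openin TG {a \<in> topspace TG. inv\<^bsub>G\<^esub> a \<in> W}"
      unfolding openin_TG
    proof (intro conjI ballI)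
      fix a assume "a \<in> {a \<in> topspace TG. inv\<^bsub>G\<^esub> a \<in> W}"
      then have c: "a \<in> carrier G" "inv\<^bsub>G\<^esub> a \<in> W" by (auto simp: topspace_TG)
      obtain F where F: "finite F" "F \<subseteq> X" "nb (inv\<^bsub>G\<^esub> a) F \<subseteq> W" using openin_TG_nb[OF W c(2)] by blast
      let ?F = "ev (inv\<^bsub>G\<^esub> a) ` F"
      have "nb a ?F \<subseteq> {a \<in> topspace TG. inv\<^bsub>G\<^esub> a \<in> W}"
      proof
        fix b assume b: "b \<in> nb a ?F"
        then have bc: "b \<in> carrier G" by (simp add: nb_def)
        have "ev (inv\<^bsub>G\<^esub> b) x = ev (inv\<^bsub>G\<^esub> a) x" if x: "x \<in> F" for x
        proof -
          have xX: "x \<in> X" using x F by auto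
          have "ev b (ev (inv\<^bsub>G\<^esub> a) x) = x" using b x ev_inv_eq(2)[OF c(1) xX] by (simp add: nb_def)
          then show ?thesis using ev_inv_eq(1)[OF bc, of "ev (inv\<^bsub>G\<^esub> a) x"] ev_mem c xX by simp
        qed
        then have "inv\<^bsub>G\<^esub> b \<in> nb (inv\<^bsub>G\<^esub> a) F" using bc by (simp add: nb_def)
        then show "b \<in> {a \<in> topspace TG. inv\<^bsub>G\<^esub> a \<in> W}" using bc F by (auto simp: topspace_TG)
      qed
      moreover have "finite ?F" "?F \<subseteq> X" using F ev_mem c by auto
      ultimately show "\<exists>F. finite F \<and> F \<subseteq> X \<and> nb a F \<subseteq> {a \<in> topspace TG. inv\<^bsub>G\<^esub> a \<in> W}" by blast
    qed (auto simp: topspace_TG)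
  qed
qed (auto simp: topspace_TG G_group)

lemma separate:
  assumes "a \<in> carrier G" "b \<in> carrier G" "a \<noteq> b"
  shows "\<exists>x\<in>X. nb a {x} \<inter> nb b {x} = {}"
proof -
  obtain x where "x \<in> X" "ev a x \<noteq> ev b x" using ev_eqI assms by blast
  then show ?thesis by (intro bexI[of _ x]) (auto simp: nb_def)
qed

lemma nb_clopen: assumes "finite F" "F \<subseteq> X" shows "closedin TG (nb a F)"
  unfolding closedin_def
proof (intro conjI)
  show "nb a F \<subseteq> topspace TG" by (auto simp: nb_def topspace_TG)
  have "topspace TG - nb a F = (\<Union>b\<in>carrier G - nb a F. nb b F)"
    by (auto simp: nb_def topspace_TG)
  then show "openin TG (topspace TG - nb a F)" using nb_open[OF assms] by (simp add: openin_clauses(3) openin_Union)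
qed

lemma Hausdorff_TG: "Hausdorff_space TG"
  unfolding Hausdorff_space_def
proof (intro allI impI)
  fix a b assume "a \<in> topspace TG \<and> b \<in> topspace TG \<and> a \<noteq> b"
  then have ab: "a \<in> carrier G" "b \<in> carrier G" "a \<noteq> b" by (auto simp: topspace_TG)
  then obtain x where "x \<in> X" "nb a {x} \<inter> nb b {x} = {}" using separate by blast
  then show "\<exists>U V. openin TG U \<and> openin TG V \<and> a \<in> U \<and> b \<in> V \<and> disjnt U V"
    using nb_open nb_self ab by (intro exI[of _ "nb a {x}"] exI[of _ "nb b {x}"]) (auto simp: disjnt_def)
qed

text \<open>
  Two different elements are separated by one of the clopen sets \<open>nb a {x}\<close>.
\<close>

lemma totally_disconnected_TG: "totally_disconnected_space TG"
  unfolding totally_disconnected_space_def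
proof (intro allI impI)
  fix S assume S: "connectedin TG S"
  have "a = b" if "a \<in> S" "b \<in> S" for a b
  proof (rule ccontr)
    assume ne: "a \<noteq> b"
    have ab: "a \<in> carrier G" "b \<in> carrier G"
      using that connectedin_subset_topspace[OF S] by (auto simp: topspace_TG)
    obtain x where x: "x \<in> X" "nb a {x} \<inter> nb b {x} = {}" using separate[OF ab ne] by blast
    have "S \<subseteq> nb a {x} \<or> disjnt S (nb a {x})"
      using connectedin_clopen_cases[OF S] nb_clopen[of "{x}" a] nb_open[of "{x}" a] x by blast
    then show False using that nb_self[OF ab(1)] nb_self[OF ab(2)] x by (auto simp: disjnt_def)
  qed
  then show "\<exists>x. S \<subseteq> {x}" by (metis insertI1 subsetI empty_iff singleton_iff)
qed

section \<open>Local compactness of the completion\<close>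

definition orb :: "'a \<Rightarrow> 'a set" where "orb x = (\<lambda>k. act k x) ` stab"

lemma finite_orb: "x \<in> X \<Longrightarrow> finite (orb x)"
  using finite_orbits[of x] by (auto simp: orb_def stab_def image_def elim!: rev_finite_subset)

lemma stab_carrier: "k \<in> stab \<Longrightarrow> k \<in> carrier H" by (simp add: stab_def)

lemma stab_subgroup: "subgroup stab H"
proof
  fix x assume x: "x \<in> stab"
  then show "inv x \<in> stab" using act_inv(1)[of x x0] x0 by (auto simp: stab_def)
qed (auto simp: stab_def act_mult act_one x0)

text \<open>
  The stabiliser of the base point in the completion; it is the closure of \<open>stab\<close>.
\<close>

definition U0 :: "'x set" where "U0 = nb \<one>\<^bsub>G\<^esub> {x0}"

lemma U0_iff: "a \<in> U0 \<longleftrightarrow> a \<in> carrier G \<and> ev a x0 = x0"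
  by (auto simp: U0_def nb_def ev_one_eq x0)

lemma U0_subgroup: "subgroup U0 G"
proof
  fix a assume "a \<in> U0"
  then show "inv\<^bsub>G\<^esub> a \<in> U0" using ev_inv_eq(1)[of a x0] x0 by (auto simp: U0_iff)
qed (auto simp: U0_iff ev_mult_eq ev_one_eq x0)

lemma U0_open: "openin TG U0" unfolding U0_def using x0 by (intro nb_open) auto

text \<open>
  The set \<open>Z\<close> of all pointwise limits of \<open>stab\<close> is closed in the product of the finite orbits, so
  it is compact by Tychonoff's theorem. A limit is injective because it agrees with a permutation
  on any two points, and it is surjective because it is an injective self-map of every finite
  orbit. So \<open>Z\<close> consists of permutations, and \<open>j\<close> maps it continuously onto \<open>U0\<close>.
\<close>

lemma U0_compact: "compactin TG U0"
proof -
  let ?P = "product_topology (\<lambda>x. discrete_topology (orb x)) X"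
  define Z where "Z = {f \<in> topspace ?P. \<forall>F. finite F \<and> F \<subseteq> X \<longrightarrow> (\<exists>k\<in>stab. \<forall>x\<in>F. act k x = f x)}"
  have single: "openin ?P {f \<in> topspace ?P. f x = c}" if "x \<in> X" for x c
  proof -
    have "openin ?P {f \<in> topspace ?P. f x \<in> {c} \<inter> orb x}"
      by (rule openin_continuous_map_preimage[OF continuous_map_product_projection[OF that]]) simp
    moreover have "{f \<in> topspace ?P. f x \<in> {c} \<inter> orb x} = {f \<in> topspace ?P. f x = c}"
      using that by auto
    ultimately show ?thesis by simp
  qed
  have coord: "openin ?P {f \<in> topspace ?P. \<forall>x\<in>F. f x = c x}" if "finite F" "F \<subseteq> X" for F c
    using that
  proof (induction F)
    case empty
    have "{f \<in> topspace ?P. \<forall>x\<in>{}. f x = c x} = topspace ?P" by blast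
    then show ?case by (simp only: openin_topspace)
  next
    case (insert y F)
    have "{f \<in> topspace ?P. \<forall>x\<in>insert y F. f x = c x} = {f \<in> topspace ?P. f y = c y} \<inter> {f \<in> topspace ?P. \<forall>x\<in>F. f x = c x}"
      by blast
    then show ?case using insert single[of y "c y"] by (simp only: openin_Int insert_subset)
  qed
  have cZ: "closedin ?P Z"
    unfolding closedin_def
  proof (intro conjI)
    show "Z \<subseteq> topspace ?P" by (auto simp: Z_def)
    show "openin ?P (topspace ?P - Z)"
    proof (subst openin_subopen, intro ballI)
      fix f assume f: "f \<in> topspace ?P - Z"
      then obtain F where F: "finite F" "F \<subseteq> X" "\<not> (\<exists>k\<in>stab. \<forall>x\<in>F. act k x = f x)" by (auto simp: Z_def)
      have "{f' \<in> topspace ?P. \<forall>x\<in>F. f' x = f x} \<subseteq> topspace ?P - Z"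
      proof
        fix f' assume f': "f' \<in> {f' \<in> topspace ?P. \<forall>x\<in>F. f' x = f x}"
        have "f' \<notin> Z"
        proof
          assume "f' \<in> Z"
          then have "\<exists>k\<in>stab. \<forall>x\<in>F. act k x = f' x" using F(1,2) unfolding Z_def by blast
          then show False using F(3) f' by auto
        qed
        then show "f' \<in> topspace ?P - Z" using f' by blast
      qed
      then show "\<exists>T. openin ?P T \<and> f \<in> T \<and> T \<subseteq> topspace ?P - Z"
        using coord[OF F(1,2), of f] f by (intro exI[of _ "{f' \<in> topspace ?P. \<forall>x\<in>F. f' x = f x}"]) auto
    qed
  qed
  have "compact_space ?P"
    by (auto simp: compact_space_product_topology compact_space_discrete_topology finite_orb)
  then have kZ: "compactin ?P Z" using cZ by (rule closedin_compact_space)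
  have ZGc: "f \<in> Gc \<and> f x0 = x0" if f: "f \<in> Z" for f
  proof -
    have app: "\<exists>k\<in>stab. \<forall>x\<in>F. act k x = f x" if "finite F" "F \<subseteq> X" for F
      using f that by (auto simp: Z_def)
    have ext: "f \<in> extensional X" and forb: "\<And>x. x \<in> X \<Longrightarrow> f x \<in> orb x"
      using f by (auto simp: Z_def PiE_def)
    have fX: "f x \<in> X" if "x \<in> X" for x
      using forb[OF that] that act_mem by (auto simp: orb_def stab_def)
    have inj: "inj_on f X"
    proof (rule inj_onI)
      fix x y assume xy: "x \<in> X" "y \<in> X" "f x = f y"
      obtain k where k: "k \<in> stab" "act k x = f x" "act k y = f y" using app[of "{x, y}"] xy by auto
      then have "act k x = act k y" using xy by simp
      then show "x = y" using act_inv(1)[of k x] act_inv(1)[of k y] xy k stab_carrier by metis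
    qed
    have surj: "f ` X = X"
    proof
      show "f ` X \<subseteq> X" using fX by auto
      show "X \<subseteq> f ` X"
      proof
        fix y assume y: "y \<in> X"
        have oX: "orb y \<subseteq> X" using y act_mem by (auto simp: orb_def stab_def)
        have "f ` orb y \<subseteq> orb y"
        proof
          fix w assume "w \<in> f ` orb y"
          then obtain z where z: "z \<in> orb y" "w = f z" by auto
          obtain k where k: "k \<in> stab" "z = act k y" using z by (auto simp: orb_def)
          obtain l where l: "l \<in> stab" "w = act l z" using forb[of z] z oX by (auto simp: orb_def)
          have "w = act (l \<otimes> k) y" using k l y act_mult stab_carrier by simp
          moreover have "l \<otimes> k \<in> stab" using k l subgroup.m_closed[OF stab_subgroup] by simp
          ultimately show "w \<in> orb y" unfolding orb_def by simp
        qed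
        moreover have "inj_on f (orb y)" using inj oX inj_on_subset by blast
        ultimately have "f ` orb y = orb y" using endo_inj_surj finite_orb[OF y] by blast
        moreover have "y \<in> orb y"
          unfolding orb_def using imageI[OF subgroup.one_closed[OF stab_subgroup], of "\<lambda>k. act k y"] act_one[OF y]
          by simp
        ultimately show "y \<in> f ` X" using oX by blast
      qed
    qed
    have "f \<in> Bij X" using ext inj surj by (simp add: Bij_def bij_betw_def)
    moreover have "f x0 = x0" using app[of "{x0}"] x0 by (auto simp: stab_def)
    ultimately show ?thesis unfolding Gc_def using app stab_carrier by blast
  qed
  have "continuous_map (subtopology ?P Z) TG j"
    unfolding continuous_map_def
  proof (intro conjI allI impI)
    show "j \<in> topspace (subtopology ?P Z) \<rightarrow> topspace TG"
      using ZGc j_carrier by (auto simp: topspace_TG topspace_subtopology)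
    fix W assume W: "openin TG W"
    show "openin (subtopology ?P Z) {f \<in> topspace (subtopology ?P Z). j f \<in> W}"
    proof (subst openin_subopen, intro ballI)
      fix f assume "f \<in> {f \<in> topspace (subtopology ?P Z). j f \<in> W}"
      then have f: "f \<in> Z" "j f \<in> W" by auto
      obtain F where F: "finite F" "F \<subseteq> X" "nb (j f) F \<subseteq> W" using openin_TG_nb[OF W f(2)] by blast
      let ?T = "{f' \<in> topspace ?P. \<forall>x\<in>F. f' x = f x} \<inter> Z"
      have "?T \<subseteq> {f \<in> topspace (subtopology ?P Z). j f \<in> W}"
      proof
        fix f' assume f': "f' \<in> ?T"
        then have "j f' \<in> nb (j f) F"
          using ZGc f(1) j_carrier ev_j[OF Gc_Bij] by (auto simp: nb_def)
        then show "f' \<in> {f \<in> topspace (subtopology ?P Z). j f \<in> W}"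
          using F(3) f' by (auto simp: topspace_subtopology)
      qed
      moreover have "openin (subtopology ?P Z) ?T"
        using coord[OF F(1,2), of f] by (auto simp: openin_subtopology)
      moreover have "f \<in> ?T" using f by (auto simp: Z_def)
      ultimately show "\<exists>T. openin (subtopology ?P Z) T \<and> f \<in> T \<and> T \<subseteq> {f \<in> topspace (subtopology ?P Z). j f \<in> W}"
        by blast
    qed
  qed
  moreover have "compactin (subtopology ?P Z) Z" using kZ by (simp add: compactin_subtopology)
  ultimately have "compactin TG (j ` Z)" by (rule image_compactin[rotated])
  moreover have "j ` Z = U0"
  proof
    show "j ` Z \<subseteq> U0" using ZGc j_carrier ev_j[OF Gc_Bij] by (auto simp: U0_iff)
    show "U0 \<subseteq> j ` Z"
    proof
      fix a assume a: "a \<in> U0"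
      then have aG: "a \<in> carrier G" "ev a x0 = x0" by (auto simp: U0_iff)
      have app: "\<exists>k\<in>stab. \<forall>x\<in>F. act k x = ev a x" if F: "finite F" "F \<subseteq> X" for F
      proof -
        obtain h where "h \<in> carrier H" "\<forall>x\<in>insert x0 F. act h x = ev a x"
          using Gc_approx[OF ev_Gc[OF aG(1)], of "insert x0 F"] F x0 by auto
        then show ?thesis using aG(2) by (auto simp: stab_def)
      qed
      have "ev a x \<in> orb x" if xX: "x \<in> X" for x
      proof -
        obtain k where "k \<in> stab" "act k x = ev a x" using app[of "{x}"] xX by auto
        then show ?thesis unfolding orb_def using imageI[of k stab "\<lambda>k. act k x"] by simp
      qed
      then have "ev a \<in> Z"
        using app Bij_imp_extensional[OF ev_Bij[OF aG(1)]] by (auto simp: Z_def PiE_def)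
      then show "a \<in> j ` Z" using j_ev[OF aG(1)] by force
    qed
  qed
  ultimately show ?thesis by simp
qed

lemma left_mult_cont: "a \<in> carrier G \<Longrightarrow> continuous_map TG TG (\<lambda>b. a \<otimes>\<^bsub>G\<^esub> b)"
proof -
  assume a: "a \<in> carrier G"
  have "continuous_map TG (prod_topology TG TG) (\<lambda>b. (a, b))"
    using a by (intro continuous_map_pairedI) (auto simp: topspace_TG)
  then have "continuous_map TG TG ((\<lambda>(x, y). x \<otimes>\<^bsub>G\<^esub> y) \<circ> (\<lambda>b. (a, b)))"
    using topological_group_G continuous_map_compose unfolding topological_group_def by blast
  then show ?thesis by (simp add: o_def)
qed

text \<open>
  The translates of the compact open subgroup \<open>U0\<close> are compact neighbourhoods.
\<close>

lemma locally_compact_TG: "locally_compact_space TG"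
  unfolding locally_compact_space_def
proof
  fix a assume "a \<in> topspace TG"
  then have a: "a \<in> carrier G" by (simp add: topspace_TG)
  let ?K = "(\<lambda>b. a \<otimes>\<^bsub>G\<^esub> b) ` U0"
  have "compactin TG ?K" using image_compactin[OF U0_compact left_mult_cont[OF a]] .
  moreover have "nb a {x0} \<subseteq> ?K"
  proof
    fix b assume b: "b \<in> nb a {x0}"
    then have bc: "b \<in> carrier G" "ev b x0 = ev a x0" by (auto simp: nb_def)
    have "inv\<^bsub>G\<^esub> a \<otimes>\<^bsub>G\<^esub> b \<in> U0"
      using bc a x0 by (auto simp: U0_iff ev_mult_eq ev_inv_eq)
    moreover have "b = a \<otimes>\<^bsub>G\<^esub> (inv\<^bsub>G\<^esub> a \<otimes>\<^bsub>G\<^esub> b)" using a bc by (simp add: GG.mult_inv_cancel)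
    ultimately show "b \<in> ?K" by blast
  qed
  ultimately show "\<exists>U K. openin TG U \<and> compactin TG K \<and> a \<in> U \<and> U \<subseteq> K"
    using nb_open[of "{x0}" a] nb_self[OF a] x0 by blast
qed

text \<open>
  Immediate from the definition of \<open>Gc\<close>: basic open sets only see finitely many points.
\<close>

lemma dense: "openin TG W \<Longrightarrow> a \<in> W \<Longrightarrow> \<exists>h\<in>carrier H. emb h \<in> W"
proof -
  assume W: "openin TG W" "a \<in> W"
  then have a: "a \<in> carrier G" using openin_subset topspace_TG by blast
  obtain F where F: "finite F" "F \<subseteq> X" "nb a F \<subseteq> W" using openin_TG_nb[OF W] by blast
  obtain h where "h \<in> carrier H" "\<forall>x\<in>F. act h x = ev a x" using Gc_approx[OF ev_Gc[OF a] F(1,2)] by blast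
  then have "emb h \<in> nb a F" by (auto simp: nb_def emb_carrier ev_emb)
  then show ?thesis using F(3) \<open>h \<in> carrier H\<close> by blast
qed

lemma tdlc_completion_G: "tdlc_completion H (discrete_topology (carrier H)) G TG emb"
  unfolding tdlc_completion_def completion_def tdlc_group_def locally_compact_group_def
proof (intro conjI)
  have "prod_topology (discrete_topology (carrier H)) (discrete_topology (carrier H))
      = discrete_topology (carrier H \<times> carrier H)"
    by (simp add: prod_topology_discrete_topology)
  then show "topological_group H (discrete_topology (carrier H))"
    by (auto simp: topological_group_def)
  show "continuous_map (discrete_topology (carrier H)) TG emb"
    using emb_carrier by (auto simp: topspace_TG)
  show "TG closure_of (emb ` carrier H) = carrier G"
    using dense by (auto simp: in_closure_of set_eq_iff topspace_TG)
qed (auto simp: emb_hom topological_group_G Hausdorff_TG locally_compact_TG totally_disconnected_TG)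

definition pre :: "'x set \<Rightarrow> 'h set" where "pre U = emb -` U \<inter> carrier H"

lemma pre_iff: "h \<in> pre U \<longleftrightarrow> h \<in> carrier H \<and> emb h \<in> U" by (auto simp: pre_def)

lemma pre_subgroup: "subgroup U G \<Longrightarrow> subgroup (pre U) H"
  by unfold_locales (auto simp: pre_iff subgroup.m_closed subgroup.one_closed subgroup.m_inv_closed)

lemma pre_U0: "pre U0 = stab"
  by (auto simp: pre_iff U0_iff emb_carrier ev_emb stab_def)

lemma r_coset_open:
  assumes V: "openin TG V" and u: "u \<in> carrier G"
  shows "openin TG (V #>\<^bsub>G\<^esub> u)"
  unfolding openin_TG
proof (intro conjI ballI)
  have VG: "V \<subseteq> carrier G" using openin_subset[OF V] topspace_TG by simp
  then show "V #>\<^bsub>G\<^esub> u \<subseteq> carrier G" using u by (rule GG.r_coset_subset_G)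
  fix b assume "b \<in> V #>\<^bsub>G\<^esub> u"
  then obtain v where v: "v \<in> V" "b = v \<otimes>\<^bsub>G\<^esub> u" by (auto simp: r_coset_def)
  obtain F where F: "finite F" "F \<subseteq> X" "nb v F \<subseteq> V" using openin_TG_nb[OF V v(1)] by blast
  let ?F = "ev (inv\<^bsub>G\<^esub> u) ` F"
  have "nb b ?F \<subseteq> V #>\<^bsub>G\<^esub> u"
  proof
    fix c assume c: "c \<in> nb b ?F"
    then have cG: "c \<in> carrier G" by (simp add: nb_def)
    have vG: "v \<in> carrier G" using v VG by auto
    have "ev (c \<otimes>\<^bsub>G\<^esub> inv\<^bsub>G\<^esub> u) x = ev v x" if x: "x \<in> F" for x
    proof -
      have xX: "x \<in> X" using F x by auto
      have "ev c (ev (inv\<^bsub>G\<^esub> u) x) = ev b (ev (inv\<^bsub>G\<^esub> u) x)" using c x by (auto simp: nb_def)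
      then show ?thesis using cG u xX vG v(2) ev_mem[of "inv\<^bsub>G\<^esub> u" x] ev_inv_eq(2)[OF u xX]
        by (simp add: ev_mult_eq)
    qed
    then have "c \<otimes>\<^bsub>G\<^esub> inv\<^bsub>G\<^esub> u \<in> V" using F(3) cG u by (auto simp: nb_def)
    moreover have "c = c \<otimes>\<^bsub>G\<^esub> inv\<^bsub>G\<^esub> u \<otimes>\<^bsub>G\<^esub> u" using cG u by (simp add: GG.m_assoc)
    ultimately show "c \<in> V #>\<^bsub>G\<^esub> u" unfolding r_coset_def by blast
  qed
  moreover have "finite ?F" "?F \<subseteq> X" using F ev_mem u by auto
  ultimately show "\<exists>F. finite F \<and> F \<subseteq> X \<and> nb b F \<subseteq> V #>\<^bsub>G\<^esub> u" by blast
qed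

text \<open>
  The cosets of the open subgroup \<open>V\<close> form an open cover of the compact set \<open>U\<close>.
\<close>

lemma covers_compact:
  assumes "compactin TG U" "openin TG V" "subgroup V G"
  shows "covers G V U"
proof -
  have UG: "U \<subseteq> carrier G" using compactin_subset_topspace[OF assms(1)] topspace_TG by simp
  have op: "\<forall>W\<in>(\<lambda>u. V #>\<^bsub>G\<^esub> u) ` U. openin TG W" using r_coset_open assms(2) UG by auto
  have cov: "U \<subseteq> \<Union> ((\<lambda>u. V #>\<^bsub>G\<^esub> u) ` U)" using GG.rcos_self[OF _ assms(3)] UG by blast
  obtain \<F> where F: "finite \<F>" "\<F> \<subseteq> (\<lambda>u. V #>\<^bsub>G\<^esub> u) ` U" "U \<subseteq> \<Union> \<F>"
    using assms(1) op cov unfolding compactin_def by meson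
  obtain R where R: "R \<subseteq> U" "finite R" "\<F> = (\<lambda>u. V #>\<^bsub>G\<^esub> u) ` R"
    using F(1,2) by (meson finite_subset_image)
  show ?thesis unfolding covers_def using R F(3) UG by (intro exI[of _ R]) auto
qed

text \<open>
  A coset of \<open>V\<close> that contains images of elements of \<open>H\<close> pulls back to a single coset of the
  preimage of \<open>V\<close>.
\<close>

lemma covers_pre:
  assumes "covers G V U" "subgroup V G" "U \<subseteq> carrier G"
  shows "covers H (pre V) (pre U)"
proof -
  interpret V: subgroup V G by fact
  obtain R where R: "finite R" "R \<subseteq> carrier G" "U \<subseteq> (\<Union>r\<in>R. V #>\<^bsub>G\<^esub> r)"
    using assms(1) unfolding covers_def by blast
  define R' where "R' = {r \<in> R. \<exists>h\<in>carrier H. emb h \<in> V #>\<^bsub>G\<^esub> r}"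
  have "\<forall>r\<in>R'. \<exists>h\<in>carrier H. emb h \<in> V #>\<^bsub>G\<^esub> r" by (simp add: R'_def)
  then obtain f where f: "\<And>r. r \<in> R' \<Longrightarrow> f r \<in> carrier H \<and> emb (f r) \<in> V #>\<^bsub>G\<^esub> r" by metis
  have "pre U \<subseteq> (\<Union>r\<in>f ` R'. pre V #> r)"
  proof
    fix h assume h: "h \<in> pre U"
    then have hc: "h \<in> carrier H" "emb h \<in> U" by (auto simp: pre_iff)
    then obtain r where r: "r \<in> R" "emb h \<in> V #>\<^bsub>G\<^esub> r" using R(3) by auto
    then have r': "r \<in> R'" using hc by (auto simp: R'_def)
    have rG: "r \<in> carrier G" using r R by auto
    obtain v w where v: "v \<in> V" "emb h = v \<otimes>\<^bsub>G\<^esub> r" "w \<in> V" "emb (f r) = w \<otimes>\<^bsub>G\<^esub> r"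
      using r f[OF r'] by (auto simp: r_coset_def)
    have "emb (h \<otimes> inv f r) = v \<otimes>\<^bsub>G\<^esub> inv\<^bsub>G\<^esub> w"
      using v rG hc f[OF r'] by (simp add: GG.m_assoc GG.inv_mult_group GG.mult_inv_cancel)
    then have "h \<otimes> inv f r \<in> pre V" using v hc f[OF r'] by (auto simp: pre_iff)
    moreover have "h = h \<otimes> inv f r \<otimes> f r" using hc f[OF r'] by (simp add: H.m_assoc)
    ultimately have "h \<in> pre V #> f r" unfolding r_coset_def by blast
    then show "h \<in> (\<Union>r\<in>f ` R'. pre V #> r)" using r' by blast
  qed
  then show ?thesis unfolding covers_def using R(1) f by (intro exI[of _ "f ` R'"]) (auto simp: R'_def)
qed

lemma U0_compact_open: "compact_open_subgroup G TG U0"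
  unfolding compact_open_subgroup_def using U0_subgroup U0_compact U0_open by blast

text \<open>
  All compact open subgroups, and hence their preimages in \<open>H\<close>, are commensurate.
\<close>

lemma compact_open_covers:
  assumes "compact_open_subgroup G TG U" "compact_open_subgroup G TG V"
  shows "covers G V U" "covers H (pre V) (pre U)"
proof -
  show 1: "covers G V U" using assms covers_compact unfolding compact_open_subgroup_def by blast
  show "covers H (pre V) (pre U)"
    using covers_pre[OF 1] assms subgroup.subset unfolding compact_open_subgroup_def by blast
qed

text \<open>
  The conjugate of \<open>stab\<close> by \<open>h\<close> is the stabiliser of \<open>h x0\<close>, and \<open>stab\<close> has a finite orbit
  through this point.
\<close>

lemma stab_covers_orbit:
  assumes h: "h \<in> carrier H"
  shows "covers H (h <# stab #> inv h) stab"
proof -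
  let ?y = "act h x0"
  have y: "?y \<in> X" using act_mem[OF h x0] .
  have fin: "finite ((\<lambda>k. act (inv k) ?y) ` stab)"
    by (rule finite_subset[OF _ finite_orb[OF y]])
       (use subgroup.m_inv_closed[OF stab_subgroup] in \<open>auto simp: orb_def\<close>)
  have sub: "h <# stab #> inv h \<subseteq> carrier H"
    using h stab_carrier by (auto simp: r_coset_def l_coset_def)
  show ?thesis
  proof (rule H.covers_fiber[where f = "\<lambda>k. act (inv k) ?y", OF fin _ sub])
    show "stab \<subseteq> carrier H" using stab_carrier by auto
    fix k l assume kl: "k \<in> stab" "l \<in> stab" "act (inv k) ?y = act (inv l) ?y"
    let ?s = "inv h \<otimes> (k \<otimes> inv l) \<otimes> h"
    have c: "k \<in> carrier H" "l \<in> carrier H" using kl stab_carrier by auto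
    have "act (k \<otimes> inv l) ?y = act k (act (inv k) ?y)" using act_mult[of k "inv l" ?y] c y kl by simp
    also have "\<dots> = ?y" using act_inv(2)[OF c(1) y] .
    finally have 1: "act (k \<otimes> inv l) ?y = ?y" .
    have "act ?s x0 = act (inv h) (act (k \<otimes> inv l) ?y)"
      using act_mult[of "inv h \<otimes> (k \<otimes> inv l)" h x0] act_mult[of "inv h" "k \<otimes> inv l" ?y] h c x0 y by simp
    also have "\<dots> = x0" using 1 act_inv(1)[OF h x0] by simp
    finally have "?s \<in> stab" using h c by (simp add: stab_def)
    moreover have "k \<otimes> inv l = h \<otimes> ?s \<otimes> inv h"
      using h c by (simp add: H.m_assoc H.mult_inv_cancel)
    ultimately show "k \<otimes> inv l \<in> h <# stab #> inv h"
      unfolding r_coset_def l_coset_def by blast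
  qed
qed

lemma conj_conj: "h \<in> carrier H \<Longrightarrow> M \<subseteq> carrier H \<Longrightarrow> h <# (inv h <# M #> h) #> inv h = M"
  using H.subgroup_conjugation_is_surj0[of "inv h" M] by (auto simp: l_coset_def r_coset_def H.m_assoc H.mult_inv_cancel subset_iff)

lemma stab_commensurated:
  assumes h: "h \<in> carrier H"
  shows "covers H stab (h <# stab #> inv h)"
proof -
  have S: "stab \<subseteq> carrier H" using stab_carrier by auto
  have "covers H (inv h <# stab #> inv (inv h)) stab" using stab_covers_orbit[of "inv h"] h by simp
  then have "covers H (inv h <# stab #> h) stab" using h by simp
  then have "covers H (h <# (inv h <# stab #> h) #> inv h) (h <# stab #> inv h)"
    using H.covers_conjugate[of "inv h <# stab #> h" stab h] h S
    by (auto simp: r_coset_def l_coset_def)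
  then show ?thesis using conj_conj[OF h S] by simp
qed

text \<open>
  The preimage of \<open>U\<close> is commensurate to \<open>stab\<close>, and \<open>stab\<close> is commensurate to its conjugates.
\<close>

lemma commensurated_pre:
  assumes U: "compact_open_subgroup G TG U"
  shows "commensurated H (pre U)"
  unfolding commensurated_def
proof (intro conjI ballI)
  have sU: "subgroup U G" using U by (simp add: compact_open_subgroup_def)
  show sK: "subgroup (pre U) H" using pre_subgroup[OF sU] .
  fix h assume h: "h \<in> carrier H"
  let ?c = "\<lambda>M. h <# M #> inv h"
  have 1: "covers H stab (pre U)" "covers H (pre U) stab"
    using compact_open_covers[OF U U0_compact_open] compact_open_covers[OF U0_compact_open U]
    by (simp_all add: pre_U0)
  have S: "stab \<subseteq> carrier H" and K: "pre U \<subseteq> carrier H" using stab_carrier by (auto simp: pre_def)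
  have cS: "?c stab \<subseteq> carrier H" and cK: "?c (pre U) \<subseteq> carrier H"
    using h S K by (auto simp: r_coset_def l_coset_def)
  have 2: "covers H (?c stab) (?c (pre U))" "covers H (?c (pre U)) (?c stab)"
    using H.covers_conjugate[OF 1(1) S h] H.covers_conjugate[OF 1(2) K h] .
  have "covers H (pre U) (?c (pre U))"
    using H.covers_trans[OF 1(2) H.covers_trans[OF stab_commensurated[OF h] 2(1) S] K] .
  moreover have "covers H (?c (pre U)) (pre U)"
    using H.covers_trans[OF 2(2) H.covers_trans[OF stab_covers_orbit[OF h] 1(1) cS] cK] .
  ultimately show "commensurate H (pre U) (?c (pre U))"
    using H.commensurate_iff_covers[OF sK H.subgroup_conjugation_is_surj2[OF h sK]] by blast
qed

lemma commens_class_pre: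
  assumes U: "compact_open_subgroup G TG U"
  shows "commens_class H (pre U) = commens_class H stab"
proof (rule H.commens_class_cong)
  show "subgroup (pre U) H" using U pre_subgroup by (simp add: compact_open_subgroup_def)
  show "subgroup stab H" by (rule stab_subgroup)
  show "covers H (pre U) stab" "covers H stab (pre U)"
    using compact_open_covers[OF U U0_compact_open] compact_open_covers[OF U0_compact_open U]
    by (simp_all add: pre_U0)
qed

subsection \<open>Local prime content\<close>

text \<open>
  Taking preimages is a bijection between the cosets of \<open>V\<close> in \<open>U0\<close> and those of its preimage in
  \<open>stab\<close>, since every coset of the open subgroup \<open>V\<close> contains an element of the dense subgroup
  \<open>H\<close>.
\<close>

lemma index_pre:
  assumes V: "subgroup V G" "openin TG V" "V \<subseteq> U0"
  shows "index H stab (pre V) = index G U0 V"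
proof -
  interpret V: subgroup V G by fact
  have pullback: "\<exists>k\<in>stab. emb k \<in> W \<and> W = V #>\<^bsub>G\<^esub> emb k \<and> pre W = pre V #> k" if "W \<in> cosets_in G U0 V" for W
  proof -
    obtain u where u: "u \<in> U0" "W = V #>\<^bsub>G\<^esub> u" using \<open>W \<in> _\<close> by (auto simp: cosets_in_eq)
    have uG: "u \<in> carrier G" using u by (simp add: U0_iff)
    obtain k where k: "k \<in> carrier H" "emb k \<in> W"
      using dense[OF r_coset_open[OF V(2) uG] GG.rcos_self[OF uG V(1)]] u by auto
    have W: "W = V #>\<^bsub>G\<^esub> emb k"
      using GG.repr_independence[OF _ uG V(1), of "emb k"] k u by simp
    have "emb k \<in> U0"
      using k(2) u V(3) subgroup.m_closed[OF U0_subgroup] by (auto simp: r_coset_def)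
    then have ks: "k \<in> stab" using k pre_U0 pre_iff by blast
    have "pre W = pre V #> k"
    proof
      show "pre W \<subseteq> pre V #> k"
      proof
        fix h assume "h \<in> pre W"
        then obtain v where hv: "h \<in> carrier H" "v \<in> V" "emb h = v \<otimes>\<^bsub>G\<^esub> emb k"
          using W by (auto simp: pre_iff r_coset_def)
        then have "emb (h \<otimes> inv k) = v" using k by (simp add: GG.m_assoc V.mem_carrier)
        then have "h \<otimes> inv k \<in> pre V" using hv k by (simp add: pre_iff)
        moreover have "h = h \<otimes> inv k \<otimes> k" using hv k by (simp add: H.m_assoc)
        ultimately show "h \<in> pre V #> k" unfolding r_coset_def by blast
      qed
      show "pre V #> k \<subseteq> pre W"
        using k W by (auto simp: pre_iff r_coset_def)
    qed
    then show ?thesis using ks k W by blast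
  qed
  have "bij_betw pre (cosets_in G U0 V) (cosets_in H stab (pre V))"
    unfolding bij_betw_def
  proof
    show "inj_on pre (cosets_in G U0 V)"
    proof (rule inj_onI)
      fix W W' assume W: "W \<in> cosets_in G U0 V" "W' \<in> cosets_in G U0 V" "pre W = pre W'"
      obtain k where k: "k \<in> stab" "emb k \<in> W" "W = V #>\<^bsub>G\<^esub> emb k" using pullback[OF W(1)] by blast
      have "k \<in> pre W'" using k W(3) stab_carrier by (auto simp: pre_iff)
      then have "emb k \<in> W'" by (simp add: pre_iff)
      obtain l where l: "l \<in> stab" "W' = V #>\<^bsub>G\<^esub> emb l" using pullback[OF W(2)] by blast
      show "W = W'"
        using GG.repr_independence[of "emb k" V "emb l"] \<open>emb k \<in> W'\<close> k l V(1) emb_carrier[OF stab_carrier[OF l(1)]] by simp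
    qed
    show "pre ` cosets_in G U0 V = cosets_in H stab (pre V)"
    proof
      show "pre ` cosets_in G U0 V \<subseteq> cosets_in H stab (pre V)"
      proof
        fix c assume "c \<in> pre ` cosets_in G U0 V"
        then obtain W where W: "W \<in> cosets_in G U0 V" "c = pre W" by auto
        then obtain k where "k \<in> stab" "pre W = pre V #> k" using pullback[OF W(1)] by blast
        then show "c \<in> cosets_in H stab (pre V)" using W(2) by (simp add: cosets_in_eq)
      qed
      show "cosets_in H stab (pre V) \<subseteq> pre ` cosets_in G U0 V"
      proof
        fix c assume "c \<in> cosets_in H stab (pre V)"
        then obtain k where k: "k \<in> stab" "c = pre V #> k" by (auto simp: cosets_in_eq)
        have kG: "emb k \<in> carrier G" "emb k \<in> U0" using k pre_U0 stab_carrier emb_carrier pre_iff by blast+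
        then have "V #>\<^bsub>G\<^esub> emb k \<in> cosets_in G U0 V" by (auto simp: cosets_in_eq)
        then obtain l where l: "l \<in> stab" "pre (V #>\<^bsub>G\<^esub> emb k) = pre V #> l" using pullback by blast
        have "k \<in> pre (V #>\<^bsub>G\<^esub> emb k)" using GG.rcos_self[OF kG(1) V(1)] k stab_carrier by (simp add: pre_iff)
        then have "c = pre V #> l"
          using k l H.repr_independence[of k "pre V" l] pre_subgroup[OF V(1)] stab_carrier by simp
        then show "c \<in> pre ` cosets_in G U0 V"
          using l \<open>V #>\<^bsub>G\<^esub> emb k \<in> cosets_in G U0 V\<close> by (metis imageI)
      qed
    qed
  qed
  then show ?thesis unfolding index_def by (simp add: bij_betw_same_card)
qed

lemma index_stab_prime:
  assumes tor: "\<And>k. k \<in> stab \<Longrightarrow> \<exists>s::nat. k [^] s = \<one> \<and> \<not> q dvd s"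
    and q: "prime q" and L: "subgroup L H" "L \<subseteq> stab" "covers H L stab"
  shows "\<not> q dvd index H stab L"
proof -
  let ?S = "H\<lparr>carrier := stab\<rparr>"
  interpret S: group ?S using H.subgroup_imp_group[OF stab_subgroup] .
  have "finite (cosets_in H stab (stab \<inter> L))"
    using H.covers_iff_finite_cosets[OF stab_subgroup L(1)] L(3) by simp
  then have fin: "finite (rcosets\<^bsub>?S\<^esub> L)" using L(2) by (simp add: cosets_in_def Int_absorb1)
  have "\<exists>s::nat. k [^]\<^bsub>?S\<^esub> s = \<one>\<^bsub>?S\<^esub> \<and> \<not> q dvd s" if "k \<in> carrier ?S" for k
    using tor[of k] that by (simp add: nat_pow_def)
  then show ?thesis unfolding index_def cosets_in_def
    using S.index_coprime_of_torsion[OF H.subgroup_incl[OF L(1) stab_subgroup L(2)] fin q] by blast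
qed

text \<open>
  By the pigeonhole principle two elements of the infinite group \<open>A\<close> lie in the same coset of \<open>L\<close>.
  Their quotient is a non-trivial element of \<open>L\<close> of \<open>p\<close>-power order, and one of its powers has
  order \<open>p\<close>.
\<close>

lemma prime_element:
  assumes A: "A \<subseteq> stab" "infinite A" "\<And>a b. a \<in> A \<Longrightarrow> b \<in> A \<Longrightarrow> a \<otimes> inv b \<in> A"
    and tor: "\<And>a. a \<in> A \<Longrightarrow> \<exists>n::nat. a [^] (p ^ n) = \<one>"
    and L: "subgroup L H" "covers H L stab"
  shows "\<exists>k\<in>L. k \<noteq> \<one> \<and> k [^] (p::nat) = \<one>"
proof -
  obtain R where R: "finite R" "R \<subseteq> carrier H" "stab \<subseteq> (\<Union>r\<in>R. L #> r)"
    using L(2) unfolding covers_def by blast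
  have "\<forall>a\<in>A. \<exists>r\<in>R. a \<in> L #> r" using A(1) R(3) by blast
  then obtain f where f: "\<And>a. a \<in> A \<Longrightarrow> f a \<in> R \<and> a \<in> L #> f a" by metis
  have "\<not> inj_on f A"
  proof
    assume "inj_on f A"
    moreover have "finite (f ` A)" using f R(1) by (meson finite_subset image_subsetI)
    ultimately show False using A(2) finite_imageD by blast
  qed
  then obtain a b where ab: "a \<in> A" "b \<in> A" "a \<noteq> b" "f a = f b" by (auto simp: inj_on_def)
  have abH: "a \<in> carrier H" "b \<in> carrier H" using ab A(1) stab_carrier by auto
  have rH: "f a \<in> carrier H" using f[OF ab(1)] R(2) by auto
  define r where "r = f a"
  have in_r: "a \<in> L #> r" "b \<in> L #> r" using f[OF ab(1)] f[OF ab(2)] ab(4) by (simp_all add: r_def)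
  have rH: "r \<in> carrier H" using rH by (simp add: r_def)
  obtain l where l: "l \<in> L" "a = l \<otimes> r" using in_r(1) unfolding r_coset_def by blast
  obtain m where m: "m \<in> L" "b = m \<otimes> r" using in_r(2) unfolding r_coset_def by blast
  note lm = l m
  have lmH: "l \<in> carrier H" "m \<in> carrier H" using lm subgroup.mem_carrier[OF L(1)] by auto
  define c where "c = a \<otimes> inv b"
  have "c = (l \<otimes> r) \<otimes> inv (m \<otimes> r)" using lm by (simp add: c_def)
  also have "\<dots> = l \<otimes> inv m" using lmH rH by (simp add: H.m_assoc H.inv_mult_group H.mult_inv_cancel)
  finally have cL: "c \<in> L" using lm subgroup.m_closed[OF L(1)] subgroup.m_inv_closed[OF L(1)] by simp
  have cA: "c \<in> A" using A(3) ab by (simp add: c_def)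
  have cH: "c \<in> carrier H" using cA A(1) stab_carrier by auto
  have c1: "c \<noteq> \<one>"
  proof
    assume "c = \<one>"
    then have "a = b" using abH unfolding c_def by (metis H.inv_equality H.inv_inv H.inv_closed)
    then show False using ab by simp
  qed
  define n where "n = (LEAST n. c [^] (p ^ n) = \<one>)"
  have n: "c [^] (p ^ n) = \<one>" unfolding n_def using tor[OF cA] by (rule LeastI_ex)
  have "n \<noteq> 0"
  proof
    assume "n = 0" then show False using n c1 cH by simp
  qed
  then obtain n' where n': "n = Suc n'" by (cases n) auto
  have "c [^] (p ^ n') \<noteq> \<one>" using not_less_Least[of n' "\<lambda>n. c [^] (p ^ n) = \<one>"] n' unfolding n_def by simp
  moreover have "(c [^] (p ^ n')) [^] p = \<one>" using n n' cH by (simp add: H.nat_pow_pow mult.commute)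
  ultimately show ?thesis using H.subgroup_nat_pow[OF L(1) cL] by blast
qed

text \<open>
  No prime outside \<open>P\<close> occurs, because all elements of \<open>stab\<close> have orders prime to it. For
  \<open>p \<in> P\<close>, every subgroup in question contains an element of order \<open>p\<close>; by faithfulness it moves a
  point, whose orbit is finite, and \<open>orbit_kernel_index\<close> applies. The argument is carried out once
  for subgroups of \<open>H\<close> commensurate to \<open>stab\<close> and once for compact open subgroups of \<open>G\<close>.
\<close>

theorem lpc_completion:
  assumes prime: "\<And>p. p \<in> P \<Longrightarrow> prime p"
    and faithful: "\<And>h. h \<in> carrier H \<Longrightarrow> (\<And>x. x \<in> X \<Longrightarrow> act h x = x) \<Longrightarrow> h = \<one>"
    and tor: "\<And>q k. prime q \<Longrightarrow> q \<notin> P \<Longrightarrow> k \<in> stab \<Longrightarrow> \<exists>s::nat. k [^] s = \<one> \<and> \<not> q dvd s"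
    and inf: "\<And>p. p \<in> P \<Longrightarrow> \<exists>A\<subseteq>stab. infinite A \<and> (\<forall>a\<in>A. \<forall>b\<in>A. a \<otimes> inv b \<in> A) \<and> (\<forall>a\<in>A. \<exists>n::nat. a [^] (p ^ n) = \<one>)"
  shows "lpc_class H (commens_class H stab) = P" "lpc G TG = P"
proof -
  have sc: "stab \<subseteq> carrier H" using stab_carrier by auto
  have ev_hom: "ev \<in> hom G (BijGroup X)"
    by (rule homI) (auto simp: BijGroup_def ev_Bij ev_mult)
  have elem: "\<exists>k\<in>L. k [^] p = \<one> \<and> (\<exists>x\<in>X. act k x \<noteq> x)"
    if p: "p \<in> P" and L: "subgroup L H" "covers H L stab" for p L
  proof -
    obtain A where "A \<subseteq> stab" "infinite A" "\<forall>a\<in>A. \<forall>b\<in>A. a \<otimes> inv b \<in> A" "\<forall>a\<in>A. \<exists>n::nat. a [^] (p ^ n) = \<one>"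
      using inf[OF p] by blast
    then obtain k where k: "k \<in> L" "k \<noteq> \<one>" "k [^] p = \<one>" using prime_element[of A p L] L by blast
    then show ?thesis using faithful[of k] subgroup.mem_carrier[OF L(1) k(1)] by blast
  qed
  have cls: "L \<in> commens_class H stab \<longleftrightarrow> subgroup L H \<and> covers H L stab \<and> covers H stab L" for L
    unfolding commens_class_def using H.commensurate_iff_covers[OF stab_subgroup] by auto
  show "lpc_class H (commens_class H stab) = P"
  proof
    show "lpc_class H (commens_class H stab) \<subseteq> P"
    proof
      fix q assume q: "q \<in> lpc_class H (commens_class H stab)"
      have "stab \<in> commens_class H stab"
        using cls stab_subgroup H.covers_refl[OF stab_subgroup] by blast
      then obtain L where L: "L \<in> commens_class H stab" "L \<subseteq> stab" "q dvd index H stab L" "prime q"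
        using q unfolding lpc_class_def by blast
      show "q \<in> P"
      proof (rule ccontr)
        assume "q \<notin> P"
        then show False using index_stab_prime[of q L] tor[of q] L cls by blast
      qed
    qed
    show "P \<subseteq> lpc_class H (commens_class H stab)"
    proof
      fix p assume p: "p \<in> P"
      have "\<exists>L'\<in>commens_class H stab. L' \<subseteq> L \<and> p dvd index H L L'" if Lc: "L \<in> commens_class H stab" for L
      proof -
        have L: "subgroup L H" "covers H L stab" "covers H stab L" using Lc cls by auto
        obtain k x where k: "k \<in> L" "k [^] p = \<one>" "x \<in> X" "act k x \<noteq> x" using elem[OF p L(1,2)] by blast
        define E where "E = (\<lambda>l. act l x) ` L"
        obtain R where R: "finite R" "R \<subseteq> carrier H" "L \<subseteq> (\<Union>r\<in>R. stab #> r)"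
          using L(3) unfolding covers_def by blast
        have "E \<subseteq> (\<Union>r\<in>R. orb (act r x))"
        proof
          fix y assume "y \<in> E"
          then obtain l where l: "l \<in> L" "y = act l x" by (auto simp: E_def)
          then obtain r s where r: "r \<in> R" "s \<in> stab" "l = s \<otimes> r" using R(3) by (auto simp: r_coset_def)
          then have "y = act s (act r x)" using l act_mult[of s r x] R(2) k(3) stab_carrier by auto
          then show "y \<in> (\<Union>r\<in>R. orb (act r x))" using r by (auto simp: orb_def)
        qed
        moreover have "finite (\<Union>r\<in>R. orb (act r x))"
          using R(1,2) finite_orb act_mem k(3) by auto
        ultimately have E: "finite E" by (rule finite_subset)
        define M where "M = {l \<in> L. \<forall>y\<in>E. act l y = y}"
        note ok = H.orbit_kernel_index[OF act_hom L(1) k(3) E E_def k(1,2,4) prime[OF p] M_def]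
        have "M \<subseteq> L" by (auto simp: M_def)
        then have "covers H stab M" using L(3) covers_mono by blast
        moreover have "covers H M stab"
          using H.covers_trans[OF ok(2) L(2) subgroup.subset[OF ok(1)]] .
        ultimately show ?thesis using ok cls \<open>M \<subseteq> L\<close> by blast
      qed
      then show "p \<in> lpc_class H (commens_class H stab)" unfolding lpc_class_def using prime[OF p] by blast
    qed
  qed
  show "lpc G TG = P"
  proof
    show "lpc G TG \<subseteq> P"
    proof
      fix q assume "q \<in> lpc G TG"
      then obtain V where V: "subgroup V G" "openin TG V" "V \<subseteq> U0" "q dvd index G U0 V" and q: "prime q"
        unfolding lpc_def using U0_compact_open by blast
      have 1: "pre V \<subseteq> stab" using V(3) pre_U0 by (auto simp: pre_def)
      have "covers H (pre V) stab"
        using covers_pre[OF covers_compact[OF U0_compact V(2,1)] V(1)] U0_subgroup subgroup.subset pre_U0 by metis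
      then show "q \<in> P"
        using index_stab_prime[of q "pre V"] tor[OF q] q pre_subgroup[OF V(1)] 1 index_pre[OF V(1-3)] V(4)
        by (metis (no_types, lifting))
    qed
    show "P \<subseteq> lpc G TG"
    proof
      fix p assume p: "p \<in> P"
      have "\<exists>V. subgroup V G \<and> openin TG V \<and> V \<subseteq> U \<and> p dvd index G U V"
        if U: "compact_open_subgroup G TG U" for U
      proof -
        have sU: "subgroup U G" and kU: "compactin TG U" and oU: "openin TG U"
          using U by (auto simp: compact_open_subgroup_def)
        have "covers H (pre U) stab" using compact_open_covers(2)[OF U0_compact_open U] by (simp add: pre_U0)
        then obtain k x where k: "k \<in> pre U" "k [^] p = \<one>" "x \<in> X" "act k x \<noteq> x"
          using elem[OF p pre_subgroup[OF sU]] by blast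
        have kH: "k \<in> carrier H" "emb k \<in> U" using k(1) by (auto simp: pre_iff)
        have kp: "emb k [^]\<^bsub>G\<^esub> p = \<one>\<^bsub>G\<^esub>" using eh.hom_nat_pow[OF kH(1), of p] k(2) by simp
        have kx: "ev (emb k) x \<noteq> x" using k kH ev_emb by simp
        define E where "E = (\<lambda>l. ev l x) ` U"
        define V0 where "V0 = nb \<one>\<^bsub>G\<^esub> {x}"
        have E: "finite E"
        proof -
          have sV0: "subgroup (nb \<one>\<^bsub>G\<^esub> {x}) G"
          proof
            fix a assume "a \<in> nb \<one>\<^bsub>G\<^esub> {x}"
            then show "inv\<^bsub>G\<^esub> a \<in> nb \<one>\<^bsub>G\<^esub> {x}" using ev_inv_eq(1)[of a x] k(3) by (auto simp: nb_def ev_one_eq)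
          qed (auto simp: nb_def ev_mult_eq ev_one_eq k(3))
          have "covers G V0 ((\<lambda>a. inv\<^bsub>G\<^esub> a) ` U)"
            using covers_compact[OF _ nb_open sV0, of U] kU k(3) sU unfolding V0_def
            by (metis (no_types, lifting) covers_mono empty_subsetI finite.emptyI finite_insert image_subsetI insert_subset order_refl subgroup.m_inv_closed)
          then obtain R where R: "finite R" "R \<subseteq> carrier G" "(\<lambda>a. inv\<^bsub>G\<^esub> a) ` U \<subseteq> (\<Union>r\<in>R. V0 #>\<^bsub>G\<^esub> r)"
            unfolding covers_def by blast
          have "E \<subseteq> (\<lambda>r. ev (inv\<^bsub>G\<^esub> r) x) ` R"
          proof
            fix y assume "y \<in> E"
            then obtain a where a: "a \<in> U" "y = ev a x" by (auto simp: E_def)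
            then obtain r v where r: "r \<in> R" "v \<in> V0" "inv\<^bsub>G\<^esub> a = v \<otimes>\<^bsub>G\<^esub> r" using R(3) by (auto simp: r_coset_def)
            have c: "a \<in> carrier G" "v \<in> carrier G" "r \<in> carrier G" "inv\<^bsub>G\<^esub> v \<in> V0"
              using a r R(2) sU subgroup.mem_carrier subgroup.m_inv_closed[OF sV0] by (auto simp: V0_def nb_def)
            have "a = inv\<^bsub>G\<^esub> r \<otimes>\<^bsub>G\<^esub> inv\<^bsub>G\<^esub> v" using r(3) c by (metis GG.inv_inv GG.inv_mult_group)
            then have "y = ev (inv\<^bsub>G\<^esub> r) (ev (inv\<^bsub>G\<^esub> v) x)" using a(2) c k(3) by (simp add: ev_mult_eq)
            also have "ev (inv\<^bsub>G\<^esub> v) x = x" using c(4) k(3) by (simp add: V0_def nb_def ev_one_eq)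
            finally show "y \<in> (\<lambda>r. ev (inv\<^bsub>G\<^esub> r) x) ` R" using r(1) by blast
          qed
          then show ?thesis using R(1) finite_surj by blast
        qed
        define M where "M = {l \<in> U. \<forall>y\<in>E. ev l y = y}"
        note ok = GG.orbit_kernel_index[OF ev_hom sU k(3) E E_def kH(2) kp kx prime[OF p] M_def]
        have EX: "E \<subseteq> X" using k(3) ev_mem subgroup.mem_carrier[OF sU] by (auto simp: E_def)
        have "M = U \<inter> nb \<one>\<^bsub>G\<^esub> E"
          using EX subgroup.mem_carrier[OF sU] by (auto simp: M_def nb_def ev_one_eq subset_iff)
        then have "openin TG M" using oU nb_open[OF E EX] by (simp add: openin_Int)
        moreover have "M \<subseteq> U" by (auto simp: M_def)
        ultimately show ?thesis using ok by blast
      qed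
      then show "p \<in> lpc G TG" unfolding lpc_def using prime[OF p] by blast
    qed
  qed
qed

end

section \<open>The shift space and prefix replacement maps\<close>

definition agree :: "nat \<Rightarrow> (nat \<Rightarrow> 'e) \<Rightarrow> (nat \<Rightarrow> 'e) \<Rightarrow> bool" where
  "agree n x y \<longleftrightarrow> (\<forall>j<n. x j = y j)"

definition glue :: "nat \<Rightarrow> (nat \<Rightarrow> 'e) \<Rightarrow> nat \<Rightarrow> (nat \<Rightarrow> 'e) \<Rightarrow> nat \<Rightarrow> 'e" where
  "glue b y a x = (\<lambda>j. if j < b then y j else x (a + (j - b)))"

lemma agree_refl [simp]: "agree n x x" by (simp add: agree_def)
lemma agree_sym: "agree n x y \<Longrightarrow> agree n y x" by (simp add: agree_def)
lemma agree_trans: "agree n x y \<Longrightarrow> agree n y z \<Longrightarrow> agree n x z" by (simp add: agree_def)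
lemma agree_mono: "agree n x y \<Longrightarrow> m \<le> n \<Longrightarrow> agree m x y" by (simp add: agree_def)
lemma agree_0 [simp]: "agree 0 x y" by (simp add: agree_def)

lemma agree_glue: "agree b y (glue b y a x)" by (simp add: agree_def glue_def)
lemma glue_tail: "glue b y a x (b + j) = x (a + j)" by (simp add: glue_def)

lemma glue_eqI: "agree b y z \<Longrightarrow> (\<And>j. z (b + j) = x (a + j)) \<Longrightarrow> z = glue b y a x"
proof
  fix j assume *: "agree b y z" "\<And>j. z (b + j) = x (a + j)"
  show "z j = glue b y a x j"
    using *(1) *(2)[of "j - b"] by (auto simp: glue_def agree_def)
qed

lemma funpow_shift: "(shift ^^ n) x j = x (n + j)"
  by (induction n arbitrary: j) (auto simp: shift_def)

lemma funpow_shift_eq: "(shift ^^ n) x = (shift ^^ m) y \<longleftrightarrow> (\<forall>j. x (n + j) = y (m + j))"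
  by (simp add: fun_eq_iff funpow_shift)

locale shift_graph = fin_digraph g for g :: "('v, 'e) pre_digraph"
begin

abbreviation "X \<equiv> shift_space g"

lemma X_arc: "x \<in> X \<Longrightarrow> x k \<in> arcs g" by (simp add: shift_space_def)
lemma X_step: "x \<in> X \<Longrightarrow> tail g (x (Suc k)) = head g (x k)" by (simp add: shift_space_def)

lemma glue_X:
  assumes "y \<in> X" "x \<in> X" "0 < b" "head g (y (b - 1)) = tail g (x a)"
  shows "glue b y a x \<in> X"
proof -
  have "tail g (glue b y a x (Suc k)) = head g (glue b y a x k)" for k
  proof -
    consider "Suc k < b" | "Suc k = b" | "b \<le> k" by linarith
    then show ?thesis
    proof cases
      case 1 then show ?thesis using X_step[OF assms(1)] by (simp add: glue_def)
    next
      case 2 then show ?thesis using assms(4) by (simp add: glue_def flip: 2)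
    next
      case 3
      then have "a + (Suc k - b) = Suc (a + (k - b))" by simp
      then show ?thesis using X_step[OF assms(2)] 3 by (simp add: glue_def)
    qed
  qed
  then show ?thesis using X_arc assms by (auto simp: shift_space_def glue_def)
qed

abbreviation "prodtop \<equiv> product_topology (\<lambda>_::nat. discrete_topology (arcs g)) UNIV"

lemma X_sub: "X \<subseteq> topspace prodtop" by (auto simp: shift_space_def)

lemma topspace_shift: "topspace (shift_top g) = X"
  using X_sub by (auto simp: shift_top_def)

lemma open_cyl: "openin prodtop {y \<in> topspace prodtop. agree n x y}"
proof (induction n)
  case 0
  have "{y \<in> topspace prodtop. agree 0 x y} = topspace prodtop" by simp
  then show ?case by (simp only: openin_topspace)
next
  case (Suc n)
  have "openin prodtop {y \<in> topspace prodtop. y n \<in> {x n} \<inter> arcs g}"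
    by (rule openin_continuous_map_preimage[OF continuous_map_product_projection]) auto
  then have "openin prodtop ({y \<in> topspace prodtop. agree n x y} \<inter> {y \<in> topspace prodtop. y n \<in> {x n} \<inter> arcs g})"
    using Suc by (rule openin_Int[rotated])
  moreover have "{y \<in> topspace prodtop. agree n x y} \<inter> {y \<in> topspace prodtop. y n \<in> {x n} \<inter> arcs g}
      = {y \<in> topspace prodtop. agree (Suc n) x y}"
    by (auto simp: agree_def less_Suc_eq)
  ultimately show ?case by simp
qed

text \<open>
  The cylinders, given by finitely many initial letters, form a base of the topology.
\<close>

lemma openin_shift:
  "openin (shift_top g) U \<longleftrightarrow> U \<subseteq> X \<and> (\<forall>x\<in>U. \<exists>n. \<forall>y\<in>X. agree n x y \<longrightarrow> y \<in> U)"
proof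
  assume o: "openin (shift_top g) U"
  then obtain T where T: "openin prodtop T" "U = T \<inter> X"
    unfolding shift_top_def by (auto simp: openin_subtopology)
  have "\<exists>n. \<forall>y\<in>X. agree n x y \<longrightarrow> y \<in> U" if x: "x \<in> U" for x
  proof -
    have "x \<in> T" using x T by simp
    then obtain W where W: "finite {i. W i \<noteq> topspace (discrete_topology (arcs g))}"
        "x \<in> Pi\<^sub>E UNIV W" "Pi\<^sub>E UNIV W \<subseteq> T"
      using T(1) unfolding openin_product_topology_alt by fastforce
    obtain n where n: "\<forall>i\<in>{i. W i \<noteq> topspace (discrete_topology (arcs g))}. i < n"
      using W(1) finite_nat_bounded by (metis lessThan_iff subsetD)
    have "y \<in> U" if y: "y \<in> X" "agree n x y" for y
    proof -
      have "y i \<in> W i" for i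
      proof (cases "W i = arcs g")
        case True then show ?thesis using X_arc[OF y(1)] by simp
      next
        case False
        then have "i < n" using n by simp
        then have "x i = y i" using y(2) by (simp add: agree_def)
        moreover have "x i \<in> W i" using W(2) by auto
        ultimately show ?thesis by simp
      qed
      then show ?thesis using W(3) T(2) y(1) by auto
    qed
    then show ?thesis by blast
  qed
  then show "U \<subseteq> X \<and> (\<forall>x\<in>U. \<exists>n. \<forall>y\<in>X. agree n x y \<longrightarrow> y \<in> U)" using T(2) by blast
next
  assume a: "U \<subseteq> X \<and> (\<forall>x\<in>U. \<exists>n. \<forall>y\<in>X. agree n x y \<longrightarrow> y \<in> U)"
  show "openin (shift_top g) U"
  proof (subst openin_subopen, intro ballI)
    fix x assume x: "x \<in> U"
    then obtain n where n: "\<forall>y\<in>X. agree n x y \<longrightarrow> y \<in> U" using a by blast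
    have "openin (shift_top g) ({y \<in> topspace prodtop. agree n x y} \<inter> X)"
      unfolding shift_top_def using open_cyl[of n x] by (auto simp: openin_subtopology)
    moreover have "x \<in> {y \<in> topspace prodtop. agree n x y} \<inter> X" using x a X_sub by auto
    ultimately show "\<exists>T. openin (shift_top g) T \<and> x \<in> T \<and> T \<subseteq> U" using n by blast
  qed
qed

lemma openin_cyl: "openin (shift_top g) {y \<in> X. agree n x y}"
  unfolding openin_shift by (auto simp: agree_def)

lemma clopen_cyl: "clopenin (shift_top g) {y \<in> X. agree n x y}"
proof -
  have "topspace (shift_top g) - {y \<in> X. agree n x y} = {y \<in> X. \<not> agree n x y}"
    unfolding topspace_shift by blast
  moreover have "openin (shift_top g) {y \<in> X. \<not> agree n x y}"
    unfolding openin_shift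
  proof (intro conjI ballI)
    fix y assume "y \<in> {y \<in> X. \<not> agree n x y}"
    then show "\<exists>m. \<forall>z\<in>X. agree m y z \<longrightarrow> z \<in> {y \<in> X. \<not> agree n x y}"
      by (intro exI[of _ n]) (use agree_sym agree_trans in blast)
  qed blast
  ultimately show ?thesis using openin_cyl unfolding clopenin_def closedin_def topspace_shift by simp
qed

text \<open>
  The shift space is closed in a product of finite discrete spaces.
\<close>

lemma compact_shift: "compact_space (shift_top g)"
proof -
  have "closedin prodtop X"
    unfolding closedin_def
  proof (intro conjI X_sub)
    show "openin prodtop (topspace prodtop - X)"
    proof (subst openin_subopen, intro ballI)
      fix x assume x: "x \<in> topspace prodtop - X"
      then obtain k where k: "tail g (x (Suc k)) \<noteq> head g (x k)" by (auto simp: shift_space_def)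
      have "{y \<in> topspace prodtop. agree (Suc (Suc k)) x y} \<subseteq> topspace prodtop - X"
        using k by (auto simp: shift_space_def agree_def)
      then show "\<exists>T. openin prodtop T \<and> x \<in> T \<and> T \<subseteq> topspace prodtop - X"
        using open_cyl[of "Suc (Suc k)" x] x by (intro exI[of _ "{y \<in> topspace prodtop. agree (Suc (Suc k)) x y}"]) auto
    qed
  qed
  moreover have "compact_space prodtop"
    by (auto simp: compact_space_product_topology compact_space_discrete_topology)
  ultimately have "compactin prodtop X" by (rule closedin_compact_space[rotated])
  then show ?thesis unfolding shift_top_def by (rule compact_space_subtopology)
qed

lemma Hausdorff_shift: "Hausdorff_space (shift_top g)"
  unfolding shift_top_def
  by (intro Hausdorff_space_subtopology) (simp add: Hausdorff_space_product_topology Hausdorff_space_discrete_topology)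

end

locale shift_clopen = shift_graph g for g :: "('v, 'e) pre_digraph" +
  fixes Y :: "(nat \<Rightarrow> 'e) set"
  assumes clopen_Y: "clopenin (shift_top g) Y"
begin

lemma YX: "y \<in> Y \<Longrightarrow> y \<in> X"
  using clopen_Y topspace_shift by (auto simp: clopenin_def dest: openin_subset)

abbreviation "obY \<equiv> subtopology (shift_top g) Y"

lemma topspace_obY: "topspace obY = Y"
  using YX by (auto simp: topspace_shift)

lemma openin_obY: "openin obY U \<longleftrightarrow> U \<subseteq> Y \<and> (\<forall>x\<in>U. \<exists>n. \<forall>y\<in>Y. agree n x y \<longrightarrow> y \<in> U)"
proof -
  have oY: "openin (shift_top g) Y" using clopen_Y by (simp add: clopenin_def)
  have "openin obY U \<longleftrightarrow> openin (shift_top g) U \<and> U \<subseteq> Y"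
    using openin_open_subtopology[OF oY] by simp
  also have "\<dots> \<longleftrightarrow> U \<subseteq> Y \<and> (\<forall>x\<in>U. \<exists>n. \<forall>y\<in>Y. agree n x y \<longrightarrow> y \<in> U)"
  proof
    assume "openin (shift_top g) U \<and> U \<subseteq> Y"
    then show "U \<subseteq> Y \<and> (\<forall>x\<in>U. \<exists>n. \<forall>y\<in>Y. agree n x y \<longrightarrow> y \<in> U)"
      using YX unfolding openin_shift by blast
  next
    assume a: "U \<subseteq> Y \<and> (\<forall>x\<in>U. \<exists>n. \<forall>y\<in>Y. agree n x y \<longrightarrow> y \<in> U)"
    have "\<exists>n. \<forall>y\<in>X. agree n x y \<longrightarrow> y \<in> U" if x: "x \<in> U" for x
    proof -
      obtain n where n: "\<forall>y\<in>Y. agree n x y \<longrightarrow> y \<in> U" using a x by blast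
      obtain m where m: "\<forall>y\<in>X. agree m x y \<longrightarrow> y \<in> Y" using oY a x unfolding openin_shift by blast
      show ?thesis using n m by (intro exI[of _ "max n m"]) (meson agree_mono max.cobounded1 max.cobounded2)
    qed
    then show "openin (shift_top g) U \<and> U \<subseteq> Y" unfolding openin_shift using a YX by blast
  qed
  finally show ?thesis .
qed

lemma compact_obY: "compact_space obY"
  using closedin_compact_space[OF compact_shift] clopen_Y
  by (intro compact_space_subtopology) (simp add: clopenin_def)

lemma Hausdorff_obY: "Hausdorff_space obY"
  using Hausdorff_shift by (rule Hausdorff_space_subtopology)

text \<open>
  Compactness of \<open>Y\<close> in the form in which it is used: a property that holds locally with some
  bound, and is preserved when the bound increases, holds everywhere with one bound.
\<close>

lemma uniform:
  assumes loc: "\<And>x. x \<in> Y \<Longrightarrow> \<exists>n N. \<forall>y\<in>Y. agree n x y \<longrightarrow> P y (N::nat)"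
    and mono: "\<And>y N N'. P y N \<Longrightarrow> N \<le> N' \<Longrightarrow> P y N'"
  shows "\<exists>N. \<forall>y\<in>Y. P y N"
proof -
  obtain n N where nN: "\<And>x y. x \<in> Y \<Longrightarrow> y \<in> Y \<Longrightarrow> agree (n x) x y \<Longrightarrow> P y (N x)"
    using loc by metis
  let ?c = "\<lambda>x. {y \<in> Y. agree (n x) x y}"
  have "\<forall>U\<in>?c ` Y. openin obY U" by (auto simp: openin_obY agree_def)
  moreover have "topspace obY \<subseteq> \<Union> (?c ` Y)" unfolding topspace_obY by auto
  moreover have "compactin obY (topspace obY)" using compact_obY by (simp add: compact_space_def)
  ultimately obtain \<F> where F: "finite \<F>" "\<F> \<subseteq> ?c ` Y" "topspace obY \<subseteq> \<Union> \<F>"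
    unfolding compactin_def by meson
  obtain R where R: "R \<subseteq> Y" "finite R" "\<F> = ?c ` R" using F(1,2) by (meson finite_subset_image)
  have "P y (Max (insert 0 (N ` R)))" if "y \<in> Y" for y
  proof -
    have "y \<in> \<Union> (?c ` R)" using F(3) R(3) that unfolding topspace_obY by auto
    then obtain x where x: "x \<in> R" "agree (n x) x y" by auto
    have "P y (N x)" using nN x R(1) that by blast
    moreover have "N x \<le> Max (insert 0 (N ` R))" using R(2) x(1) by simp
    ultimately show ?thesis using mono by blast
  qed
  then show ?thesis by blast
qed

text \<open>
  A length such that the first \<open>depth\<close> letters of a point of the shift space decide whether it
  lies in \<open>Y\<close>; it exists by compactness. Positivity guarantees a letter before every position that
  is at least \<open>depth\<close>.
\<close>

definition depth :: nat where
  "depth = (SOME n. 0 < n \<and> (\<forall>x\<in>Y. \<forall>y\<in>X. agree n x y \<longrightarrow> y \<in> Y))"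

lemma depth: "0 < depth" "x \<in> Y \<Longrightarrow> y \<in> X \<Longrightarrow> agree depth x y \<Longrightarrow> y \<in> Y"
proof -
  have oY: "openin (shift_top g) Y" using clopen_Y by (simp add: clopenin_def)
  have "\<exists>N. \<forall>x\<in>Y. \<forall>y\<in>X. agree N x y \<longrightarrow> y \<in> Y"
  proof (rule uniform[where P = "\<lambda>x N. \<forall>y\<in>X. agree N x y \<longrightarrow> y \<in> Y"])
    fix x assume "x \<in> Y"
    then obtain n where "\<forall>y\<in>X. agree n x y \<longrightarrow> y \<in> Y" using oY unfolding openin_shift by blast
    then show "\<exists>n N. \<forall>y\<in>Y. agree n x y \<longrightarrow> (\<forall>z\<in>X. agree N y z \<longrightarrow> z \<in> Y)"
      by (intro exI[of _ n]) (meson agree_trans)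
  qed (meson agree_mono)
  then obtain N where "\<forall>x\<in>Y. \<forall>y\<in>X. agree N x y \<longrightarrow> y \<in> Y" by blast
  then have "0 < Suc N \<and> (\<forall>x\<in>Y. \<forall>y\<in>X. agree (Suc N) x y \<longrightarrow> y \<in> Y)"
    by (meson agree_mono le_SucI order_refl zero_less_Suc)
  then have *: "0 < depth \<and> (\<forall>x\<in>Y. \<forall>y\<in>X. agree depth x y \<longrightarrow> y \<in> Y)"
    unfolding depth_def by (rule someI)
  show "0 < depth" using * by blast
  show "x \<in> Y \<Longrightarrow> y \<in> X \<Longrightarrow> agree depth x y \<Longrightarrow> y \<in> Y" using * by blast
qed

text \<open>
  The map \<open>h\<close> is a prefix replacement near \<open>x\<close>: on the points of \<open>Y\<close> that share the first \<open>a\<close>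
  letters of \<open>x\<close>, it replaces these by the first \<open>b\<close> letters of \<open>h x\<close>.
\<close>

definition lp :: "((nat \<Rightarrow> 'e) \<Rightarrow> nat \<Rightarrow> 'e) \<Rightarrow> (nat \<Rightarrow> 'e) \<Rightarrow> nat \<Rightarrow> nat \<Rightarrow> bool" where
  "lp h x a b \<longleftrightarrow> (\<forall>y\<in>Y. agree a x y \<longrightarrow> agree b (h x) (h y) \<and> (\<forall>j. h y (b + j) = y (a + j)))"

text \<open>
  This is the carrier of the topological full group, see \<open>full_group_eq\<close>.
\<close>

definition prefix_maps :: "((nat \<Rightarrow> 'e) \<Rightarrow> nat \<Rightarrow> 'e) set" where
  "prefix_maps = {h \<in> Bij Y. \<forall>x\<in>Y. \<exists>a b. lp h x a b}"

lemma lp_agree: "lp h x a b \<Longrightarrow> y \<in> Y \<Longrightarrow> agree a x y \<Longrightarrow> agree b (h x) (h y)"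
  and lp_tail: "lp h x a b \<Longrightarrow> y \<in> Y \<Longrightarrow> agree a x y \<Longrightarrow> h y (b + j) = y (a + j)"
  by (auto simp: lp_def)

lemma lp_move: "lp h x a b \<Longrightarrow> y \<in> Y \<Longrightarrow> agree a x y \<Longrightarrow> lp h y a b"
  unfolding lp_def by (meson agree_sym agree_trans)

text \<open>
  Both prefixes can be extended by the same letters.
\<close>

lemma lp_shift:
  assumes "lp h x a b" "x \<in> Y" shows "lp h x (a + t) (b + t)"
  unfolding lp_def
proof (intro ballI impI conjI allI)
  fix y assume y: "y \<in> Y" "agree (a + t) x y"
  then have ay: "agree a x y" by (rule_tac agree_mono) auto
  show "agree (b + t) (h x) (h y)"
    unfolding agree_def
  proof (intro allI impI)
    fix i assume i: "i < b + t"
    show "h x i = h y i"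
    proof (cases "i < b")
      case True then show ?thesis using lp_agree[OF assms(1) y(1) ay] by (simp add: agree_def)
    next
      case False
      then have "h x i = x (a + (i - b))" "h y i = y (a + (i - b))"
        using lp_tail[OF assms(1,2), of "i - b"] lp_tail[OF assms(1) y(1) ay, of "i - b"] by auto
      moreover have "a + (i - b) < a + t" using i False by simp
      ultimately show ?thesis using y(2) by (simp add: agree_def)
    qed
  qed
  fix j show "h y (b + t + j) = y (a + t + j)"
    using lp_tail[OF assms(1) y(1) ay, of "t + j"] by (simp add: add.assoc)
qed

lemma prefix_maps_Bij: "h \<in> prefix_maps \<Longrightarrow> h \<in> Bij Y" by (simp add: prefix_maps_def)
lemma prefix_maps_mem: "h \<in> prefix_maps \<Longrightarrow> y \<in> Y \<Longrightarrow> h y \<in> Y"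
  by (auto simp: prefix_maps_def Bij_def bij_betw_def)
lemma prefix_maps_inj: "h \<in> prefix_maps \<Longrightarrow> x \<in> Y \<Longrightarrow> y \<in> Y \<Longrightarrow> h x = h y \<Longrightarrow> x = y"
  by (auto simp: prefix_maps_def Bij_def bij_betw_def dest: inj_onD)

text \<open>
  The letters of \<open>x\<close> before position \<open>a\<close> and of \<open>h x\<close> before position \<open>b\<close> have the same head,
  because \<open>x\<close> and \<open>h x\<close> continue with the same letter. So \<open>h\<close> maps the cylinder of \<open>x\<close> of length
  \<open>a\<close> onto the cylinder of \<open>h x\<close> of length \<open>b\<close>.
\<close>

lemma lp_onto:
  assumes h: "h \<in> prefix_maps" and x: "x \<in> Y" and lp: "lp h x a b" and ab: "depth \<le> a" "0 < b"
    and z: "z \<in> Y" "agree b (h x) z"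
  shows "glue a x b z \<in> Y" "h (glue a x b z) = z"
proof -
  have a: "0 < a" using ab depth(1) by linarith
  have hxX: "h x \<in> X" using prefix_maps_mem[OF h x] YX by blast
  have "head g (x (a - 1)) = tail g (x a)" using X_step[OF YX[OF x], of "a - 1"] a by simp
  also have "x a = h x b" using lp_tail[OF lp x agree_refl, of 0] by simp
  also have "tail g (h x b) = head g (h x (b - 1))" using X_step[OF hxX, of "b - 1"] ab(2) by simp
  also have "h x (b - 1) = z (b - 1)" using z(2) ab(2) by (simp add: agree_def)
  also have "head g (z (b - 1)) = tail g (z b)" using X_step[OF YX[OF z(1)], of "b - 1"] ab(2) by simp
  finally have "glue a x b z \<in> X" using glue_X[OF YX[OF x] YX[OF z(1)] a] by simp
  then show Y: "glue a x b z \<in> Y"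
    using depth(2)[OF x] agree_mono[OF agree_glue ab(1)] by blast
  have "agree b (h x) (h (glue a x b z))" using lp_agree[OF lp Y agree_glue] .
  then have 1: "agree b z (h (glue a x b z))" using z(2) agree_sym agree_trans by blast
  have 2: "h (glue a x b z) (b + j) = z (b + j)" for j
    using lp_tail[OF lp Y agree_glue, of j] by (simp add: glue_tail)
  show "h (glue a x b z) = z"
    using glue_eqI[OF 1 2] glue_eqI[OF agree_refl, of z b z b] by simp
qed

lemma prefix_maps_lpE:
  assumes "h \<in> prefix_maps" "x \<in> Y"
  obtains a b where "lp h x a b" "m \<le> a" "m \<le> b"
proof -
  obtain a b where "lp h x a b" using assms by (auto simp: prefix_maps_def)
  then have "lp h x (a + m) (b + m)" using lp_shift assms(2) by blast
  then show ?thesis using that by simp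
qed

text \<open>
  By compactness, and since prefixes can be extended, one length \<open>A\<close> serves all points.
\<close>

lemma uniform_lp:
  assumes h: "h \<in> prefix_maps"
  shows "\<exists>A B. m \<le> A \<and> (\<forall>x\<in>Y. \<exists>b. m \<le> b \<and> b \<le> B \<and> lp h x A b)"
proof -
  have "\<exists>N. \<forall>x\<in>Y. \<exists>a b. a \<le> N \<and> b \<le> N \<and> lp h x a b"
  proof (rule uniform[where P = "\<lambda>x N. \<exists>a b. a \<le> N \<and> b \<le> N \<and> lp h x a b"])
    fix x assume x: "x \<in> Y"
    obtain a b where ab: "lp h x a b" using prefix_maps_lpE[OF h x] .
    show "\<exists>n N. \<forall>y\<in>Y. agree n x y \<longrightarrow> (\<exists>a b. a \<le> N \<and> b \<le> N \<and> lp h y a b)"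
    proof -
      have "\<forall>y\<in>Y. agree a x y \<longrightarrow> (\<exists>a' b'. a' \<le> max a b \<and> b' \<le> max a b \<and> lp h y a' b')"
        using lp_move[OF ab] max.cobounded1 max.cobounded2 by blast
      then show ?thesis by blast
    qed
  qed (meson order_trans)
  then obtain N where N: "\<forall>x\<in>Y. \<exists>a b. a \<le> N \<and> b \<le> N \<and> lp h x a b" by blast
  have "\<exists>b. m \<le> b \<and> b \<le> N + (N + m) \<and> lp h x (N + m) b" if x: "x \<in> Y" for x
  proof -
    obtain a b where ab: "a \<le> N" "b \<le> N" "lp h x a b" using N x by blast
    have "lp h x (a + (N + m - a)) (b + (N + m - a))" using lp_shift[OF ab(3) x] .
    then show ?thesis using ab(1,2) by (intro exI[of _ "b + (N + m - a)"]) auto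
  qed
  then show ?thesis by (intro exI[of _ "N + m"] exI[of _ "N + (N + m)"]) auto
qed

lemma prefix_maps_subgroup: "subgroup prefix_maps (BijGroup Y)"
proof -
  interpret B: group "BijGroup Y" by (rule group_BijGroup)
  show ?thesis
  proof (rule B.subgroupI)
    show "prefix_maps \<subseteq> carrier (BijGroup Y)" by (auto simp: BijGroup_def prefix_maps_def)
    have "(\<lambda>x\<in>Y. x) \<in> prefix_maps"
      unfolding prefix_maps_def
    proof (intro CollectI conjI ballI)
      fix x assume "x \<in> Y"
      then show "\<exists>a b. lp (\<lambda>x\<in>Y. x) x a b" by (intro exI[of _ 0]) (simp add: lp_def)
    qed (rule id_Bij)
    then show "prefix_maps \<noteq> {}" by blast
    fix h assume h: "h \<in> prefix_maps"
    have hB: "h \<in> Bij Y" using h prefix_maps_Bij by blast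
    have surj: "h ` Y = Y" using hB by (simp add: Bij_def bij_betw_def)
    let ?i = "restrict (inv_into Y h) Y"
    have iB: "?i \<in> Bij Y" using restrict_inv_into_Bij[OF hB] .
    have "\<exists>a b. lp ?i y a b" if y: "y \<in> Y" for y
    proof -
      define x where "x = inv_into Y h y"
      have x: "x \<in> Y" "h x = y" using y surj by (auto simp: x_def f_inv_into_f inv_into_into)
      obtain a b where ab: "lp h x a b" "depth \<le> a" "depth \<le> b" using prefix_maps_lpE[OF h x(1)] .
      have b0: "0 < b" using ab(3) depth(1) by linarith
      have "lp ?i y b a"
        unfolding lp_def
      proof (intro ballI impI)
        fix z assume z: "z \<in> Y" "agree b y z"
        have G: "glue a x b z \<in> Y" "h (glue a x b z) = z"
          using lp_onto[OF h x(1) ab(1,2) b0 z(1)] z(2) x(2) by auto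
        have "?i z = glue a x b z"
          using G z(1) hB by (simp add: Bij_def bij_betw_def) (metis inv_into_f_f)
        moreover have "?i y = x" using y by (simp add: x_def)
        ultimately show "agree a (?i y) (?i z) \<and> (\<forall>j. ?i z (a + j) = z (b + j))"
          using agree_glue glue_tail by metis
      qed
      then show ?thesis by blast
    qed
    then have "?i \<in> prefix_maps" using iB by (simp add: prefix_maps_def)
    then show "inv\<^bsub>BijGroup Y\<^esub> h \<in> prefix_maps" using inv_BijGroup[OF hB] by simp
    fix k assume k: "k \<in> prefix_maps"
    have kB: "k \<in> Bij Y" using k prefix_maps_Bij by blast
    have "compose Y h k \<in> prefix_maps"
      unfolding prefix_maps_def
    proof (intro CollectI conjI ballI)
      show "compose Y h k \<in> Bij Y" using hB kB by (rule compose_Bij)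
      fix x assume x: "x \<in> Y"
      obtain c d where cd: "lp h (k x) c d" using prefix_maps_lpE[OF h prefix_maps_mem[OF k x]] .
      obtain a b where ab: "lp k x a b" "c \<le> a" "c \<le> b" using prefix_maps_lpE[OF k x] .
      have "lp h (k x) b (d + (b - c))" using lp_shift[OF cd prefix_maps_mem[OF k x], of "b - c"] ab(3) by simp
      then have "lp (compose Y h k) x a (d + (b - c))"
        using ab(1) x prefix_maps_mem[OF k] unfolding lp_def by (auto simp: compose_def)
      then show "\<exists>a b. lp (compose Y h k) x a b" by blast
    qed
    then show "h \<otimes>\<^bsub>BijGroup Y\<^esub> k \<in> prefix_maps" using hB kB by (simp add: BijGroup_def)
  qed
qed

section \<open>Bisections and prefix replacement maps\<close>

abbreviation "MB \<equiv> {shift_groupoid_basic_open U n m V | U n m V. clopenin (shift_top g) U \<and> clopenin (shift_top g) V}"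
abbreviation "MT \<equiv> topology_generated_by MB"
abbreviation "GY \<equiv> groupoid_restrict (shift_groupoid g) Y"
abbreviation "MY \<equiv> mor_top GY"

lemma GY_simps [simp]:
  "obj_top GY = obY" "gsource GY (x, c, y) = y" "grange GY (x, c, y) = x"
  by (simp_all add: groupoid_restrict_def shift_groupoid_def)

lemma MY_eq: "MY = subtopology MT {(x, c, y). x \<in> Y \<and> y \<in> Y}"
proof -
  have "{a. gsource (shift_groupoid g) a \<in> Y \<and> grange (shift_groupoid g) a \<in> Y} = {(x, c, y). x \<in> Y \<and> y \<in> Y}"
    by (auto simp: shift_groupoid_def)
  then show ?thesis by (simp add: groupoid_restrict_def shift_groupoid_def)
qed

lemma basic_open: "clopenin (shift_top g) U \<Longrightarrow> clopenin (shift_top g) V \<Longrightarrow> openin MT (shift_groupoid_basic_open U n m V)"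
  by (rule topology_generated_by_Basis) blast

lemma basic_iff:
  "(x, c, y) \<in> shift_groupoid_basic_open U n m V \<longleftrightarrow>
    x \<in> U \<and> y \<in> V \<and> c = int n - int m \<and> (\<forall>j. x (n + j) = y (m + j))"
  by (auto simp: shift_groupoid_basic_open_def funpow_shift_eq)

lemma MT_point:
  assumes "(x, c, y) \<in> topspace MT"
  obtains n m where "x \<in> X" "y \<in> X" "c = int n - int m" "\<forall>j. x (n + j) = y (m + j)"
proof -
  obtain U n m V where "clopenin (shift_top g) U" "clopenin (shift_top g) V"
    "(x, c, y) \<in> shift_groupoid_basic_open U n m V"
    using assms unfolding topology_generated_by_topspace by blast
  then show thesis using that openin_subset[of "shift_top g"] topspace_shift
    by (auto simp: basic_iff clopenin_def)
qed

lemma MY_point: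
  assumes "\<gamma> \<in> topspace MY"
  shows "\<exists>x y n m. \<gamma> = (x, int n - int m, y) \<and> x \<in> Y \<and> y \<in> Y \<and> (\<forall>j. x (n + j) = y (m + j))"
proof -
  obtain x c y where p: "\<gamma> = (x, c, y)" by (metis prod_cases3)
  have "(x, c, y) \<in> topspace MT \<inter> {(x, c, y). x \<in> Y \<and> y \<in> Y}"
    using assms unfolding MY_eq topspace_subtopology p .
  then have xy: "(x, c, y) \<in> topspace MT" "x \<in> Y" "y \<in> Y" by (blast, blast, blast)
  obtain n m where "c = int n - int m" "\<forall>j. x (n + j) = y (m + j)" by (rule MT_point[OF xy(1)])
  then show ?thesis using xy p by blast
qed

text \<open>
  The cylinders around the source and the range give small neighbourhoods of a morphism.
\<close>

lemma MY_nbhd: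
  assumes "x \<in> Y" "y \<in> Y" "\<forall>j. x (n + j) = y (m + j)"
  shows "openin MY ({(x', c, y'). x' \<in> Y \<and> y' \<in> Y} \<inter> shift_groupoid_basic_open {x' \<in> X. agree N x x'} n m {y' \<in> X. agree M y y'})"
    "(x, int n - int m, y) \<in> {(x', c, y'). x' \<in> Y \<and> y' \<in> Y} \<inter> shift_groupoid_basic_open {x' \<in> X. agree N x x'} n m {y' \<in> X. agree M y y'}"
proof -
  show "openin MY ({(x', c, y'). x' \<in> Y \<and> y' \<in> Y} \<inter> shift_groupoid_basic_open {x' \<in> X. agree N x x'} n m {y' \<in> X. agree M y y'})"
    unfolding MY_eq openin_subtopology using basic_open[OF clopen_cyl clopen_cyl, of N x n m M y] by blast
  show "(x, int n - int m, y) \<in> {(x', c, y'). x' \<in> Y \<and> y' \<in> Y} \<inter> shift_groupoid_basic_open {x' \<in> X. agree N x x'} n m {y' \<in> X. agree M y y'}"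
    using assms YX by (simp add: basic_iff)
qed

lemma source_cont: "continuous_map MY obY (gsource GY)"
  unfolding continuous_map_def
proof (intro conjI allI impI)
  show "gsource GY \<in> topspace MY \<rightarrow> topspace obY"
    unfolding topspace_obY by (auto dest!: MY_point)
  fix W assume W: "openin obY W"
  show "openin MY {\<gamma> \<in> topspace MY. gsource GY \<gamma> \<in> W}"
  proof (subst openin_subopen, intro ballI)
    fix \<gamma> assume g: "\<gamma> \<in> {\<gamma> \<in> topspace MY. gsource GY \<gamma> \<in> W}"
    then obtain x y n m where p: "\<gamma> = (x, int n - int m, y)" "x \<in> Y" "y \<in> Y" "\<forall>j. x (n + j) = y (m + j)"
      using MY_point[of \<gamma>] by blast
    have "y \<in> W" using g p(1) by simp
    then obtain M where M: "\<forall>y'\<in>Y. agree M y y' \<longrightarrow> y' \<in> W" using W unfolding openin_obY by blast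
    let ?T = "{(x', c, y'). x' \<in> Y \<and> y' \<in> Y} \<inter> shift_groupoid_basic_open {x' \<in> X. agree 0 x x'} n m {y' \<in> X. agree M y y'}"
    have o: "openin MY ?T" "\<gamma> \<in> ?T" unfolding p(1) by (rule MY_nbhd[OF p(2-4)])+
    moreover have "?T \<subseteq> {\<gamma> \<in> topspace MY. gsource GY \<gamma> \<in> W}"
    proof
      fix d assume d: "d \<in> ?T"
      obtain x' c y' where d': "d = (x', c, y')" by (metis prod_cases3)
      have "d \<in> topspace MY" using openin_subset[OF o(1)] d by blast
      moreover have "y' \<in> W" using d d' M by (auto simp: basic_iff)
      ultimately show "d \<in> {\<gamma> \<in> topspace MY. gsource GY \<gamma> \<in> W}" using d' by simp
    qed
    ultimately show "\<exists>T. openin MY T \<and> \<gamma> \<in> T \<and> T \<subseteq> {\<gamma> \<in> topspace MY. gsource GY \<gamma> \<in> W}" by blast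
  qed
qed

lemma range_cont: "continuous_map MY obY (grange GY)"
  unfolding continuous_map_def
proof (intro conjI allI impI)
  show "grange GY \<in> topspace MY \<rightarrow> topspace obY"
    unfolding topspace_obY by (auto dest!: MY_point)
  fix W assume W: "openin obY W"
  show "openin MY {\<gamma> \<in> topspace MY. grange GY \<gamma> \<in> W}"
  proof (subst openin_subopen, intro ballI)
    fix \<gamma> assume g: "\<gamma> \<in> {\<gamma> \<in> topspace MY. grange GY \<gamma> \<in> W}"
    then obtain x y n m where p: "\<gamma> = (x, int n - int m, y)" "x \<in> Y" "y \<in> Y" "\<forall>j. x (n + j) = y (m + j)"
      using MY_point[of \<gamma>] by blast
    have "x \<in> W" using g p(1) by simp
    then obtain M where M: "\<forall>y'\<in>Y. agree M x y' \<longrightarrow> y' \<in> W" using W unfolding openin_obY by blast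
    let ?T = "{(x', c, y'). x' \<in> Y \<and> y' \<in> Y} \<inter> shift_groupoid_basic_open {x' \<in> X. agree M x x'} n m {y' \<in> X. agree 0 y y'}"
    have o: "openin MY ?T" "\<gamma> \<in> ?T" unfolding p(1) by (rule MY_nbhd[OF p(2-4)])+
    moreover have "?T \<subseteq> {\<gamma> \<in> topspace MY. grange GY \<gamma> \<in> W}"
    proof
      fix d assume d: "d \<in> ?T"
      obtain x' c y' where d': "d = (x', c, y')" by (metis prod_cases3)
      have "d \<in> topspace MY" using openin_subset[OF o(1)] d by blast
      moreover have "x' \<in> W" using d d' M by (auto simp: basic_iff)
      ultimately show "d \<in> {\<gamma> \<in> topspace MY. grange GY \<gamma> \<in> W}" using d' by simp
    qed
    ultimately show "\<exists>T. openin MY T \<and> \<gamma> \<in> T \<and> T \<subseteq> {\<gamma> \<in> topspace MY. grange GY \<gamma> \<in> W}" by blast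
  qed
qed

text \<open>
  Let \<open>\<sigma>\<close> be the inverse of the source map on the bisection. The morphism \<open>\<sigma> y\<close> lies in a basic
  open set for some \<open>n\<close> and \<open>m\<close>; near \<open>y\<close> the map \<open>\<sigma>\<close> stays in this set, so that \<open>h z\<close> after \<open>n\<close>
  letters continues like \<open>z\<close> after \<open>m\<close> letters. By continuity of \<open>h\<close> the first \<open>n\<close> letters of
  \<open>h z\<close> are constant near \<open>y\<close>.
\<close>

lemma bisection_prefix_maps:
  assumes U: "bisection GY U"
  shows "restrict (grange GY \<circ> inv_into U (gsource GY)) Y \<in> prefix_maps"
proof -
  let ?S = "subtopology MY U"
  have cU: "clopenin MY U" and hs: "homeomorphic_map ?S obY (gsource GY)" and hr: "homeomorphic_map ?S obY (grange GY)"
    using U unfolding bisection_def by simp_all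
  have UM: "U \<subseteq> topspace MY" using cU openin_subset by (auto simp: clopenin_def)
  have tS: "topspace ?S = U" using UM by (auto simp: topspace_subtopology)
  obtain \<sigma> where s: "homeomorphic_maps ?S obY (gsource GY) \<sigma>" using hs homeomorphic_map_maps by blast
  have inj: "inj_on (gsource GY) U" using homeomorphic_imp_injective_map[OF hs] tS by simp
  have surj: "gsource GY ` U = Y" using homeomorphic_imp_surjective_map[OF hs] tS unfolding topspace_obY by simp
  have sc: "continuous_map obY ?S \<sigma>" using s by (simp add: homeomorphic_maps_def)
  have sU: "\<sigma> y \<in> U" if "y \<in> Y" for y
    using sc that tS topspace_obY unfolding continuous_map_def by blast
  have ss: "gsource GY (\<sigma> y) = y" if "y \<in> Y" for y
    using s that topspace_obY unfolding homeomorphic_maps_def by blast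
  have inv: "inv_into U (gsource GY) y = \<sigma> y" if "y \<in> Y" for y
    using inv_into_f_eq[OF inj sU[OF that] ss[OF that]] .
  define h where "h = restrict (grange GY \<circ> inv_into U (gsource GY)) Y"
  have h: "h y = grange GY (\<sigma> y)" if "y \<in> Y" for y using inv that by (simp add: h_def)
  have "bij_betw (inv_into U (gsource GY)) Y U" using inj surj by (metis bij_betw_inv_into inj_on_imp_bij_betw)
  moreover have "bij_betw (grange GY) U Y"
    using homeomorphic_imp_injective_map[OF hr] homeomorphic_imp_surjective_map[OF hr] tS topspace_obY
    by (simp add: bij_betw_def)
  ultimately have "bij_betw (grange GY \<circ> inv_into U (gsource GY)) Y Y" by (rule bij_betw_trans)
  then have hB: "h \<in> Bij Y" unfolding h_def Bij_def by (auto simp: bij_betw_restrict_eq cong: bij_betw_cong)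
  have hc: "continuous_map obY obY (grange GY \<circ> \<sigma>)"
    using continuous_map_compose[OF sc continuous_map_from_subtopology[OF range_cont]] .
  have "\<exists>a b. lp h y a b" if y: "y \<in> Y" for y
  proof -
    obtain x y' n m where p: "\<sigma> y = (x, int n - int m, y')" "x \<in> Y" "y' \<in> Y" "\<forall>j. x (n + j) = y' (m + j)"
      using MY_point[of "\<sigma> y"] UM sU[OF y] by blast
    have y': "y' = y" and x: "x = h y" using ss[OF y] h[OF y] p(1) by simp_all
    let ?B = "shift_groupoid_basic_open {x' \<in> X. agree 0 x x'} n m {y' \<in> X. agree 0 y y'}"
    have sM: "continuous_map obY MT \<sigma>"
      using sc unfolding MY_eq by (simp add: continuous_map_in_subtopology)
    have "openin obY {z \<in> topspace obY. \<sigma> z \<in> ?B}"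
      using openin_continuous_map_preimage[OF sM basic_open[OF clopen_cyl clopen_cyl]] .
    moreover have "y \<in> {z \<in> topspace obY. \<sigma> z \<in> ?B}"
      using y p y' YX unfolding topspace_obY by (simp add: basic_iff)
    ultimately obtain r1 where r1: "\<forall>z\<in>Y. agree r1 y z \<longrightarrow> \<sigma> z \<in> ?B" unfolding openin_obY by blast
    have "openin obY {z \<in> Y. agree n (h y) z}" by (auto simp: openin_obY agree_def)
    then have "openin obY {z \<in> topspace obY. (grange GY \<circ> \<sigma>) z \<in> {z \<in> Y. agree n (h y) z}}"
      by (rule openin_continuous_map_preimage[OF hc])
    moreover have "y \<in> {z \<in> topspace obY. (grange GY \<circ> \<sigma>) z \<in> {z \<in> Y. agree n (h y) z}}"
      using y h[OF y] p(1,2) x unfolding topspace_obY by simp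
    ultimately obtain r2 where r2': "\<forall>z\<in>Y. agree r2 y z \<longrightarrow> z \<in> {z \<in> topspace obY. (grange GY \<circ> \<sigma>) z \<in> {z \<in> Y. agree n (h y) z}}"
      unfolding openin_obY by blast
    have r2: "\<forall>z\<in>Y. agree r2 y z \<longrightarrow> agree n (h y) (h z)"
      using r2' h by simp
    define r where "r = max r1 (max r2 m)"
    have tail: "h z (n + j) = z (m + j)" if z: "z \<in> Y" "agree r y z" for z j
    proof -
      have "\<sigma> z \<in> ?B" using r1 z agree_mono[OF z(2), of r1] by (simp add: r_def)
      moreover obtain u c v where uv: "\<sigma> z = (u, c, v)" by (metis prod_cases3)
      ultimately have "\<forall>j. u (n + j) = v (m + j)" by (simp add: basic_iff)
      moreover have "u = h z" "v = z" using uv ss[OF z(1)] h[OF z(1)] by simp_all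
      ultimately show ?thesis by simp
    qed
    have "lp h y r (n + (r - m))"
      unfolding lp_def
    proof (intro ballI impI conjI allI)
      fix z assume z: "z \<in> Y" "agree r y z"
      have 1: "agree n (h y) (h z)" using r2 z agree_mono[OF z(2), of r2] by (simp add: r_def)
      show "agree (n + (r - m)) (h y) (h z)"
        unfolding agree_def
      proof (intro allI impI)
        fix j assume j: "j < n + (r - m)"
        show "h y j = h z j"
        proof (cases "j < n")
          case True then show ?thesis using 1 by (simp add: agree_def)
        next
          case False
          have "h y j = y (m + (j - n))" "h z j = z (m + (j - n))"
            using tail[OF y agree_refl, of "j - n"] tail[OF z, of "j - n"] False by simp_all
          moreover have "m + (j - n) < r" using j False by (auto simp: r_def)
          ultimately show ?thesis using z(2) by (simp add: agree_def)
        qed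
      qed
      fix j
      have "m + (r - m + j) = r + j" by (simp add: r_def)
      then show "h z (n + (r - m) + j) = z (r + j)" using tail[OF z, of "r - m + j"] by (simp add: add.assoc)
    qed
    then show ?thesis by blast
  qed
  then show ?thesis using hB unfolding prefix_maps_def h_def by blast
qed

lemma prefix_maps_cont:
  assumes h: "h \<in> prefix_maps" shows "continuous_map obY obY h"
  unfolding continuous_map_def
proof (intro conjI allI impI)
  show "h \<in> topspace obY \<rightarrow> topspace obY" unfolding topspace_obY using prefix_maps_mem[OF h] by blast
  fix W assume W: "openin obY W"
  show "openin obY {x \<in> topspace obY. h x \<in> W}"
    unfolding openin_obY topspace_obY
  proof (intro conjI ballI)
    fix x assume "x \<in> {x \<in> Y. h x \<in> W}"
    then have x: "x \<in> Y" "h x \<in> W" by auto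
    obtain n where n: "\<forall>z\<in>Y. agree n (h x) z \<longrightarrow> z \<in> W" using W x(2) unfolding openin_obY by blast
    obtain a b where ab: "lp h x a b" "n \<le> a" "n \<le> b" using prefix_maps_lpE[OF h x(1)] .
    have "\<forall>y\<in>Y. agree a x y \<longrightarrow> y \<in> {x \<in> Y. h x \<in> W}"
      using lp_agree[OF ab(1)] agree_mono[OF _ ab(3)] n prefix_maps_mem[OF h] by blast
    then show "\<exists>n. \<forall>y\<in>Y. agree n x y \<longrightarrow> y \<in> {x \<in> Y. h x \<in> W}" by blast
  qed auto
qed

text \<open>
  The bisection is the set \<open>U\<close> of all \<open>(h y, e y - A, y)\<close>, where \<open>h\<close> replaces the first \<open>A\<close>
  letters of \<open>y\<close> by \<open>e y\<close> letters. The lag \<open>e y - A\<close> is locally constant because \<open>e y\<close> is chosen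
  depending only on the first \<open>A\<close> letters of \<open>y\<close>. So \<open>U\<close> is open; it is closed because it is
  defined by an equation between continuous maps to a Hausdorff space and a locally constant
  condition.
\<close>

lemma prefix_maps_bisection:
  assumes h: "h \<in> prefix_maps"
  shows "\<exists>U. bisection GY U \<and> h = restrict (grange GY \<circ> inv_into U (gsource GY)) Y"
proof -
  obtain A B where A: "\<forall>x\<in>Y. \<exists>b. 0 \<le> b \<and> b \<le> B \<and> lp h x A b"
    using uniform_lp[OF h, of 0] by blast
  define e where "e y = (SOME b. lp h y A b)" for y
  have e: "lp h y A (e y)" if "y \<in> Y" for y
    unfolding e_def using A that by (metis (mono_tags, lifting) someI_ex)
  \<comment> \<open>\<open>e\<close> is chosen from a set that depends only on the first \<open>A\<close> letters.\<close>
  have e_eq: "e y = e z" if "y \<in> Y" "z \<in> Y" "agree A y z" for y z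
  proof -
    have "lp h y A = lp h z A"
      using lp_move[of h y A _ z] lp_move[of h z A _ y] that agree_sym by blast
    then show ?thesis by (simp add: e_def)
  qed
  define d where "d y = int (e y) - int A" for y
  define \<sigma> where "\<sigma> y = (h y, d y, y)" for y
  define U where "U = \<sigma> ` Y"
  have \<sigma>c: "continuous_map obY MY \<sigma>"
    unfolding MY_eq continuous_map_in_subtopology
  proof
    have in_basic: "\<sigma> y \<in> shift_groupoid_basic_open X (e y) A X" if y: "y \<in> Y" for y
      using lp_tail[OF e[OF y] y agree_refl] YX[OF y] YX[OF prefix_maps_mem[OF h y]]
      by (simp add: \<sigma>_def d_def basic_iff)
    have cX: "clopenin (shift_top g) X" by (simp add: clopenin_def flip: topspace_shift)
    show "continuous_map obY MT \<sigma>"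
    proof (rule continuous_on_generated_topo)
      show "\<sigma> ` topspace obY \<subseteq> \<Union> MB"
      proof
        fix w assume "w \<in> \<sigma> ` topspace obY"
        then obtain y where "y \<in> Y" "w = \<sigma> y" unfolding topspace_obY by blast
        then have "w \<in> shift_groupoid_basic_open X (e y) A X" using in_basic by simp
        then show "w \<in> \<Union> MB" using cX by blast
      qed
      fix W assume "W \<in> MB"
      then obtain U n m V where W: "W = shift_groupoid_basic_open U n m V"
        and UV: "clopenin (shift_top g) U" "clopenin (shift_top g) V" by blast
      show "openin obY (\<sigma> -` W \<inter> topspace obY)"
        unfolding openin_obY topspace_obY
      proof (intro conjI ballI)
        fix y assume "y \<in> \<sigma> -` W \<inter> Y"
        then have y: "y \<in> Y" "h y \<in> U" "y \<in> V" "d y = int n - int m" "\<forall>j. h y (n + j) = y (m + j)"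
          by (auto simp: W \<sigma>_def basic_iff)
        have oU: "openin (shift_top g) U" and oV: "openin (shift_top g) V" using UV by (auto simp: clopenin_def)
        obtain N where N: "\<forall>z\<in>X. agree N (h y) z \<longrightarrow> z \<in> U" using oU y(2) unfolding openin_shift by blast
        obtain M where M: "\<forall>z\<in>X. agree M y z \<longrightarrow> z \<in> V" using oV y(3) unfolding openin_shift by blast
        define R where "R = A + N + M"
        define b where "b = e y"
        have lpR: "lp h y R (b + (N + M))"
          using lp_shift[OF e[OF y(1)] y(1), of "N + M"] by (simp add: R_def b_def add.assoc)
        have "z \<in> \<sigma> -` W \<inter> Y" if z: "z \<in> Y" "agree R y z" for z
        proof -
          have zA: "agree A y z" using agree_mono[OF z(2)] by (simp add: R_def)
          have 1: "d z = int n - int m" using y(4) e_eq[OF y(1) z(1) zA] by (simp add: d_def)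
          have 2: "z \<in> V" using M YX[OF z(1)] agree_mono[OF z(2), of M] by (simp add: R_def)
          have "agree N (h y) (h z)" using agree_mono[OF lp_agree[OF lpR z], of N] by simp
          then have 3: "h z \<in> U" using N YX[OF prefix_maps_mem[OF h z(1)]] by blast
          have nm: "int n - int m = int b - int A" using y(4) by (simp add: d_def b_def)
          have "h z (n + j) = z (m + j)" for j
          proof (cases "b \<le> n + j")
            case True
            then have "h z (n + j) = z (A + (n + j - b))"
              using lp_tail[OF e[OF y(1)] z(1) zA, of "n + j - b"] by (simp add: b_def)
            moreover have "A + (n + j - b) = m + j" using nm True by linarith
            ultimately show ?thesis by simp
          next
            case False
            then have "h z (n + j) = h y (n + j)"
              using lp_agree[OF e[OF y(1)] z(1) zA] by (simp add: agree_def b_def)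
            also have "\<dots> = y (m + j)" using y(5) by simp
            also have "\<dots> = z (m + j)"
            proof -
              have "m + j < A" using nm False by linarith
              then show ?thesis using zA by (simp add: agree_def)
            qed
            finally show ?thesis .
          qed
          then show ?thesis using 1 2 3 z(1) by (simp add: W \<sigma>_def basic_iff)
        qed
        then show "\<exists>n. \<forall>z\<in>Y. agree n y z \<longrightarrow> z \<in> \<sigma> -` W \<inter> Y" by blast
      qed auto
    qed
    show "\<sigma> \<in> topspace obY \<rightarrow> {(x, c, y). x \<in> Y \<and> y \<in> Y}"
      unfolding topspace_obY using prefix_maps_mem[OF h] by (auto simp: \<sigma>_def)
  qed
  have UM: "U \<subseteq> topspace MY"
    using \<sigma>c topspace_obY unfolding U_def continuous_map_def by blast
  have oU: "openin MY U"
  proof (subst openin_subopen, intro ballI)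
    fix \<gamma> assume "\<gamma> \<in> U"
    then obtain y where y: "y \<in> Y" "\<gamma> = \<sigma> y" by (auto simp: U_def)
    let ?T = "{(x', c, y'). x' \<in> Y \<and> y' \<in> Y} \<inter> shift_groupoid_basic_open {x' \<in> X. agree (e y) (h y) x'} (e y) A {y' \<in> X. agree A y y'}"
    have t: "\<forall>j. h y (e y + j) = y (A + j)" using lp_tail[OF e[OF y(1)] y(1) agree_refl] by blast
    have o: "openin MY ?T" "\<gamma> \<in> ?T" unfolding y(2) \<sigma>_def d_def by (rule MY_nbhd[OF prefix_maps_mem[OF h y(1)] y(1) t])+
    moreover have "?T \<subseteq> U"
    proof
      fix w assume w: "w \<in> ?T"
      obtain x' c y' where w': "w = (x', c, y')" by (metis prod_cases3)
      have p: "x' \<in> Y" "y' \<in> Y" "agree (e y) (h y) x'" "agree A y y'" "c = int (e y) - int A"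
          "\<And>j. x' (e y + j) = y' (A + j)"
        using w w' by (auto simp: basic_iff)
      have "agree (e y) (h y) (h y')" using lp_agree[OF e[OF y(1)] p(2,4)] .
      then have "agree (e y) x' (h y')" using p(3) agree_sym agree_trans by blast
      moreover have "h y' (e y + j) = x' (e y + j)" for j
        using lp_tail[OF e[OF y(1)] p(2,4), of j] p(6) by simp
      ultimately have "x' = h y'"
        using glue_eqI[of "e y" x' "h y'" x' "e y"] glue_eqI[of "e y" x' x' x' "e y"] by simp
      moreover have "c = d y'" using p(5) e_eq[OF y(1) p(2,4)] by (simp add: d_def)
      ultimately show "w \<in> U" using w' p(2) by (simp add: U_def \<sigma>_def)
    qed
    ultimately show "\<exists>T. openin MY T \<and> \<gamma> \<in> T \<and> T \<subseteq> U" by blast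
  qed
  have cl: "closedin MY U"
  proof -
    have hs: "continuous_map MY obY (h \<circ> gsource GY)"
      using continuous_map_compose[OF source_cont prefix_maps_cont[OF h]] .
    have "closedin MY {\<gamma> \<in> topspace MY. grange GY \<gamma> = (h \<circ> gsource GY) \<gamma>}"
      by (rule closedin_continuous_maps_eq[OF Hausdorff_obY range_cont hs])
    moreover have "closedin MY {\<gamma> \<in> topspace MY. fst (snd \<gamma>) = d (gsource GY \<gamma>)}"
      unfolding closedin_def
    proof (intro conjI)
      show "openin MY (topspace MY - {\<gamma> \<in> topspace MY. fst (snd \<gamma>) = d (gsource GY \<gamma>)})"
      proof (subst openin_subopen, intro ballI)
        fix \<gamma> assume g: "\<gamma> \<in> topspace MY - {\<gamma> \<in> topspace MY. fst (snd \<gamma>) = d (gsource GY \<gamma>)}"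
        then obtain x y n m where p: "\<gamma> = (x, int n - int m, y)" "x \<in> Y" "y \<in> Y" "\<forall>j. x (n + j) = y (m + j)"
          using MY_point[of \<gamma>] by blast
        let ?T = "{(x', c, y'). x' \<in> Y \<and> y' \<in> Y} \<inter> shift_groupoid_basic_open {x' \<in> X. agree 0 x x'} n m {y' \<in> X. agree A y y'}"
        have o: "openin MY ?T" "\<gamma> \<in> ?T" unfolding p(1) by (rule MY_nbhd[OF p(2-4)])+
        moreover have "?T \<subseteq> topspace MY - {\<gamma> \<in> topspace MY. fst (snd \<gamma>) = d (gsource GY \<gamma>)}"
        proof
          fix w assume w: "w \<in> ?T"
          obtain x' c y' where w': "w = (x', c, y')" by (metis prod_cases3)
          have "w \<in> topspace MY" using openin_subset[OF o(1)] w by blast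
          moreover have "y' \<in> Y" "agree A y y'" "c = int n - int m" using w w' by (auto simp: basic_iff)
          moreover have "int n - int m \<noteq> d y" using g p(1) by auto
          ultimately show "w \<in> topspace MY - {\<gamma> \<in> topspace MY. fst (snd \<gamma>) = d (gsource GY \<gamma>)}"
            using w' e_eq[OF p(3), of y'] by (simp add: d_def)
        qed
        ultimately show "\<exists>T. openin MY T \<and> \<gamma> \<in> T \<and> T \<subseteq> topspace MY - {\<gamma> \<in> topspace MY. fst (snd \<gamma>) = d (gsource GY \<gamma>)}"
          by blast
      qed
    qed auto
    ultimately have "closedin MY ({\<gamma> \<in> topspace MY. grange GY \<gamma> = (h \<circ> gsource GY) \<gamma>} \<inter> {\<gamma> \<in> topspace MY. fst (snd \<gamma>) = d (gsource GY \<gamma>)})"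
      by (rule closedin_Int)
    moreover have "{\<gamma> \<in> topspace MY. grange GY \<gamma> = (h \<circ> gsource GY) \<gamma>} \<inter> {\<gamma> \<in> topspace MY. fst (snd \<gamma>) = d (gsource GY \<gamma>)} = U"
    proof
      show "U \<subseteq> {\<gamma> \<in> topspace MY. grange GY \<gamma> = (h \<circ> gsource GY) \<gamma>} \<inter> {\<gamma> \<in> topspace MY. fst (snd \<gamma>) = d (gsource GY \<gamma>)}"
        using UM by (auto simp: U_def \<sigma>_def)
      show "{\<gamma> \<in> topspace MY. grange GY \<gamma> = (h \<circ> gsource GY) \<gamma>} \<inter> {\<gamma> \<in> topspace MY. fst (snd \<gamma>) = d (gsource GY \<gamma>)} \<subseteq> U"
      proof
        fix \<gamma> assume g: "\<gamma> \<in> {\<gamma> \<in> topspace MY. grange GY \<gamma> = (h \<circ> gsource GY) \<gamma>} \<inter> {\<gamma> \<in> topspace MY. fst (snd \<gamma>) = d (gsource GY \<gamma>)}"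
        then obtain x y n m where p: "\<gamma> = (x, int n - int m, y)" "x \<in> Y" "y \<in> Y"
          using MY_point[of \<gamma>] by blast
        then have "\<gamma> = \<sigma> y" using g by (simp add: \<sigma>_def)
        then show "\<gamma> \<in> U" using p(3) by (simp add: U_def)
      qed
    qed
    ultimately show ?thesis by simp
  qed
  let ?S = "subtopology MY U"
  have tS: "topspace ?S = U" using UM by (auto simp: topspace_subtopology)
  have \<sigma>S: "continuous_map obY ?S \<sigma>"
    unfolding continuous_map_in_subtopology using \<sigma>c topspace_obY U_def by blast
  have maps: "homeomorphic_maps ?S obY (gsource GY) \<sigma>"
    unfolding homeomorphic_maps_def tS topspace_obY
    using continuous_map_from_subtopology[OF source_cont] \<sigma>S by (auto simp: U_def \<sigma>_def)
  then have hs: "homeomorphic_map ?S obY (gsource GY)" using homeomorphic_map_maps by blast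
  have "homeomorphic_map obY obY h"
  proof (rule continuous_imp_homeomorphic_map[OF prefix_maps_cont[OF h] compact_obY Hausdorff_obY])
    show "h ` topspace obY = topspace obY" "inj_on h (topspace obY)"
      unfolding topspace_obY using prefix_maps_Bij[OF h] by (simp_all add: Bij_def bij_betw_def)
  qed
  then have "homeomorphic_map ?S obY (h \<circ> gsource GY)" using hs homeomorphic_map_compose by blast
  moreover have "\<forall>\<gamma>\<in>topspace ?S. (h \<circ> gsource GY) \<gamma> = grange GY \<gamma>"
    unfolding tS by (auto simp: U_def \<sigma>_def)
  ultimately have hr: "homeomorphic_map ?S obY (grange GY)"
    using homeomorphic_map_eq by blast
  have "bisection GY U"
    unfolding bisection_def clopenin_def using oU cl hs hr by simp
  moreover have "h = restrict (grange GY \<circ> inv_into U (gsource GY)) Y"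
  proof
    fix y
    have inj: "inj_on (gsource GY) U" by (auto simp: inj_on_def U_def \<sigma>_def)
    show "h y = restrict (grange GY \<circ> inv_into U (gsource GY)) Y y"
    proof (cases "y \<in> Y")
      case True
      have "inv_into U (gsource GY) y = \<sigma> y"
        by (rule inv_into_f_eq[OF inj]) (use True in \<open>auto simp: U_def \<sigma>_def\<close>)
      then show ?thesis using True by (simp add: \<sigma>_def)
    next
      case False
      then show ?thesis using prefix_maps_Bij[OF h] by (simp add: Bij_def extensional_def)
    qed
  qed
  ultimately show ?thesis by blast
qed

lemma full_group_eq: "full_group GY = (BijGroup Y)\<lparr>carrier := prefix_maps\<rparr>"
proof -
  have "{restrict (grange GY \<circ> inv_into U (gsource GY)) Y | U. bisection GY U} = prefix_maps"
    using bisection_prefix_maps prefix_maps_bisection by blast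
  then show ?thesis unfolding full_group_def using topspace_obY by simp
qed

end

section \<open>Words, walks and the construction of digits\<close>

definition occurs :: "(nat \<Rightarrow> 'e) \<Rightarrow> nat \<Rightarrow> 'e list \<Rightarrow> bool" where
  "occurs x a u \<longleftrightarrow> (\<forall>j<length u. x (a + j) = u ! j)"

definition pcat :: "'e list \<Rightarrow> (nat \<Rightarrow> 'e) \<Rightarrow> nat \<Rightarrow> 'e" where
  "pcat p y = (\<lambda>j. if j < length p then p ! j else y (j - length p))"

lemma occ_agree: "occurs x a u \<Longrightarrow> agree n x y \<Longrightarrow> a + length u \<le> n \<Longrightarrow> occurs y a u"
  by (simp add: occurs_def agree_def)

lemma pcat_Nil [simp]: "pcat [] y = y" by (simp add: pcat_def)

lemma pcat_append: "pcat (p @ q) y = pcat p (pcat q y)"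
  by (auto simp: pcat_def fun_eq_iff nth_append)

lemma occ_pcat: "occurs (pcat p y) 0 p" by (simp add: occurs_def pcat_def)

lemma occ_pcat_iff: "occurs (pcat p y) (length p + a) q \<longleftrightarrow> occurs y a q"
  by (simp add: occurs_def pcat_def)

lemma agree_pcat_map: "agree n x (pcat (map x [0..<n]) y)"
  by (simp add: agree_def pcat_def)

lemma occ_eq_map: "occurs x a u \<longleftrightarrow> map (\<lambda>j. x (a + j)) [0..<length u] = u"
  unfolding occurs_def by (subst list_eq_iff_nth_eq) simp

abbreviation pow_list :: "nat \<Rightarrow> 'a list \<Rightarrow> 'a list" where
  "pow_list k u \<equiv> concat (replicate k u)"

lemma length_pow_list: "length (pow_list k u) = k * length u"
  by (induction k) auto

lemma set_pow_list: "set (pow_list k u) \<subseteq> set u"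
  by (induction k) auto

lemma nth_mid: "length u \<le> t \<Longrightarrow> t < length u + length v \<Longrightarrow> (u @ v @ w) ! t = v ! (t - length u)"
  using nth_append[of u "v @ w" t] nth_append[of v w "t - length u"] by auto

context shift_graph
begin

lemma shift_X: "x \<in> X \<Longrightarrow> (\<lambda>j. x (k + j)) \<in> X"
  by (simp add: shift_space_def)

lemma cons_X: "x \<in> X \<Longrightarrow> a \<in> arcs g \<Longrightarrow> head g a = tail g (x 0) \<Longrightarrow> pcat [a] x \<in> X"
proof -
  assume a: "x \<in> X" "a \<in> arcs g" "head g a = tail g (x 0)"
  have "tail g (pcat [a] x (Suc k)) = head g (pcat [a] x k)" for k
    using a(3) X_step[OF a(1)] by (cases k) (simp_all add: pcat_def)
  then show ?thesis using a X_arc[OF a(1)] by (simp add: shift_space_def) (simp add: pcat_def)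
qed

lemma pcat_X: "awalk u p v \<Longrightarrow> y \<in> X \<Longrightarrow> tail g (y 0) = v \<Longrightarrow> pcat p y \<in> X"
proof (induction p arbitrary: u)
  case Nil then show ?case by simp
next
  case (Cons a p)
  then have a: "a \<in> arcs g" "awalk (head g a) p v" by (auto simp: awalk_Cons_iff)
  have 1: "pcat p y \<in> X" using Cons a by blast
  have "tail g (pcat p y 0) = head g a"
    using a Cons.prems(3) by (cases p) (auto simp: pcat_def awalk_Cons_iff awalk_def)
  then have "pcat [a] (pcat p y) \<in> X" using cons_X[OF 1 a(1)] by simp
  then show ?case using pcat_append[of "[a]" p y] by simp
qed

lemma map_awalk: "x \<in> X \<Longrightarrow> awalk (tail g (x a)) (map (\<lambda>j. x (a + j)) [0..<n]) (tail g (x (a + n)))"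
proof (induction n)
  case 0 then show ?case using X_arc by (simp add: awalk_Nil_iff)
next
  case (Suc n)
  have "awalk (tail g (x (a + n))) [x (a + n)] (tail g (x (a + Suc n)))"
    using X_arc[OF Suc.prems] X_step[OF Suc.prems, of "a + n"] by (simp add: awalk_Cons_iff awalk_Nil_iff)
  then show ?case using Suc by (auto intro: awalk_appendI)
qed

lemma occ_awalk:
  assumes "x \<in> X" "occurs x a p" "awalk u p v" "p \<noteq> []"
  shows "u = tail g (x a)" "v = tail g (x (a + length p))"
proof -
  have "awalk (tail g (x a)) p (tail g (x (a + length p)))"
    using map_awalk[OF assms(1), of a "length p"] assms(2) unfolding occ_eq_map by simp
  then show "u = tail g (x a)" "v = tail g (x (a + length p))"
    using awalk_ends[OF assms(3)] assms(4) by auto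
qed

lemma adj_pow_walk:
  "v \<in> verts g \<Longrightarrow> adj_pow g n v w \<noteq> 0 \<Longrightarrow> \<exists>p. awalk v p w \<and> length p = n"
proof (induction n arbitrary: w)
  case 0 then show ?case by (auto simp: awalk_Nil_iff split: if_splits)
next
  case (Suc n)
  then obtain u where u: "u \<in> verts g" "adj_pow g n v u \<noteq> 0" "adj g u w \<noteq> 0"
    by (auto split: if_splits)
  obtain p where p: "awalk v p u" "length p = n" using Suc.IH[OF Suc.prems(1) u(2)] by blast
  obtain e where e: "e \<in> arcs g" "tail g e = u" "head g e = w"
    using u(3) unfolding adj_def by (metis (mono_tags, lifting) card.empty empty_Collect_eq)
  have "awalk u [e] w" using e by (auto simp: awalk_Cons_iff awalk_Nil_iff)
  then have "awalk v (p @ [e]) w" using p by (auto intro: awalk_appendI)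
  then show ?case using p(2) by (intro exI[of _ "p @ [e]"]) simp
qed

lemma diconnected_walk:
  assumes "diconnected g" "v \<in> verts g" "w \<in> verts g"
  shows "\<exists>p. awalk v p w \<and> p \<noteq> []"
proof -
  obtain n where "n > 0" "adj_pow g n v w \<noteq> 0" using assms unfolding diconnected_def by blast
  then show ?thesis using adj_pow_walk[OF assms(2)] by (metis length_greater_0_conv)
qed

text \<open>
  Otherwise every vertex has exactly one outgoing arc. The map to the head of this arc is
  surjective on the finite set of vertices, hence a permutation, and the adjacency matrix is its
  matrix.
\<close>

lemma branching:
  assumes dc: "diconnected g" and nc: "non_circular g"
  shows "\<exists>e f. e \<in> arcs g \<and> f \<in> arcs g \<and> e \<noteq> f \<and> tail g e = tail g f"
proof (rule ccontr)
  assume "\<not> ?thesis"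
  then have uniq: "\<And>e f. e \<in> arcs g \<Longrightarrow> f \<in> arcs g \<Longrightarrow> tail g e = tail g f \<Longrightarrow> e = f" by blast
  have "\<forall>v\<in>verts g. \<exists>e. e \<in> arcs g \<and> tail g e = v"
  proof
    fix v assume "v \<in> verts g"
    then obtain p where "awalk v p v" "p \<noteq> []" using diconnected_walk[OF dc] by blast
    then show "\<exists>e. e \<in> arcs g \<and> tail g e = v" by (cases p) (auto simp: awalk_Cons_iff)
  qed
  then obtain a where a: "\<And>v. v \<in> verts g \<Longrightarrow> a v \<in> arcs g \<and> tail g (a v) = v" by metis
  define \<pi> where "\<pi> v = head g (a v)" for v
  have au: "e = a (tail g e)" if "e \<in> arcs g" for e using uniq[OF that, of "a (tail g e)"] a that by simp
  have sub: "\<pi> ` verts g \<subseteq> verts g" using a by (auto simp: \<pi>_def)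
  have "verts g \<subseteq> \<pi> ` verts g"
  proof
    fix w assume w: "w \<in> verts g"
    then obtain p where p: "awalk w p w" "p \<noteq> []" using diconnected_walk[OF dc] by blast
    then obtain q e where q: "p = q @ [e]" by (metis append_butlast_last_id)
    then have e: "e \<in> arcs g" "head g e = w" using p(1) by (auto simp: awalk_append_iff awalk_Cons_iff awalk_Nil_iff)
    then have "w = \<pi> (tail g e)" using au[OF e(1)] by (simp add: \<pi>_def)
    then show "w \<in> \<pi> ` verts g" using e(1) by auto
  qed
  then have surj: "\<pi> ` verts g = verts g" using sub by auto
  then have bij: "bij_betw \<pi> (verts g) (verts g)"
    using finite_surj_inj[of "verts g" \<pi>] by (simp add: bij_betw_def)
  have "adj g v w = (if w = \<pi> v then 1 else 0)" if "v \<in> verts g" "w \<in> verts g" for v w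
  proof -
    have "{e \<in> arcs g. tail g e = v \<and> head g e = w} = (if w = \<pi> v then {a v} else {})"
      using a[OF that(1)] au by (auto simp: \<pi>_def)
    then show ?thesis by (simp add: adj_def)
  qed
  then have "permutation_matrix_on (verts g) (adj g)" using bij unfolding permutation_matrix_on_def by blast
  then show False using nc by (simp add: non_circular_def)
qed

lemma shortest_walk:
  assumes "\<exists>p. awalk u p v"
  shows "\<exists>p. awalk u p v \<and> (\<forall>q. awalk u q v \<longrightarrow> length p \<le> length q)"
  using ex_has_least_nat[of "\<lambda>p. awalk u p v" _ length] assms by blast

text \<open>
  Choose two arcs \<open>e\<close> and \<open>f\<close> with the same tail and extend them by shortest walks back to it. A
  shortest walk to the tail of \<open>e\<close> cannot use \<open>e\<close>.
\<close>

lemma return_cycles: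
  assumes dc: "diconnected g" and nc: "non_circular g"
  shows "\<exists>w e \<beta> \<gamma>. awalk w (e # \<beta>) w \<and> awalk w \<gamma> w \<and> e \<notin> set \<beta> \<and> e \<notin> set \<gamma> \<and> \<gamma> \<noteq> []"
proof -
  obtain e f where ef: "e \<in> arcs g" "f \<in> arcs g" "e \<noteq> f" "tail g e = tail g f"
    using branching[OF dc nc] by blast
  let ?w = "tail g e"
  obtain p where p: "awalk (head g e) p ?w" "\<And>q. awalk (head g e) q ?w \<Longrightarrow> length p \<le> length q"
    using shortest_walk[of "head g e" ?w] diconnected_walk[OF dc, of "head g e" ?w] ef by auto
  obtain q where q: "awalk (head g f) q ?w" "\<And>q'. awalk (head g f) q' ?w \<Longrightarrow> length q \<le> length q'"
    using shortest_walk[of "head g f" ?w] diconnected_walk[OF dc, of "head g f" ?w] ef by auto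
  have "e \<notin> set p"
  proof
    assume "e \<in> set p"
    then obtain p1 p2 where s: "p = p1 @ e # p2" by (meson split_list)
    then have "awalk (head g e) p2 ?w" using p(1) by (auto simp: awalk_append_iff awalk_Cons_iff)
    then show False using p(2)[of p2] s by simp
  qed
  moreover have "e \<notin> set q"
  proof
    assume "e \<in> set q"
    then obtain q1 q2 where s: "q = q1 @ e # q2" by (meson split_list)
    then have "awalk (head g f) q1 ?w" using q(1) by (auto simp: awalk_append_iff awalk_Cons_iff)
    then show False using q(2)[of q1] s by simp
  qed
  moreover have "awalk ?w (e # p) ?w" using p(1) ef by (simp add: awalk_Cons_iff)
  moreover have "awalk ?w (f # q) ?w" using q(1) ef by (simp add: awalk_Cons_iff)
  ultimately show ?thesis using ef(3) by (intro exI[of _ ?w] exI[of _ e] exI[of _ p] exI[of _ "f # q"]) auto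
qed

lemma pow_list_awalk: "awalk w u w \<Longrightarrow> awalk w (pow_list k u) w"
  by (induction k) (auto simp: awalk_Nil_iff intro: awalk_appendI)

text \<open>
  Let \<open>\<beta>\<close> be a cycle that uses an arc \<open>e\<close> only as its first arc, and let \<open>\<gamma>\<close> be a cycle at the
  same vertex without \<open>e\<close>. The digits are \<open>d i = \<beta> \<beta> \<gamma>\<^sup>i\<^sup>+\<^sup>1 \<beta> \<gamma>\<^sup>m\<^sup>+\<^sup>k\<^sup>-\<^sup>i\<close>, where \<open>k\<close> is the
  length of the marker \<open>\<mu> = \<beta> \<beta>\<close>. The marker shows the arc \<open>e\<close> twice at distance \<open>B\<close>, the length
  of \<open>\<beta>\<close>. In \<open>d i\<close> the arc \<open>e\<close> occurs exactly at the starts of the three copies of \<open>\<beta>\<close>, so only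
  the first copy is followed by another one at this distance; and as \<open>d i\<close> ends with at least \<open>B\<close>
  letters different from \<open>e\<close>, no marker can start at the last copy either. The long power of \<open>\<gamma>\<close>
  at the end provides the common final segment.
\<close>

lemma digit_words:
  fixes m :: nat
  assumes dc: "diconnected g" and nc: "non_circular g"
  shows "\<exists>w (d :: nat \<Rightarrow> 'e list) \<mu> \<rho> l. (\<forall>i<m. awalk w (d i) w \<and> length (d i) = l \<and> take (length \<mu>) (d i) = \<mu>
            \<and> drop (l - length \<mu>) (d i) = \<rho>)
      \<and> inj_on d {..<m} \<and> 0 < length \<mu> \<and> 2 * length \<mu> \<le> l \<and> awalk w \<mu> w
      \<and> (\<forall>i<m. \<forall>x a b. occurs x a (d i) \<longrightarrow> occurs x b \<mu> \<longrightarrow> a \<le> b \<longrightarrow> b < a + l \<longrightarrow> b = a)"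
proof -
  obtain w e \<beta>' \<gamma> where c: "awalk w (e # \<beta>') w" "awalk w \<gamma> w" "e \<notin> set \<beta>'" "e \<notin> set \<gamma>" "\<gamma> \<noteq> []"
    using return_cycles[OF dc nc] by blast
  define \<beta> where "\<beta> = e # \<beta>'"
  define B where "B = length \<beta>"
  define C where "C = length \<gamma>"
  have B: "0 < B" and C: "0 < C" using c by (auto simp: B_def \<beta>_def C_def)
  define \<mu> where "\<mu> = \<beta> @ \<beta>"
  define k where "k = length \<mu>"
  \<comment> \<open>The number of copies of \<open>\<gamma>\<close> does not depend on \<open>i\<close>, and at least \<open>k\<close> of them stand at the end.\<close>
  define d where "d i = \<beta> @ \<beta> @ pow_list (Suc i) \<gamma> @ \<beta> @ pow_list (m + k - i) \<gamma>" for i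
  define l where "l = 3 * B + (Suc m + k) * C"
  have len: "length (d i) = l" if "i < m" for i
  proof -
    have "length (d i) = 3 * B + (Suc i + (m + k - i)) * C"
      by (simp add: d_def l_def length_pow_list B_def C_def distrib_right del: replicate_Suc)
    then show ?thesis using that by (simp add: l_def)
  qed
  have \<beta>_nth: "t = 0" if "t < B" "\<beta> ! t = e" for t
    using that c(3) by (cases t) (auto simp: \<beta>_def B_def)
  have pow_nth: "pow_list n \<gamma> ! t \<noteq> e" if "t < n * C" for t n
    using that set_pow_list[of n \<gamma>] c(4) nth_mem[of t "pow_list n \<gamma>"] by (auto simp: length_pow_list C_def)
  \<comment> \<open>The arc \<open>e\<close> occurs in a digit exactly at the starts of the three copies of \<open>\<beta>\<close>.\<close>
  have pos: "t = 0 \<or> t = B \<or> t = 2 * B + Suc i * C" if "i < m" "t < l" "d i ! t = e" for i t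
  proof -
    consider "t < B" | "B \<le> t" "t < 2 * B" | "2 * B \<le> t" "t < 2 * B + Suc i * C"
      | "2 * B + Suc i * C \<le> t" "t < 3 * B + Suc i * C" | "3 * B + Suc i * C \<le> t" by linarith
    then show ?thesis
    proof cases
      case 1
      then have "\<beta> ! t = e" using that(3) by (simp add: d_def nth_append B_def)
      then show ?thesis using \<beta>_nth 1 by blast
    next
      case 2
      then have "\<beta> ! (t - B) = e"
        using nth_mid[of \<beta> t \<beta> "pow_list (Suc i) \<gamma> @ \<beta> @ pow_list (m + k - i) \<gamma>"] that(3)
        by (simp add: d_def B_def)
      then show ?thesis using \<beta>_nth[of "t - B"] 2 by auto
    next
      case 3
      then have "pow_list (Suc i) \<gamma> ! (t - 2 * B) = e"
        using nth_mid[of "\<beta> @ \<beta>" t "pow_list (Suc i) \<gamma>" "\<beta> @ pow_list (m + k - i) \<gamma>"] that(3)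
        by (simp add: d_def B_def C_def length_pow_list mult_2 del: replicate_Suc)
      moreover have "t - 2 * B < Suc i * C" using 3 by linarith
      ultimately show ?thesis using pow_nth by blast
    next
      case 4
      then have "\<beta> ! (t - (2 * B + Suc i * C)) = e"
        using nth_mid[of "\<beta> @ \<beta> @ pow_list (Suc i) \<gamma>" t \<beta> "pow_list (m + k - i) \<gamma>"] that(3)
        by (simp add: d_def B_def C_def length_pow_list add.assoc mult_2 del: replicate_Suc mult_Suc)
      moreover have "t - (2 * B + Suc i * C) < B" using 4 B by linarith
      ultimately show ?thesis using \<beta>_nth[of "t - (2 * B + Suc i * C)"] 4 by auto
    next
      case 5
      have "t - (3 * B + Suc i * C) < (m + k - i) * C"
      proof -
        have "l = 3 * B + Suc i * C + (m + k - i) * C"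
          using that(1) unfolding l_def by (simp add: distrib_right[symmetric] add.assoc del: mult_Suc)
        then show ?thesis using that(2) 5 by linarith
      qed
      moreover have "pow_list (m + k - i) \<gamma> ! (t - (3 * B + Suc i * C)) = e"
      proof -
        have "d i = (\<beta> @ \<beta> @ pow_list (Suc i) \<gamma> @ \<beta>) @ pow_list (m + k - i) \<gamma>" by (simp add: d_def)
        moreover have "length (\<beta> @ \<beta> @ pow_list (Suc i) \<gamma> @ \<beta>) = 3 * B + Suc i * C"
          by (simp add: length_pow_list B_def C_def del: replicate_Suc)
        ultimately show ?thesis using that(3) 5 by (metis nth_append not_less)
      qed
      ultimately show ?thesis using pow_nth by blast
    qed
  qed
  have at: "d i ! (2 * B + Suc i * C) = e" for i
    by (simp add: d_def nth_append B_def C_def length_pow_list mult_2 \<beta>_def del: replicate_Suc mult_Suc)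
  have sl: "2 * B + Suc i * C < l" "2 * B + Suc i * C + B < l" if "i < m" for i
  proof -
    have "Suc i * C < (Suc m + k) * C" using that C by simp
    then show "2 * B + Suc i * C + B < l" by (simp add: l_def)
    then show "2 * B + Suc i * C < l" by simp
  qed
  have inj: "inj_on d {..<m}"
  proof (rule inj_onI)
    fix i i' assume i: "i \<in> {..<m}" "i' \<in> {..<m}" "d i = d i'"
    have "d i' ! (2 * B + Suc i * C) = e" using at[of i] i(3) by simp
    then have "2 * B + Suc i * C = 0 \<or> 2 * B + Suc i * C = B \<or> 2 * B + Suc i * C = 2 * B + Suc i' * C"
      using pos[of i' "2 * B + Suc i * C"] sl(1)[of i] i by blast
    then have "Suc i * C = Suc i' * C" using B by linarith
    then show "i = i'" using C by simp
  qed
  \<comment> \<open>A marker at \<open>b\<close> shows \<open>e\<close> at \<open>b\<close> and at \<open>b + B\<close>.\<close>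
  have over: "b = a" if "i < m" "occurs x a (d i)" "occurs x b \<mu>" "a \<le> b" "b < a + l" for i x a b
  proof -
    have mu: "0 < length \<mu>" "B < length \<mu>" "\<mu> ! 0 = e" "\<mu> ! B = e"
      by (simp_all add: \<mu>_def B_def \<beta>_def nth_append)
    have x1: "x b = e" "x (b + B) = e" using that(3) mu unfolding occurs_def by (metis add.right_neutral, metis)
    have x2: "x (a + t) = d i ! t" if "t < l" for t
      using \<open>occurs x a (d i)\<close> len[OF \<open>i < m\<close>] that by (simp add: occurs_def)
    define t where "t = b - a"
    have t: "b = a + t" "t < l" using that by (auto simp: t_def)
    have "d i ! t = e" using x1(1) x2[OF t(2)] t by simp
    then have cases: "t = 0 \<or> t = B \<or> t = 2 * B + Suc i * C" using pos[OF \<open>i < m\<close> t(2)] by blast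
    have nx: "t + B = 0 \<or> t + B = B \<or> t + B = 2 * B + Suc i * C" if "t + B < l"
    proof -
      have "d i ! (t + B) = e" using x1(2) x2[OF that] t by (simp add: add.assoc)
      then show ?thesis using pos[OF \<open>i < m\<close> that] by blast
    qed
    have pC: "0 < Suc i * C" using C by simp
    have "t = 0"
    proof (rule ccontr)
      assume "t \<noteq> 0"
      then consider "t = B" | "t = 2 * B + Suc i * C" using cases by blast
      then show False
      proof cases
        case 1
        then have "t + B < l" using sl[OF \<open>i < m\<close>] pC by linarith
        then show False using nx 1 B pC by linarith
      next
        case 2
        then have "t + B < l" using sl[OF \<open>i < m\<close>] by linarith
        then show False using nx 2 B pC by linarith
      qed
    qed
    then show ?thesis using t by simp
  qed
  have walk: "awalk w (d i) w" for i
    using c(1,2) pow_list_awalk[OF c(2)] unfolding d_def \<beta>_def[symmetric] by (intro awalk_appendI) auto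
  have kl: "k \<le> k * C" using C by simp
  have dr: "drop (l - k) (d i) = drop (k * C - k) (pow_list k \<gamma>)" if "i < m" for i
  proof -
    define u where "u = \<beta> @ \<beta> @ pow_list (Suc i) \<gamma> @ \<beta> @ pow_list (m - i) \<gamma>"
    have "pow_list (m + k - i) \<gamma> = pow_list (m - i) \<gamma> @ pow_list k \<gamma>"
      using that by (metis concat_append replicate_add Nat.diff_add_assoc2 less_imp_le)
    then have du: "d i = u @ pow_list k \<gamma>" by (simp add: d_def u_def)
    then have "l = length u + k * C" using len[OF that] by (simp add: length_pow_list C_def)
    then have "l - k = length u + (k * C - k)" using kl by linarith
    then show ?thesis unfolding du by simp
  qed
  have "k * C \<le> (Suc m + k) * C" by (rule mult_le_mono1) simp
  moreover have "k = 2 * B" by (simp add: k_def \<mu>_def B_def)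
  ultimately have "2 * k \<le> l" using kl unfolding l_def by linarith
  moreover have "take k (d i) = \<mu>" for i by (simp add: d_def k_def \<mu>_def)
  moreover have "awalk w \<mu> w" using c(1) unfolding \<mu>_def \<beta>_def by (intro awalk_appendI) auto
  moreover have "0 < k" using B by (simp add: k_def \<mu>_def B_def)
  ultimately show ?thesis
    using walk len dr inj over unfolding k_def[symmetric]
    by (intro exI[of _ w] exI[of _ d] exI[of _ \<mu>] exI[of _ "drop (k * C - k) (pow_list k \<gamma>)"] exI[of _ l])
       (simp add: k_def)
qed

end

section \<open>The group of digit changes\<close>

text \<open>
  The output of \<open>digit_words\<close> for a fixed non-empty clopen set.
\<close>

locale digit_system = shift_clopen g Y for g :: "('v, 'e) pre_digraph" and Y +
  fixes d :: "nat \<Rightarrow> 'e list" and \<mu> \<rho> :: "'e list" and l m :: nat and w :: 'v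
  assumes dc: "diconnected g" and Y_ne: "Y \<noteq> {}" and m_pos: "0 < m"
    and d_walk: "\<And>i. i < m \<Longrightarrow> awalk w (d i) w"
    and d_len: "\<And>i. i < m \<Longrightarrow> length (d i) = l"
    and d_take: "\<And>i. i < m \<Longrightarrow> take (length \<mu>) (d i) = \<mu>"
    and d_drop: "\<And>i. i < m \<Longrightarrow> drop (l - length \<mu>) (d i) = \<rho>"
    and d_inj: "inj_on d {..<m}"
    and mu_pos: "0 < length \<mu>" and mu_l: "2 * length \<mu> \<le> l" and mu_walk: "awalk w \<mu> w"
    and overlap: "\<And>i x a b. i < m \<Longrightarrow> occurs x a (d i) \<Longrightarrow> occurs x b \<mu> \<Longrightarrow> a \<le> b \<Longrightarrow> b < a + l \<Longrightarrow> b = a"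
begin

abbreviation "HH \<equiv> (BijGroup Y)\<lparr>carrier := prefix_maps\<rparr>"

lemma HH_group: "group HH"
  using group.subgroup_imp_group[OF group_BijGroup prefix_maps_subgroup] .

lemma HH_carrier [simp]: "carrier HH = prefix_maps" by simp

lemma HH_mult: "h \<in> prefix_maps \<Longrightarrow> k \<in> prefix_maps \<Longrightarrow> x \<in> Y \<Longrightarrow> (h \<otimes>\<^bsub>HH\<^esub> k) x = h (k x)"
  using prefix_maps_Bij by (simp add: BijGroup_def compose_eq)

lemma HH_one: "x \<in> Y \<Longrightarrow> \<one>\<^bsub>HH\<^esub> x = x" by (simp add: BijGroup_def)

lemma HH_inv_mem: "h \<in> prefix_maps \<Longrightarrow> inv\<^bsub>HH\<^esub> h \<in> prefix_maps"
  using group.inv_closed[OF HH_group] by simp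

lemma HH_mult_mem: "h \<in> prefix_maps \<Longrightarrow> k \<in> prefix_maps \<Longrightarrow> h \<otimes>\<^bsub>HH\<^esub> k \<in> prefix_maps"
  using monoid.m_closed[OF group.is_monoid[OF HH_group], of h k] by simp

lemma HH_inv:
  assumes "h \<in> prefix_maps" "x \<in> Y"
  shows "(inv\<^bsub>HH\<^esub> h) (h x) = x" "h ((inv\<^bsub>HH\<^esub> h) x) = x"
proof -
  have "(inv\<^bsub>HH\<^esub> h) (h x) = (inv\<^bsub>HH\<^esub> h \<otimes>\<^bsub>HH\<^esub> h) x" using HH_mult[OF HH_inv_mem[OF assms(1)] assms] by simp
  also have "\<dots> = x" using group.l_inv[OF HH_group, of h] assms HH_one by simp
  finally show "(inv\<^bsub>HH\<^esub> h) (h x) = x" .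
  have "h ((inv\<^bsub>HH\<^esub> h) x) = (h \<otimes>\<^bsub>HH\<^esub> inv\<^bsub>HH\<^esub> h) x" using HH_mult[OF assms(1) HH_inv_mem[OF assms(1)] assms(2)] by simp
  also have "\<dots> = x" using group.r_inv[OF HH_group, of h] assms HH_one by simp
  finally show "h ((inv\<^bsub>HH\<^esub> h) x) = x" .
qed

lemma prefix_maps_eqI: "h \<in> prefix_maps \<Longrightarrow> k \<in> prefix_maps \<Longrightarrow> (\<And>x. x \<in> Y \<Longrightarrow> h x = k x) \<Longrightarrow> h = k"
  using prefix_maps_Bij by (meson Bij_imp_extensional extensionalityI)

lemma HH_pow:
  assumes "h \<in> prefix_maps" "x \<in> Y"
  shows "(h [^]\<^bsub>HH\<^esub> (n::nat)) x = (h ^^ n) x \<and> h [^]\<^bsub>HH\<^esub> n \<in> prefix_maps \<and> (h ^^ n) x \<in> Y"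
proof (induction n)
  case 0
  have "\<one>\<^bsub>HH\<^esub> \<in> prefix_maps" using monoid.one_closed[OF group.is_monoid[OF HH_group]] by simp
  moreover have "h [^]\<^bsub>HH\<^esub> (0::nat) = \<one>\<^bsub>HH\<^esub>" by (simp only: nat_pow_def) simp
  ultimately show ?case using assms(2) HH_one[OF assms(2)] by (simp only: funpow_0 simp_thms)
next
  case (Suc n)
  interpret group HH by (rule HH_group)
  have 1: "h [^]\<^bsub>HH\<^esub> Suc n = h \<otimes>\<^bsub>HH\<^esub> h [^]\<^bsub>HH\<^esub> n"
    using assms(1) by (subst nat_pow_Suc2) auto
  show ?case using Suc HH_mult[of h "h [^]\<^bsub>HH\<^esub> n" x] assms HH_mult_mem prefix_maps_mem unfolding 1 by auto
qed

subsection \<open>Digits\<close>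

definition digit_at :: "(nat \<Rightarrow> 'e) \<Rightarrow> nat \<Rightarrow> nat \<Rightarrow> bool" where
  "digit_at x a s \<longleftrightarrow> s < m \<and> occurs x a (d s)"

lemma dig_lt: "digit_at x a s \<Longrightarrow> s < m" by (simp add: digit_at_def)

lemma l_pos: "0 < l" using mu_pos mu_l by linarith

lemma dig_nth: "digit_at x a s \<Longrightarrow> j < l \<Longrightarrow> x (a + j) = d s ! j"
  using d_len by (simp add: digit_at_def occurs_def)

lemma dig_unique: "digit_at x a s \<Longrightarrow> digit_at x a t \<Longrightarrow> s = t"
proof -
  assume st: "digit_at x a s" "digit_at x a t"
  then have "d s = d t" using d_len dig_nth by (metis digit_at_def nth_equalityI)
  then show "s = t" using d_inj st by (auto simp: digit_at_def dest: inj_onD)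
qed

lemma dig_mu: "digit_at x a s \<Longrightarrow> occurs x a \<mu>"
proof -
  assume s: "digit_at x a s"
  have "x (a + j) = \<mu> ! j" if j: "j < length \<mu>" for j
  proof -
    have "\<mu> ! j = d s ! j" using d_take[OF dig_lt[OF s]] j by (metis nth_take)
    then show ?thesis using dig_nth[OF s] j mu_l by simp
  qed
  then show ?thesis by (simp add: occurs_def)
qed

text \<open>
  Each digit starts with a marker, and a digit contains no marker except at its start.
\<close>

lemma dig_sep: "digit_at x a s \<Longrightarrow> digit_at x b t \<Longrightarrow> a \<noteq> b \<Longrightarrow> a + l \<le> b \<or> b + l \<le> a"
proof -
  assume st: "digit_at x a s" "digit_at x b t" "a \<noteq> b"
  have o: "occurs x a (d s)" "s < m" "occurs x b (d t)" "t < m" using st by (auto simp: digit_at_def)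
  show ?thesis
    using overlap[OF o(2,1) dig_mu[OF st(2)]] overlap[OF o(4,3) dig_mu[OF st(1)]] st(3) by linarith
qed

lemma dig_agree: "digit_at x a s \<Longrightarrow> agree n x y \<Longrightarrow> a + l \<le> n \<Longrightarrow> digit_at y a s"
  using occ_agree[of x a "d s" n y] d_len[of s] by (simp add: digit_at_def)

lemma dig_eqI: "(\<And>j. j < l \<Longrightarrow> x (a + j) = y (b + j)) \<Longrightarrow> digit_at x a s \<longleftrightarrow> digit_at y b s"
  using d_len by (auto simp: digit_at_def occurs_def)

text \<open>
  Only digits at positions from \<open>depth\<close> on count: changing such a digit does not leave \<open>Y\<close>.
\<close>

definition covered :: "(nat \<Rightarrow> 'e) \<Rightarrow> nat \<Rightarrow> bool" where
  "covered x j \<longleftrightarrow> (\<exists>a s. depth \<le> a \<and> digit_at x a s \<and> a \<le> j \<and> j < a + l)"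

definition shifted :: "nat \<Rightarrow> nat \<Rightarrow> (nat \<Rightarrow> 'e) \<Rightarrow> (nat \<Rightarrow> 'e) \<Rightarrow> bool" where
  "shifted a i x y \<longleftrightarrow> agree a x y \<and> (\<exists>s t. digit_at x a s \<and> digit_at y a t \<and> t = (s + i) mod m)"

lemma shifted_0: "shifted a 0 x y \<longleftrightarrow> agree a x y \<and> (\<exists>s. digit_at x a s \<and> digit_at y a s)"
  unfolding shifted_def using dig_lt by (metis add.right_neutral mod_less)

text \<open>
  Preservation of \<open>shifted\<close> means that digits stay at their positions and that, for all points
  with given letters before a digit, the images again have common letters before it and the same
  residue is added to the digit.
\<close>

definition Kset :: "((nat \<Rightarrow> 'e) \<Rightarrow> nat \<Rightarrow> 'e) set" where
  "Kset = {k \<in> Bij Y.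
     (\<forall>x\<in>Y. \<forall>j. \<not> covered x j \<longrightarrow> k x j = x j) \<and>
     (\<forall>x\<in>Y. \<forall>y\<in>Y. \<forall>a i. depth \<le> a \<longrightarrow> (shifted a i x y \<longleftrightarrow> shifted a i (k x) (k y))) \<and>
     (\<exists>n. \<forall>x\<in>Y. \<forall>j\<ge>n. k x j = x j)}"

lemma K_Bij: "k \<in> Kset \<Longrightarrow> k \<in> Bij Y" by (simp add: Kset_def)
lemma K_mem: "k \<in> Kset \<Longrightarrow> x \<in> Y \<Longrightarrow> k x \<in> Y" using K_Bij by (auto simp: Bij_def bij_betw_def)
lemma K_uncovered: "k \<in> Kset \<Longrightarrow> x \<in> Y \<Longrightarrow> \<not> covered x j \<Longrightarrow> k x j = x j" by (simp add: Kset_def)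
lemma K_shifted: "k \<in> Kset \<Longrightarrow> x \<in> Y \<Longrightarrow> y \<in> Y \<Longrightarrow> depth \<le> a \<Longrightarrow> shifted a i (k x) (k y) \<longleftrightarrow> shifted a i x y"
  by (simp add: Kset_def)
lemma K_eventually: "k \<in> Kset \<Longrightarrow> \<exists>n. \<forall>x\<in>Y. \<forall>j\<ge>n. k x j = x j" by (simp add: Kset_def)

lemma K_dig: "k \<in> Kset \<Longrightarrow> x \<in> Y \<Longrightarrow> depth \<le> a \<Longrightarrow> (\<exists>s. digit_at (k x) a s) \<longleftrightarrow> (\<exists>s. digit_at x a s)"
  using K_shifted[of k x x a 0] by (simp add: shifted_0)

lemma K_covered: "k \<in> Kset \<Longrightarrow> x \<in> Y \<Longrightarrow> covered (k x) j \<longleftrightarrow> covered x j"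
  using K_dig unfolding covered_def by blast

text \<open>
  A letter outside of all digits is fixed. A digit at \<open>a \<le> j\<close> lies within the first \<open>n + l\<close>
  letters, so it is common to \<open>x\<close> and \<open>y\<close> and has the same image by preservation of \<open>shifted\<close> with
  residue 0.
\<close>

lemma K_prefix:
  assumes k: "k \<in> Kset" and xy: "x \<in> Y" "y \<in> Y" "agree (n + l) x y"
  shows "agree n (k x) (k y)"
  unfolding agree_def
proof (intro allI impI)
  fix j assume j: "j < n"
  have cov: "k u j = k v j"
    if uv: "u \<in> Y" "v \<in> Y" "agree (n + l) u v" and c: "covered u j" for u v
  proof -
    obtain a s where a: "depth \<le> a" "digit_at u a s" "a \<le> j" "j < a + l" using c by (auto simp: covered_def)
    have "digit_at v a s" using dig_agree[OF a(2) uv(3)] a j by simp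
    moreover have "agree a u v" using agree_mono[OF uv(3)] a j by simp
    ultimately have "shifted a 0 u v" using a by (auto simp: shifted_0)
    then have "shifted a 0 (k u) (k v)" using K_shifted[OF k uv(1,2) a(1)] by simp
    then obtain t where t: "digit_at (k u) a t" "digit_at (k v) a t" by (auto simp: shifted_0)
    have "j - a < l" using a by simp
    then show ?thesis using dig_nth[OF t(1), of "j - a"] dig_nth[OF t(2), of "j - a"] a by simp
  qed
  show "k x j = k y j"
  proof (cases "covered x j \<or> covered y j")
    case True
    then show ?thesis using cov[OF xy] cov[OF xy(2,1) agree_sym[OF xy(3)]] by auto
  next
    case False
    then show ?thesis using K_uncovered[OF k] xy j by (auto simp: agree_def)
  qed
qed

lemma K_prefix_maps: assumes k: "k \<in> Kset" shows "k \<in> prefix_maps"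
proof -
  obtain n where n: "\<forall>x\<in>Y. \<forall>j\<ge>n. k x j = x j" using K_eventually[OF k] by blast
  have "lp k x (n + l) (n + l)" if x: "x \<in> Y" for x
    unfolding lp_def
  proof (intro ballI impI conjI allI)
    fix y assume y: "y \<in> Y" "agree (n + l) x y"
    show "agree (n + l) (k x) (k y)"
      unfolding agree_def
    proof (intro allI impI)
      fix j assume j: "j < n + l"
      show "k x j = k y j"
      proof (cases "j < n")
        case True
        then show ?thesis using K_prefix[OF k x y] by (simp add: agree_def)
      next
        case False
        then show ?thesis using n x y j by (auto simp: agree_def)
      qed
    qed
    fix j show "k y (n + l + j) = y (n + l + j)" using n y by simp
  qed
  then show ?thesis using K_Bij[OF k] by (auto simp: prefix_maps_def)
qed

lemma K_I:
  assumes "k \<in> Bij Y" "\<And>x j. x \<in> Y \<Longrightarrow> \<not> covered x j \<Longrightarrow> k x j = x j"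
    "\<And>x y a i. x \<in> Y \<Longrightarrow> y \<in> Y \<Longrightarrow> depth \<le> a \<Longrightarrow> shifted a i x y \<longleftrightarrow> shifted a i (k x) (k y)"
    "\<And>x j. x \<in> Y \<Longrightarrow> n \<le> j \<Longrightarrow> k x j = x j"
  shows "k \<in> Kset"
  unfolding Kset_def using assms by blast

lemma K_subgroup: "subgroup Kset HH"
proof -
  interpret group HH by (rule HH_group)
  show ?thesis
  proof (rule subgroupI)
    show "Kset \<subseteq> carrier HH" using K_prefix_maps by auto
    have "(\<lambda>x\<in>Y. x) \<in> Kset" by (rule K_I[where n = 0]) (auto simp: id_Bij)
    then show "Kset \<noteq> {}" by blast
    fix k assume k: "k \<in> Kset"
    have kH: "k \<in> prefix_maps" using K_prefix_maps[OF k] .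
    have iH: "inv\<^bsub>HH\<^esub> k \<in> prefix_maps" using HH_inv_mem[OF kH] .
    have im: "(inv\<^bsub>HH\<^esub> k) x \<in> Y" if "x \<in> Y" for x using prefix_maps_mem[OF iH that] .
    note ki = HH_inv(2)[OF kH]
    obtain n where n: "\<forall>x\<in>Y. \<forall>j\<ge>n. k x j = x j" using K_eventually[OF k] by blast
    show "inv\<^bsub>HH\<^esub> k \<in> Kset"
    proof (rule K_I[where n = n])
      show "inv\<^bsub>HH\<^esub> k \<in> Bij Y" using prefix_maps_Bij[OF iH] .
      fix x assume x: "x \<in> Y"
      {
        fix j assume "\<not> covered x j"
        then have "\<not> covered ((inv\<^bsub>HH\<^esub> k) x) j" using K_covered[OF k im[OF x]] ki[OF x] by simp
        then show "(inv\<^bsub>HH\<^esub> k) x j = x j" using K_uncovered[OF k im[OF x]] ki[OF x] by simp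
      }
      {
        fix j assume "n \<le> j"
        then show "(inv\<^bsub>HH\<^esub> k) x j = x j" using n im[OF x] ki[OF x] by metis
      }
      fix y a i assume "y \<in> Y" "depth \<le> a"
      then show "shifted a i x y \<longleftrightarrow> shifted a i ((inv\<^bsub>HH\<^esub> k) x) ((inv\<^bsub>HH\<^esub> k) y)"
        using K_shifted[OF k im[OF x] im] ki x by metis
    qed
    fix k' assume k': "k' \<in> Kset"
    have k'H: "k' \<in> prefix_maps" using K_prefix_maps[OF k'] .
    note mu = HH_mult[OF kH k'H]
    obtain n' where n': "\<forall>x\<in>Y. \<forall>j\<ge>n'. k' x j = x j" using K_eventually[OF k'] by blast
    show "k \<otimes>\<^bsub>HH\<^esub> k' \<in> Kset"
    proof (rule K_I[where n = "max n n'"])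
      show "k \<otimes>\<^bsub>HH\<^esub> k' \<in> Bij Y" using prefix_maps_Bij[OF HH_mult_mem[OF kH k'H]] .
      fix x assume x: "x \<in> Y"
      {
        fix j assume "\<not> covered x j"
        then show "(k \<otimes>\<^bsub>HH\<^esub> k') x j = x j"
          unfolding mu[OF x] using K_uncovered[OF k K_mem[OF k' x]] K_covered[OF k' x] K_uncovered[OF k' x] by simp
      }
      {
        fix j assume "max n n' \<le> j"
        then show "(k \<otimes>\<^bsub>HH\<^esub> k') x j = x j" unfolding mu[OF x] using n n' x K_mem[OF k'] by simp
      }
      fix y a i assume y: "y \<in> Y" "depth \<le> a"
      then show "shifted a i x y \<longleftrightarrow> shifted a i ((k \<otimes>\<^bsub>HH\<^esub> k') x) ((k \<otimes>\<^bsub>HH\<^esub> k') y)"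
        unfolding mu[OF x] mu[OF y(1)]
        using K_shifted[OF k K_mem[OF k' x] K_mem[OF k' y(1)] y(2)] K_shifted[OF k' x y] by simp
    qed
  qed
qed

definition Kn :: "nat \<Rightarrow> ((nat \<Rightarrow> 'e) \<Rightarrow> nat \<Rightarrow> 'e) set" where
  "Kn n = {k \<in> Kset. \<forall>x\<in>Y. agree n x (k x)}"

lemma Kn_subgroup: "subgroup (Kn n) HH"
proof -
  interpret group HH by (rule HH_group)
  interpret K: subgroup Kset HH by (rule K_subgroup)
  show ?thesis
  proof (rule subgroupI)
    show "Kn n \<subseteq> carrier HH" using K.subset by (auto simp: Kn_def)
    have "\<one>\<^bsub>HH\<^esub> \<in> Kn n" using K.one_closed HH_one by (auto simp: Kn_def)
    then show "Kn n \<noteq> {}" by blast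
    fix k assume k: "k \<in> Kn n"
    then have kK: "k \<in> Kset" and kH: "k \<in> prefix_maps" using K_prefix_maps by (auto simp: Kn_def)
    have "agree n x ((inv\<^bsub>HH\<^esub> k) x)" if x: "x \<in> Y" for x
    proof -
      have iY: "(inv\<^bsub>HH\<^esub> k) x \<in> Y" using prefix_maps_mem[OF HH_inv_mem[OF kH] x] .
      have "agree n ((inv\<^bsub>HH\<^esub> k) x) (k ((inv\<^bsub>HH\<^esub> k) x))" using k iY by (simp add: Kn_def)
      then show ?thesis using HH_inv(2)[OF kH x] agree_sym by metis
    qed
    then show "inv\<^bsub>HH\<^esub> k \<in> Kn n" using K.m_inv_closed[OF kK] by (simp add: Kn_def)
    fix k' assume k': "k' \<in> Kn n"
    then have kK': "k' \<in> Kset" and kH': "k' \<in> prefix_maps" using K_prefix_maps by (auto simp: Kn_def)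
    have "agree n x ((k \<otimes>\<^bsub>HH\<^esub> k') x)" if x: "x \<in> Y" for x
      unfolding HH_mult[OF kH kH' x] using k k' x K_mem[OF kK' x] agree_trans
      by (metis (mono_tags, lifting) Kn_def mem_Collect_eq)
    then show "k \<otimes>\<^bsub>HH\<^esub> k' \<in> Kn n" using K.m_closed[OF kK kK'] by (simp add: Kn_def)
  qed
qed

lemma Kn_0: "Kn 0 = Kset" by (simp add: Kn_def)

text \<open>
  By \<open>K_prefix\<close> the first \<open>n\<close> letters of \<open>k y\<close> are a function of the first \<open>n + l\<close> letters of \<open>y\<close>.
  There are finitely many such functions, and elements with the same function lie in one coset.
\<close>

lemma covers_Kn: "covers HH (Kn n) Kset"
proof -
  interpret group HH by (rule HH_group)
  let ?L = "\<lambda>n. {xs. set xs \<subseteq> arcs g \<and> length xs = n}"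
  \<comment> \<open>The graph of the function from initial segments to initial segments that \<open>k\<close> induces.\<close>
  let ?f = "\<lambda>k. (\<lambda>y. (map y [0..<n + l], map (k y) [0..<n])) ` Y"
  have arc: "y j \<in> arcs g" if "y \<in> Y" for y j using X_arc[OF YX[OF that]] .
  have "?f k \<in> Pow (?L (n + l) \<times> ?L n)" if "k \<in> Kset" for k
    using arc arc[OF K_mem[OF that]] by auto
  then have "?f ` Kset \<subseteq> Pow (?L (n + l) \<times> ?L n)" by blast
  moreover have "finite (Pow (?L (n + l) \<times> ?L n))" by (simp add: finite_lists_length_eq)
  ultimately have fin: "finite (?f ` Kset)" by (rule finite_subset)
  show ?thesis
  proof (rule covers_fiber[where f = ?f, OF fin])
    show "Kset \<subseteq> carrier HH" using K_prefix_maps by auto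
    show "Kn n \<subseteq> carrier HH" using K_prefix_maps by (auto simp: Kn_def)
    fix k k' assume k: "k \<in> Kset" "k' \<in> Kset" "?f k = ?f k'"
    have kH: "k \<in> prefix_maps" "k' \<in> prefix_maps" using k K_prefix_maps by auto
    have "agree n x ((k \<otimes>\<^bsub>HH\<^esub> inv\<^bsub>HH\<^esub> k') x)" if x: "x \<in> Y" for x
    proof -
      define y where "y = (inv\<^bsub>HH\<^esub> k') x"
      have y: "y \<in> Y" using prefix_maps_mem[OF HH_inv_mem[OF kH(2)] x] by (simp add: y_def)
      have "(map y [0..<n + l], map (k y) [0..<n]) \<in> ?f k'" using k(3) y by blast
      then obtain y' where y': "y' \<in> Y" "map y [0..<n + l] = map y' [0..<n + l]" "map (k y) [0..<n] = map (k' y') [0..<n]"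
        by blast
      have "agree (n + l) y y'" using y'(2) by (auto simp: agree_def)
      then have "agree n (k' y) (k' y')" using K_prefix[OF k(2) y y'(1)] by simp
      moreover have "agree n (k y) (k' y')" using y'(3) by (auto simp: agree_def)
      ultimately have "agree n (k' y) (k y)" using agree_sym agree_trans by blast
      moreover have "k' y = x" using HH_inv(2)[OF kH(2) x] by (simp add: y_def)
      moreover have "(k \<otimes>\<^bsub>HH\<^esub> inv\<^bsub>HH\<^esub> k') x = k y"
        using HH_mult[OF kH(1) HH_inv_mem[OF kH(2)] x] by (simp add: y_def)
      ultimately show ?thesis by simp
    qed
    then show "k \<otimes>\<^bsub>HH\<^esub> inv\<^bsub>HH\<^esub> k' \<in> Kn n"
      using subgroup.m_closed[OF K_subgroup k(1) subgroup.m_inv_closed[OF K_subgroup k(2)]] by (simp add: Kn_def)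
  qed
qed

subsection \<open>Torsion\<close>

text \<open>
  Digit changes by multiples of \<open>q\<close>; it is used for divisors \<open>q\<close> of \<open>m\<close>.
\<close>

definition Kq :: "nat \<Rightarrow> ((nat \<Rightarrow> 'e) \<Rightarrow> nat \<Rightarrow> 'e) set" where
  "Kq q = {k \<in> Kset. \<forall>x\<in>Y. \<forall>a s t. depth \<le> a \<longrightarrow> digit_at x a s \<longrightarrow> digit_at (k x) a t \<longrightarrow> s mod q = t mod q}"

lemma Kq_1: "Kq 1 = Kset" by (simp add: Kq_def)

lemma Kq_diff:
  assumes k: "k \<in> Kq q" and k': "k' \<in> Kq q"
  shows "k \<otimes>\<^bsub>HH\<^esub> inv\<^bsub>HH\<^esub> k' \<in> Kq q"
proof -
  have kK: "k \<in> Kset" "k' \<in> Kset" using k k' by (auto simp: Kq_def)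
  have kH: "k \<in> prefix_maps" "k' \<in> prefix_maps" using kK K_prefix_maps by auto
  have "s mod q = t mod q"
    if x: "x \<in> Y" "depth \<le> a" "digit_at x a s" "digit_at ((k \<otimes>\<^bsub>HH\<^esub> inv\<^bsub>HH\<^esub> k') x) a t" for x a s t
  proof -
    define y where "y = (inv\<^bsub>HH\<^esub> k') x"
    have y: "y \<in> Y" using prefix_maps_mem[OF HH_inv_mem[OF kH(2)] x(1)] by (simp add: y_def)
    have ky: "k' y = x" using HH_inv(2)[OF kH(2) x(1)] by (simp add: y_def)
    have "(k \<otimes>\<^bsub>HH\<^esub> inv\<^bsub>HH\<^esub> k') x = k y"
      using HH_mult[OF kH(1) HH_inv_mem[OF kH(2)] x(1)] by (simp add: y_def)
    then have t: "digit_at (k y) a t" using x(4) by simp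
    obtain r where r: "digit_at y a r" using K_dig[OF kK(2) y x(2)] ky x(3) by auto
    have "r mod q = s mod q" using k' y x(2,3) r ky unfolding Kq_def by blast
    moreover have "r mod q = t mod q" using k y x(2) r t unfolding Kq_def by blast
    ultimately show ?thesis by simp
  qed
  then show ?thesis
    using subgroup.m_closed[OF K_subgroup kK(1) subgroup.m_inv_closed[OF K_subgroup kK(2)]]
    unfolding Kq_def by blast
qed

definition fixes_digits :: "nat \<Rightarrow> ((nat \<Rightarrow> 'e) \<Rightarrow> nat \<Rightarrow> 'e) \<Rightarrow> bool" where
  "fixes_digits t k \<longleftrightarrow> (\<forall>x\<in>Y. \<forall>a s. depth \<le> a \<longrightarrow> a < t \<longrightarrow> digit_at x a s \<longrightarrow> digit_at (k x) a s)"

lemma fixes_digits_agree: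
  assumes "k \<in> Kset" "fixes_digits t k" "x \<in> Y" shows "agree t x (k x)"
  unfolding agree_def
proof (intro allI impI)
  fix j assume j: "j < t"
  show "x j = k x j"
  proof (cases "covered x j")
    case True
    then obtain a s where a: "depth \<le> a" "digit_at x a s" "a \<le> j" "j < a + l" by (auto simp: covered_def)
    then have "digit_at (k x) a s" using assms j by (auto simp: fixes_digits_def)
    then show ?thesis using dig_nth[OF a(2), of "j - a"] dig_nth[of "k x" a s "j - a"] a by simp
  next
    case False then show ?thesis using K_uncovered[OF assms(1,3)] by simp
  qed
qed

lemma K_pow: "k \<in> Kset \<Longrightarrow> k [^]\<^bsub>HH\<^esub> (n::nat) \<in> Kset"
  using group.subgroup_nat_pow[OF HH_group K_subgroup] .

lemma K_pow_apply:
  assumes "k \<in> Kset" "x \<in> Y" shows "(k [^]\<^bsub>HH\<^esub> (n::nat)) x = (k ^^ n) x" "(k ^^ n) x \<in> Y"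
  using HH_pow[OF K_prefix_maps[OF assms(1)] assms(2)] by auto

lemma Kq_pow_mod:
  assumes k: "k \<in> Kq q" and x: "x \<in> Y" "depth \<le> a" "digit_at x a s" "digit_at ((k ^^ n) x) a t"
  shows "s mod q = t mod q"
  using x(4)
proof (induction n arbitrary: t)
  case 0
  then show ?case using dig_unique[OF x(3)] by simp
next
  case (Suc n)
  have kK: "k \<in> Kset" using k by (simp add: Kq_def)
  have y: "(k ^^ n) x \<in> Y" using K_pow_apply(2)[OF kK x(1)] .
  obtain r where r: "digit_at ((k ^^ n) x) a r" using K_dig[OF kK y x(2)] Suc.prems by auto
  then have "r mod q = t mod q" using k y x(2) Suc.prems unfolding Kq_def by auto
  then show ?case using Suc.IH[OF r] by simp
qed

lemma Kq_pow:
  assumes k: "k \<in> Kq q" shows "k [^]\<^bsub>HH\<^esub> (n::nat) \<in> Kq q"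
proof -
  have kK: "k \<in> Kset" using k by (simp add: Kq_def)
  have "s mod q = t mod q"
    if "x \<in> Y" "depth \<le> a" "digit_at x a s" "digit_at ((k [^]\<^bsub>HH\<^esub> n) x) a t" for x a s t
    using Kq_pow_mod[OF k that(1-3), of n t] K_pow_apply(1)[OF kK that(1)] that(4) by simp
  then show ?thesis using K_pow[OF kK] unfolding Kq_def by blast
qed

text \<open>
  Consider a digit at position \<open>t\<close>. Since everything before \<open>t\<close> is fixed, \<open>k\<close> adds the same
  residue \<open>i\<close> at every application, and \<open>i\<close> is a multiple of \<open>q\<close>. So \<open>k\<^sup>r\<close> adds a multiple of
  \<open>q r = m\<close>.
\<close>

lemma fixes_digits_step:
  assumes qr: "m = q * r" and k: "k \<in> Kq q" and f: "fixes_digits t k"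
  shows "fixes_digits (Suc t) (k [^]\<^bsub>HH\<^esub> r)"
  unfolding fixes_digits_def
proof (intro ballI allI impI)
  have kK: "k \<in> Kset" using k by (simp add: Kq_def)
  fix x a s assume x: "x \<in> Y" and a: "depth \<le> a" "a < Suc t" and s: "digit_at x a s"
  note app = K_pow_apply[OF kK x]
  show "digit_at ((k [^]\<^bsub>HH\<^esub> r) x) a s"
  proof (cases "a < t")
    case True
    have "digit_at ((k ^^ n) x) a s" for n
      by (induction n) (use s f app a True in \<open>auto simp: fixes_digits_def\<close>)
    then show ?thesis using app by simp
  next
    case False
    then have at: "a = t" using a by simp
    obtain s' where s': "digit_at (k x) a s'" using K_dig[OF kK x a(1)] s by auto
    have smod: "s mod q = s' mod q" using k x a(1) s s' unfolding Kq_def by blast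
    \<comment> \<open>The residue that \<open>k\<close> adds, represented by a natural number.\<close>
    define i where "i = s' + m - s"
    have si: "s + i = s' + m" using dig_lt[OF s] by (simp add: i_def)
    have "(s + i) mod q = (s + 0) mod q" unfolding si using smod qr by simp
    then have "q dvd i" by (metis add_left_cancel mod_eq_dvd_iff_nat add.right_neutral diff_add_inverse le_add1)
    then have mir: "m dvd i * r" using qr by (auto simp: dvd_def)
    have "shifted a i x (k x)"
      unfolding shifted_def using fixes_digits_agree[OF kK f x] at s s' si dig_lt[OF s']
      by (intro conjI exI[of _ s] exI[of _ s']) auto
    then have sh: "shifted a i ((k ^^ n) x) ((k ^^ Suc n) x)" for n
    proof (induction n)
      case (Suc n)
      then show ?case using K_shifted[OF kK app(2)[of n] app(2)[of "Suc n"] a(1)] by simp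
    qed simp
    have "digit_at ((k ^^ n) x) a ((s + i * n) mod m)" for n
    proof (induction n)
      case 0 then show ?case using s dig_lt[OF s] by simp
    next
      case (Suc n)
      obtain u v where uv: "digit_at ((k ^^ n) x) a u" "digit_at ((k ^^ Suc n) x) a v" "v = (u + i) mod m"
        using sh[of n] unfolding shifted_def by blast
      have "u = (s + i * n) mod m" using dig_unique[OF uv(1) Suc] .
      then have "v = (s + i * Suc n) mod m" using uv(3) by (simp add: mod_simps algebra_simps)
      then show ?case using uv(2) by simp
    qed
    then have "digit_at ((k ^^ r) x) a ((s + i * r) mod m)" .
    moreover have "(s + i * r) mod m = s" using mir dig_lt[OF s] by (metis mod_add_right_eq add.right_neutral dvd_imp_mod_0 mod_less)
    ultimately show ?thesis using app by simp
  qed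
qed

text \<open>
  Iterating \<open>fixes_digits_step\<close>, the power with exponent \<open>r\<^sup>t\<close> fixes the digits at the first \<open>t\<close> positions
  after \<open>depth\<close>. As \<open>k\<close> changes only finitely many positions, some power fixes everything.
\<close>

lemma Kq_torsion:
  assumes qr: "m = q * r" and k: "k \<in> Kq q"
  shows "\<exists>n::nat. k [^]\<^bsub>HH\<^esub> (r ^ n) = \<one>\<^bsub>HH\<^esub>"
proof -
  interpret group HH by (rule HH_group)
  have kK: "k \<in> Kset" using k by (simp add: Kq_def)
  have kH: "k \<in> carrier HH" using K_prefix_maps[OF kK] by simp
  obtain n where n: "\<forall>x\<in>Y. \<forall>j\<ge>n. k x j = x j" using K_eventually[OF kK] by blast
  have fx: "fixes_digits (depth + t) (k [^]\<^bsub>HH\<^esub> (r ^ t))" for t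
  proof (induction t)
    case 0
    then show ?case by (auto simp: fixes_digits_def)
  next
    case (Suc t)
    have "k [^]\<^bsub>HH\<^esub> (r ^ Suc t) = (k [^]\<^bsub>HH\<^esub> (r ^ t)) [^]\<^bsub>HH\<^esub> r"
      using nat_pow_pow[OF kH, of "r ^ t" r] by (simp add: mult.commute)
    then show ?case using fixes_digits_step[OF qr Kq_pow[OF k] Suc] by simp
  qed
  define h where "h = k [^]\<^bsub>HH\<^esub> (r ^ n)"
  have hK: "h \<in> Kset" using K_pow[OF kK] by (simp add: h_def)
  have "h x = x" if x: "x \<in> Y" for x
  proof
    fix j
    have ev: "(k ^^ t) x j = x j" if "n \<le> j" for t
      by (induction t) (use n that K_pow_apply(2)[OF kK x] in auto)
    have ag: "agree (depth + n) x (h x)" using fixes_digits_agree[OF hK _ x] fx[of n] by (simp add: h_def)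
    show "h x j = x j"
    proof (cases "j < n")
      case True then show ?thesis using ag by (simp add: agree_def)
    next
      case False then show ?thesis using ev[of "r ^ n"] K_pow_apply(1)[OF kK x] by (simp add: h_def)
    qed
  qed
  then have "h = \<one>\<^bsub>HH\<^esub>"
    using prefix_maps_eqI[OF K_prefix_maps[OF hK]] one_closed HH_one by simp
  then show ?thesis unfolding h_def by blast
qed

subsection \<open>Commensuration\<close>

text \<open>
  The conjugate of a deep element is again a digit change. Near \<open>hi x\<close>, the map \<open>h\<close> replaces the
  first \<open>A\<close> letters by \<open>b \<le> B\<close> letters and shifts the remaining ones, together with their digits,
  from \<open>A + j\<close> to \<open>b + j\<close>. As \<open>k\<close> fixes many more than \<open>A\<close> letters, it acts after the replaced
  prefix only, and the prefix replacement for \<open>hi x\<close> also applies to \<open>k (hi x)\<close>. Digits of \<open>x\<close>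
  that lie within the first \<open>B + l + depth + n0\<close> letters are fixed, and all others start beyond
  the replaced prefix.
\<close>

lemma conj_step:
  assumes h: "h \<in> prefix_maps" and k: "k \<in> Kset" and hi: "\<And>x. x \<in> Y \<Longrightarrow> hi x \<in> Y \<and> h (hi x) = x"
    and lpu: "\<And>x. x \<in> Y \<Longrightarrow> \<exists>b. depth \<le> b \<and> b \<le> B \<and> lp h x A b" and A: "depth \<le> A"
    and kn: "\<And>x. x \<in> Y \<Longrightarrow> agree (A + B + l + depth + n0) x (k x)"
    and x: "x \<in> Y"
  shows "agree (B + l + depth + n0) x (h (k (hi x)))"
    and "\<not> covered x t \<Longrightarrow> h (k (hi x)) t = x t"
    and "y \<in> Y \<Longrightarrow> depth \<le> c \<Longrightarrow> shifted c i x y \<Longrightarrow> shifted c i (h (k (hi x))) (h (k (hi y)))"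
    and "\<forall>x\<in>Y. \<forall>j\<ge>n. k x j = x j \<Longrightarrow> n + B \<le> t \<Longrightarrow> h (k (hi x)) t = x t"
proof -
  let ?N = "B + l + depth + n0"
  let ?g = "\<lambda>x. h (k (hi x))"
  have loc: "\<exists>b. depth \<le> b \<and> b \<le> B \<and> lp h (hi x) A b \<and> (\<forall>j. x (b + j) = hi x (A + j))
      \<and> (\<forall>j. ?g x (b + j) = k (hi x) (A + j)) \<and> agree b x (?g x) \<and> agree ?N x (?g x)" if x: "x \<in> Y" for x
  proof -
    have hx: "hi x \<in> Y" "h (hi x) = x" using hi[OF x] by auto
    have kx: "k (hi x) \<in> Y" using K_mem[OF k hx(1)] .
    obtain b where b: "depth \<le> b" "b \<le> B" "lp h (hi x) A b" using lpu[OF hx(1)] by blast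
    have ag: "agree A (hi x) (k (hi x))" using agree_mono[OF kn[OF hx(1)], of A] by simp
    have 1: "x (b + j) = hi x (A + j)" for j using lp_tail[OF b(3) hx(1) agree_refl, of j] hx(2) by simp
    have 2: "?g x (b + j) = k (hi x) (A + j)" for j using lp_tail[OF b(3) kx ag, of j] .
    have 3: "agree b x (?g x)" using lp_agree[OF b(3) kx ag] hx(2) by simp
    have "agree ?N x (?g x)"
      unfolding agree_def
    proof (intro allI impI)
      fix t assume t: "t < ?N"
      show "x t = ?g x t"
      proof (cases "t < b")
        case True then show ?thesis using 3 by (simp add: agree_def)
      next
        case False
        then have tb: "t = b + (t - b)" by simp
        have "hi x (A + (t - b)) = k (hi x) (A + (t - b))"
          using kn[OF hx(1)] t by (simp add: agree_def)
        then show ?thesis using 1[of "t - b"] 2[of "t - b"] tb by simp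
      qed
    qed
    then show ?thesis using b 1 2 3 by blast
  qed
  show N: "agree ?N x (?g x)" using loc[OF x] by blast
  obtain b where b: "depth \<le> b" "b \<le> B" "lp h (hi x) A b" "\<And>j. x (b + j) = hi x (A + j)"
      "\<And>j. ?g x (b + j) = k (hi x) (A + j)" "agree b x (?g x)" using loc[OF x] by blast
  have hx: "hi x \<in> Y" "h (hi x) = x" using hi[OF x] by auto
  show "?g x t = x t" if unc: "\<not> covered x t"
  proof (cases "t < ?N")
    case True then show ?thesis using N by (simp add: agree_def)
  next
    case False
    define j where "j = t - b"
    have j: "t = b + j" "l + depth \<le> j" using False b(2) by (auto simp: j_def)
    have "\<not> covered (hi x) (A + j)"
    proof
      assume "covered (hi x) (A + j)"
      then obtain a s where a: "depth \<le> a" "digit_at (hi x) a s" "a \<le> A + j" "A + j < a + l" by (auto simp: covered_def)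
      define i where "i = a - A"
      have ai: "a = A + i" using a j by (simp add: i_def)
      have "digit_at (hi x) (A + i) s \<longleftrightarrow> digit_at x (b + i) s"
        by (rule dig_eqI) (use b(4) in \<open>simp add: add.assoc\<close>)
      then have "digit_at x (b + i) s" using a(2) ai by simp
      moreover have "depth \<le> b + i" "b + i \<le> t" "t < b + i + l" using b(1) a j ai by auto
      ultimately show False using unc unfolding covered_def by blast
    qed
    then show ?thesis using K_uncovered[OF k hx(1)] b(4)[of j] b(5)[of j] j(1) by simp
  qed
  show "?g x t = x t" if ev: "\<forall>x\<in>Y. \<forall>j\<ge>n. k x j = x j" and t: "n + B \<le> t"
  proof -
    have "t = b + (t - b)" "n \<le> A + (t - b)" using t b(2) by auto
    then show ?thesis using b(4)[of "t - b"] b(5)[of "t - b"] ev hx(1) by metis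
  qed
  show "shifted c i (?g x) (?g y)" if y: "y \<in> Y" and c: "depth \<le> c" and sh: "shifted c i x y"
  proof -
    obtain s t where st: "agree c x y" "digit_at x c s" "digit_at y c t" "t = (s + i) mod m" using sh by (auto simp: shifted_def)
    have hy: "hi y \<in> Y" "h (hi y) = y" using hi[OF y] by auto
    show ?thesis
    proof (cases "c + l \<le> ?N")
      case True
      \<comment> \<open>The digit lies among the letters that the conjugate fixes.\<close>
      have Ny: "agree ?N y (?g y)" using loc[OF y] by blast
      have "agree c x (?g x)" "agree c y (?g y)" using agree_mono[OF N, of c] agree_mono[OF Ny, of c] True by simp_all
      then have "agree c (?g x) (?g y)" using st(1) agree_sym agree_trans by blast
      then show ?thesis using dig_agree[OF st(2) N True] dig_agree[OF st(3) Ny True] st(4) by (auto simp: shifted_def)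
    next
      case False
      \<comment> \<open>The position \<open>c\<close> of the digit lies beyond the replaced prefix and corresponds to \<open>A + i0\<close> before the replacement.\<close>
      define i0 where "i0 = c - b"
      have ci: "c = b + i0" using False b(2) by (simp add: i0_def)
      have b0: "0 < b" using b(1) depth(1) by linarith
      have "agree b (h (hi x)) y" using agree_mono[OF st(1), of b] ci hx(2) by simp
      then have G: "glue A (hi x) b y \<in> Y" "h (glue A (hi x) b y) = y"
        using lp_onto[OF h hx(1) b(3) A b0 y] by auto
      then have gy: "hi y = glue A (hi x) b y" using prefix_maps_inj[OF h hy(1) G(1)] hy(2) G(2) by simp
      have aA: "agree A (hi x) (hi y)" unfolding gy by (rule agree_glue)
      have yj: "hi y (A + j) = y (b + j)" for j unfolding gy by (rule glue_tail)
      have "hi x i' = hi y i'" if "i' < A + i0" for i'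
      proof (cases "i' < A")
        case True then show ?thesis using aA by (simp add: agree_def)
      next
        case False
        then have "x (b + (i' - A)) = y (b + (i' - A))" using st(1) that ci by (simp add: agree_def)
        then show ?thesis using b(4)[of "i' - A"] yj[of "i' - A"] False by simp
      qed
      then have ag: "agree (A + i0) (hi x) (hi y)" by (simp add: agree_def)
      have "digit_at (hi x) (A + i0) s \<longleftrightarrow> digit_at x (b + i0) s"
        by (rule dig_eqI) (use b(4) in \<open>simp add: add.assoc\<close>)
      moreover have "digit_at (hi y) (A + i0) t \<longleftrightarrow> digit_at y (b + i0) t"
        by (rule dig_eqI) (use yj in \<open>simp add: add.assoc\<close>)
      ultimately have "shifted (A + i0) i (hi x) (hi y)" using ag st ci by (auto simp: shifted_def)
      then have "shifted (A + i0) i (k (hi x)) (k (hi y))" using K_shifted[OF k hx(1) hy(1)] A by simp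
      then obtain u v where uv: "agree (A + i0) (k (hi x)) (k (hi y))" "digit_at (k (hi x)) (A + i0) u"
          "digit_at (k (hi y)) (A + i0) v" "v = (u + i) mod m" by (auto simp: shifted_def)
      have kxA: "agree A (hi x) (k (hi x))" using agree_mono[OF kn[OF hx(1)], of A] by simp
      have "agree A (hi y) (k (hi y))" using agree_mono[OF kn[OF hy(1)], of A] by simp
      then have kyA: "agree A (hi x) (k (hi y))" using aA agree_trans by blast
      have kY: "k (hi x) \<in> Y" "k (hi y) \<in> Y" using K_mem[OF k] hx hy by auto
      have gyj: "?g y (b + j) = k (hi y) (A + j)" for j using lp_tail[OF b(3) kY(2) kyA] .
      have gb: "agree b (?g x) (?g y)"
        using lp_agree[OF b(3) kY(1) kxA] lp_agree[OF b(3) kY(2) kyA] agree_sym agree_trans by blast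
      have "?g x t' = ?g y t'" if "t' < b + i0" for t'
      proof (cases "t' < b")
        case True then show ?thesis using gb by (simp add: agree_def)
      next
        case False
        then have "k (hi x) (A + (t' - b)) = k (hi y) (A + (t' - b))" using uv(1) that by (simp add: agree_def)
        then show ?thesis using b(5)[of "t' - b"] gyj[of "t' - b"] False by simp
      qed
      then have "agree c (?g x) (?g y)" by (simp add: agree_def ci)
      moreover have "digit_at (k (hi x)) (A + i0) u \<longleftrightarrow> digit_at (?g x) (b + i0) u"
        by (rule dig_eqI) (use b(5) in \<open>simp add: add.assoc\<close>)
      moreover have "digit_at (k (hi y)) (A + i0) v \<longleftrightarrow> digit_at (?g y) (b + i0) v"
        by (rule dig_eqI) (use gyj in \<open>simp add: add.assoc\<close>)
      ultimately show ?thesis using uv ci by (auto simp: shifted_def)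
    qed
  qed
qed

text \<open>
  This is the commensuration property. The bound depends on the lengths of the prefixes that \<open>h\<close>
  replaces.
\<close>

lemma conj_K:
  assumes h: "h \<in> prefix_maps"
  shows "\<exists>n. \<forall>k\<in>Kn n. h \<otimes>\<^bsub>HH\<^esub> k \<otimes>\<^bsub>HH\<^esub> inv\<^bsub>HH\<^esub> h \<in> Kn n0"
proof -
  interpret group HH by (rule HH_group)
  obtain A B where A: "depth \<le> A" and lpu: "\<forall>x\<in>Y. \<exists>b. depth \<le> b \<and> b \<le> B \<and> lp h x A b"
    using uniform_lp[OF h, of depth] by blast
  \<comment> \<open>Deep enough for all four conclusions of \<open>conj_step\<close>.\<close>
  let ?n = "A + B + l + depth + n0"
  let ?hi = "inv\<^bsub>HH\<^esub> h"
  have iH: "?hi \<in> prefix_maps" using HH_inv_mem[OF h] .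
  have hi: "?hi x \<in> Y \<and> h (?hi x) = x" if "x \<in> Y" for x
    using prefix_maps_mem[OF iH that] HH_inv(2)[OF h that] by blast
  have "h \<otimes>\<^bsub>HH\<^esub> k \<otimes>\<^bsub>HH\<^esub> ?hi \<in> Kn n0" if k: "k \<in> Kn ?n" for k
  proof -
    have kK: "k \<in> Kset" and kH: "k \<in> prefix_maps" and kn: "\<And>x. x \<in> Y \<Longrightarrow> agree ?n x (k x)"
      using k K_prefix_maps by (auto simp: Kn_def)
    let ?k' = "inv\<^bsub>HH\<^esub> k"
    have k': "?k' \<in> Kn ?n" using subgroup.m_inv_closed[OF Kn_subgroup k] .
    have k'K: "?k' \<in> Kset" and k'H: "?k' \<in> prefix_maps" and k'n: "\<And>x. x \<in> Y \<Longrightarrow> agree ?n x (?k' x)"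
      using k' K_prefix_maps by (auto simp: Kn_def)
    define gg where "gg = h \<otimes>\<^bsub>HH\<^esub> k \<otimes>\<^bsub>HH\<^esub> ?hi"
    have hkH: "h \<otimes>\<^bsub>HH\<^esub> k \<in> prefix_maps" using HH_mult_mem[OF h kH] .
    have gH: "gg \<in> prefix_maps" unfolding gg_def using HH_mult_mem[OF hkH iH] .
    have g: "gg x = h (k (?hi x))" if "x \<in> Y" for x
      unfolding gg_def using HH_mult[OF hkH iH that] HH_mult[OF h kH] hi[OF that] by simp
    note st = conj_step[OF h kK hi lpu[rule_format] A kn]
    note st' = conj_step[OF h k'K hi lpu[rule_format] A k'n]
    obtain n where n: "\<forall>x\<in>Y. \<forall>j\<ge>n. k x j = x j" using K_eventually[OF kK] by blast
    have "gg \<in> Kset"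
    proof (rule K_I[where n = "n + B"])
      show "gg \<in> Bij Y" using prefix_maps_Bij[OF gH] .
      fix x assume x: "x \<in> Y"
      show "gg x j = x j" if "\<not> covered x j" for j using st(2)[OF _ _ _ x that] g[OF x] by simp
      show "gg x j = x j" if "n + B \<le> j" for j using st(4)[OF _ _ _ x n that] g[OF x] by simp
      fix y a i assume y: "y \<in> Y" and a: "depth \<le> a"
      have bk: "h (?k' (?hi (gg z))) = z" if z: "z \<in> Y" for z
      proof -
        have "?hi (gg z) = k (?hi z)" using g[OF z] HH_inv(1)[OF h K_mem[OF kK]] hi[OF z] by simp
        then show ?thesis using HH_inv(1)[OF kH] hi[OF z] by simp
      qed
      show "shifted a i x y \<longleftrightarrow> shifted a i (gg x) (gg y)"
      proof
        assume "shifted a i x y"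
        then show "shifted a i (gg x) (gg y)" using st(3)[OF _ _ _ x y a] g[OF x] g[OF y] by simp
      next
        assume "shifted a i (gg x) (gg y)"
        then show "shifted a i x y"
          using st'(3)[OF _ _ _ prefix_maps_mem[OF gH x] prefix_maps_mem[OF gH y] a] bk[OF x] bk[OF y] by simp
      qed
    qed
    moreover have "agree n0 x (gg x)" if x: "x \<in> Y" for x
      using agree_mono[OF st(1)[OF _ _ _ x], of n0] g[OF x] by simp
    ultimately show ?thesis unfolding gg_def[symmetric] by (simp add: Kn_def)
  qed
  then show ?thesis by blast
qed

subsection \<open>Digit rotations\<close>

definition put_digit :: "nat \<Rightarrow> nat \<Rightarrow> (nat \<Rightarrow> 'e) \<Rightarrow> nat \<Rightarrow> 'e" where
  "put_digit a t y = (\<lambda>j. if a \<le> j \<and> j < a + l then d t ! (j - a) else y j)"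

lemma rep_X:
  assumes y: "y \<in> X" "digit_at y a s" and t: "t < m"
  shows "put_digit a t y \<in> X"
proof -
  have s: "s < m" "occurs y a (d s)" using y by (auto simp: digit_at_def)
  have dne: "d s \<noteq> []" using d_len[OF s(1)] l_pos by auto
  have w1: "w = tail g (y a)" and w2: "w = tail g (y (a + l))"
    using occ_awalk[OF y(1) s(2) d_walk[OF s(1)] dne] d_len[OF s(1)] by auto
  let ?z = "\<lambda>j. y ((a + l) + j)"
  have "?z \<in> X" using shift_X[OF y(1)] by simp
  then have 1: "pcat (d t) ?z \<in> X" using pcat_X[OF d_walk[OF t]] w2 by simp
  have "tail g (pcat (d t) ?z 0) = w"
    using occ_awalk(1)[OF 1 occ_pcat d_walk[OF t]] d_len[OF t] l_pos by auto
  moreover have "awalk (tail g (y 0)) (map (\<lambda>j. y (0 + j)) [0..<a]) w"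
    using map_awalk[OF y(1), of 0 a] w1 by simp
  ultimately have "pcat (map (\<lambda>j. y (0 + j)) [0..<a]) (pcat (d t) ?z) \<in> X" using pcat_X 1 by blast
  moreover have "pcat (map (\<lambda>j. y (0 + j)) [0..<a]) (pcat (d t) ?z) = put_digit a t y"
    using d_len[OF t] by (auto simp: pcat_def put_digit_def fun_eq_iff)
  ultimately show ?thesis by simp
qed

lemma rep_agree: "agree a y (put_digit a t y)" by (simp add: agree_def put_digit_def)

lemma rep_Y: "y \<in> Y \<Longrightarrow> digit_at y a s \<Longrightarrow> t < m \<Longrightarrow> depth \<le> a \<Longrightarrow> put_digit a t y \<in> Y"
  using depth(2)[of y "put_digit a t y"] rep_X[OF YX] agree_mono[OF rep_agree] by blast

lemma dig_rep_same: "t < m \<Longrightarrow> digit_at (put_digit a t y) a t"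
  using d_len by (simp add: digit_at_def occurs_def put_digit_def)

lemma dig_far: "a + l \<le> b \<or> b + l \<le> a \<Longrightarrow> digit_at (put_digit a t y) b u \<longleftrightarrow> digit_at y b u"
  by (rule dig_eqI) (auto simp: put_digit_def)

text \<open>
  Other digits are disjoint from the overwritten one, before and after the change.
\<close>

lemma dig_rep_other:
  assumes "digit_at y a s" "t < m" "b \<noteq> a"
  shows "digit_at (put_digit a t y) b u \<longleftrightarrow> digit_at y b u"
proof
  assume "digit_at (put_digit a t y) b u"
  then show "digit_at y b u" using dig_sep[OF dig_rep_same[OF assms(2)], of a y b u] assms(3) dig_far by blast
next
  assume "digit_at y b u"
  then show "digit_at (put_digit a t y) b u" using dig_sep[OF assms(1), of b u] assms(3) dig_far by blast
qed

lemma rep_rep: "put_digit a t (put_digit a t' y) = put_digit a t y" by (auto simp: put_digit_def)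

lemma rep_dig: "digit_at y a s \<Longrightarrow> put_digit a s y = y"
  using dig_nth by (fastforce simp: put_digit_def fun_eq_iff)

definition dg :: "nat \<Rightarrow> (nat \<Rightarrow> 'e) \<Rightarrow> nat" where "dg a y = (THE s. digit_at y a s)"

lemma dg: "digit_at y a s \<Longrightarrow> dg a y = s"
  unfolding dg_def using dig_unique by blast

definition on :: "nat \<Rightarrow> (nat \<Rightarrow> 'e) \<Rightarrow> (nat \<Rightarrow> 'e) \<Rightarrow> bool" where
  "on a x0 y \<longleftrightarrow> agree a x0 y \<and> (\<exists>s. digit_at y a s)"

text \<open>
  The simplest digit changes: add \<open>i\<close> to the digit at position \<open>a\<close> of those points that start with
  the first \<open>a\<close> letters of \<open>x0\<close> and have a digit there.
\<close>

definition rot :: "nat \<Rightarrow> (nat \<Rightarrow> 'e) \<Rightarrow> nat \<Rightarrow> (nat \<Rightarrow> 'e) \<Rightarrow> nat \<Rightarrow> 'e" where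
  "rot a x0 i = (\<lambda>y\<in>Y. if on a x0 y then put_digit a ((dg a y + i) mod m) y else y)"

lemma rot_on:
  "y \<in> Y \<Longrightarrow> agree a x0 y \<Longrightarrow> digit_at y a s \<Longrightarrow> rot a x0 i y = put_digit a ((s + i) mod m) y"
  by (auto simp: rot_def on_def dg)

lemma rot_off: "y \<in> Y \<Longrightarrow> \<not> on a x0 y \<Longrightarrow> rot a x0 i y = y" by (simp add: rot_def)

lemma mod_m: "n mod m < m" using m_pos by simp

lemma rot_mem: "depth \<le> a \<Longrightarrow> y \<in> Y \<Longrightarrow> rot a x0 i y \<in> Y"
  using rot_on[of y a x0 _ i] rot_off[of y a x0 i] rep_Y mod_m unfolding on_def by metis

lemma rot_agree: "y \<in> Y \<Longrightarrow> agree a y (rot a x0 i y)"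
  using rot_on[of y a x0 _ i] rot_off[of y a x0 i] rep_agree unfolding on_def by (metis agree_refl)

lemma rot_far: "y \<in> Y \<Longrightarrow> a + l \<le> j \<Longrightarrow> rot a x0 i y j = y j"
  by (simp add: rot_def put_digit_def)

lemma rot_dig:
  assumes "y \<in> Y" "b \<noteq> a" shows "digit_at (rot a x0 i y) b u \<longleftrightarrow> digit_at y b u"
proof (cases "on a x0 y")
  case True
  then obtain s where "agree a x0 y" "digit_at y a s" by (auto simp: on_def)
  then show ?thesis using rot_on[OF assms(1), of a x0 s i] dig_rep_other[OF _ mod_m assms(2)] by simp
qed (use rot_off assms in simp)

lemma rot_undo:
  assumes "y \<in> Y" "depth \<le> a" "i \<le> m" shows "rot a x0 (m - i) (rot a x0 i y) = y"
proof (cases "on a x0 y")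
  case True
  then obtain s where s: "agree a x0 y" "digit_at y a s" by (auto simp: on_def)
  define t where "t = (s + i) mod m"
  have t: "t < m" by (simp add: t_def mod_m)
  have r: "rot a x0 i y = put_digit a t y" using rot_on[OF assms(1) s] by (simp add: t_def)
  have rY: "put_digit a t y \<in> Y" using rep_Y[OF assms(1) s(2) t assms(2)] .
  have "agree a x0 (put_digit a t y)" using s(1) rep_agree agree_trans by blast
  then have "rot a x0 (m - i) (put_digit a t y) = put_digit a ((t + (m - i)) mod m) (put_digit a t y)"
    using rot_on[OF rY _ dig_rep_same[OF t]] by blast
  moreover have "(t + (m - i)) mod m = s"
  proof -
    have "(t + (m - i)) mod m = (s + i + (m - i)) mod m" unfolding t_def by (simp add: mod_add_left_eq)
    also have "\<dots> = s" using assms(3) dig_lt[OF s(2)] by simp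
    finally show ?thesis .
  qed
  ultimately show ?thesis using r rep_rep rep_dig[OF s(2)] by simp
next
  case False
  then show ?thesis using rot_off assms(1) by simp
qed

lemma rot_Bij:
  assumes "depth \<le> a" "i \<le> m" shows "rot a x0 i \<in> Bij Y"
proof -
  have "bij_betw (rot a x0 i) Y Y"
    by (rule bij_betw_byWitness[of _ "rot a x0 (m - i)"])
       (use rot_undo[OF _ assms(1), of _ i x0] rot_undo[OF _ assms(1), of _ "m - i" x0] assms rot_mem in auto)
  then show ?thesis by (simp add: Bij_def rot_def)
qed

text \<open>
  If the compared position \<open>c\<close> lies before \<open>a\<close>, then only letters after \<open>c\<close> change. If \<open>c = a\<close>,
  the same residue is added to both digits or to none. If \<open>c\<close> lies after \<open>a\<close>, then the digit at
  \<open>a\<close> ends before \<open>c\<close>, so it is the same in both points and is changed in the same way.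
\<close>

lemma rot_shifted:
  assumes a: "depth \<le> a" and xy: "x \<in> Y" "y \<in> Y" and sh: "shifted c i' x y"
  shows "shifted c i' (rot a x0 i x) (rot a x0 i y)"
proof -
  obtain s t where st: "agree c x y" "digit_at x c s" "digit_at y c t" "t = (s + i') mod m"
    using sh by (auto simp: shifted_def)
  consider "c < a" | "c = a" | "a < c" by linarith
  then show ?thesis
  proof cases
    case 1
    have "agree c (rot a x0 i x) (rot a x0 i y)"
      using agree_mono[OF rot_agree[OF xy(1)], of c] agree_mono[OF rot_agree[OF xy(2)], of c] 1 st(1)
        agree_sym agree_trans by (metis less_imp_le)
    then show ?thesis using st rot_dig xy 1 by (auto simp: shifted_def)
  next
    case 2
    show ?thesis
    proof (cases "agree a x0 x")
      case True
      then have ay: "agree a x0 y" using st(1) 2 agree_trans by blast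
      have r: "rot a x0 i x = put_digit a ((s + i) mod m) x" "rot a x0 i y = put_digit a ((t + i) mod m) y"
        using rot_on[OF xy(1) True] rot_on[OF xy(2) ay] st 2 by auto
      have "agree a (put_digit a ((s + i) mod m) x) (put_digit a ((t + i) mod m) y)"
        using st(1) 2 by (simp add: agree_def put_digit_def)
      moreover have "(t + i) mod m = ((s + i) mod m + i') mod m"
        unfolding st(4) by (simp add: mod_simps algebra_simps)
      ultimately show ?thesis unfolding r 2 shifted_def using dig_rep_same[OF mod_m] by blast
    next
      case False
      then have "\<not> agree a x0 y" using st(1) 2 agree_sym agree_trans by blast
      then show ?thesis using False rot_off[OF xy(1)] rot_off[OF xy(2)] sh by (simp add: on_def)
    qed
  next
    case 3
    have tr: "digit_at v a u" if uv: "digit_at x' a u" "digit_at x' c s'" "agree c x' v" for u s' x' v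
      using dig_sep[OF uv(1,2)] 3 dig_agree[OF uv(1,3)] l_pos by auto
    have ac: "agree a x y" using agree_mono[OF st(1), of a] 3 by simp
    show ?thesis
    proof (cases "on a x0 x")
      case True
      then obtain u where u: "agree a x0 x" "digit_at x a u" by (auto simp: on_def)
      have ay: "agree a x0 y" using u(1) ac agree_trans by blast
      have uy: "digit_at y a u" using tr[OF u(2) st(2,1)] .
      have r: "rot a x0 i x = put_digit a ((u + i) mod m) x" "rot a x0 i y = put_digit a ((u + i) mod m) y"
        using rot_on[OF xy(1) u] rot_on[OF xy(2) ay uy] by auto
      have "agree c (put_digit a ((u + i) mod m) x) (put_digit a ((u + i) mod m) y)"
        using st(1) by (simp add: agree_def put_digit_def)
      then show ?thesis unfolding r shifted_def
        using dig_rep_other[OF u(2) mod_m, of c] dig_rep_other[OF uy mod_m, of c] st 3 by auto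
    next
      case False
      have "\<not> on a x0 y"
      proof
        assume "on a x0 y"
        then obtain u where u: "agree a x0 y" "digit_at y a u" by (auto simp: on_def)
        have "digit_at x a u" using tr[OF u(2) st(3) agree_sym[OF st(1)]] .
        moreover have "agree a x0 x" using u(1) agree_sym[OF ac] agree_trans by blast
        ultimately show False using False by (auto simp: on_def)
      qed
      then show ?thesis using False rot_off[OF xy(1)] rot_off[OF xy(2)] sh by simp
    qed
  qed
qed

text \<open>
  The rotation at \<open>a\<close> by \<open>m - i\<close> inverts the rotation by \<open>i\<close>.
\<close>

lemma rot_Kq:
  assumes a: "depth \<le> a" and i: "i \<le> m" "q dvd i" "q dvd m"
  shows "rot a x0 i \<in> Kq q" "rot a x0 i \<in> Kn a"
proof -
  have K: "rot a x0 i \<in> Kset"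
  proof (rule K_I[where n = "a + l"])
    show "rot a x0 i \<in> Bij Y" using rot_Bij[OF a i(1)] .
    fix x assume x: "x \<in> Y"
    show "rot a x0 i x j = x j" if "\<not> covered x j" for j
    proof (cases "on a x0 x")
      case True
      then obtain s where s: "agree a x0 x" "digit_at x a s" by (auto simp: on_def)
      then have "\<not> (a \<le> j \<and> j < a + l)" using that a unfolding covered_def by blast
      then show ?thesis unfolding rot_on[OF x s] put_digit_def by argo
    qed (use rot_off x in simp)
    show "rot a x0 i x j = x j" if "a + l \<le> j" for j using rot_far[OF x that] .
    fix y c i' assume y: "y \<in> Y"
    show "shifted c i' x y \<longleftrightarrow> shifted c i' (rot a x0 i x) (rot a x0 i y)"
    proof
      assume "shifted c i' x y"
      then show "shifted c i' (rot a x0 i x) (rot a x0 i y)" by (rule rot_shifted[OF a x y])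
    next
      assume "shifted c i' (rot a x0 i x) (rot a x0 i y)"
      then have "shifted c i' (rot a x0 (m - i) (rot a x0 i x)) (rot a x0 (m - i) (rot a x0 i y))"
        by (rule rot_shifted[OF a rot_mem[OF a x] rot_mem[OF a y]])
      then show "shifted c i' x y" using rot_undo[OF x a i(1)] rot_undo[OF y a i(1)] by simp
    qed
  qed
  show "rot a x0 i \<in> Kn a" using K rot_agree by (simp add: Kn_def)
  have "s mod q = t mod q" if x: "x \<in> Y" "digit_at x b s" "digit_at (rot a x0 i x) b t" for x b s t
  proof (cases "b = a \<and> on a x0 x")
    case True
    then have "rot a x0 i x = put_digit a ((s + i) mod m) x" using rot_on[OF x(1), of a x0 s i] x(2) by (simp add: on_def)
    then have "t = (s + i) mod m" using x(3) True dig_rep_same[OF mod_m] dig_unique by metis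
    then show ?thesis using i(2,3) by (simp add: mod_mod_cancel) (metis dvd_eq_mod_eq_0 mod_add_right_eq add.right_neutral)
  next
    case False
    then have "digit_at x b t" using rot_dig[OF x(1), of b a x0 i t] rot_off[OF x(1), of a x0 i] x(3) by (cases "b = a") auto
    then show ?thesis using dig_unique[OF x(2)] by simp
  qed
  then show "rot a x0 i \<in> Kq q" using K unfolding Kq_def by blast
qed

lemma rot_moves:
  assumes "x0 \<in> Y" "digit_at x0 a s" "0 < i" "i < m" shows "rot a x0 i x0 \<noteq> x0"
proof
  assume e: "rot a x0 i x0 = x0"
  have "rot a x0 i x0 = put_digit a ((s + i) mod m) x0" using rot_on[OF assms(1) agree_refl assms(2)] .
  then have "digit_at x0 a ((s + i) mod m)" using e dig_rep_same[OF mod_m, of a "s + i" x0] by simp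
  then have "s = (s + i) mod m" using dig_unique[OF assms(2)] by blast
  moreover have "s < m" using dig_lt[OF assms(2)] .
  moreover have "(s + i) mod m = (if s + i < m then s + i else s + i - m)"
    using \<open>s < m\<close> assms(4) by (auto simp: le_mod_geq not_less)
  ultimately show False using assms(3,4) by (auto split: if_splits)
qed

text \<open>
  By diconnectedness every walk can be reached from, and continued to, any point.
\<close>

lemma walk_occurs:
  assumes x: "x \<in> X" and p: "awalk u p v"
  shows "\<exists>z\<in>X. \<exists>b\<ge>n. agree n x z \<and> occurs z b p"
proof -
  have tv: "tail g (x k) \<in> verts g" for k using X_arc[OF x] by simp
  have uv: "u \<in> verts g" "v \<in> verts g" using p by auto
  obtain q where q: "awalk (tail g (x n)) q u" using diconnected_walk[OF dc tv uv(1)] by blast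
  obtain r where r: "awalk v r (tail g (x 0))" "r \<noteq> []" using diconnected_walk[OF dc uv(2) tv] by blast
  have W: "awalk (tail g (x 0)) (map x [0..<n] @ q @ p @ r) (tail g (x 0))"
    using map_awalk[OF x, of 0 n] q p r by (intro awalk_appendI) auto
  define z where "z = pcat (map x [0..<n] @ q @ p @ r) x"
  have "z \<in> X" unfolding z_def using pcat_X[OF W x] by simp
  moreover have "agree n x z" unfolding z_def pcat_append by (rule agree_pcat_map)
  moreover have "occurs z (n + length q) p"
    unfolding z_def pcat_append using occ_pcat_iff[of "map x [0..<n]"] occ_pcat_iff[of q _ 0] occ_pcat
    by (metis add.right_neutral diff_zero length_map length_upt)
  ultimately show ?thesis by (intro bexI[of _ z] exI[of _ "n + length q"]) auto
qed

lemma dig_exists: "\<exists>z\<in>Y. \<exists>b\<ge>n. depth \<le> b \<and> digit_at z b 0"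
proof -
  obtain x where x: "x \<in> Y" using Y_ne by blast
  obtain z b where z: "z \<in> X" "max n depth \<le> b" "agree (max n depth) x z" "occurs z b (d 0)"
    using walk_occurs[OF YX[OF x] d_walk[OF m_pos], of "max n depth"] by blast
  have "z \<in> Y" using depth(2)[OF x z(1) agree_mono[OF z(3)]] by simp
  then show ?thesis using z m_pos by (auto simp: digit_at_def)
qed

text \<open>
  In a finite set of maps, one that fixes sufficiently many initial letters is trivial. But there
  are non-trivial rotations by \<open>q\<close> at arbitrarily late positions.
\<close>

lemma Kq_infinite:
  assumes "m = q * r" "1 < r" shows "infinite (Kq q)"
proof
  assume fin: "finite (Kq q)"
  have "\<forall>k\<in>Kq q. \<exists>n. (\<forall>x\<in>Y. agree n x (k x)) \<longrightarrow> (\<forall>x\<in>Y. k x = x)"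
  proof
    fix k assume k: "k \<in> Kq q"
    show "\<exists>n. (\<forall>x\<in>Y. agree n x (k x)) \<longrightarrow> (\<forall>x\<in>Y. k x = x)"
    proof (cases "\<forall>x\<in>Y. k x = x")
      case False
      then obtain x j where "x \<in> Y" "k x j \<noteq> x j" by (auto simp: fun_eq_iff)
      then have "\<not> agree (Suc j) x (k x)" unfolding agree_def by (metis lessI)
      then show ?thesis using \<open>x \<in> Y\<close> by blast
    qed blast
  qed
  then obtain N where N: "\<And>k. k \<in> Kq q \<Longrightarrow> (\<forall>x\<in>Y. agree (N k) x (k x)) \<Longrightarrow> (\<forall>x\<in>Y. k x = x)" by metis
  define n where "n = Max (insert 0 (N ` Kq q))"
  obtain z a where z: "z \<in> Y" "n \<le> a" "depth \<le> a" "digit_at z a 0" using dig_exists by blast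
  have q: "0 < q" "q < m" using assms m_pos by auto
  have k: "rot a z q \<in> Kq q" "rot a z q \<in> Kn a" using rot_Kq[OF z(3), of q q z] q assms by auto
  have "N (rot a z q) \<le> n" unfolding n_def using fin k(1) by simp
  then have "\<forall>x\<in>Y. agree (N (rot a z q)) x (rot a z q x)"
    using k(2) z(2) agree_mono unfolding Kn_def by (metis (mono_tags, lifting) mem_Collect_eq le_trans)
  then have "rot a z q z = z" using N[OF k(1)] z(1) by blast
  then show False using rot_moves[OF z(1,4) q] by simp
qed

subsection \<open>Countability\<close>

text \<open>
  A prefix replacement map is determined by a finite set of pairs of finite words, and there are
  countably many of these.
\<close>

lemma countable_prefix_maps: "countable prefix_maps"
proof -
  let ?L = "lists (arcs g) \<times> lists (arcs g)"
  define dec where "dec \<tau> = (\<lambda>x\<in>Y. SOME y. \<exists>u v z. (u, v) \<in> \<tau> \<and> x = pcat u z \<and> y = pcat v z)" for \<tau> :: "('e list \<times> 'e list) set"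
  have "h \<in> dec ` {\<tau>. finite \<tau> \<and> \<tau> \<subseteq> ?L}" if h: "h \<in> prefix_maps" for h
  proof -
    obtain A B where AB: "\<forall>x\<in>Y. \<exists>b. 0 \<le> b \<and> b \<le> B \<and> lp h x A b" using uniform_lp[OF h, of 0] by blast
    define e where "e x = (SOME b. b \<le> B \<and> lp h x A b)" for x
    have e: "e x \<le> B" "lp h x A (e x)" if "x \<in> Y" for x
      using someI_ex[of "\<lambda>b. b \<le> B \<and> lp h x A b"] AB that unfolding e_def by auto
    define \<tau> where "\<tau> = (\<lambda>x. (map x [0..<A], map (h x) [0..<e x])) ` Y"
    let ?F = "\<lambda>n. {xs. set xs \<subseteq> arcs g \<and> length xs \<le> n}"
    have arc: "y j \<in> arcs g" if "y \<in> Y" for y j using X_arc[OF YX[OF that]] .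
    have "\<tau> \<subseteq> ?F A \<times> ?F B" unfolding \<tau>_def using arc prefix_maps_mem[OF h] e(1) by auto
    then have 1: "finite \<tau>" by (rule finite_subset) (simp add: finite_lists_length_le)
    have 2: "\<tau> \<subseteq> ?L" unfolding \<tau>_def using arc prefix_maps_mem[OF h] by auto
    have pc: "z = pcat (map z [0..<n]) (\<lambda>j. z (n + j))" for z :: "nat \<Rightarrow> 'e" and n
      by (auto simp: pcat_def fun_eq_iff)
    have "dec \<tau> x = h x" if x: "x \<in> Y" for x
    proof -
      have hx: "h x = pcat (map (h x) [0..<e x]) (\<lambda>j. x (A + j))"
        using pc[of "h x" "e x"] lp_tail[OF e(2)[OF x] x agree_refl] by simp
      have "\<exists>y u v z. (u, v) \<in> \<tau> \<and> x = pcat u z \<and> y = pcat v z"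
        using pc[of x A] x unfolding \<tau>_def by blast
      then have ex: "\<exists>u v z. (u, v) \<in> \<tau> \<and> x = pcat u z \<and> dec \<tau> x = pcat v z"
        using someI_ex[of "\<lambda>y. \<exists>u v z. (u, v) \<in> \<tau> \<and> x = pcat u z \<and> y = pcat v z"] x by (simp add: dec_def)
      then obtain u v z where uvz: "(u, v) \<in> \<tau>" "x = pcat u z" "dec \<tau> x = pcat v z" by blast
      obtain x' where x': "x' \<in> Y" "u = map x' [0..<A]" "v = map (h x') [0..<e x']" using uvz(1) by (auto simp: \<tau>_def)
      have ag: "agree A x' x" unfolding uvz(2) x'(2) by (rule agree_pcat_map)
      have zt: "z j = x (A + j)" for j unfolding uvz(2) x'(2) by (simp add: pcat_def)
      have "h x = pcat v z"
      proof
        fix j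
        show "h x j = pcat v z j"
        proof (cases "j < e x'")
          case True
          then show ?thesis using lp_agree[OF e(2)[OF x'(1)] x ag] x'(3) by (simp add: pcat_def agree_def)
        next
          case False
          then show ?thesis using lp_tail[OF e(2)[OF x'(1)] x ag, of "j - e x'"] x'(3) zt by (simp add: pcat_def)
        qed
      qed
      then show ?thesis using uvz by simp
    qed
    moreover have "dec \<tau> \<in> extensional Y" by (simp add: dec_def)
    ultimately have "dec \<tau> = h" using Bij_imp_extensional[OF prefix_maps_Bij[OF h]] by (meson extensionalityI)
    then show ?thesis using 1 2 by blast
  qed
  then have "prefix_maps \<subseteq> dec ` {\<tau>. finite \<tau> \<and> \<tau> \<subseteq> ?L}" by blast
  moreover have "countable {\<tau>. finite \<tau> \<and> \<tau> \<subseteq> ?L}"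
    by (intro countable_Collect_finite_subset countable_SIGMA countable_lists countable_finite) simp_all
  ultimately show ?thesis by (meson countable_image countable_subset)
qed

section \<open>The completion of the full group\<close>

interpretation HG: group HH by (rule HH_group)

text \<open>
  The cosets of all groups \<open>Kn n\<close>, and not only those of \<open>Kset\<close>, are needed for a faithful action.
\<close>

definition cosets :: "((nat \<Rightarrow> 'e) \<Rightarrow> nat \<Rightarrow> 'e) set set" where
  "cosets = {h <#\<^bsub>HH\<^esub> Kn n | h n. h \<in> prefix_maps}"

definition coset_act :: "((nat \<Rightarrow> 'e) \<Rightarrow> nat \<Rightarrow> 'e) \<Rightarrow> ((nat \<Rightarrow> 'e) \<Rightarrow> nat \<Rightarrow> 'e) set \<Rightarrow> ((nat \<Rightarrow> 'e) \<Rightarrow> nat \<Rightarrow> 'e) set" where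
  "coset_act h = (\<lambda>c\<in>cosets. h <#\<^bsub>HH\<^esub> c)"

lemma Kn_sub: "Kn n \<subseteq> carrier HH"
  using subgroup.subset[OF Kn_subgroup] .

lemma cosets_sub: "c \<in> cosets \<Longrightarrow> c \<subseteq> carrier HH"
  using HG.l_coset_subset_G[OF Kn_sub] by (auto simp: cosets_def)

lemma coset_act_coset: "h \<in> prefix_maps \<Longrightarrow> k \<in> prefix_maps \<Longrightarrow> h <#\<^bsub>HH\<^esub> (k <#\<^bsub>HH\<^esub> Kn n) = (h \<otimes>\<^bsub>HH\<^esub> k) <#\<^bsub>HH\<^esub> Kn n"
  using HG.lcos_m_assoc[OF Kn_sub, of h k] by simp

lemma coset_act_mem: "h \<in> prefix_maps \<Longrightarrow> c \<in> cosets \<Longrightarrow> h <#\<^bsub>HH\<^esub> c \<in> cosets"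
  using coset_act_coset HH_mult_mem unfolding cosets_def by blast

lemma Kn_cosets: "Kn n \<in> cosets"
proof -
  have "\<one>\<^bsub>HH\<^esub> <#\<^bsub>HH\<^esub> Kn n = Kn n" using HG.lcos_mult_one[OF Kn_sub] .
  moreover have "\<one>\<^bsub>HH\<^esub> \<in> prefix_maps" using HG.one_closed by simp
  ultimately show ?thesis unfolding cosets_def by force
qed

lemma coset_act_mult:
  "h \<in> prefix_maps \<Longrightarrow> k \<in> prefix_maps \<Longrightarrow> c \<in> cosets \<Longrightarrow> coset_act (h \<otimes>\<^bsub>HH\<^esub> k) c = coset_act h (coset_act k c)"
  using HG.lcos_m_assoc[OF cosets_sub, of c h k] coset_act_mem by (simp add: coset_act_def)

lemma coset_act_one: "c \<in> cosets \<Longrightarrow> coset_act \<one>\<^bsub>HH\<^esub> c = c"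
  using HG.lcos_mult_one[OF cosets_sub] unfolding coset_act_def by simp

lemma coset_act_Bij: assumes h: "h \<in> prefix_maps" shows "coset_act h \<in> Bij cosets"
proof -
  have cl: "coset_act k c \<in> cosets" if "k \<in> prefix_maps" "c \<in> cosets" for k c
    using coset_act_mem that by (simp add: coset_act_def)
  have "bij_betw (coset_act h) cosets cosets"
  proof (rule bij_betw_byWitness[of _ "coset_act (inv\<^bsub>HH\<^esub> h)"])
    show "\<forall>c\<in>cosets. coset_act (inv\<^bsub>HH\<^esub> h) (coset_act h c) = c"
      using coset_act_mult[OF HH_inv_mem[OF h] h] coset_act_one HG.l_inv[of h] h by simp
    show "\<forall>c\<in>cosets. coset_act h (coset_act (inv\<^bsub>HH\<^esub> h) c) = c"
      using coset_act_mult[OF h HH_inv_mem[OF h]] coset_act_one HG.r_inv[of h] h by simp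
  qed (use cl h HH_inv_mem[OF h] in auto)
  then show ?thesis by (simp add: Bij_def coset_act_def)
qed

lemma coset_act_hom: "coset_act \<in> hom HH (BijGroup cosets)"
proof (rule homI)
  fix h assume "h \<in> carrier HH"
  then show "coset_act h \<in> carrier (BijGroup cosets)" using coset_act_Bij by (simp add: BijGroup_def)
next
  fix h k assume hk: "h \<in> carrier HH" "k \<in> carrier HH"
  then have hk': "h \<in> prefix_maps" "k \<in> prefix_maps" by simp_all
  have "coset_act (h \<otimes>\<^bsub>HH\<^esub> k) = compose cosets (coset_act h) (coset_act k)"
  proof
    fix c
    show "coset_act (h \<otimes>\<^bsub>HH\<^esub> k) c = compose cosets (coset_act h) (coset_act k) c"
    proof (cases "c \<in> cosets")
      case True
      then show ?thesis using coset_act_mult[OF hk'] by (simp add: compose_eq)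
    next
      case False
      then show ?thesis unfolding compose_def coset_act_def[of "h \<otimes>\<^bsub>HH\<^esub> k"] by simp
    qed
  qed
  moreover have "coset_act h \<otimes>\<^bsub>BijGroup cosets\<^esub> coset_act k = compose cosets (coset_act h) (coset_act k)"
    using coset_act_Bij[OF hk'(1)] coset_act_Bij[OF hk'(2)] by (simp add: BijGroup_def)
  ultimately show "coset_act (h \<otimes>\<^bsub>HH\<^esub> k) = coset_act h \<otimes>\<^bsub>BijGroup cosets\<^esub> coset_act k" by simp
qed

lemma coset_fix: "h \<in> prefix_maps \<Longrightarrow> coset_act h (Kn n) = Kn n \<longleftrightarrow> h \<in> Kn n"
proof -
  assume h: "h \<in> prefix_maps"
  have e: "coset_act h (Kn n) = h <#\<^bsub>HH\<^esub> Kn n" using Kn_cosets by (simp add: coset_act_def)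
  show ?thesis
  proof
    assume "coset_act h (Kn n) = Kn n"
    moreover have "h \<in> h <#\<^bsub>HH\<^esub> Kn n"
    proof -
      have "h = h \<otimes>\<^bsub>HH\<^esub> \<one>\<^bsub>HH\<^esub>" using HG.r_one[of h] h by simp
      then show ?thesis unfolding l_coset_def using subgroup.one_closed[OF Kn_subgroup] by blast
    qed
    ultimately show "h \<in> Kn n" using e by simp
  next
    assume "h \<in> Kn n"
    then have "h <#\<^bsub>HH\<^esub> Kn n = Kn n" using HG.coset_join3[of h "Kn n"] Kn_subgroup h by simp
    then show "coset_act h (Kn n) = Kn n" using e by simp
  qed
qed

text \<open>
  Let \<open>c = h (Kn n)\<close>. By \<open>conj_K\<close> some \<open>Kn n'\<close> fixes \<open>c\<close>, and \<open>Kset\<close> is covered by finitely many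
  cosets of it.
\<close>

lemma coset_orbits_finite:
  assumes c: "c \<in> cosets"
  shows "finite {coset_act k c | k. k \<in> carrier HH \<and> coset_act k Kset = Kset}"
proof -
  obtain h n where h: "h \<in> prefix_maps" "c = h <#\<^bsub>HH\<^esub> Kn n" using c by (auto simp: cosets_def)
  have hi: "inv\<^bsub>HH\<^esub> h \<in> prefix_maps" using HH_inv_mem[OF h(1)] .
  obtain n' where n': "\<forall>k\<in>Kn n'. inv\<^bsub>HH\<^esub> h \<otimes>\<^bsub>HH\<^esub> k \<otimes>\<^bsub>HH\<^esub> inv\<^bsub>HH\<^esub> (inv\<^bsub>HH\<^esub> h) \<in> Kn n"
    using conj_K[OF hi] by blast
  have hh: "inv\<^bsub>HH\<^esub> (inv\<^bsub>HH\<^esub> h) = h" using HG.inv_inv[of h] h by simp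
  obtain R where R: "finite R" "R \<subseteq> carrier HH" "Kset \<subseteq> (\<Union>r\<in>R. Kn n' #>\<^bsub>HH\<^esub> r)"
    using covers_Kn[of n'] unfolding covers_def by blast
  have "{coset_act k c | k. k \<in> carrier HH \<and> coset_act k Kset = Kset} \<subseteq> (\<lambda>r. inv\<^bsub>HH\<^esub> r <#\<^bsub>HH\<^esub> c) ` R"
  proof
    fix c' assume "c' \<in> {coset_act k c | k. k \<in> carrier HH \<and> coset_act k Kset = Kset}"
    then obtain k where k: "k \<in> prefix_maps" "coset_act k Kset = Kset" "c' = coset_act k c" by auto
    have kK: "k \<in> Kset" using coset_fix[OF k(1), of 0] k(2) by (simp add: Kn_0)
    have "inv\<^bsub>HH\<^esub> k \<in> Kset" using subgroup.m_inv_closed[OF K_subgroup kK] .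
    then obtain r where r: "r \<in> R" "inv\<^bsub>HH\<^esub> k \<in> Kn n' #>\<^bsub>HH\<^esub> r" using R(3) by blast
    then obtain k' where k': "k' \<in> Kn n'" "inv\<^bsub>HH\<^esub> k = k' \<otimes>\<^bsub>HH\<^esub> r" by (auto simp: r_coset_def)
    have rH: "r \<in> prefix_maps" using r R(2) by auto
    have k'H: "k' \<in> prefix_maps" using k' Kn_sub by auto
    define k'' where "k'' = inv\<^bsub>HH\<^esub> k'"
    have k'': "k'' \<in> Kn n'" "k'' \<in> prefix_maps"
      using subgroup.m_inv_closed[OF Kn_subgroup k'(1)] HH_inv_mem[OF k'H] by (simp_all add: k''_def)
    have "k = inv\<^bsub>HH\<^esub> (k' \<otimes>\<^bsub>HH\<^esub> r)" using k'(2) HG.inv_inv[of k] k(1) by simp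
    also have "\<dots> = inv\<^bsub>HH\<^esub> r \<otimes>\<^bsub>HH\<^esub> k''" using HG.inv_mult_group[of k' r] k'H rH by (simp add: k''_def)
    finally have keq: "k = inv\<^bsub>HH\<^esub> r \<otimes>\<^bsub>HH\<^esub> k''" .
    define k3 where "k3 = inv\<^bsub>HH\<^esub> h \<otimes>\<^bsub>HH\<^esub> k'' \<otimes>\<^bsub>HH\<^esub> h"
    have k3: "k3 \<in> Kn n" using n' k'' hh by (simp add: k3_def)
    have k3H: "k3 \<in> prefix_maps" using k3 Kn_sub by auto
    have "h \<otimes>\<^bsub>HH\<^esub> k3 = k'' \<otimes>\<^bsub>HH\<^esub> h"
      unfolding k3_def using h hi k'' HH_mult_mem HG.m_assoc[of h] HG.m_assoc[of "inv\<^bsub>HH\<^esub> h"] HG.mult_inv_cancel(1)[of h "k'' \<otimes>\<^bsub>HH\<^esub> h"]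
      by simp
    then have "k'' <#\<^bsub>HH\<^esub> c = h <#\<^bsub>HH\<^esub> (k3 <#\<^bsub>HH\<^esub> Kn n)"
      using coset_act_coset[OF k''(2) h(1)] coset_act_coset[OF h(1) k3H] h(2) by simp
    also have "k3 <#\<^bsub>HH\<^esub> Kn n = Kn n" using HG.coset_join3[of k3 "Kn n"] Kn_subgroup k3 k3H by simp
    finally have "k'' <#\<^bsub>HH\<^esub> c = c" using h(2) by simp
    then have "coset_act k'' c = c" using c by (simp add: coset_act_def)
    then have "c' = coset_act (inv\<^bsub>HH\<^esub> r) c"
      using k(3) coset_act_mult[OF HH_inv_mem[OF rH] k''(2) c] keq by simp
    then have "c' = inv\<^bsub>HH\<^esub> r <#\<^bsub>HH\<^esub> c" using c by (simp add: coset_act_def)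
    then show "c' \<in> (\<lambda>r. inv\<^bsub>HH\<^esub> r <#\<^bsub>HH\<^esub> c) ` R" using r(1) by blast
  qed
  then show ?thesis using R(1) finite_surj by blast
qed

lemma countable_cosets: "countable cosets"
proof -
  have "cosets = (\<lambda>(h, n). h <#\<^bsub>HH\<^esub> Kn n) ` (prefix_maps \<times> UNIV)" by (auto simp: cosets_def)
  then show ?thesis using countable_prefix_maps by (simp add: countable_SIGMA)
qed

text \<open>
  The permutations of the countable set of cosets are encoded by singleton sets of partial
  functions on words, a coset being represented by a word whose length is its number.
\<close>

theorem completion_part:
  assumes P: "finite P" "\<And>p. p \<in> P \<Longrightarrow> prime p" "m = \<Prod>P"
  shows "\<exists>(G :: ('e list \<rightharpoonup> 'e list) set monoid) TG \<phi>.
        tdlc_completion HH (discrete_topology (carrier HH)) G TG \<phi> \<and>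
        lpc G TG = P \<and>
        (\<forall>U. compact_open_subgroup G TG U \<longrightarrow>
           commensurated HH (\<phi> -` U \<inter> carrier HH) \<and>
           lpc_class HH (commens_class HH (\<phi> -` U \<inter> carrier HH)) = P)"
proof -
  define \<iota> :: "((nat \<Rightarrow> 'e) \<Rightarrow> nat \<Rightarrow> 'e) set \<Rightarrow> 'e list" where
    "\<iota> c = replicate (to_nat_on cosets c) undefined" for c
  have \<iota>: "c = c'" if "c \<in> cosets" "c' \<in> cosets" "\<iota> c = \<iota> c'" for c c'
  proof -
    have "to_nat_on cosets c = to_nat_on cosets c'" using that(3) unfolding \<iota>_def by (metis length_replicate)
    then show ?thesis using inj_on_to_nat_on[OF countable_cosets] that by (meson inj_onD)
  qed
  \<comment> \<open>The permutation \<open>f\<close>, read through \<open>\<iota>\<close>, as a partial function on words.\<close>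
  define j :: "(((nat \<Rightarrow> 'e) \<Rightarrow> nat \<Rightarrow> 'e) set \<Rightarrow> ((nat \<Rightarrow> 'e) \<Rightarrow> nat \<Rightarrow> 'e) set) \<Rightarrow> ('e list \<rightharpoonup> 'e list) set" where
    "j f = {\<lambda>u. if u \<in> \<iota> ` cosets then Some (\<iota> (f (inv_into cosets \<iota> u))) else None}" for f
  have inj\<iota>: "inj_on \<iota> cosets" using \<iota> by (rule inj_onI)
  have inj: "inj_on j (Bij cosets)"
  proof (rule inj_onI)
    fix f f' assume f: "f \<in> Bij cosets" "f' \<in> Bij cosets" "j f = j f'"
    have "f c = f' c" if c: "c \<in> cosets" for c
    proof -
      have "(\<lambda>u. if u \<in> \<iota> ` cosets then Some (\<iota> (f (inv_into cosets \<iota> u))) else None)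
          = (\<lambda>u. if u \<in> \<iota> ` cosets then Some (\<iota> (f' (inv_into cosets \<iota> u))) else None)"
        using f(3) by (simp add: j_def)
      from fun_cong[OF this, of "\<iota> c"] have "\<iota> (f c) = \<iota> (f' c)"
        using c inv_into_f_f[OF inj\<iota> c] by simp
      moreover have "f c \<in> cosets" "f' c \<in> cosets" using f(1,2) c by (auto simp: Bij_def bij_betw_def)
      ultimately show ?thesis using \<iota> by blast
    qed
    then show "f = f'" using f(1,2) by (meson Bij_imp_extensional extensionalityI)
  qed
  interpret CA: completion_action HH cosets coset_act Kset j
  proof unfold_locales
    show "coset_act \<in> hom HH (BijGroup cosets)" by (rule coset_act_hom)
    \<comment> \<open>\<open>Kset\<close> is \<open>Kn 0\<close>.\<close>
    show "Kset \<in> cosets" using Kn_cosets[of 0] by (simp add: Kn_0)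
    show "inj_on j (Bij cosets)" by (rule inj)
    fix c assume "c \<in> cosets"
    then show "finite {coset_act k c | k. k \<in> carrier HH \<and> coset_act k Kset = Kset}" by (rule coset_orbits_finite)
  qed
  have st: "CA.stab = Kset"
  proof
    show "CA.stab \<subseteq> Kset" using coset_fix[of _ 0] unfolding CA.stab_def by (auto simp: Kn_0)
    show "Kset \<subseteq> CA.stab" using coset_fix[of _ 0] K_prefix_maps unfolding CA.stab_def by (auto simp: Kn_0)
  qed
  have faithful: "h = \<one>\<^bsub>HH\<^esub>" if h: "h \<in> carrier HH" "\<And>x. x \<in> cosets \<Longrightarrow> coset_act h x = x" for h
  proof -
    have hH: "h \<in> prefix_maps" using h by simp
    have "h \<in> Kn n" for n using coset_fix[OF hH, of n] h(2)[OF Kn_cosets] by simp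
    then have "agree n x (h x)" if "x \<in> Y" for x n using that by (simp add: Kn_def)
    then have "h x = x" if "x \<in> Y" for x using that unfolding agree_def by (metis ext lessI)
    then show "h = \<one>\<^bsub>HH\<^esub>" using prefix_maps_eqI[OF hH] HG.one_closed HH_one by simp
  qed
  have tor: "\<exists>s::nat. k [^]\<^bsub>HH\<^esub> s = \<one>\<^bsub>HH\<^esub> \<and> \<not> q dvd s" if q: "prime q" "q \<notin> P" and k: "k \<in> CA.stab" for q k
  proof -
    have "k \<in> Kq 1" using k st Kq_1 by blast
    then obtain n :: nat where n: "k [^]\<^bsub>HH\<^esub> (m ^ n) = \<one>\<^bsub>HH\<^esub>" using Kq_torsion[of 1 m k] by auto
    have "\<not> q dvd m ^ n"
    proof
      assume "q dvd m ^ n"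
      then have "q dvd m" using q(1) prime_dvd_power by blast
      then obtain p where "p \<in> P" "q dvd p" using q(1) P(1,3) by (auto simp: prime_dvd_prod_iff)
      then show False using q P(2) primes_dvd_imp_eq by blast
    qed
    then show "\<exists>s::nat. k [^]\<^bsub>HH\<^esub> s = \<one>\<^bsub>HH\<^esub> \<and> \<not> q dvd s" using n by blast
  qed
  have inf: "\<exists>A\<subseteq>CA.stab. infinite A \<and> (\<forall>a\<in>A. \<forall>b\<in>A. a \<otimes>\<^bsub>HH\<^esub> inv\<^bsub>HH\<^esub> b \<in> A) \<and>
      (\<forall>a\<in>A. \<exists>n::nat. a [^]\<^bsub>HH\<^esub> (p ^ n) = \<one>\<^bsub>HH\<^esub>)" if p: "p \<in> P" for p
  proof -
    have pm: "p dvd m" using dvd_prodI[OF P(1) p, of "\<lambda>x. x"] P(3) by simp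
    then have mp: "m = (m div p) * p" by simp
    have p1: "1 < p" using P(2)[OF p] prime_gt_1_nat by blast
    show ?thesis
    proof (intro exI[of _ "Kq (m div p)"] conjI ballI)
      show "Kq (m div p) \<subseteq> CA.stab" unfolding st by (auto simp: Kq_def)
      show "infinite (Kq (m div p))" using Kq_infinite[OF mp p1] .
    qed (use Kq_diff Kq_torsion[OF mp] in blast)+
  qed
  have lpc: "lpc_class HH (commens_class HH CA.stab) = P" "lpc CA.G CA.TG = P"
    using CA.lpc_completion[OF P(2) faithful tor inf] by blast+
  show ?thesis
  proof (intro exI[of _ CA.G] exI[of _ CA.TG] exI[of _ CA.emb] conjI allI impI)
    show "tdlc_completion HH (discrete_topology (carrier HH)) CA.G CA.TG CA.emb" by (rule CA.tdlc_completion_G)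
    show "lpc CA.G CA.TG = P" using lpc by blast
    fix U assume U: "compact_open_subgroup CA.G CA.TG U"
    show "commensurated HH (CA.emb -` U \<inter> carrier HH)"
      using CA.commensurated_pre[OF U] by (simp add: CA.pre_def)
    show "lpc_class HH (commens_class HH (CA.emb -` U \<inter> carrier HH)) = P"
      using CA.commens_class_pre[OF U] lpc by (simp add: CA.pre_def)
  qed
qed

text \<open>
  No point of \<open>Y\<close> is isolated: a walk from any prefix can be led to a vertex with two outgoing
  arcs.
\<close>

lemma another_point:
  assumes nc: "non_circular g" and x: "x \<in> Y" shows "\<exists>y\<in>Y. agree n x y \<and> y \<noteq> x"
proof -
  obtain e f where ef: "e \<in> arcs g" "f \<in> arcs g" "e \<noteq> f" "tail g e = tail g f" using branching[OF dc nc] by blast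
  have we: "awalk (tail g e) [e] (head g e)" "awalk (tail g f) [f] (head g f)"
    using ef by (auto simp: awalk_Cons_iff awalk_Nil_iff)
  obtain z b where z: "z \<in> X" "max n depth \<le> b" "agree (max n depth) x z" "occurs z b [e]"
    using walk_occurs[OF YX[OF x] we(1), of "max n depth"] by blast
  obtain z' b' where z': "z' \<in> X" "occurs z' b' [f]"
    using walk_occurs[OF YX[OF x] we(2), of 0] by blast
  have zb: "z b = e" "z' b' = f" using z(4) z'(2) by (auto simp: occurs_def)
  have b0: "0 < b" using z(2) depth(1) by linarith
  have "head g (z (b - 1)) = tail g (z' b')" using X_step[OF z(1), of "b - 1"] b0 zb ef(4) by simp
  then have yX: "glue b z b' z' \<in> X" using glue_X[OF z(1) z'(1) b0] by simp
  have zY: "z \<in> Y" using depth(2)[OF x z(1)] agree_mono[OF z(3)] by simp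
  have "agree (max n depth) z (glue b z b' z')" using agree_mono[OF agree_glue z(2)] .
  then have ay: "agree (max n depth) x (glue b z b' z')" using z(3) agree_trans by blast
  then have yY: "glue b z b' z' \<in> Y" using depth(2)[OF x yX] agree_mono[OF ay] by simp
  have "glue b z b' z' b = f" using glue_tail[of b z b' z' 0] zb by simp
  then have "glue b z b' z' \<noteq> z" using zb ef(3) by auto
  then consider "z \<noteq> x" | "glue b z b' z' \<noteq> x" by auto
  then show ?thesis
  proof cases
    case 1 then show ?thesis using zY agree_mono[OF z(3), of n] by (intro bexI[of _ z]) auto
  next
    case 2 then show ?thesis using yY agree_mono[OF ay, of n] by (intro bexI[of _ "glue b z b' z'"]) auto
  qed
qed

end

section \<open>Trees of words ordered by the prefix relation\<close>

text \<open>
  A set \<open>S\<close> of non-empty words, together with the empty word as the root, is a tree: the parent of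
  a word is its longest proper prefix in the set.
\<close>

locale prefix_tree =
  fixes S :: "'a list set"
  assumes Nil_notin: "[] \<notin> S"
begin

definition "V = insert [] S"

definition E :: "('a list \<times> 'a list) set" where
  "E = {(u, v). u \<in> V \<and> v \<in> S \<and> strict_prefix u v \<and> \<not> (\<exists>w\<in>S. strict_prefix u w \<and> strict_prefix w v)}"

definition T :: "'a list pair_pre_digraph" where "T = \<lparr>pverts = V, parcs = E\<rparr>"

lemma T_simps [simp]: "pverts T = V" "parcs T = E" by (simp_all add: T_def)

lemma SV: "u \<in> S \<Longrightarrow> u \<in> V" by (simp add: V_def)
lemma NilV: "[] \<in> V" by (simp add: V_def)

lemma ED:
  assumes "(u, v) \<in> E"
  shows "u \<in> V" "v \<in> S" "v \<in> V" "strict_prefix u v" "prefix u v"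
  using assms SV by (auto simp: E_def)

lemma E_between: "(u, v) \<in> E \<Longrightarrow> w \<in> S \<Longrightarrow> strict_prefix u w \<Longrightarrow> \<not> strict_prefix w v"
  by (auto simp: E_def)

lemma V_strict: "w \<in> V \<Longrightarrow> strict_prefix u w \<Longrightarrow> w \<in> S"
  by (auto simp: V_def)

lemma comparable: "prefix u w \<Longrightarrow> prefix v w \<Longrightarrow> prefix u v \<or> prefix v u"
  by (metis prefix_length_prefix nat_le_linear)

lemma longest_prefix:
  assumes "P []" "\<And>u. P u \<Longrightarrow> prefix u v"
  shows "\<exists>u. P u \<and> (\<forall>w. P w \<longrightarrow> length w \<le> length u)"
proof -
  have "\<forall>u. P u \<longrightarrow> length u < Suc (length v)" using assms(2) prefix_length_le by (metis less_Suc_eq_le)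
  then show ?thesis by (rule ex_has_greatest_nat[where P = P and k = "[]", OF assms(1)])
qed

lemma parent_ex:
  assumes "v \<in> S" shows "\<exists>u. (u, v) \<in> E"
proof -
  let ?P = "\<lambda>u. u \<in> V \<and> strict_prefix u v"
  have "?P []" using NilV assms Nil_notin by (cases v) (auto simp: strict_prefix_def)
  moreover have "\<And>u. ?P u \<Longrightarrow> prefix u v" by auto
  ultimately have "\<exists>u. ?P u \<and> (\<forall>w. ?P w \<longrightarrow> length w \<le> length u)" by (rule longest_prefix)
  then obtain u where u: "?P u" "\<And>w. ?P w \<Longrightarrow> length w \<le> length u" by blast
  have "\<not> (\<exists>w\<in>S. strict_prefix u w \<and> strict_prefix w v)"
    using u(2) SV prefix_length_less by (metis not_le)
  then show ?thesis using u(1) assms by (auto simp: E_def)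
qed

text \<open>
  Prefixes of one word are comparable, and no word of \<open>S\<close> lies strictly between parent and child.
\<close>

lemma below_parent:
  assumes "(u, v) \<in> E" "w \<in> V" "strict_prefix w v" shows "prefix w u"
proof -
  have "prefix u v" "prefix w v" using ED[OF assms(1)] assms(3) by auto
  then consider "prefix w u" | "strict_prefix u w" using comparable by (metis prefix_order.le_less)
  then show ?thesis
    using E_between[OF assms(1)] V_strict[OF assms(2)] assms(3) by cases blast+
qed

lemma parent_unique: "(u, v) \<in> E \<Longrightarrow> (u', v) \<in> E \<Longrightarrow> u = u'"
  using below_parent ED by (metis prefix_order.antisym)

lemma child_toward:
  assumes "u \<in> V" "v \<in> V" "strict_prefix u v"
  shows "\<exists>c. (u, c) \<in> E \<and> prefix c v"
proof -
  let ?P = "\<lambda>c. c \<in> S \<and> strict_prefix u c \<and> prefix c v"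
  have "?P v" using V_strict[OF assms(2,3)] assms(3) by simp
  then obtain c where c: "?P c" "\<And>w. ?P w \<Longrightarrow> length c \<le> length w"
    using ex_has_least_nat[of ?P v length] by meson
  have "\<not> strict_prefix w c" if w: "w \<in> S" "strict_prefix u w" for w
  proof
    assume wc: "strict_prefix w c"
    then have "prefix w v" using c(1) prefix_order.trans by (metis prefix_order.less_imp_le)
    then show False using c(2)[of w] w prefix_length_less[OF wc] by simp
  qed
  then have "(u, c) \<in> E" using c(1) assms(1) unfolding E_def by blast
  then show ?thesis using c(1) by blast
qed

lemma wf_T: "wf_digraph (with_proj T)"
  by unfold_locales (auto dest: ED)

interpretation W: wf_digraph "with_proj T" by (rule wf_T)

lemma reach_prefix: "u \<in> V \<Longrightarrow> v \<in> V \<Longrightarrow> prefix u v \<Longrightarrow> (u, v) \<in> rtrancl_on V E"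
proof (induction "length v" arbitrary: v rule: less_induct)
  case less
  show ?case
  proof (cases "u = v")
    case True then show ?thesis using less by simp
  next
    case False
    then have s: "strict_prefix u v" using less by simp
    then have "v \<in> S" using V_strict less by blast
    then obtain p where p: "(p, v) \<in> E" using parent_ex by blast
    have "prefix u p" using below_parent[OF p less.prems(1) s] .
    moreover have "length p < length v" using ED(4)[OF p] prefix_length_less by blast
    ultimately have "(u, p) \<in> rtrancl_on V E" using less.hyps ED(1)[OF p] less.prems by blast
    then show ?thesis using p less.prems(2) by (rule rtrancl_on_into_rtrancl_on)
  qed
qed

text \<open>
  Descendants are the extensions, so the tree order is the prefix order.
\<close>

lemma reachable_T: "u \<rightarrow>\<^sup>*\<^bsub>with_proj T\<^esub> v \<longleftrightarrow> u \<in> V \<and> v \<in> V \<and> prefix u v"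
proof
  assume "u \<rightarrow>\<^sup>*\<^bsub>with_proj T\<^esub> v"
  then have "(u, v) \<in> rtrancl_on V E" by (simp add: reachable_def)
  then show "u \<in> V \<and> v \<in> V \<and> prefix u v"
    by (induction rule: rtrancl_on_induct) (auto dest: ED intro: prefix_order.trans)
next
  assume "u \<in> V \<and> v \<in> V \<and> prefix u v"
  then show "u \<rightarrow>\<^sup>*\<^bsub>with_proj T\<^esub> v" using reach_prefix by (simp add: reachable_def)
qed

text \<open>
  The last edge of a walk ends in its final vertex and is determined by it, as parents are unique.
\<close>

lemma awalk_unique: "W.awalk [] p v \<Longrightarrow> W.awalk [] q v \<Longrightarrow> p = q"
proof (induction "length v" arbitrary: p q v rule: less_induct)
  case less
  have last: "\<exists>r' u. r = r' @ [(u, v)] \<and> (u, v) \<in> E \<and> W.awalk [] r' u" if r: "W.awalk [] r v" "r \<noteq> []" for r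
  proof -
    obtain r' e where r': "r = r' @ [e]" using r(2) by (metis append_butlast_last_id)
    then show ?thesis using r(1) by (cases e) (auto simp: W.awalk_append_iff W.awalk_Cons_iff W.awalk_Nil_iff)
  qed
  have nil: "v = []" if "W.awalk [] [] v" using that by (simp add: W.awalk_Nil_iff)
  have noE: "(u, []) \<notin> E" for u using ED(2) Nil_notin by blast
  show ?case
  proof (cases "p = [] \<or> q = []")
    case True
    then have "v = []" using nil less.prems by auto
    then show ?thesis using last noE less.prems by metis
  next
    case False
    then obtain p' u q' u' where pq: "p = p' @ [(u, v)]" "(u, v) \<in> E" "W.awalk [] p' u"
      "q = q' @ [(u', v)]" "(u', v) \<in> E" "W.awalk [] q' u'" using last less.prems by metis
    have "u = u'" using parent_unique pq by blast
    moreover have "length u < length v" using ED(4)[OF pq(2)] prefix_length_less by blast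
    ultimately show ?thesis using less.hyps pq by blast
  qed
qed

lemma rooted: "rooted_tree T []"
  unfolding rooted_tree_def
proof (intro conjI ballI)
  fix v assume "v \<in> pverts T"
  then have "[] \<rightarrow>\<^sup>*\<^bsub>with_proj T\<^esub> v" using reachable_T NilV by simp
  then obtain p where "W.awalk [] p v" using W.reachable_awalk by blast
  then show "\<exists>!p. pre_digraph.awalk (with_proj T) [] p v" using awalk_unique by blast
qed (auto simp: wf_T NilV)

lemma descendants_T: "v \<in> V \<Longrightarrow> descendants T v = {w \<in> V. prefix v w}"
  by (auto simp: descendants_def reachable_T)

lemma children_T: "children T v = {w. (v, w) \<in> E}" by (simp add: children_def)

definition symE :: "'a list set \<Rightarrow> ('a list \<times> 'a list) set" where
  "symE A = {(u, v). u \<in> A \<and> v \<in> A \<and> ((u, v) \<in> E \<or> (v, u) \<in> E)}"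

lemma subtree_T: "subtree T A \<longleftrightarrow> A \<subseteq> V \<and> A \<noteq> {} \<and> (\<forall>u\<in>A. \<forall>v\<in>A. (u, v) \<in> rtrancl_on A (symE A))"
proof -
  have "parcs (mk_symmetric (with_proj T \<restriction> A)) = symE A"
    by (auto simp: mk_symmetric_def symE_def)
  moreover have "pverts (mk_symmetric (with_proj T \<restriction> A)) = A"
    by (simp add: mk_symmetric_def)
  ultimately show ?thesis
    by (auto simp: subtree_def connected_def strongly_connected_def reachable_def)
qed

text \<open>
  A path inside \<open>A\<close> from a descendant of \<open>v\<close> to a non-descendant leaves the subtree below \<open>v\<close>
  through the only edge that leads into it.
\<close>

lemma crossing:
  assumes A: "subtree T A" and ab: "a \<in> A" "b \<in> A" and v: "v \<in> V" "prefix v a" "\<not> prefix v b"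
  shows "v \<in> A \<and> (\<exists>z\<in>A. (z, v) \<in> E)"
proof -
  have "(a, b) \<in> rtrancl_on A (symE A)" using A ab subtree_T by blast
  then have "prefix v b \<or> (v \<in> A \<and> (\<exists>z\<in>A. (z, v) \<in> E))"
  proof (induction rule: rtrancl_on_induct)
    case base then show ?case using v by simp
  next
    case (step y z)
    show ?case
    proof (cases "prefix v y \<and> \<not> prefix v z")
      case True
      consider "(y, z) \<in> E" | "(z, y) \<in> E" using step(2) by (auto simp: symE_def)
      then show ?thesis
      proof cases
        case 1
        then show ?thesis using ED(5) True prefix_order.trans by blast
      next
        case 2
        have "prefix z v" using comparable[OF ED(5)[OF 2], of v] True by blast
        then have sz: "strict_prefix z v" using True by (metis prefix_order.le_less prefix_order.order_refl)
        then have "v \<in> S" using V_strict v(1) by blast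
        then have "\<not> strict_prefix v y" using E_between[OF 2 _ sz] by blast
        then have "v = y" using True by (simp add: strict_prefix_def)
        then show ?thesis using 2 step by (auto simp: symE_def)
      qed
    next
      case False then show ?thesis using step.IH by blast
    qed
  qed
  then show ?thesis using v by blast
qed

lemma subtree_ancestor:
  assumes "subtree T A" "[] \<in> A" "a \<in> A" "v \<in> V" "prefix v a" shows "v \<in> A"
  using crossing[OF assms(1,3,2,4,5)] assms(2) by (cases "v = []") auto

lemma subtreeI:
  assumes A: "A \<subseteq> V" "[] \<in> A" and anc: "\<And>a v. a \<in> A \<Longrightarrow> v \<in> V \<Longrightarrow> prefix v a \<Longrightarrow> v \<in> A"
  shows "subtree T A"
proof -
  have "([], a) \<in> rtrancl_on A (symE A) \<and> (a, []) \<in> rtrancl_on A (symE A)" if "a \<in> A" for a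
    using that
  proof (induction "length a" arbitrary: a rule: less_induct)
    case less
    show ?case
    proof (cases "a = []")
      case True then show ?thesis using A by simp
    next
      case False
      then have "a \<in> S" using less.prems A(1) by (auto simp: V_def)
      then obtain u where u: "(u, a) \<in> E" using parent_ex by blast
      have uA: "u \<in> A" using anc[OF less.prems ED(1)[OF u] ED(5)[OF u]] .
      have "length u < length a" using ED(4)[OF u] prefix_length_less by blast
      then have IH: "([], u) \<in> rtrancl_on A (symE A)" "(u, []) \<in> rtrancl_on A (symE A)" using less.hyps uA by auto
      have e: "(u, a) \<in> symE A" "(a, u) \<in> symE A" using u uA less.prems by (auto simp: symE_def)
      show ?thesis
        using rtrancl_on_into_rtrancl_on[OF IH(1) e(1) less.prems]
          converse_rtrancl_on_into_rtrancl_on[OF e(2) IH(2) less.prems] by blast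
    qed
  qed
  then show ?thesis using A subtree_T rtrancl_on_trans by (metis empty_iff)
qed

text \<open>
  A subtree containing the root is a set of vertices closed under taking ancestors.
\<close>

lemma complete_T:
  "complete_subtree T [] A \<longleftrightarrow> A \<subseteq> V \<and> finite A \<and> [] \<in> A \<and> (\<forall>a\<in>A. \<forall>v\<in>V. prefix v a \<longrightarrow> v \<in> A)
    \<and> (\<forall>v\<in>A. \<forall>c c'. (v, c) \<in> E \<longrightarrow> (v, c') \<in> E \<longrightarrow> c \<in> A \<longrightarrow> c' \<in> A)"
proof
  assume "complete_subtree T [] A"
  then have *: "subtree T A" "finite A" "[] \<in> A" "\<forall>v\<in>A. children T v \<subseteq> A \<or> children T v \<inter> A = {}"
    by (auto simp: complete_subtree_def)
  then show "A \<subseteq> V \<and> finite A \<and> [] \<in> A \<and> (\<forall>a\<in>A. \<forall>v\<in>V. prefix v a \<longrightarrow> v \<in> A)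
    \<and> (\<forall>v\<in>A. \<forall>c c'. (v, c) \<in> E \<longrightarrow> (v, c') \<in> E \<longrightarrow> c \<in> A \<longrightarrow> c' \<in> A)"
    using subtree_ancestor[OF *(1,3)] unfolding children_T subtree_T by blast
next
  assume *: "A \<subseteq> V \<and> finite A \<and> [] \<in> A \<and> (\<forall>a\<in>A. \<forall>v\<in>V. prefix v a \<longrightarrow> v \<in> A)
    \<and> (\<forall>v\<in>A. \<forall>c c'. (v, c) \<in> E \<longrightarrow> (v, c') \<in> E \<longrightarrow> c \<in> A \<longrightarrow> c' \<in> A)"
  have sub: "subtree T A"
  proof (rule subtreeI)
    show "A \<subseteq> V" "[] \<in> A" using * by blast+
    fix a v assume "a \<in> A" "v \<in> V" "prefix v a"
    then show "v \<in> A" using * by blast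
  qed
  have sib: "{w. (v, w) \<in> E} \<subseteq> A \<or> {w. (v, w) \<in> E} \<inter> A = {}" if v: "v \<in> A" for v
  proof (cases "\<exists>c. (v, c) \<in> E \<and> c \<in> A")
    case True
    then obtain c where c: "(v, c) \<in> E" "c \<in> A" by blast
    have "c' \<in> A" if "(v, c') \<in> E" for c' using * v c that by blast
    then show ?thesis by blast
  qed blast
  have fin: "finite A" "[] \<in> A" using * by blast+
  show "complete_subtree T [] A"
    unfolding complete_subtree_def children_T using sub sib fin by blast
qed

lemma
  assumes "complete_subtree T [] A"
  shows complete_V: "A \<subseteq> V" and complete_finite: "finite A" and complete_Nil: "[] \<in> A"
    and complete_anc: "\<And>a v. a \<in> A \<Longrightarrow> v \<in> V \<Longrightarrow> prefix v a \<Longrightarrow> v \<in> A"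
    and complete_sib: "\<And>v c c'. (v, c) \<in> E \<Longrightarrow> (v, c') \<in> E \<Longrightarrow> c \<in> A \<Longrightarrow> c' \<in> A"
proof -
  note c = assms[unfolded complete_T]
  show "A \<subseteq> V" using c by (rule conjunct1)
  show "finite A" using c by (elim conjE)
  show "[] \<in> A" using c by (elim conjE)
  have anc': "\<forall>a\<in>A. \<forall>v\<in>V. prefix v a \<longrightarrow> v \<in> A" using c by (elim conjE)
  then show anc: "\<And>a v. a \<in> A \<Longrightarrow> v \<in> V \<Longrightarrow> prefix v a \<Longrightarrow> v \<in> A" by simp
  have sib': "\<forall>v\<in>A. \<forall>c c'. (v, c) \<in> E \<longrightarrow> (v, c') \<in> E \<longrightarrow> c \<in> A \<longrightarrow> c' \<in> A" using c by (elim conjE)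
  fix v c c' assume e: "(v, c) \<in> E" "(v, c') \<in> E" "c \<in> A"
  have "v \<in> A" using anc[OF e(3) ED(1,5)[OF e(1)]] .
  then show "c' \<in> A" using sib' e by blast
qed

lemma leaf_iff: "v \<in> leaves T A \<longleftrightarrow> v \<in> A \<and> (\<forall>c. (v, c) \<in> E \<longrightarrow> c \<notin> A)"
  by (auto simp: leaves_def children_T)

lemma leaf_maximal:
  assumes A: "complete_subtree T [] A" and v: "v \<in> leaves T A" and w: "w \<in> A" "prefix v w"
  shows "w = v"
proof (rule ccontr)
  assume "w \<noteq> v"
  then have s: "strict_prefix v w" using w(2) by (simp add: strict_prefix_def)
  have V: "v \<in> V" "w \<in> V" using v w complete_V[OF A] by (auto simp: leaf_iff)
  obtain c where c: "(v, c) \<in> E" "prefix c w" using child_toward[OF V s] by blast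
  then have "c \<in> A" using complete_anc[OF A w(1) ED(3)[OF c(1)]] by blast
  then show False using v c by (auto simp: leaf_iff)
qed

lemma forest_T:
  assumes A: "complete_subtree T [] A"
  shows "u \<in> forest_verts T A \<longleftrightarrow> u \<in> V \<and> (\<exists>v\<in>leaves T A. prefix v u)"
  using complete_V[OF A] unfolding forest_verts_def by (auto simp: descendants_T leaf_iff subset_iff)

text \<open>
  The longest prefix of \<open>u\<close> in \<open>A\<close> is a leaf: it has a child outside of \<open>A\<close>, hence no child in
  \<open>A\<close>.
\<close>

lemma forest_outside:
  assumes A: "complete_subtree T [] A" and u: "u \<in> V" "u \<notin> A"
  shows "u \<in> forest_verts T A"
proof -
  let ?P = "\<lambda>a. a \<in> A \<and> prefix a u"
  have "?P []" using complete_Nil[OF A] by simp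
  moreover have "\<And>a. ?P a \<Longrightarrow> prefix a u" by auto
  ultimately have "\<exists>a. ?P a \<and> (\<forall>w. ?P w \<longrightarrow> length w \<le> length a)" by (rule longest_prefix)
  then obtain a where a: "?P a" "\<And>b. ?P b \<Longrightarrow> length b \<le> length a" by blast
  have aV: "a \<in> V" using a complete_V[OF A] by blast
  have "strict_prefix a u" using a(1) u(2) by (auto simp: strict_prefix_def)
  then obtain c where c: "(a, c) \<in> E" "prefix c u" using child_toward[OF aV u(1)] by blast
  have "c \<notin> A" using a(2)[of c] c prefix_length_less[OF ED(4)[OF c(1)]] by auto
  then have "a \<in> leaves T A" using a(1) complete_sib[OF A _ c(1)] by (auto simp: leaf_iff)
  then show ?thesis using forest_T[OF A] u(1) a(1) by blast
qed

lemma forest_leaf_unique: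
  assumes A: "complete_subtree T [] A" and v: "v \<in> leaves T A" "v' \<in> leaves T A" "prefix v u" "prefix v' u"
  shows "v = v'"
  using comparable[OF v(3,4)] leaf_maximal[OF A v(1), of v'] leaf_maximal[OF A v(2), of v] v(1,2)
  by (auto simp: leaf_iff)

lemma forest_edges_T: "forest_edges T A = {(u, v). (u, v) \<in> E \<and> u \<in> forest_verts T A \<and> v \<in> forest_verts T A}"
  by (auto simp: forest_edges_def)

end

section \<open>The tree of a digit system\<close>

lemma pcat_map_tail: "x = pcat (map x [0..<n]) (\<lambda>j. x (n + j))"
  by (auto simp: pcat_def fun_eq_iff)

lemma map_pcat: "map (pcat u z) [0..<length u] = u"
  by (rule nth_equalityI) (simp_all add: pcat_def)

lemma map_pcat_le: "n \<le> length u \<Longrightarrow> map (pcat u z) [0..<n] = take n u"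
  by (rule nth_equalityI) (simp_all add: pcat_def)

lemma map_eq_agree: "map x [0..<n] = map y [0..<n'] \<longleftrightarrow> n = n' \<and> agree n x y"
proof
  assume a: "map x [0..<n] = map y [0..<n']"
  then have "n = n'" by (metis diff_zero length_map length_upt)
  then show "n = n' \<and> agree n x y" using a by (auto simp: agree_def)
qed (auto simp: agree_def)

lemma prefix_map: "n \<le> n' \<Longrightarrow> prefix (map x [0..<n]) (map x [0..<n'])"
proof -
  assume "n \<le> n'"
  then have "[0..<n'] = [0..<n] @ [n..<n']" by (metis le_add_diff_inverse upt_add_eq_append zero_le)
  then show ?thesis by simp
qed

lemma pcat_inj: "pcat u z = pcat u z' \<Longrightarrow> z = z'"
proof
  fix j assume "pcat u z = pcat u z'"
  then have "pcat u z (length u + j) = pcat u z' (length u + j)" by simp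
  then show "z j = z' j" by (simp add: pcat_def)
qed

lemma prefix_pcat: "prefix u v \<Longrightarrow> \<exists>z'. pcat v z = pcat u z'"
  by (auto simp: prefix_def pcat_append)

lemma pcat_prefix:
  assumes "pcat u z = pcat v z'" "length u \<le> length v" shows "prefix u v"
proof -
  have "u = map (pcat u z) [0..<length u]" by (simp add: map_pcat)
  also have "\<dots> = take (length u) v" using assms map_pcat_le by metis
  finally show ?thesis by (metis take_is_prefix)
qed

text \<open>
  The number \<open>n1\<close> is a lower bound for the lengths of the vertices other than the root. It is at least
  \<open>depth\<close>, so that the letters after a vertex are only restricted by the graph; at least \<open>l\<close>, so
  that the last \<open>l\<close> letters of a vertex, which decide whether it is one, exist; and so large that
  the root has at least two children.
\<close>

locale digit_tree = digit_system g Y d \<mu> \<rho> l m w for g :: "('v, 'e) pre_digraph" and Y d \<mu> \<rho> l m w +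
  fixes n1 :: nat
  assumes n1_depth: "depth \<le> n1" and n1_l: "l \<le> n1"
    and n1_split: "\<exists>x\<in>Y. \<exists>y\<in>Y. \<not> agree n1 x y"
begin

abbreviation "mk \<equiv> length \<mu>"

text \<open>
  The rest of the digit need not follow in \<open>x\<close>, so that this is a property of the prefix of length
  \<open>n\<close>. Segments that are not longer than the marker are admitted, so that a marker always ends at
  a vertex.
\<close>

definition inside_digit :: "(nat \<Rightarrow> 'e) \<Rightarrow> nat \<Rightarrow> bool" where
  "inside_digit x n \<longleftrightarrow> (\<exists>a s. s < m \<and> a + mk < n \<and> n < a + l \<and> (\<forall>j. a \<le> j \<and> j < n \<longrightarrow> x j = d s ! (j - a)))"

definition S :: "'e list set" where
  "S = {map x [0..<n] | x n. x \<in> Y \<and> n1 \<le> n \<and> \<not> inside_digit x n}"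

definition lab :: "'e list \<Rightarrow> 'e list" where "lab u = drop (length u - mk) u"

lemma mk_l: "mk \<le> l" using mu_l by simp
lemma mk_n1: "mk \<le> n1" using mk_l n1_l by simp
lemma n1_pos: "0 < n1" using n1_depth depth(1) by simp

lemma inside_digit_agree: "agree n x y \<Longrightarrow> inside_digit x n \<Longrightarrow> inside_digit y n"
  unfolding inside_digit_def agree_def by metis

text \<open>
  If the segment of the digit that ends at \<open>n + i\<close> started more than \<open>mk\<close> letters before \<open>n\<close>, then
  \<open>n\<close> itself would lie inside the digit. So the segment is contained in the part where \<open>x\<close> and
  \<open>x'\<close> have the same letters.
\<close>

lemma bad_sync:
  assumes n: "mk \<le> n" "mk \<le> n'" and e: "\<And>j. j < mk + i \<Longrightarrow> x (n - mk + j) = x' (n' - mk + j)"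
    and nb: "\<not> inside_digit x n" and b: "inside_digit x (n + i)"
  shows "inside_digit x' (n' + i)"
proof -
  obtain a s where a: "s < m" "a + mk < n + i" "n + i < a + l" "\<And>j. a \<le> j \<Longrightarrow> j < n + i \<Longrightarrow> x j = d s ! (j - a)"
    using b unfolding inside_digit_def by blast
  have "\<not> a + mk < n"
  proof
    assume "a + mk < n"
    then have "inside_digit x n" unfolding inside_digit_def using a by (intro exI[of _ a] exI[of _ s]) auto
    then show False using nb by simp
  qed
  then have an: "n - mk \<le> a" by simp
  define c where "c = a - (n - mk)"
  have ac: "a = n - mk + c" using an by (simp add: c_def)
  have "x' j = d s ! (j - (n' - mk + c))" if j: "n' - mk + c \<le> j" "j < n' + i" for j
  proof -
    define t where "t = j - (n' - mk)"
    have t: "j = n' - mk + t" "c \<le> t" "t < mk + i" using j n by (auto simp: t_def)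
    have "x' j = x (n - mk + t)" using e[OF t(3)] t(1) by simp
    also have "\<dots> = d s ! (n - mk + t - a)" using a(4)[of "n - mk + t"] ac t n by simp
    also have "n - mk + t - a = j - (n' - mk + c)" using ac t by simp
    finally show ?thesis .
  qed
  then show ?thesis unfolding inside_digit_def using a n ac
    by (intro exI[of _ "n' - mk + c"] exI[of _ s]) auto
qed

text \<open>
  The segment of a digit is shorter than \<open>l\<close>, so only the last \<open>l\<close> letters matter.
\<close>

lemma bad_suffix:
  assumes n: "l \<le> n" "l \<le> n'" and e: "\<And>j. j < l \<Longrightarrow> x (n - l + j) = x' (n' - l + j)" and b: "inside_digit x n"
  shows "inside_digit x' n'"
proof -
  obtain a s where a: "s < m" "a + mk < n" "n < a + l" "\<And>j. a \<le> j \<Longrightarrow> j < n \<Longrightarrow> x j = d s ! (j - a)"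
    using b unfolding inside_digit_def by blast
  define c where "c = a - (n - l)"
  have ac: "a = n - l + c" using a by (simp add: c_def)
  have "x' j = d s ! (j - (n' - l + c))" if j: "n' - l + c \<le> j" "j < n'" for j
  proof -
    define t where "t = j - (n' - l)"
    have t: "j = n' - l + t" "c \<le> t" "t < l" using j n by (auto simp: t_def)
    have "x' j = x (n - l + t)" using e[OF t(3)] t(1) by simp
    also have "\<dots> = d s ! (n - l + t - a)" using a(4)[of "n - l + t"] ac t n by simp
    also have "n - l + t - a = j - (n' - l + c)" using ac t by simp
    finally show ?thesis .
  qed
  then show ?thesis unfolding inside_digit_def using a n ac
    by (intro exI[of _ "n' - l + c"] exI[of _ s]) auto
qed

text \<open>
  A segment of a digit can be completed to the whole digit by changing later letters; so the
  property of the marker holds for segments as well.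
\<close>

lemma overlap_partial:
  assumes s: "s < m" and p: "\<And>j. a \<le> j \<Longrightarrow> j < n \<Longrightarrow> x j = d s ! (j - a)" and n: "n \<le> a + l"
    and o: "occurs x b \<mu>" "a \<le> b" "b + mk \<le> n"
  shows "b = a"
proof -
  have 1: "occurs (put_digit a s x) a (d s)" using dig_rep_same[OF s] by (simp add: digit_at_def)
  have "put_digit a s x j = x j" if "a \<le> j" "j < n" for j
    using p[OF that] that by (simp add: put_digit_def)
  then have "occurs (put_digit a s x) b \<mu>" using o by (simp add: occurs_def)
  moreover have "b < a + l" using o n mu_pos by linarith
  ultimately show ?thesis using overlap[OF s 1 _ o(2)] by blast
qed

lemma mu_start:
  assumes s: "s < m" and p: "\<And>j. a \<le> j \<Longrightarrow> j < n \<Longrightarrow> x j = d s ! (j - a)" and n: "a + mk \<le> n"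
  shows "occurs x a \<mu>"
proof -
  have "x (a + j) = \<mu> ! j" if "j < mk" for j
  proof -
    have "\<mu> ! j = d s ! j" using d_take[OF s] that by (metis nth_take)
    then show ?thesis using p[of "a + j"] that n by simp
  qed
  then show ?thesis by (simp add: occurs_def)
qed

lemma mu_not_bad: assumes "occurs x (n - mk) \<mu>" "mk \<le> n" shows "\<not> inside_digit x n"
proof
  assume "inside_digit x n"
  then obtain a s where a: "s < m" "a + mk < n" "n < a + l" "\<And>j. a \<le> j \<Longrightarrow> j < n \<Longrightarrow> x j = d s ! (j - a)"
    unfolding inside_digit_def by blast
  have "n - mk = a" by (rule overlap_partial[OF a(1,4)]) (use a assms in auto)
  then show False using a by simp
qed

text \<open>
  A digit that started earlier would contain the marker of the digit ending here, or coincide with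
  it.
\<close>

lemma end_not_bad: assumes "i < m" "occurs x a (d i)" shows "\<not> inside_digit x (a + l)"
proof
  assume "inside_digit x (a + l)"
  then obtain b s where b: "s < m" "b + mk < a + l" "a + l < b + l" "\<And>j. b \<le> j \<Longrightarrow> j < a + l \<Longrightarrow> x j = d s ! (j - b)"
    unfolding inside_digit_def by blast
  have "occurs x b \<mu>" by (rule mu_start[OF b(1,4)]) (use b in auto)
  then have "b = a" using overlap[OF assms, of b] b by simp
  then show False using b by simp
qed

text \<open>
  Suppose that \<open>n\<close> lies inside a segment of a digit that starts at \<open>a\<close>, and continue the segment
  as far as it agrees with some digit, or to its full length, up to \<open>r\<close>. A segment of a digit
  ending at \<open>r\<close> starts at \<open>a\<close>, since a marker occurs in a segment only at its start; so \<open>r\<close> is not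
  interior. Hence gaps between vertices along a point are bounded.
\<close>

lemma gap: "\<exists>i\<le>l. \<not> inside_digit x (n + i)"
proof (cases "inside_digit x n")
  case True
  then obtain a s where a: "s < m" "a + mk < n" "n < a + l" "\<And>j. a \<le> j \<Longrightarrow> j < n \<Longrightarrow> x j = d s ! (j - a)"
    unfolding inside_digit_def by blast
  let ?Q = "\<lambda>n'. \<exists>s<m. \<forall>j. a \<le> j \<and> j < n' \<longrightarrow> x j = d s ! (j - a)"
  \<comment> \<open>The first position where the letters from \<open>a\<close> on no longer form an initial segment of any digit.\<close>
  define r where "r = (LEAST r. n < r \<and> (r = a + l \<or> \<not> ?Q r))"
  have ex: "n < a + l \<and> (a + l = a + l \<or> \<not> ?Q (a + l))" using a by simp
  have r: "n < r" "r = a + l \<or> \<not> ?Q r"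
    using LeastI[of "\<lambda>r. n < r \<and> (r = a + l \<or> \<not> ?Q r)", OF ex] unfolding r_def by blast+
  have rl: "r \<le> a + l" unfolding r_def using Least_le[of "\<lambda>r. n < r \<and> (r = a + l \<or> \<not> ?Q r)", OF ex] by simp
  have "?Q (r - 1)"
  proof (cases "r - 1 = n")
    case True then show ?thesis using a by (intro exI[of _ s]) auto
  next
    case False
    then have "n < r - 1" "r - 1 < r" using r(1) by auto
    then have "\<not> (n < r - 1 \<and> (r - 1 = a + l \<or> \<not> ?Q (r - 1)))"
      using not_less_Least[of "r - 1" "\<lambda>r. n < r \<and> (r = a + l \<or> \<not> ?Q r)"] unfolding r_def by blast
    then show ?thesis using \<open>n < r - 1\<close> by blast
  qed
  then obtain s0 where s0: "s0 < m" "\<And>j. a \<le> j \<Longrightarrow> j < r - 1 \<Longrightarrow> x j = d s0 ! (j - a)" by blast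
  have "\<not> inside_digit x r"
  proof
    assume "inside_digit x r"
    then obtain b t where b: "t < m" "b + mk < r" "r < b + l" "\<And>j. b \<le> j \<Longrightarrow> j < r \<Longrightarrow> x j = d t ! (j - b)"
      unfolding inside_digit_def by blast
    have ob: "occurs x b \<mu>" by (rule mu_start[OF b(1,4)]) (use b in auto)
    have oa: "occurs x a \<mu>" by (rule mu_start[OF a(1,4)]) (use a in auto)
    show False
    proof (cases "a \<le> b")
      case True
      have "b = a"
        by (rule overlap_partial[where s = s0 and a = a and n = "r - 1" and x = x and b = b])
           (use s0 ob True b rl in auto)
      then have "?Q r" "r \<noteq> a + l" using b by auto
      then show False using r(2) by blast
    next
      case False
      have "a = b" by (rule overlap_partial[OF b(1,4) _ oa]) (use False a r b in auto)
      then show False using False by simp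
    qed
  qed
  moreover have "r = n + (r - n)" "r - n \<le> l" using r(1) rl a by auto
  ultimately show ?thesis by metis
next
  case False
  then show ?thesis by (intro exI[of _ 0]) simp
qed

subsection \<open>The vertex set\<close>

lemma tk_S: "x \<in> Y \<Longrightarrow> map x [0..<n] \<in> S \<longleftrightarrow> n1 \<le> n \<and> \<not> inside_digit x n"
proof
  assume x: "x \<in> Y" and "map x [0..<n] \<in> S"
  then obtain y where "y \<in> Y" "n1 \<le> n" "\<not> inside_digit y n" "agree n x y" by (auto simp: S_def map_eq_agree)
  then show "n1 \<le> n \<and> \<not> inside_digit x n" using inside_digit_agree by blast
qed (auto simp: S_def)

lemma S_point: "u \<in> S \<Longrightarrow> \<exists>z. pcat u z \<in> Y"
proof -
  assume "u \<in> S"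
  then obtain x n where "x \<in> Y" "u = map x [0..<n]" by (auto simp: S_def)
  then have "pcat u (\<lambda>j. x (n + j)) \<in> Y" using pcat_map_tail[of x n] by simp
  then show ?thesis by blast
qed

lemma pcat_S: "pcat u z \<in> Y \<Longrightarrow> u \<in> S \<longleftrightarrow> n1 \<le> length u \<and> \<not> inside_digit (pcat u z) (length u)"
  using tk_S[of "pcat u z" "length u"] by (simp add: map_pcat)

lemma S_length: "u \<in> S \<Longrightarrow> n1 \<le> length u"
  using S_point pcat_S by blast

lemma Nil_S: "[] \<notin> S" using S_length n1_pos by fastforce

lemma S_arcs: "u \<in> S \<Longrightarrow> u \<in> lists (arcs g)"
  unfolding S_def using X_arc[OF YX] by auto

lemma lab_length: "u \<in> S \<Longrightarrow> length (lab u) = mk"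
  using S_length mk_n1 by (fastforce simp: lab_def)

lemma lab_nth: "u \<in> S \<Longrightarrow> j < mk \<Longrightarrow> lab u ! j = u ! (length u - mk + j)"
  unfolding lab_def by simp

lemma lab_append: "mk \<le> length u \<Longrightarrow> lab (u @ v) = drop (length v) (lab u @ v)"
  unfolding lab_def by (simp add: add.commute)

text \<open>
  The label contains the last letter, so any continuation of \<open>u\<close> in the graph is also one of \<open>v\<close>.
\<close>

lemma swap_Y:
  assumes u: "u \<in> S" and v: "v \<in> S" and e: "lab u = lab v" and z: "pcat u z \<in> Y"
  shows "pcat v z \<in> Y"
proof -
  obtain z' where z': "pcat v z' \<in> Y" using S_point[OF v] by blast
  have lu: "0 < length u" "mk \<le> length u" using S_length[OF u] n1_pos mk_n1 by auto
  have lv: "0 < length v" "mk \<le> length v" using S_length[OF v] n1_pos mk_n1 by auto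
  have "u ! (length u - 1) = lab u ! (mk - 1)" using lab_nth[OF u, of "mk - 1"] mu_pos lu by simp
  also have "\<dots> = v ! (length v - 1)" using lab_nth[OF v, of "mk - 1"] mu_pos lv e by simp
  finally have last: "u ! (length u - 1) = v ! (length v - 1)" .
  have "head g (pcat v z' (length v - 1)) = tail g (pcat u z (length u))"
    using X_step[OF YX[OF z], of "length u - 1"] last lu lv by (simp add: pcat_def)
  then have "glue (length v) (pcat v z') (length u) (pcat u z) \<in> X"
    using glue_X[OF YX[OF z'] YX[OF z] lv(1)] by simp
  moreover have "glue (length v) (pcat v z') (length u) (pcat u z) = pcat v z"
    by (auto simp: glue_def pcat_def fun_eq_iff)
  moreover have "agree depth (pcat v z') (pcat v z)"
    using S_length[OF v] n1_depth by (auto simp: agree_def pcat_def)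
  ultimately show ?thesis using depth(2)[OF z'] by simp
qed

lemma
  assumes u: "u \<in> S" and v: "v \<in> S" and e: "lab u = lab v" and wd: "u @ wd \<in> S"
  shows sync_S: "v @ wd \<in> S" and sync_lab: "lab (v @ wd) = lab (u @ wd)"
proof -
  obtain z where z: "pcat (u @ wd) z \<in> Y" using S_point[OF wd] by blast
  have zu: "pcat u (pcat wd z) \<in> Y" using z by (simp add: pcat_append)
  then have zv: "pcat v (pcat wd z) \<in> Y" using swap_Y[OF u v e] by blast
  have lu: "mk \<le> length u" and lv: "mk \<le> length v" using S_length[OF u] S_length[OF v] mk_n1 by auto
  have nb: "\<not> inside_digit (pcat v (pcat wd z)) (length v)" using pcat_S[OF zv] v by blast
  have "\<not> inside_digit (pcat v (pcat wd z)) (length v + length wd)"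
  proof
    assume b: "inside_digit (pcat v (pcat wd z)) (length v + length wd)"
    have "inside_digit (pcat u (pcat wd z)) (length u + length wd)"
    proof (rule bad_sync[OF lv lu _ nb b])
      fix j
      show "pcat v (pcat wd z) (length v - mk + j) = pcat u (pcat wd z) (length u - mk + j)"
      proof (cases "j < mk")
        case True
        then show ?thesis using lab_nth[OF u True] lab_nth[OF v True] e lu lv by (simp add: pcat_def)
      next
        case False
        then have "length v - mk + j = length v + (j - mk)" "length u - mk + j = length u + (j - mk)" using lu lv by auto
        then show ?thesis by (simp add: pcat_def)
      qed
    qed
    then show False using pcat_S[OF z] wd by (simp add: pcat_append)
  qed
  then show "v @ wd \<in> S"
    using pcat_S[of "v @ wd" z] zv S_length[OF v] by (simp add: pcat_append)
  show "lab (v @ wd) = lab (u @ wd)" using lab_append[OF lu] lab_append[OF lv] e by simp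
qed

interpretation PT: prefix_tree S by unfold_locales (rule Nil_S)

lemma V_point: "u \<in> PT.V \<Longrightarrow> \<exists>z. pcat u z \<in> Y"
  using S_point Y_ne by (auto simp: PT.V_def)

lemma next_S: "x \<in> Y \<Longrightarrow> \<exists>n'. n \<le> n' \<and> n' \<le> max n n1 + l \<and> map x [0..<n'] \<in> S"
proof -
  assume x: "x \<in> Y"
  obtain i where i: "i \<le> l" "\<not> inside_digit x (max n n1 + i)" using gap by blast
  then have "map x [0..<max n n1 + i] \<in> S" using tk_S[OF x] by simp
  then show ?thesis using i(1) by (intro exI[of _ "max n n1 + i"]) auto
qed

lemma map_strict_prefix: "n < n' \<Longrightarrow> strict_prefix (map x [0..<n]) (map x [0..<n'])"
  using prefix_map[of n n' x] by (auto simp: strict_prefix_def map_eq_agree)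

lemma strict_prefix_pcat: "length u < n \<Longrightarrow> strict_prefix u (map (pcat u z) [0..<n])"
  using map_strict_prefix[of "length u" n "pcat u z"] by (simp add: map_pcat)

lemma child_length: "(u, c) \<in> PT.E \<Longrightarrow> length c \<le> max (Suc (length u)) n1 + l"
proof (rule ccontr)
  assume e: "(u, c) \<in> PT.E" and lc: "\<not> length c \<le> max (Suc (length u)) n1 + l"
  obtain z where z: "pcat c z \<in> Y" using S_point PT.ED(2)[OF e] by blast
  obtain n where n: "Suc (length u) \<le> n" "n \<le> max (Suc (length u)) n1 + l" "map (pcat c z) [0..<n] \<in> S"
    using next_S[OF z, of "Suc (length u)"] by blast
  have nc: "n < length c" using n lc by simp
  have t: "map (pcat c z) [0..<n] = take n c" using map_pcat_le[of n c z] nc by simp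
  have "strict_prefix (take n c) c" using nc by (simp add: strict_prefix_def take_is_prefix)
  moreover have "strict_prefix u (take n c)"
  proof -
    have "u = take (length u) c" using PT.ED(5)[OF e] by (metis append_eq_conv_conj prefix_def)
    then have "prefix u (take n c)" using n(1) by (metis Suc_leD min.absorb1 take_is_prefix take_take)
    moreover have "length (take n c) = n" using nc by simp
    ultimately show ?thesis using n(1) by (auto simp: strict_prefix_def)
  qed
  ultimately show False using PT.E_between[OF e n(3)[unfolded t]] by blast
qed

lemma finite_short: "finite {u \<in> PT.V. length u \<le> n}"
proof (rule finite_subset)
  show "{u \<in> PT.V. length u \<le> n} \<subseteq> {xs. set xs \<subseteq> arcs g \<and> length xs \<le> n}"
    using S_arcs by (auto simp: PT.V_def)
qed (simp add: finite_lists_length_le)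

text \<open>
  By \<open>gap\<close> the lengths of children are bounded.
\<close>

lemma finite_children: "finite {c. (u, c) \<in> PT.E}"
  by (rule finite_subset[OF _ finite_short[of "max (Suc (length u)) n1 + l"]])
     (use child_length PT.ED(3) in auto)

lemma child_exists: "u \<in> PT.V \<Longrightarrow> \<exists>c. (u, c) \<in> PT.E"
proof -
  assume u: "u \<in> PT.V"
  obtain z where z: "pcat u z \<in> Y" using V_point[OF u] by blast
  obtain n where n: "Suc (length u) \<le> n" "map (pcat u z) [0..<n] \<in> S" using next_S[OF z] by blast
  then show ?thesis
    using PT.child_toward[OF u PT.SV[OF n(2)]] strict_prefix_pcat[of u n z] by auto
qed

text \<open>
  Intermediate vertices are transported along with the endpoints, in both directions.
\<close>

lemma child_sync:
  assumes u: "u \<in> S" and v: "v \<in> S" and e: "lab u = lab v" and wd: "(u, u @ wd) \<in> PT.E"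
  shows "(v, v @ wd) \<in> PT.E"
proof -
  have uw: "u @ wd \<in> S" and ne: "wd \<noteq> []" using PT.ED[OF wd] by (auto simp: strict_prefix_def)
  have vw: "v @ wd \<in> S" using sync_S[OF u v e uw] .
  have "\<not> (\<exists>c\<in>S. strict_prefix v c \<and> strict_prefix c (v @ wd))"
  proof
    assume "\<exists>c\<in>S. strict_prefix v c \<and> strict_prefix c (v @ wd)"
    then obtain c where c: "c \<in> S" "strict_prefix v c" "strict_prefix c (v @ wd)" by blast
    obtain t where t: "c = v @ t" "t \<noteq> []" using c(2) by (auto simp: strict_prefix_def prefix_def)
    have tw: "strict_prefix t wd" using c(3) t by (simp add: strict_prefix_def)
    have "u @ t \<in> S" using sync_S[OF v u e[symmetric]] c(1) t by simp
    moreover have "strict_prefix u (u @ t)" "strict_prefix (u @ t) (u @ wd)" using t tw by (auto simp: strict_prefix_def)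
    ultimately show False using PT.E_between[OF wd] by blast
  qed
  then show ?thesis using v vw PT.SV[OF v] ne by (auto simp: PT.E_def strict_prefix_def)
qed

text \<open>
  Walk from \<open>u\<close> to an occurrence of the last \<open>l\<close> letters of \<open>v\<close>; these letters determine the label
  and the fact that the word is a vertex.
\<close>

lemma label_below:
  assumes u: "u \<in> PT.V" and v: "v \<in> S"
  shows "\<exists>u'\<in>S. prefix u u' \<and> lab u' = lab v"
proof -
  obtain z where z: "pcat u z \<in> Y" using V_point[OF u] by blast
  obtain z' where z': "pcat v z' \<in> Y" using S_point[OF v] by blast
  let ?y = "pcat v z'"
  have lv: "l \<le> length v" "mk \<le> length v" using S_length[OF v] n1_l mk_n1 by auto
  let ?p = "map (\<lambda>j. ?y (length v - l + j)) [0..<l]"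
  obtain y b where y: "y \<in> X" "max (length u) n1 \<le> b" "agree (max (length u) n1) (pcat u z) y" "occurs y b ?p"
    using walk_occurs[OF YX[OF z] map_awalk[OF YX[OF z']], of "max (length u) n1"] by blast
  have yY: "y \<in> Y" using depth(2)[OF z y(1) agree_mono[OF y(3)]] n1_depth by simp
  have yp: "y (b + j) = ?y (length v - l + j)" if "j < l" for j using y(4) that by (simp add: occurs_def)
  have "\<not> inside_digit y (b + l)"
  proof
    assume "inside_digit y (b + l)"
    then have "inside_digit ?y (length v)" by (rule bad_suffix[rotated 3]) (use lv yp in auto)
    then show False using pcat_S[OF z'] v by blast
  qed
  then have S: "map y [0..<b + l] \<in> S" using tk_S[OF yY] y(2) by simp
  have "prefix u (map y [0..<b + l])"
  proof -
    have "u = map y [0..<length u]"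
      using agree_mono[OF y(3), of "length u"] map_pcat[of u z] by (metis map_eq_agree max.cobounded1)
    then show ?thesis using prefix_map[of "length u" "b + l" y] y(2) by simp
  qed
  moreover have "lab (map y [0..<b + l]) = lab v"
  proof (rule nth_equalityI)
    show "length (lab (map y [0..<b + l])) = length (lab v)" using lab_length[OF S] lab_length[OF v] by simp
    fix j assume "j < length (lab (map y [0..<b + l]))"
    then have j: "j < mk" using lab_length[OF S] by simp
    have lt: "b + l - mk + j < b + l" using j mk_l by linarith
    have "lab (map y [0..<b + l]) ! j = map y [0..<b + l] ! (b + l - mk + j)" using lab_nth[OF S j] by simp
    also have "\<dots> = y (b + l - mk + j)" using nth_map_upt[of "b + l - mk + j" "b + l" 0 y] lt by simp
    also have "b + l - mk + j = b + (l - mk + j)" using mk_l by simp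
    also have "y (b + (l - mk + j)) = ?y (length v - l + (l - mk + j))" using yp[of "l - mk + j"] j mk_l by simp
    also have "length v - l + (l - mk + j) = length v - mk + j" using lv mk_l by simp
    also have "?y (length v - mk + j) = lab v ! j"
    proof -
      have "length v - mk + j < length v" using j lv by linarith
      then show ?thesis using lab_nth[OF v j] unfolding pcat_def by argo
    qed
    finally show "lab (map y [0..<b + l]) ! j = lab v ! j" .
  qed
  ultimately show ?thesis using S by blast
qed

lemma two_root_children: "\<exists>c c'. ([], c) \<in> PT.E \<and> ([], c') \<in> PT.E \<and> c \<noteq> c'"
proof -
  obtain x y where xy: "x \<in> Y" "y \<in> Y" "\<not> agree n1 x y" using n1_split by blast
  have root: "\<exists>c. ([], c) \<in> PT.E \<and> (\<exists>n\<ge>n1. c = map z [0..<n])" if z: "z \<in> Y" for z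
  proof -
    obtain n where n: "map z [0..<n] \<in> S" using next_S[OF z] by blast
    have "map z [0..<n] \<noteq> []" using n Nil_S by metis
    then have "strict_prefix [] (map z [0..<n])" unfolding strict_prefix_def by (metis Nil_prefix)
    then obtain c where c: "([], c) \<in> PT.E" "prefix c (map z [0..<n])"
      using PT.child_toward[OF PT.NilV PT.SV[OF n]] by blast
    have "c = take (length c) (map z [0..<n])" using c(2) by (metis append_eq_conv_conj prefix_def)
    also have "\<dots> = map z [0..<length c]" using prefix_length_le[OF c(2)] by (simp add: take_map)
    finally show ?thesis using c(1) S_length[OF PT.ED(2)[OF c(1)]] by blast
  qed
  obtain c n where c: "([], c) \<in> PT.E" "n1 \<le> n" "c = map x [0..<n]" using root[OF xy(1)] by blast
  obtain c' n' where c': "([], c') \<in> PT.E" "n1 \<le> n'" "c' = map y [0..<n']" using root[OF xy(2)] by blast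
  have "c \<noteq> c'"
  proof
    assume "c = c'"
    then have "agree n x y" using c(3) c'(3) map_eq_agree by metis
    then show False using agree_mono[OF _ c(2)] xy(3) by blast
  qed
  then show ?thesis using c c' by blast
qed

lemma siblings_incomparable: "(u, c) \<in> PT.E \<Longrightarrow> (u, c') \<in> PT.E \<Longrightarrow> prefix c c' \<Longrightarrow> c = c'"
  using PT.E_between[of u c' c] PT.ED[of u c] by (auto simp: strict_prefix_def)

text \<open>
  Every label occurs below every vertex. So if a subtree contains all vertices of one label, then
  for every vertex \<open>t\<close> it contains points below \<open>t\<close> and points that are not below \<open>t\<close>, hence also
  \<open>t\<close>. For the root one uses two children of the root instead.
\<close>

lemma label_spanning:
  assumes v: "v \<in> S" and A: "subtree PT.T A" "{u \<in> S. lab u = lab v} \<subseteq> A"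
  shows "A = PT.V"
proof (rule ccontr)
  assume "A \<noteq> PT.V"
  then obtain t where t: "t \<in> PT.V" "t \<notin> A" using A(1) PT.subtree_T by auto
  obtain c c' where c: "([], c) \<in> PT.E" "([], c') \<in> PT.E" "c \<noteq> c'" using two_root_children by blast
  have below: "\<exists>a\<in>A. prefix u a" if u: "u \<in> PT.V" for u using label_below[OF u v] A(2) by blast
  show False
  proof (cases "t = []")
    case True
    obtain a b where ab: "a \<in> A" "prefix c a" "b \<in> A" "prefix c' b"
      using below[OF PT.ED(3)[OF c(1)]] below[OF PT.ED(3)[OF c(2)]] by blast
    have "\<not> prefix c b"
    proof
      assume "prefix c b"
      then have "prefix c c' \<or> prefix c' c" using PT.comparable ab(4) by blast
      then show False using siblings_incomparable c by metis
    qed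
    then obtain z where z: "z \<in> A" "(z, c) \<in> PT.E" using PT.crossing[OF A(1) ab(1,3) PT.ED(3)[OF c(1)] ab(2)] by blast
    then have "z = []" using PT.parent_unique c(1) by blast
    then show False using z(1) True t(2) by simp
  next
    case False
    then have tS: "t \<in> S" using t(1) by (simp add: PT.V_def)
    obtain e where e: "([], e) \<in> PT.E" "\<not> prefix e t"
    proof (cases "prefix c t")
      case True
      have "\<not> prefix c' t"
      proof
        assume "prefix c' t"
        then have "prefix c c' \<or> prefix c' c" using PT.comparable True by blast
        then show False using siblings_incomparable c by metis
      qed
      then show ?thesis using that c(2) by blast
    next
      case False then show ?thesis using that c(1) by blast
    qed
    obtain a b where ab: "a \<in> A" "prefix t a" "b \<in> A" "prefix e b"
      using below[OF t(1)] below[OF PT.ED(3)[OF e(1)]] by blast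
    have "\<not> prefix t b"
    proof
      assume "prefix t b"
      then have "prefix t e" using PT.comparable[OF _ ab(4), of t] e(2) by blast
      moreover have "strict_prefix [] t" using False by (simp add: strict_prefix_def)
      ultimately have "t = e" using PT.E_between[OF e(1) tS] by (auto simp: strict_prefix_def)
      then show False using e(2) by simp
    qed
    then show False using PT.crossing[OF A(1) ab(1,3) t(1) ab(2)] t(2) by blast
  qed
qed

end

section \<open>The colouring structure and the patterning\<close>

definition cyclic_shift :: "'c set \<Rightarrow> (nat \<Rightarrow> 'c) \<Rightarrow> nat \<Rightarrow> nat \<Rightarrow> 'c \<Rightarrow> 'c" where
  "cyclic_shift Z c n j = (\<lambda>x\<in>Z. if x \<in> c ` {..<n} then c ((inv_into {..<n} c x + j) mod n) else x)"

context
  fixes Z :: "'c set" and c :: "nat \<Rightarrow> 'c" and n :: nat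
  assumes inj: "inj_on c {..<n}" and sub: "c ` {..<n} \<subseteq> Z" and n: "0 < n"
begin

lemma cyc_c: "i < n \<Longrightarrow> cyclic_shift Z c n j (c i) = c ((i + j) mod n)"
  using sub inv_into_f_f[OF inj, of i] by (auto simp: cyclic_shift_def)

lemma cyc_other: "x \<in> Z \<Longrightarrow> x \<notin> c ` {..<n} \<Longrightarrow> cyclic_shift Z c n j x = x"
  by (simp add: cyclic_shift_def)

lemma cyc_cyc: "x \<in> Z \<Longrightarrow> cyclic_shift Z c n j (cyclic_shift Z c n j' x) = cyclic_shift Z c n (j + j') x"
proof (cases "x \<in> c ` {..<n}")
  case True
  then obtain i where i: "i < n" "x = c i" by auto
  have "((i + j') mod n + j) mod n = (i + (j + j')) mod n" by (simp add: mod_simps add_ac)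
  then show ?thesis using i n by (simp add: cyc_c)
next
  case False
  assume "x \<in> Z" then show ?thesis using False by (simp add: cyc_other)
qed

lemma cyc_mod: "x \<in> Z \<Longrightarrow> cyclic_shift Z c n (j mod n) x = cyclic_shift Z c n j x"
proof (cases "x \<in> c ` {..<n}")
  case True
  then obtain i where i: "i < n" "x = c i" by auto
  then show ?thesis by (simp add: cyc_c mod_add_right_eq)
next
  case False
  assume "x \<in> Z" then show ?thesis using False by (simp add: cyc_other)
qed

lemma cyc_0: "x \<in> Z \<Longrightarrow> cyclic_shift Z c n 0 x = x"
proof (cases "x \<in> c ` {..<n}")
  case True
  then obtain i where i: "i < n" "x = c i" by auto
  then show ?thesis by (simp add: cyc_c)
next
  case False
  assume "x \<in> Z" then show ?thesis using False by (simp add: cyc_other)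
qed

lemma cyc_mem: "x \<in> Z \<Longrightarrow> cyclic_shift Z c n j x \<in> Z"
  using sub n by (auto simp: cyclic_shift_def)

lemma cyc_Bij: "j \<le> n \<Longrightarrow> cyclic_shift Z c n j \<in> Bij Z"
proof -
  assume j: "j \<le> n"
  have nn: "cyclic_shift Z c n n x = x" if "x \<in> Z" for x using cyc_mod[OF that, of n] cyc_0[OF that] by simp
  have "bij_betw (cyclic_shift Z c n j) Z Z"
    by (rule bij_betw_byWitness[of _ "cyclic_shift Z c n (n - j)"])
       (use cyc_cyc nn j cyc_mem in auto)
  then show ?thesis by (simp add: Bij_def cyclic_shift_def)
qed

lemma cyc_subgroup: "subgroup (cyclic_shift Z c n ` {..<n}) (BijGroup Z)"
proof -
  interpret group "BijGroup Z" by (rule group_BijGroup)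
  have mult: "cyclic_shift Z c n j \<otimes>\<^bsub>BijGroup Z\<^esub> cyclic_shift Z c n j' = cyclic_shift Z c n ((j + j') mod n)" if "j < n" "j' < n" for j j'
  proof -
    have "compose Z (cyclic_shift Z c n j) (cyclic_shift Z c n j') = cyclic_shift Z c n ((j + j') mod n)"
    proof
      fix x show "compose Z (cyclic_shift Z c n j) (cyclic_shift Z c n j') x = cyclic_shift Z c n ((j + j') mod n) x"
      proof (cases "x \<in> Z")
        case True then show ?thesis by (simp add: compose_eq cyc_cyc cyc_mod)
      next
        case False then show ?thesis unfolding compose_def cyclic_shift_def[of Z c n "(j + j') mod n"] by simp
      qed
    qed
    then show ?thesis using that cyc_Bij by (simp add: BijGroup_def)
  qed
  have one: "\<one>\<^bsub>BijGroup Z\<^esub> = cyclic_shift Z c n 0"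
    unfolding BijGroup_def using cyc_0 by (auto simp: cyclic_shift_def fun_eq_iff)
  show ?thesis
  proof (rule subgroupI)
    show "cyclic_shift Z c n ` {..<n} \<subseteq> carrier (BijGroup Z)" using cyc_Bij by (auto simp: BijGroup_def)
    show "cyclic_shift Z c n ` {..<n} \<noteq> {}" using n by auto
    fix a assume "a \<in> cyclic_shift Z c n ` {..<n}"
    then obtain j where j: "j < n" "a = cyclic_shift Z c n j" by auto
    have "cyclic_shift Z c n ((n - j) mod n) \<otimes>\<^bsub>BijGroup Z\<^esub> cyclic_shift Z c n j = cyclic_shift Z c n (((n - j) mod n + j) mod n)"
      using mult j n by simp
    also have "((n - j) mod n + j) mod n = 0" using j by (simp add: mod_add_left_eq)
    finally have "inv\<^bsub>BijGroup Z\<^esub> a = cyclic_shift Z c n ((n - j) mod n)"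
      using one j n cyc_Bij by (intro inv_equality) (auto simp: BijGroup_def)
    then show "inv\<^bsub>BijGroup Z\<^esub> a \<in> cyclic_shift Z c n ` {..<n}" using n by auto
    fix b assume "b \<in> cyclic_shift Z c n ` {..<n}"
    then obtain j' where j': "j' < n" "b = cyclic_shift Z c n j'" by auto
    show "a \<otimes>\<^bsub>BijGroup Z\<^esub> b \<in> cyclic_shift Z c n ` {..<n}" using mult[OF j(1) j'(1)] j j' n by auto
  qed
qed

lemma cyc_card: "card (cyclic_shift Z c n ` {..<n}) = n"
proof -
  have "inj_on (cyclic_shift Z c n) {..<n}"
  proof (rule inj_onI)
    fix j j' assume j: "j \<in> {..<n}" "j' \<in> {..<n}" "cyclic_shift Z c n j = cyclic_shift Z c n j'"
    then have "c j = c j'" using cyc_c[of 0 j] cyc_c[of 0 j'] n by simp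
    then show "j = j'" using inj j by (auto dest: inj_onD)
  qed
  then show ?thesis by (simp add: card_image)
qed

lemma cyc_image:
  assumes "j < n" "W \<subseteq> Z" "c ` {..<n} \<subseteq> W \<or> c ` {..<n} \<inter> W = {}" shows "cyclic_shift Z c n j ` W = W"
proof -
  have into: "cyclic_shift Z c n i ` W \<subseteq> W" for i
  proof
    fix y assume "y \<in> cyclic_shift Z c n i ` W"
    then obtain x where x: "x \<in> W" "y = cyclic_shift Z c n i x" by auto
    show "y \<in> W"
    proof (cases "x \<in> c ` {..<n}")
      case True
      then obtain t where "t < n" "x = c t" by auto
      moreover have "c ` {..<n} \<subseteq> W" using assms(3) True x by auto
      ultimately show ?thesis using x n by (auto simp: cyc_c)
    next
      case False then show ?thesis using x assms(2) cyc_other by auto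
    qed
  qed
  have "W \<subseteq> cyclic_shift Z c n j ` W"
  proof
    fix x assume x: "x \<in> W"
    have "cyclic_shift Z c n j (cyclic_shift Z c n (n - j) x) = cyclic_shift Z c n n x" using cyc_cyc[of x j "n - j"] x assms by auto
    also have "\<dots> = x" using cyc_mod[of x n] cyc_0[of x] x assms(2) by auto
    finally show "x \<in> cyclic_shift Z c n j ` W" using into[of "n - j"] x by (metis image_eqI image_subset_iff)
  qed
  then show ?thesis using into by blast
qed

end

context digit_tree
begin

interpretation PT: prefix_tree S by unfold_locales (rule Nil_S)

abbreviation "Tree \<equiv> prefix_tree.T S"

lemma tree_locally_finite: "locally_finite_tree Tree []"
  unfolding locally_finite_tree_def using PT.rooted finite_children by (simp add: PT.children_T)

text \<open>
  Labels and colours are words, numbered in order to obtain natural numbers.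
\<close>

definition lenc :: "'e list \<Rightarrow> nat" where "lenc = to_nat_on (lists (arcs g))"
definition cenc :: "'e list \<times> 'e list \<Rightarrow> nat" where "cenc = to_nat_on (lists (arcs g) \<times> lists (arcs g))"

lemma countable_words: "countable (lists (arcs g))"
  by (intro countable_lists countable_finite) simp

lemma lenc_inj: "inj_on lenc (lists (arcs g))"
  unfolding lenc_def by (rule inj_on_to_nat_on[OF countable_words])

lemma cenc_inj: "inj_on cenc (lists (arcs g) \<times> lists (arcs g))"
  unfolding cenc_def by (rule inj_on_to_nat_on) (intro countable_SIGMA countable_words)

lemma lab_arcs: "u \<in> S \<Longrightarrow> lab u \<in> lists (arcs g)"
  using S_arcs[of u] unfolding lab_def by (auto dest: in_set_dropD)

definition ecol :: "'e list \<times> 'e list \<Rightarrow> nat" where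
  "ecol = (\<lambda>(u, v). cenc (lab u, drop (length u) v))"

definition col :: "('e list, nat, nat) colouring" where
  "col = \<lparr>labels = (lenc \<circ> lab) ` S, lab = lenc \<circ> lab,
     colours = (\<lambda>i i'. ecol ` {(u, v) \<in> PT.E. u \<in> S \<and> lenc (lab u) = i \<and> lenc (lab v) = i'}),
     ccol = ecol\<rparr>"

lemma col_simps [simp]:
  "labels col = (lenc \<circ> lab) ` S" "colouring.lab col = lenc \<circ> lab" "ccol col = ecol"
  "colours col i i' = ecol ` {(u, v) \<in> PT.E. u \<in> S \<and> lenc (lab u) = i \<and> lenc (lab v) = i'}"
  by (simp_all add: col_def)

lemma lenc_lab_eq: "u \<in> S \<Longrightarrow> v \<in> S \<Longrightarrow> lenc (lab u) = lenc (lab v) \<longleftrightarrow> lab u = lab v"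
  using lenc_inj lab_arcs by (auto dest: inj_onD)

lemma ecol_eq:
  assumes "u \<in> S" "u' \<in> S" "u @ r \<in> S" "u' @ r' \<in> S"
  shows "ecol (u, u @ r) = ecol (u', u' @ r') \<longleftrightarrow> lab u = lab u' \<and> r = r'"
proof -
  have "(lab u, r) \<in> lists (arcs g) \<times> lists (arcs g)" "(lab u', r') \<in> lists (arcs g) \<times> lists (arcs g)"
    using assms lab_arcs S_arcs[of "u @ r"] S_arcs[of "u' @ r'"] by auto
  then show ?thesis using cenc_inj unfolding ecol_def by (auto dest: inj_onD)
qed

lemma E_append: "(u, v) \<in> PT.E \<Longrightarrow> \<exists>r. v = u @ r \<and> u @ r \<in> S"
  using PT.ED(2,5) by (metis prefix_def)

lemma ecol_E_eq:
  assumes e: "(u, v) \<in> PT.E" "(u', v') \<in> PT.E" and u: "u \<in> S" "u' \<in> S"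
    and c: "ecol (u, v) = ecol (u', v')"
  shows "lab u = lab u'" "\<exists>r. v = u @ r \<and> v' = u' @ r" "lab v = lab v'"
proof -
  obtain r r' where r: "v = u @ r" "u @ r \<in> S" "v' = u' @ r'" "u' @ r' \<in> S" using E_append e by metis
  have 1: "lab u = lab u' \<and> r = r'" using ecol_eq[OF u r(2,4)] c r by simp
  then show "lab u = lab u'" "\<exists>r. v = u @ r \<and> v' = u' @ r" using r by auto
  show "lab v = lab v'" using sync_lab[OF u(2,1)] 1 r by metis
qed

lemma V_minus: "PT.V - {[]} = S" using Nil_S by (auto simp: PT.V_def)

lemma col_bij:
  assumes v: "v \<in> S"
  shows "bij_betw ecol {(u, w) \<in> PT.E. u = v \<and> lenc (lab w) = i'} (colours col (lenc (lab v)) i')"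
  unfolding bij_betw_def
proof
  show "inj_on ecol {(u, w) \<in> PT.E. u = v \<and> lenc (lab w) = i'}"
  proof (rule inj_onI)
    fix a b assume ab: "a \<in> {(u, w) \<in> PT.E. u = v \<and> lenc (lab w) = i'}" "b \<in> {(u, w) \<in> PT.E. u = v \<and> lenc (lab w) = i'}"
      "ecol a = ecol b"
    obtain s t where st: "a = (v, s)" "b = (v, t)" "(v, s) \<in> PT.E" "(v, t) \<in> PT.E" using ab by auto
    have "ecol (v, s) = ecol (v, t)" using ab(3) st by simp
    then show "a = b" using ecol_E_eq(2)[OF st(3,4) v v] st by auto
  qed
  show "ecol ` {(u, w) \<in> PT.E. u = v \<and> lenc (lab w) = i'} = colours col (lenc (lab v)) i'"
  proof
    show "ecol ` {(u, w) \<in> PT.E. u = v \<and> lenc (lab w) = i'} \<subseteq> colours col (lenc (lab v)) i'"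
      using v by auto
    show "colours col (lenc (lab v)) i' \<subseteq> ecol ` {(u, w) \<in> PT.E. u = v \<and> lenc (lab w) = i'}"
    proof
      fix x assume "x \<in> colours col (lenc (lab v)) i'"
      then obtain u t where u: "x = ecol (u, t)" "(u, t) \<in> PT.E" "u \<in> S" "lenc (lab u) = lenc (lab v)" "lenc (lab t) = i'"
        by auto
      have lu: "lab u = lab v" using lenc_lab_eq u v by blast
      obtain r where r: "t = u @ r" "u @ r \<in> S" using E_append[OF u(2)] by blast
      have vr: "(v, v @ r) \<in> PT.E" using child_sync[OF u(3) v lu] u(2) r by simp
      have "ecol (v, v @ r) = x" using ecol_eq[OF u(3) v r(2) PT.ED(2)[OF vr]] lu u(1) r(1) by simp
      moreover have "lab (v @ r) = lab t" using sync_lab[OF u(3) v lu r(2)] r(1) by simp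
      ultimately show "x \<in> ecol ` {(u, w) \<in> PT.E. u = v \<and> lenc (lab w) = i'}"
        using vr u(5) by (intro image_eqI[of _ _ "(v, v @ r)"]) auto
    qed
  qed
qed

text \<open>
  A bijection between the children of two vertices with the same label appends the same words.
  Different pairs of labels have disjoint sets of colours, because the colour determines the label
  of the origin and, by \<open>sync_lab\<close>, that of the terminus.
\<close>

lemma colouring: "colouring_structure Tree [] col"
  unfolding colouring_structure_def PT.T_simps V_minus
proof (intro conjI ballI impI)
  have "lab ` S \<subseteq> {xs. set xs \<subseteq> arcs g \<and> length xs = mk}" using lab_arcs lab_length by auto
  then have "finite (lab ` S)" by (rule finite_subset) (simp add: finite_lists_length_eq)
  then show "finite (labels col)" using finite_imageI[of "lab ` S" lenc] by (simp add: image_image)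
  show "colouring.lab col ` S \<subseteq> labels col" by simp
next
  fix v u assume v: "v \<in> S" "u \<in> S" and e: "colouring.lab col v = colouring.lab col u"
  have lu: "lab v = lab u" using e lenc_lab_eq v by simp
  define f where "f x = u @ drop (length v) x" for x
  have f: "(u, f x) \<in> PT.E \<and> lab (f x) = lab x" if vx: "(v, x) \<in> PT.E" for x
  proof -
    obtain r where r: "x = v @ r" "v @ r \<in> S" using E_append[OF vx] by blast
    show ?thesis using child_sync[OF v lu, of r] sync_lab[OF v lu r(2)] vx r by (simp add: f_def)
  qed
  have inj: "inj_on f {x. (v, x) \<in> PT.E}"
  proof (rule inj_onI)
    fix x y assume xy: "x \<in> {x. (v, x) \<in> PT.E}" "y \<in> {x. (v, x) \<in> PT.E}" "f x = f y"
    then obtain r r' where "x = v @ r" "y = v @ r'" using E_append by blast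
    then show "x = y" using xy(3) by (simp add: f_def)
  qed
  have surj: "f ` {x. (v, x) \<in> PT.E} = {x. (u, x) \<in> PT.E}"
  proof
    show "f ` {x. (v, x) \<in> PT.E} \<subseteq> {x. (u, x) \<in> PT.E}" using f by auto
    show "{x. (u, x) \<in> PT.E} \<subseteq> f ` {x. (v, x) \<in> PT.E}"
    proof
      fix y assume y: "y \<in> {x. (u, x) \<in> PT.E}"
      then obtain r where r: "y = u @ r" using E_append by blast
      then have "(v, v @ r) \<in> PT.E" using child_sync[OF v(2,1) lu[symmetric]] y by simp
      then show "y \<in> f ` {x. (v, x) \<in> PT.E}" using r by (intro image_eqI[of _ _ "v @ r"]) (auto simp: f_def)
    qed
  qed
  show "\<exists>f. bij_betw f (children Tree v) (children Tree u) \<and> (\<forall>x\<in>children Tree v. colouring.lab col (f x) = colouring.lab col x)"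
    unfolding PT.children_T using inj surj f by (intro exI[of _ f]) (auto simp: bij_betw_def)
next
  fix i assume "i \<in> labels col"
  then obtain v where v: "v \<in> S" "i = lenc (lab v)" by auto
  have "{u \<in> S. colouring.lab col u = i} = {u \<in> S. lab u = lab v}" using v lenc_lab_eq by auto
  then show "\<nexists>A. subtree Tree A \<and> A \<noteq> PT.V \<and> {u \<in> S. colouring.lab col u = i} \<subseteq> A"
    using label_spanning[OF v(1)] by auto
next
  fix i i' assume "i \<in> labels col"
  then obtain v where v: "v \<in> S" "i = lenc (lab v)" by auto
  have "finite {(u, w) \<in> PT.E. u = v \<and> lenc (lab w) = i'}"
    by (rule finite_subset[of _ "{v} \<times> {c. (v, c) \<in> PT.E}"]) (use finite_children in auto)
  then show "finite (colours col i i')" using bij_betw_finite[OF col_bij[OF v(1), of i']] v(2) by simp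
next
  show "disjoint_family_on (\<lambda>(l, y). colours col l y) (labels col \<times> labels col)"
    unfolding disjoint_family_on_def
  proof (intro ballI impI)
    fix p q assume pq: "p \<in> labels col \<times> labels col" "q \<in> labels col \<times> labels col" "p \<noteq> q"
    obtain i i' where p: "p = (i, i')" by (cases p)
    obtain t t' where q: "q = (t, t')" by (cases q)
    have False if x: "x \<in> colours col i i'" "x \<in> colours col t t'" for x
    proof -
      obtain u v where u: "x = ecol (u, v)" "(u, v) \<in> PT.E" "u \<in> S" "lenc (lab u) = i" "lenc (lab v) = i'" using x(1) by auto
      obtain u' v' where u': "x = ecol (u', v')" "(u', v') \<in> PT.E" "u' \<in> S" "lenc (lab u') = t" "lenc (lab v') = t'" using x(2) by auto
      have c: "ecol (u, v) = ecol (u', v')" using u(1) u'(1) by simp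
      have "lab u = lab u'" "lab v = lab v'" using ecol_E_eq[OF u(2) u'(2) u(3) u'(3) c] by simp_all
      then have "i = t" "i' = t'" using u(4,5) u'(4,5) by simp_all
      then show False using pq(3) p q by simp
    qed
    then show "(case p of (l, y) \<Rightarrow> colours col l y) \<inter> (case q of (l, y) \<Rightarrow> colours col l y) = {}"
      unfolding p q by blast
  qed
next
  fix v i' assume v: "v \<in> S"
  have "card (colours col (lenc (lab v)) i') = card {(u, w) \<in> PT.E. u = v \<and> lenc (lab w) = i'}"
    using bij_betw_same_card[OF col_bij[OF v]] by simp
  also have "\<dots> = card {w \<in> children Tree v. lenc (lab w) = i'}"
    by (rule bij_betw_same_card[of snd]) (auto simp: bij_betw_def inj_on_def PT.children_T image_iff)
  finally show "card (colours col (colouring.lab col v) i') = card {w \<in> children Tree v. colouring.lab col w = i'}"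
    by simp
  show "bij_betw (ccol col) {(u, w). (u, w) \<in> PT.E \<and> u = v \<and> colouring.lab col w = i'} (colours col (colouring.lab col v) i')"
    using col_bij[OF v, of i'] by simp
qed

text \<open>
  A walk along the marker can be reached, and a prefix ending with a marker is a vertex.
\<close>

lemma marker_vertex: "\<exists>u\<in>S. \<exists>y. u = map y [0..<length u] \<and> y \<in> Y \<and> lab u = \<mu>"
proof -
  obtain x where x: "x \<in> Y" using Y_ne by blast
  obtain z b where z: "z \<in> X" "n1 \<le> b" "agree n1 x z" "occurs z b \<mu>"
    using walk_occurs[OF YX[OF x] mu_walk, of n1] by blast
  have zY: "z \<in> Y" using depth(2)[OF x z(1) agree_mono[OF z(3) n1_depth]] .
  let ?u = "map z [0..<b + mk]"
  have uS: "?u \<in> S" using tk_S[OF zY] mu_not_bad[of z "b + mk"] z by simp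
  have "lab ?u = \<mu>"
  proof (rule nth_equalityI)
    show "length (lab ?u) = mk" using lab_length[OF uS] .
    fix i assume "i < length (lab ?u)"
    then have i: "i < mk" using lab_length[OF uS] by simp
    show "lab ?u ! i = \<mu> ! i" using lab_nth[OF uS i] z(4) i by (simp add: occurs_def)
  qed
  then show ?thesis using uS zY by (intro bexI[of _ ?u] exI[of _ z]) auto
qed

text \<open>
  Append the rest of a digit to a vertex that ends with the marker. The end of a digit is a vertex
  by \<open>end_not_bad\<close>, every position before it lies inside the digit, and the label of the child is
  the common final segment of the digits.
\<close>

lemma marker_children:
  assumes u: "u \<in> S" "lab u = \<mu>" and i: "i < m"
  shows "(u, u @ drop mk (d i)) \<in> PT.E" "lab (u @ drop mk (d i)) = \<rho>"
proof -
  obtain z where z: "pcat u z \<in> Y" using S_point[OF u(1)] by blast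
  have lu: "0 < length u" "mk \<le> length u" "n1 \<le> length u" using S_length[OF u(1)] n1_pos mk_n1 by auto
  have um: "pcat u t (length u - mk + j) = \<mu> ! j" if "j < mk" for j t
  proof -
    have lt: "length u - mk + j < length u" using that lu by linarith
    have "pcat u t (length u - mk + j) = u ! (length u - mk + j)" using lt unfolding pcat_def by argo
    also have "\<dots> = \<mu> ! j" using lab_nth[OF u(1) that] u(2) by simp
    finally show ?thesis .
  qed
  have ou: "occurs (pcat u t) (length u - mk) \<mu>" for t using um by (simp add: occurs_def)
  have wz: "w = tail g (z 0)"
    using occ_awalk(2)[OF YX[OF z] ou mu_walk] mu_pos lu by (auto simp: pcat_def)
  obtain r where r: "awalk w r (tail g (z 0))" "r = []" using wz awalk_Nil_iff[of w w] mu_walk by auto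
  have di: "d i = \<mu> @ drop mk (d i)" using d_take[OF i] by (metis append_take_drop_id)
  have kw: "awalk w (drop mk (d i)) w"
  proof -
    obtain v where v: "awalk w \<mu> v" "awalk v (drop mk (d i)) w" using d_walk[OF i] di awalk_append_iff by metis
    have "v = w" using awalk_ends[OF v(1) mu_walk] mu_pos by auto
    then show ?thesis using v by simp
  qed
  let ?k = "drop mk (d i)"
  have zX: "z \<in> X" using shift_X[OF YX[OF z], of "length u"] by (simp add: pcat_def)
  let ?z = "pcat ?k z"
  have zz: "?z \<in> X" using pcat_X[OF kw zX] wz by simp
  have lk: "length ?k = l - mk" using d_len[OF i] by simp
  have kpos: "0 < length ?k" proof -
    have "mk < l" using mu_l mu_pos by linarith
    then show ?thesis using lk by linarith
  qed
  have "tail g (?z 0) = w" using occ_awalk(1)[OF zz occ_pcat kw] kpos by auto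
  moreover have "head g (pcat u z (length u - 1)) = w"
    using X_step[OF YX[OF z], of "length u - 1"] wz lu by (simp add: pcat_def)
  ultimately have "glue (length u) (pcat u z) 0 ?z \<in> X" using glue_X[OF YX[OF z] zz lu(1)] by simp
  moreover have ge: "glue (length u) (pcat u z) 0 ?z = pcat u ?z" by (auto simp: glue_def pcat_def fun_eq_iff)
  moreover have "agree depth (pcat u z) (pcat u ?z)" using lu n1_depth by (auto simp: agree_def pcat_def)
  ultimately have yY: "pcat u ?z \<in> Y" using depth(2)[OF z] by simp
  let ?a = "length u - mk"
  have occd: "occurs (pcat u ?z) ?a (d i)"
    unfolding occurs_def
  proof (intro allI impI)
    fix j assume j: "j < length (d i)"
    show "pcat u ?z (?a + j) = d i ! j"
    proof (cases "j < mk")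
      case True
      then show ?thesis using um[OF True] di by (metis nth_append)
    next
      case False
      then have aj: "?a + j = length u + (j - mk)" using lu by simp
      have jl: "j - mk < length ?k" using False j by simp
      have "pcat u ?z (length u + (j - mk)) = ?z (j - mk)" by (simp add: pcat_def)
      also have "\<dots> = ?k ! (j - mk)" unfolding pcat_def using jl by argo
      also have "\<dots> = d i ! j" using False j by simp
      finally show ?thesis unfolding aj .
    qed
  qed
  have al: "?a + l = length u + length ?k" using lu lk mk_l by simp
  have "\<not> inside_digit (pcat u ?z) (length u + length ?k)" using end_not_bad[OF i occd] al by simp
  then have S: "u @ ?k \<in> S" using pcat_S[of "u @ ?k" z] yY lu by (simp add: pcat_append)
  have "\<not> (\<exists>c\<in>S. strict_prefix u c \<and> strict_prefix c (u @ ?k))"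
  proof
    assume "\<exists>c\<in>S. strict_prefix u c \<and> strict_prefix c (u @ ?k)"
    then obtain c where c: "c \<in> S" "strict_prefix u c" "strict_prefix c (u @ ?k)" by blast
    have "prefix c (u @ ?k)" using c(3) by auto
    then obtain z' where z': "pcat (u @ ?k) z = pcat c z'" using prefix_pcat by blast
    have lc: "length u < length c" "length c < length u + length ?k" using c prefix_length_less by fastforce+
    have "inside_digit (pcat u ?z) (length c)"
      unfolding inside_digit_def
    proof (intro exI conjI allI impI)
      show "i < m" by (rule i)
      show "?a + mk < length c" using lc(1) lu by linarith
      show "length c < ?a + l" using lc(2) al by linarith
      fix j assume j: "?a \<le> j \<and> j < length c"
      then have "j - ?a < length (d i)" using lc(2) al d_len[OF i] by linarith
      then show "pcat u ?z j = d i ! (j - ?a)" using occd j unfolding occurs_def by (metis le_add_diff_inverse)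
    qed
    then have "inside_digit (pcat c z') (length c)" using z' by (simp add: pcat_append)
    moreover have "pcat c z' \<in> Y" using yY z' by (simp add: pcat_append)
    ultimately show False using pcat_S c(1) by blast
  qed
  then show "(u, u @ ?k) \<in> PT.E" using u(1) S PT.SV kpos by (auto simp: PT.E_def strict_prefix_def)
  have "lab (u @ ?k) = drop (length ?k) (\<mu> @ ?k)" using lab_append[OF lu(2)] u(2) by simp
  also have "\<dots> = \<rho>" using d_drop[OF i] di lk by simp
  finally show "lab (u @ ?k) = \<rho>" .
qed

definition digit_col :: "nat \<Rightarrow> nat" where "digit_col i = cenc (\<mu>, drop mk (d i))"

definition pat :: "nat \<Rightarrow> (nat \<Rightarrow> nat) set" where
  "pat i = (if i = lenc \<mu> then cyclic_shift (label_colours col i) digit_col m ` {..<m} else {\<lambda>x\<in>label_colours col i. x})"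

lemma digit_col_inj: "inj_on digit_col {..<m}"
proof (rule inj_onI)
  fix i j assume ij: "i \<in> {..<m}" "j \<in> {..<m}" "digit_col i = digit_col j"
  obtain u where u: "u \<in> S" "lab u = \<mu>" using marker_vertex by blast
  have "ecol (u, u @ drop mk (d i)) = ecol (u, u @ drop mk (d j))"
    using ij(3) u by (simp add: ecol_def digit_col_def)
  then have "drop mk (d i) = drop mk (d j)"
    using ecol_eq[OF u(1) u(1)] PT.ED(2)[OF marker_children(1)[OF u]] ij by simp
  then have "d i = d j" using d_take ij by (metis append_take_drop_id lessThan_iff)
  then show "i = j" using d_inj ij by (auto dest: inj_onD)
qed

lemma digit_col_colours: "digit_col ` {..<m} \<subseteq> colours col (lenc \<mu>) (lenc \<rho>)"
proof
  fix x assume "x \<in> digit_col ` {..<m}"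
  then obtain i where i: "i < m" "x = digit_col i" by auto
  obtain u where u: "u \<in> S" "lab u = \<mu>" using marker_vertex by blast
  have "x = ecol (u, u @ drop mk (d i))" using i u by (simp add: ecol_def digit_col_def)
  then show "x \<in> colours col (lenc \<mu>) (lenc \<rho>)" using marker_children[OF u i(1)] u by auto
qed

lemma rho_label: "lenc \<rho> \<in> labels col" "lenc \<mu> \<in> labels col"
proof -
  obtain u where u: "u \<in> S" "lab u = \<mu>" using marker_vertex by blast
  then show "lenc \<mu> \<in> labels col" by (force simp: image_iff)
  have "u @ drop mk (d 0) \<in> S" "lab (u @ drop mk (d 0)) = \<rho>"
    using marker_children[OF u m_pos] PT.ED(2) by auto
  then show "lenc \<rho> \<in> labels col" by (force simp: image_iff)
qed

text \<open>
  All digit colours lead from the label \<open>\<mu>\<close> to the label \<open>\<rho>\<close>, so each part of the colours contains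
  all of them or none.
\<close>

lemma pat_patterning: "patterning Tree [] col pat"
  unfolding patterning_def
proof (intro conjI ballI colouring)
  have sub: "digit_col ` {..<m} \<subseteq> label_colours col (lenc \<mu>)"
    using digit_col_colours rho_label unfolding label_colours_def by blast
  fix i assume i: "i \<in> labels col"
  show "subgroup (pat i) (BijGroup (label_colours col i))"
  proof (cases "i = lenc \<mu>")
    case True
    then show ?thesis using cyc_subgroup[OF digit_col_inj sub m_pos] by (simp add: pat_def)
  next
    case False
    interpret B: group "BijGroup (label_colours col i)" by (rule group_BijGroup)
    have "pat i = {\<one>\<^bsub>BijGroup (label_colours col i)\<^esub>}" using False by (simp add: pat_def BijGroup_def)
    then show ?thesis using B.triv_subgroup by simp
  qed
  fix \<pi> i' assume p: "\<pi> \<in> pat i" and i': "i' \<in> labels col"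
  have ci: "colours col i i' \<subseteq> label_colours col i" using i' by (auto simp: label_colours_def)
  show "\<pi> ` colours col i i' = colours col i i'"
  proof (cases "i = lenc \<mu>")
    case True
    then obtain j where j: "j < m" "\<pi> = cyclic_shift (label_colours col (lenc \<mu>)) digit_col m j" using p by (auto simp: pat_def)
    have "digit_col ` {..<m} \<subseteq> colours col (lenc \<mu>) i' \<or> digit_col ` {..<m} \<inter> colours col (lenc \<mu>) i' = {}"
    proof (cases "i' = lenc \<rho>")
      case True then show ?thesis using digit_col_colours by simp
    next
      case False
      have "disjoint_family_on (\<lambda>(l, y). colours col l y) (labels col \<times> labels col)"
        using colouring unfolding colouring_structure_def by blast
      then have "colours col (lenc \<mu>) i' \<inter> colours col (lenc \<mu>) (lenc \<rho>) = {}"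
        using disjoint_family_onD[of "\<lambda>(l, y). colours col l y" "labels col \<times> labels col" "(lenc \<mu>, i')" "(lenc \<mu>, lenc \<rho>)"]
          False i' rho_label by (simp del: col_simps)
      then show ?thesis using digit_col_colours by blast
    qed
    then show ?thesis
      using cyc_image[OF digit_col_inj sub m_pos j(1), of "colours col (lenc \<mu>) i'"] ci True j(2) by simp
  next
    case False
    then have "\<pi> = (\<lambda>x\<in>label_colours col i. x)" using p by (simp add: pat_def)
    then have "\<pi> ` colours col i i' = (\<lambda>x. x) ` colours col i i'" using ci by (intro image_cong) auto
    then show ?thesis by simp
  qed
qed

lemma pat_card: "(\<Prod>i\<in>labels col. card (pat i)) = m"
proof -
  have sub: "digit_col ` {..<m} \<subseteq> label_colours col (lenc \<mu>)"
    using digit_col_colours rho_label unfolding label_colours_def by blast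
  have fin: "finite (labels col)" using colouring unfolding colouring_structure_def by blast
  have "(\<Prod>i\<in>labels col. card (pat i)) = (\<Prod>i\<in>labels col. if i = lenc \<mu> then m else 1)"
    using cyc_card[OF digit_col_inj sub m_pos] by (intro prod.cong) (auto simp: pat_def)
  also have "\<dots> = m" using fin rho_label(2) by (simp only: prod.delta if_True)
  finally show ?thesis .
qed

section \<open>The full group as a group of almost automorphisms\<close>

definition carries :: "((nat \<Rightarrow> 'e) \<Rightarrow> nat \<Rightarrow> 'e) \<Rightarrow> 'e list \<Rightarrow> 'e list \<Rightarrow> bool" where
  "carries h u v \<longleftrightarrow> u \<in> S \<and> v \<in> S \<and> lab u = lab v \<and> (\<forall>z. pcat u z \<in> Y \<longrightarrow> h (pcat u z) = pcat v z)"

lemma carriesD: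
  assumes "carries h u v"
  shows "u \<in> S" "v \<in> S" "lab u = lab v" "pcat u z \<in> Y \<Longrightarrow> h (pcat u z) = pcat v z"
  using assms by (auto simp: carries_def)

text \<open>
  If \<open>v' = v r\<close> were a second target, then \<open>z = r z\<close> for all continuations \<open>z\<close> of \<open>u\<close>, so that \<open>u\<close>
  would have only one continuation, contrary to \<open>another_point\<close>.
\<close>

lemma carries_unique:
  assumes nc: "non_circular g" and v: "carries h u v" "carries h u v'" shows "v = v'"
proof -
  have step: "v = v'" if v: "carries h u v" "carries h u v'" and le: "length v \<le> length v'" for v v'
  proof -
    obtain z where z: "pcat u z \<in> Y" using S_point carriesD(1)[OF v(1)] by blast
    have e: "pcat v z = pcat v' z" if "pcat u z \<in> Y" for z using carriesD(4)[OF v(1) that] carriesD(4)[OF v(2) that] by simp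
    obtain r where r: "v' = v @ r" using pcat_prefix[OF e[OF z] le] by (auto simp: prefix_def)
    have per: "z = pcat r z" if "pcat u z \<in> Y" for z
      using e[OF that] pcat_inj[of v z "pcat r z"] r by (simp add: pcat_append)
    have "r = []"
    proof (rule ccontr)
      assume rne: "r \<noteq> []"
      have det: "z j = z' j" if "pcat u z \<in> Y" "pcat u z' \<in> Y" for z z' j
      proof (induction j rule: less_induct)
        case (less j)
        have "z j = pcat r z j" "z' j = pcat r z' j" using per[OF that(1)] per[OF that(2)] by simp_all
        moreover have "j - length r < j" if "\<not> j < length r" using that rne by (cases r) auto
        ultimately show ?case using less.IH[of "j - length r"] by (cases "j < length r") (auto simp: pcat_def)
      qed
      obtain y where y: "y \<in> Y" "agree (length u) (pcat u z) y" "y \<noteq> pcat u z" using another_point[OF nc z] by blast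
      have "u = map y [0..<length u]" using y(2) map_pcat[of u z] by (metis map_eq_agree)
      then have yu: "y = pcat u (\<lambda>j. y (length u + j))" using pcat_map_tail[of y "length u"] by simp
      have "pcat u (\<lambda>j. y (length u + j)) \<in> Y" using y(1) yu by argo
      then have "(\<lambda>j. y (length u + j)) = z" using det[OF _ z] by blast
      then show False using yu y(3) by simp
    qed
    then show ?thesis using r by simp
  qed
  show ?thesis
  proof (cases "length v \<le> length v'")
    case True then show ?thesis using step[OF v] by blast
  next
    case False then show ?thesis using step[OF v(2,1)] by simp
  qed
qed

lemma carries_append:
  assumes "carries h u v" "u @ r \<in> S" shows "carries h (u @ r) (v @ r)"
  unfolding carries_def
proof (intro conjI allI impI)
  note u = carriesD(1-3)[OF assms(1)]
  show "u @ r \<in> S" by fact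
  show "v @ r \<in> S" using sync_S[OF u assms(2)] .
  show "lab (u @ r) = lab (v @ r)" using sync_lab[OF u assms(2)] by simp
  fix z assume "pcat (u @ r) z \<in> Y"
  then show "h (pcat (u @ r) z) = pcat (v @ r) z" using carriesD(4)[OF assms(1), of "pcat r z"] by (simp add: pcat_append)
qed

lemma carries_back:
  assumes "carries h u v" "v @ r \<in> S" shows "u @ r \<in> S"
  using sync_S[OF carriesD(2)[OF assms(1)] carriesD(1)[OF assms(1)] carriesD(3)[OF assms(1), symmetric] assms(2)] .

lemma carries_comp:
  assumes k: "carries k u v" and h: "carries h v t" shows "carries (compose Y h k) u t"
  unfolding carries_def
proof (intro conjI allI impI)
  note u = carriesD(1-3)[OF k]
  show "u \<in> S" "t \<in> S" "lab u = lab t" using u carriesD(1-3)[OF h] by simp_all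
  fix z assume z: "pcat u z \<in> Y"
  then have "pcat v z \<in> Y" using swap_Y[OF u] by blast
  then show "compose Y h k (pcat u z) = pcat t z" using carriesD(4)[OF k z] carriesD(4)[OF h, of z] z by (simp add: compose_eq)
qed

text \<open>
  Extend the prefixes \<open>A\<close> and \<open>b\<close> of a local replacement by at least \<open>l\<close> common letters. Then the
  last \<open>l\<close> letters agree, so the new prefix is a vertex exactly if the old one is, and the labels
  are the same.
\<close>

lemma carries_exists:
  assumes h: "h \<in> prefix_maps"
  shows "\<exists>L. \<forall>u\<in>S. L \<le> length u \<longrightarrow> (\<exists>v. carries h u v \<and> length u \<le> length v + L)"
proof -
  obtain A B where A: "n1 \<le> A" and lpu: "\<forall>x\<in>Y. \<exists>b. n1 \<le> b \<and> b \<le> B \<and> lp h x A b"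
    using uniform_lp[OF h, of n1] by blast
  have "\<exists>v. carries h u v \<and> length u \<le> length v + (A + l)" if u: "u \<in> S" and Lu: "A + l \<le> length u" for u
  proof -
    obtain z where z: "pcat u z \<in> Y" using S_point[OF u] by blast
    let ?x = "pcat u z"
    obtain b where b: "n1 \<le> b" "lp h ?x A b" using lpu z by blast
    define t where "t = length u - A"
    have ut: "length u = A + t" "l \<le> t" using Lu by (auto simp: t_def)
    define v where "v = map (h ?x) [0..<b + t]"
    have lv: "length v = b + t" by (simp add: v_def)
    have hx: "h ?x \<in> Y" using prefix_maps_mem[OF h z] .
    have tl: "h ?x (b + j) = ?x (A + j)" for j using lp_tail[OF b(2) z agree_refl] .
    have "\<not> inside_digit (h ?x) (b + t)"
    proof
      assume bad: "inside_digit (h ?x) (b + t)"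
      have "inside_digit ?x (A + t)"
      proof (rule bad_suffix[OF _ _ _ bad])
        show "l \<le> b + t" "l \<le> A + t" using ut by auto
        fix j
        have "b + t - l + j = b + (t - l + j)" "A + t - l + j = A + (t - l + j)" using ut(2) by auto
        then show "h ?x (b + t - l + j) = ?x (A + t - l + j)" by (simp only: tl)
      qed
      then show False using pcat_S[OF z] u ut(1) by simp
    qed
    then have vS: "v \<in> S" unfolding v_def using tk_S[OF hx] b(1) by simp
    have ll: "lab u = lab v"
    proof (rule nth_equalityI)
      show "length (lab u) = length (lab v)" using lab_length[OF u] lab_length[OF vS] by simp
      fix j assume "j < length (lab u)"
      then have j: "j < mk" using lab_length[OF u] by simp
      have i1: "length u - mk + j = A + (t - mk + j)" "b + t - mk + j = b + (t - mk + j)" using ut mk_l by auto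
      have i2: "A + (t - mk + j) < length u" "b + (t - mk + j) < b + t" using ut mk_l j by auto
      have "lab u ! j = u ! (A + (t - mk + j))" using lab_nth[OF u j] i1 by simp
      also have "\<dots> = ?x (A + (t - mk + j))" using i2(1) unfolding pcat_def by argo
      also have "\<dots> = h ?x (b + (t - mk + j))" using tl by simp
      also have "\<dots> = v ! (b + (t - mk + j))" unfolding v_def using nth_map_upt[of "b + (t - mk + j)" "b + t" 0 "h ?x"] i2(2) by simp
      also have "\<dots> = lab v ! j" using lab_nth[OF vS j] lv i1(2) by simp
      finally show "lab u ! j = lab v ! j" .
    qed
    have "h (pcat u z') = pcat v z'" if z': "pcat u z' \<in> Y" for z'
    proof -
      have lpt: "lp h ?x (A + t) (b + t)" using lp_shift[OF b(2) z] .
      have ag: "agree (A + t) ?x (pcat u z')" using ut(1) by (simp add: agree_def pcat_def)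
      have "h (pcat u z') = glue (b + t) (h ?x) (A + t) (pcat u z')"
        using glue_eqI[OF lp_agree[OF lpt z' ag] lp_tail[OF lpt z' ag]] .
      also have "\<dots> = pcat v z'"
      proof
        fix j show "glue (b + t) (h ?x) (A + t) (pcat u z') j = pcat v z' j"
        proof (cases "j < b + t")
          case True then show ?thesis unfolding v_def by (simp add: glue_def pcat_def)
        next
          case False
          then obtain k where k: "j = b + t + k" using le_Suc_ex by (metis not_less)
          have "glue (b + t) (h ?x) (A + t) (pcat u z') j = pcat u z' (length u + k)" unfolding k ut(1) by (rule glue_tail)
          also have "\<dots> = pcat v z' (length v + k)" by (simp add: pcat_def)
          finally show ?thesis unfolding lv k .
        qed
      qed
      finally show ?thesis .
    qed
    then have "carries h u v" using u vS ll by (simp add: carries_def)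
    moreover have "length u \<le> length v + (A + l)" using ut lv by simp
    ultimately show ?thesis by blast
  qed
  then show ?thesis by blast
qed

subsection \<open>Complete subtrees at a given depth\<close>

abbreviation "cmpl A \<equiv> complete_subtree Tree [] A"
abbreviation "Fv A \<equiv> forest_verts Tree A"
abbreviation "hon A B \<phi> \<equiv> honest_aaut Tree [] A B \<phi>"

text \<open>
  Complete finite subtrees all of whose leaves have length at least \<open>L\<close>; every finite complete
  subtree is contained in one of them.
\<close>

definition level :: "nat \<Rightarrow> 'e list set" where
  "level L = {u \<in> PT.V. \<forall>s\<in>S. strict_prefix s u \<longrightarrow> length s < L}"

lemma level_complete: "cmpl (level L)"
  unfolding PT.complete_T
proof (intro conjI ballI allI impI)
  show "level L \<subseteq> PT.V" by (auto simp: level_def)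
  have "length u \<le> max L n1 + l" if u: "u \<in> level L" for u
  proof (rule ccontr)
    assume len: "\<not> length u \<le> max L n1 + l"
    have uV: "u \<in> PT.V" using u by (simp add: level_def)
    obtain z where z: "pcat u z \<in> Y" using V_point[OF uV] by blast
    obtain n where n: "L \<le> n" "n \<le> max L n1 + l" "map (pcat u z) [0..<n] \<in> S" using next_S[OF z] by blast
    have "strict_prefix (map (pcat u z) [0..<n]) (map (pcat u z) [0..<length u])"
      using map_strict_prefix[of n "length u"] n len by simp
    then have "strict_prefix (map (pcat u z) [0..<n]) u" by (simp add: map_pcat)
    then have "n < L" using u n(3) unfolding level_def by fastforce
    then show False using n(1) by simp
  qed
  then show "finite (level L)"
    by (intro finite_subset[OF _ finite_short[of "max L n1 + l"]]) (auto simp: level_def)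
  show "[] \<in> level L" using PT.NilV by (simp add: level_def)
  fix a v assume "a \<in> level L" "v \<in> PT.V" "prefix v a"
  then show "v \<in> level L" unfolding level_def using prefix_order.less_le_trans by blast
next
  fix v c c' assume v: "v \<in> level L" and c: "(v, c) \<in> PT.E" "(v, c') \<in> PT.E" "c \<in> level L"
  have "length s < L" if s: "s \<in> S" "strict_prefix s c'" for s
  proof -
    have sv: "prefix s v" using PT.below_parent[OF c(2) PT.SV[OF s(1)] s(2)] .
    have "strict_prefix s c" using sv PT.ED(4)[OF c(1)] prefix_order.le_less_trans by blast
    then show ?thesis using c(3) s(1) by (simp add: level_def)
  qed
  then show "c' \<in> level L" using PT.ED(3)[OF c(2)] by (simp add: level_def)
qed

lemma level_leaf:
  assumes "v \<in> leaves Tree (level L)" shows "v \<in> S" "L \<le> length v"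
proof -
  have v: "v \<in> level L" "\<And>c. (v, c) \<in> PT.E \<Longrightarrow> c \<notin> level L" using assms by (auto simp: PT.leaf_iff)
  have vV: "v \<in> PT.V" using v by (simp add: level_def)
  obtain c where c: "(v, c) \<in> PT.E" using child_exists[OF vV] by blast
  then obtain s where s: "s \<in> S" "strict_prefix s c" "L \<le> length s"
    using v(2)[OF c] PT.ED(3)[OF c] by (auto simp: level_def not_less)
  have sv: "prefix s v" using PT.below_parent[OF c PT.SV[OF s(1)] s(2)] .
  then show "L \<le> length v" using s(3) prefix_length_le by fastforce
  have "v \<noteq> []" using sv s(1) Nil_S by auto
  then show "v \<in> S" using vV by (auto simp: PT.V_def)
qed

lemma level_forest:
  assumes "u \<in> Fv (level L)" shows "u \<in> S" "L \<le> length u"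
proof -
  obtain v where v: "u \<in> PT.V" "v \<in> leaves Tree (level L)" "prefix v u"
    using assms PT.forest_T[OF level_complete] by blast
  show "L \<le> length u" using level_leaf(2)[OF v(2)] prefix_length_le[OF v(3)] by simp
  have "u \<noteq> []" using v(3) level_leaf(1)[OF v(2)] Nil_S by auto
  then show "u \<in> S" using v(1) by (auto simp: PT.V_def)
qed

lemma level_sup: "A \<subseteq> PT.V \<Longrightarrow> (\<And>a. a \<in> A \<Longrightarrow> length a < L) \<Longrightarrow> A \<subseteq> level L"
  unfolding level_def using prefix_length_less by (fastforce intro: less_trans)

lemma complete_bound:
  assumes "cmpl A" shows "\<exists>N. \<forall>a\<in>A. length a < N"
proof -
  have "finite (length ` A)" using PT.complete_finite[OF assms] by simp
  then obtain N where "\<forall>n\<in>length ` A. n < N" using finite_nat_bounded by (metis lessThan_iff subsetD)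
  then show ?thesis by blast
qed

lemma deep_forest:
  assumes "cmpl A" shows "\<exists>N. \<forall>u\<in>S. N \<le> length u \<longrightarrow> u \<in> Fv A"
proof -
  obtain N where N: "\<forall>a\<in>A. length a < N" using complete_bound[OF assms] by blast
  have "u \<in> Fv A" if "u \<in> S" "N \<le> length u" for u
    using PT.forest_outside[OF assms PT.SV[OF that(1)]] N that(2) by (metis not_le)
  then show ?thesis by blast
qed

lemma nonroot_leaves:
  assumes A: "cmpl A" "A \<noteq> {[]}"
  shows "leaves Tree A \<subseteq> S" "Fv A \<subseteq> S"
proof -
  have nil: "[] \<notin> leaves Tree A"
  proof
    assume n: "[] \<in> leaves Tree A"
    have "a = []" if "a \<in> A" for a using PT.leaf_maximal[OF A(1) n that] by simp
    then show False using A(2) PT.complete_Nil[OF A(1)] by blast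
  qed
  then show "leaves Tree A \<subseteq> S" using PT.complete_V[OF A(1)] by (auto simp: PT.leaf_iff PT.V_def)
  show "Fv A \<subseteq> S"
  proof
    fix u assume "u \<in> Fv A"
    then obtain v where v: "u \<in> PT.V" "v \<in> leaves Tree A" "prefix v u" using PT.forest_T[OF A(1)] by blast
    then have "u \<noteq> []" using nil by auto
    then show "u \<in> S" using v by (auto simp: PT.V_def)
  qed
qed

lemma leaf_of_point:
  assumes A: "cmpl A" and x: "x \<in> Y" shows "\<exists>p\<in>leaves Tree A. \<exists>z. x = pcat p z"
proof -
  obtain N where N: "\<forall>u\<in>S. N \<le> length u \<longrightarrow> u \<in> Fv A" using deep_forest[OF A] by blast
  obtain n where n: "N \<le> n" "map x [0..<n] \<in> S" using next_S[OF x] by blast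
  then have "map x [0..<n] \<in> Fv A" using N by simp
  then obtain p where p: "p \<in> leaves Tree A" "prefix p (map x [0..<n])" using PT.forest_T[OF A] by blast
  then show ?thesis using prefix_pcat pcat_map_tail[of x n] by metis
qed

lemma pcat_comparable: "pcat u z = pcat v z' \<Longrightarrow> prefix u v \<or> prefix v u"
  using pcat_prefix by (metis nat_le_linear)

lemma leaf_of_point_unique:
  assumes A: "cmpl A" and p: "p \<in> leaves Tree A" "q \<in> leaves Tree A" "pcat p z = pcat q z'"
  shows "p = q"
  using pcat_comparable[OF p(3)] PT.forest_leaf_unique[OF A p(1,2)] by auto

text \<open>
  This is a single equivalence class (\<open>Phi_class\<close>). It is described without a choice of subtrees,
  so that composites can be compared easily.
\<close>

definition Phi :: "((nat \<Rightarrow> 'e) \<Rightarrow> nat \<Rightarrow> 'e) \<Rightarrow> ('e list \<rightharpoonup> 'e list) set" where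
  "Phi h = {\<phi>. (\<exists>A B. hon A B \<phi>) \<and> (\<exists>L. \<forall>u\<in>S. L \<le> length u \<longrightarrow> (\<exists>v. \<phi> u = Some v \<and> carries h u v))}"

definition phi :: "((nat \<Rightarrow> 'e) \<Rightarrow> nat \<Rightarrow> 'e) \<Rightarrow> 'e list set \<Rightarrow> 'e list \<rightharpoonup> 'e list" where
  "phi h A = (\<lambda>u. if u \<in> Fv A then Some (THE v. carries h u v) else None)"

abbreviation "rel \<equiv> aaut_rel Tree []"

text \<open>
  All sufficiently long vertices lie in the forest outside of a given finite complete subtree, and
  \<open>level L\<close> is a finite complete subtree outside of which there are only long vertices.
\<close>

lemma rel_iff: "(\<phi>, \<psi>) \<in> rel \<longleftrightarrow> (\<exists>A B. hon A B \<phi>) \<and> (\<exists>A B. hon A B \<psi>) \<and> (\<exists>L. \<forall>u\<in>S. L \<le> length u \<longrightarrow> \<phi> u = \<psi> u)"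
proof
  assume "(\<phi>, \<psi>) \<in> rel"
  then obtain A B A' B' C where C: "hon A B \<phi>" "hon A' B' \<psi>" "cmpl C" "\<forall>v\<in>Fv C. \<phi> v = \<psi> v"
    unfolding aaut_rel_def by blast
  obtain N where "\<forall>u\<in>S. N \<le> length u \<longrightarrow> u \<in> Fv C" using deep_forest[OF C(3)] by blast
  then show "(\<exists>A B. hon A B \<phi>) \<and> (\<exists>A B. hon A B \<psi>) \<and> (\<exists>L. \<forall>u\<in>S. L \<le> length u \<longrightarrow> \<phi> u = \<psi> u)"
    using C by blast
next
  assume "(\<exists>A B. hon A B \<phi>) \<and> (\<exists>A B. hon A B \<psi>) \<and> (\<exists>L. \<forall>u\<in>S. L \<le> length u \<longrightarrow> \<phi> u = \<psi> u)"
  then obtain A B A' B' L where C: "hon A B \<phi>" "hon A' B' \<psi>" and L: "\<forall>u\<in>S. L \<le> length u \<longrightarrow> \<phi> u = \<psi> u" by blast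
  have cA: "cmpl A" "cmpl A'" using C by (auto simp: honest_aaut_def)
  obtain N N' where N: "\<forall>a\<in>A. length a < N" "\<forall>a\<in>A'. length a < N'" using complete_bound cA by meson
  let ?M = "max L (max N N')"
  have "A \<union> A' \<subseteq> level ?M"
    by (rule level_sup) (use PT.complete_V cA N in fastforce)+
  moreover have "\<forall>v\<in>Fv (level ?M). \<phi> v = \<psi> v"
    using level_forest L by fastforce
  ultimately show "(\<phi>, \<psi>) \<in> rel" unfolding aaut_rel_def using C level_complete[of ?M] by blast
qed

lemma Phi_class:
  assumes nc: "non_circular g" and p: "\<phi> \<in> Phi h" shows "rel `` {\<phi>} = Phi h"
proof
  obtain L where hp: "\<exists>A B. hon A B \<phi>" and L: "\<forall>u\<in>S. L \<le> length u \<longrightarrow> (\<exists>v. \<phi> u = Some v \<and> carries h u v)"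
    using p by (auto simp: Phi_def)
  show "rel `` {\<phi>} \<subseteq> Phi h"
  proof
    fix \<psi> assume "\<psi> \<in> rel `` {\<phi>}"
    then obtain M where hq: "\<exists>A B. hon A B \<psi>" and M: "\<forall>u\<in>S. M \<le> length u \<longrightarrow> \<phi> u = \<psi> u" unfolding rel_iff Image_def by blast
    have "\<forall>u\<in>S. max L M \<le> length u \<longrightarrow> (\<exists>v. \<psi> u = Some v \<and> carries h u v)"
      using L M by (metis max.bounded_iff)
    then show "\<psi> \<in> Phi h" using hq unfolding Phi_def by blast
  qed
  show "Phi h \<subseteq> rel `` {\<phi>}"
  proof
    fix \<psi> assume "\<psi> \<in> Phi h"
    then obtain M where hq: "\<exists>A B. hon A B \<psi>" and M: "\<forall>u\<in>S. M \<le> length u \<longrightarrow> (\<exists>v. \<psi> u = Some v \<and> carries h u v)"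
      unfolding Phi_def by blast
    have "\<forall>u\<in>S. max L M \<le> length u \<longrightarrow> \<phi> u = \<psi> u"
      using L M carries_unique[OF nc] by (metis max.bounded_iff)
    then show "\<psi> \<in> rel `` {\<phi>}" using hp hq rel_iff by blast
  qed
qed

text \<open>
  If \<open>h\<close> replaces each leaf \<open>p\<close> of \<open>A\<close> by a vertex \<open>f p\<close>, then the vertices \<open>f p\<close> are the leaves
  of a finite complete subtree \<open>B\<close>: they are pairwise incomparable because \<open>h\<close> is injective, and
  every point of \<open>Y\<close> starts with one of them because \<open>h\<close> is surjective. As words appended to \<open>p\<close>
  can be appended to \<open>f p\<close>, the map \<open>f\<close> extends to a colour preserving isomorphism of forests.
\<close>

lemma realize:
  assumes nc: "non_circular g" and h: "h \<in> prefix_maps" and A: "cmpl A" "leaves Tree A \<subseteq> S"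
    and D: "\<And>p. p \<in> leaves Tree A \<Longrightarrow> \<exists>v. carries h p v"
  shows "\<exists>B. hon A B (phi h A) \<and> B \<noteq> {[]} \<and> A \<noteq> {[]} \<and>
    (\<forall>u\<in>Fv A. \<exists>v. phi h A u = Some v \<and> carries h u v) \<and>
    (\<forall>(u, v)\<in>forest_edges Tree A. ecol (the (phi h A u), the (phi h A v)) = ecol (u, v))"
proof -
  define f where "f u = (THE v. carries h u v)" for u
  have fI: "f u = v" if "carries h u v" for u v
    unfolding f_def using that carries_unique[OF nc] by blast
  have fl: "carries h p (f p)" if "p \<in> leaves Tree A" for p using D[OF that] fI by metis
  have FS: "\<exists>p r. p \<in> leaves Tree A \<and> u = p @ r \<and> u \<in> S" if "u \<in> Fv A" for u
  proof -
    obtain p where p: "u \<in> PT.V" "p \<in> leaves Tree A" "prefix p u" using \<open>u \<in> Fv A\<close> PT.forest_T[OF A(1)] by blast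
    then have "u \<noteq> []" using A(2) Nil_S by auto
    then show ?thesis using p by (auto simp: PT.V_def prefix_def)
  qed
  have fF: "carries h u (f u)" if "u \<in> Fv A" for u
    using FS[OF that] carries_append[OF fl] fI by metis
  have fapp: "f (u @ r) = f u @ r" if "u \<in> Fv A" "u @ r \<in> S" for u r
    using carries_append[OF fF[OF that(1)] that(2)] fI by blast
  have FI: "p @ r \<in> Fv A" if "p \<in> leaves Tree A" "p @ r \<in> S" for p r
    unfolding PT.forest_T[OF A(1)] using that PT.SV by (metis prefixI)
  have leafF: "p \<in> Fv A" if "p \<in> leaves Tree A" for p using FI[OF that, of "[]"] that A(2) by auto
  have disj: "p = p'" if pp: "p \<in> leaves Tree A" "p' \<in> leaves Tree A" "prefix (f p) (f p')" for p p'
  proof -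
    obtain r where r: "f p' = f p @ r" using pp(3) by (auto simp: prefix_def)
    note c = fl[OF pp(1)] and c' = fl[OF pp(2)]
    obtain z where z: "pcat p' z \<in> Y" using S_point carriesD(1)[OF c'] by blast
    have "pcat (f p') z \<in> Y" using swap_Y[OF carriesD(1-3)[OF c'] z] .
    then have "pcat (f p) (pcat r z) \<in> Y" using r by (simp add: pcat_append)
    then have z': "pcat p (pcat r z) \<in> Y" using swap_Y[OF carriesD(2,1)[OF c] carriesD(3)[OF c, symmetric]] by blast
    have "h (pcat p' z) = h (pcat p (pcat r z))"
      using carriesD(4)[OF c' z] carriesD(4)[OF c z'] r by (simp add: pcat_append)
    then have "pcat p' z = pcat p (pcat r z)" using prefix_maps_inj[OF h z z'] by blast
    then show ?thesis using leaf_of_point_unique[OF A(1) pp(2,1)] by blast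
  qed
  have cover: "\<exists>p\<in>leaves Tree A. \<exists>z. y = pcat (f p) z" if y: "y \<in> Y" for y
  proof -
    have "h ` Y = Y" using prefix_maps_Bij[OF h] by (simp add: Bij_def bij_betw_def)
    then obtain x where x: "x \<in> Y" "h x = y" using y by (metis imageE)
    obtain p z where p: "p \<in> leaves Tree A" "x = pcat p z" using leaf_of_point[OF A(1) x(1)] by blast
    then have "y = pcat (f p) z" using carriesD(4)[OF fl[OF p(1)]] x by blast
    then show ?thesis using p(1) by blast
  qed
  define B where "B = {v \<in> PT.V. \<exists>p\<in>leaves Tree A. prefix v (f p)}"
  have finl: "finite (leaves Tree A)"
    using PT.complete_finite[OF A(1)] by (rule rev_finite_subset) (auto simp: PT.leaf_iff)
  have ex_leaf: "\<exists>p. p \<in> leaves Tree A" using cover Y_ne by blast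
  have cB: "cmpl B"
    unfolding PT.complete_T
  proof (intro conjI ballI allI impI)
    show "B \<subseteq> PT.V" by (auto simp: B_def)
    obtain N where N: "\<forall>n\<in>(length \<circ> f) ` leaves Tree A. n < N"
      using finite_nat_bounded[of "(length \<circ> f) ` leaves Tree A"] finl by (metis finite_imageI lessThan_iff subsetD)
    have "length v \<le> N" if "v \<in> B" for v
      using that N prefix_length_le unfolding B_def by fastforce
    then show "finite B" by (intro finite_subset[OF _ finite_short[of N]]) (auto simp: B_def)
    show "[] \<in> B" using ex_leaf PT.NilV by (auto simp: B_def)
    fix a v assume "a \<in> B" "v \<in> PT.V" "prefix v a"
    then show "v \<in> B" unfolding B_def using prefix_order.trans by blast
  next
    fix v c c' assume c: "(v, c) \<in> PT.E" "(v, c') \<in> PT.E" "c \<in> B"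
    obtain p where p: "p \<in> leaves Tree A" "prefix c (f p)" using c(3) by (auto simp: B_def)
    obtain z where z: "pcat c' z \<in> Y" using S_point PT.ED(2)[OF c(2)] by blast
    obtain p' z' where p': "p' \<in> leaves Tree A" "pcat c' z = pcat (f p') z'" using cover[OF z] by blast
    show "c' \<in> B"
    proof (cases "prefix c' (f p')")
      case True
      then show ?thesis using p'(1) PT.ED(3)[OF c(2)] by (auto simp: B_def)
    next
      case False
      then have s: "strict_prefix (f p') c'" using pcat_comparable[OF p'(2)] by (auto simp: strict_prefix_def)
      have "f p' \<in> PT.V" using PT.SV carriesD(2)[OF fl[OF p'(1)]] by blast
      then have "prefix (f p') v" using PT.below_parent[OF c(2) _ s] by blast
      moreover have "strict_prefix v (f p)" using PT.ED(4)[OF c(1)] p(2) prefix_order.less_le_trans by blast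
      ultimately have "strict_prefix (f p') (f p)" using prefix_order.le_less_trans by blast
      then have "p' = p" using disj[OF p'(1) p(1)] by auto
      then show ?thesis using \<open>strict_prefix (f p') (f p)\<close> by simp
    qed
  qed
  have lB: "leaves Tree B = f ` leaves Tree A"
  proof
    show "leaves Tree B \<subseteq> f ` leaves Tree A"
    proof
      fix v assume v: "v \<in> leaves Tree B"
      then have vB: "v \<in> B" by (simp add: PT.leaf_iff)
      then obtain p where p: "p \<in> leaves Tree A" "prefix v (f p)" by (auto simp: B_def)
      have "f p \<in> B" using p(1) PT.SV carriesD(2)[OF fl[OF p(1)]] by (auto simp: B_def)
      then have "f p = v" using PT.leaf_maximal[OF cB v _ p(2)] by blast
      then show "v \<in> f ` leaves Tree A" using p(1) by blast
    qed
    show "f ` leaves Tree A \<subseteq> leaves Tree B"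
    proof
      fix v assume "v \<in> f ` leaves Tree A"
      then obtain p where p: "p \<in> leaves Tree A" "v = f p" by auto
      have "v \<in> B" using p PT.SV carriesD(2)[OF fl[OF p(1)]] by (auto simp: B_def)
      moreover have "c \<notin> B" if c: "(v, c) \<in> PT.E" for c
      proof
        assume "c \<in> B"
        then obtain p' where p': "p' \<in> leaves Tree A" "prefix c (f p')" by (auto simp: B_def)
        have s: "strict_prefix (f p) (f p')" using PT.ED(4)[OF c] p(2) p'(2) prefix_order.less_le_trans by blast
        then have "p = p'" using disj[OF p(1) p'(1)] by auto
        then show False using s by simp
      qed
      ultimately show "v \<in> leaves Tree B" by (simp add: PT.leaf_iff)
    qed
  qed
  have dom: "dom (phi h A) = Fv A" by (auto simp: phi_def split: if_splits)
  have the: "the (phi h A u) = f u" if "u \<in> Fv A" for u using that by (simp add: phi_def f_def)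
  have FB: "v \<in> Fv B \<longleftrightarrow> v \<in> PT.V \<and> (\<exists>p\<in>leaves Tree A. prefix (f p) v)" for v
    using PT.forest_T[OF cB] lB by auto
  have into: "f u \<in> Fv B" if u: "u \<in> Fv A" for u
  proof -
    obtain p r where p: "p \<in> leaves Tree A" "u = p @ r" "u \<in> S" using FS[OF u] by blast
    have "f u = f p @ r" using fapp[OF leafF[OF p(1)]] p by simp
    then show ?thesis unfolding FB using p(1) PT.SV[OF carriesD(2)[OF fF[OF u]]] by (metis prefixI)
  qed
  have injF: "u = u'" if u: "u \<in> Fv A" "u' \<in> Fv A" "f u = f u'" for u u'
  proof -
    obtain p r where p: "p \<in> leaves Tree A" "u = p @ r" "u \<in> S" using FS[OF u(1)] by blast
    obtain p' r' where p': "p' \<in> leaves Tree A" "u' = p' @ r'" "u' \<in> S" using FS[OF u(2)] by blast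
    have e: "f p @ r = f p' @ r'" using fapp[OF leafF[OF p(1)]] fapp[OF leafF[OF p'(1)]] p p' u(3) by simp
    then have "prefix (f p) (f p') \<or> prefix (f p') (f p)" by (metis PT.comparable prefixI)
    then have "p = p'" using disj p(1) p'(1) by blast
    then show ?thesis using e p p' by simp
  qed
  have bij: "bij_betw (the \<circ> phi h A) (Fv A) (Fv B)"
    unfolding bij_betw_def
  proof
    show "inj_on (the \<circ> phi h A) (Fv A)" using injF the by (auto intro: inj_onI)
    show "(the \<circ> phi h A) ` Fv A = Fv B"
    proof
      show "(the \<circ> phi h A) ` Fv A \<subseteq> Fv B" using into the by auto
      show "Fv B \<subseteq> (the \<circ> phi h A) ` Fv A"
      proof
        fix v assume "v \<in> Fv B"
        then obtain p where p: "v \<in> PT.V" "p \<in> leaves Tree A" "prefix (f p) v" using FB by blast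
        obtain r where r: "v = f p @ r" using p(3) by (auto simp: prefix_def)
        have "v \<in> S" using p(1) r carriesD(2)[OF fl[OF p(2)]] Nil_S by (auto simp: PT.V_def)
        then have pr: "p @ r \<in> S" using carries_back[OF fl[OF p(2)]] r by simp
        then have "f (p @ r) = v" using fapp[OF leafF[OF p(2)] pr] r by simp
        then show "v \<in> (the \<circ> phi h A) ` Fv A" using FI[OF p(2) pr] the by force
      qed
    qed
  qed
  have edge: "(u, v) \<in> forest_edges Tree A \<longleftrightarrow> (f u, f v) \<in> forest_edges Tree B"
    if uv: "u \<in> Fv A" "v \<in> Fv A" for u v
  proof
    assume "(u, v) \<in> forest_edges Tree A"
    then have e: "(u, v) \<in> PT.E" by (simp add: PT.forest_edges_T)
    obtain r where r: "v = u @ r" "u @ r \<in> S" using E_append[OF e] by blast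
    have "(f u, f u @ r) \<in> PT.E" using child_sync[OF carriesD(1-3)[OF fF[OF uv(1)]]] e r by simp
    then show "(f u, f v) \<in> forest_edges Tree B"
      using fapp[OF uv(1) r(2)] r(1) into[OF uv(1)] into[OF uv(2)] by (simp add: PT.forest_edges_T)
  next
    assume "(f u, f v) \<in> forest_edges Tree B"
    then have e: "(f u, f v) \<in> PT.E" by (simp add: PT.forest_edges_T)
    obtain r where r: "f v = f u @ r" "f u @ r \<in> S" using E_append[OF e] by blast
    note c = carriesD(1-3)[OF fF[OF uv(1)]]
    have e': "(u, u @ r) \<in> PT.E" using child_sync[OF c(2,1) c(3)[symmetric]] e r by simp
    obtain p r' where p: "p \<in> leaves Tree A" "u = p @ r'" using FS[OF uv(1)] by blast
    have ur: "u @ r \<in> Fv A" using FI[OF p(1), of "r' @ r"] PT.ED(2)[OF e'] p(2) by simp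
    have "f (u @ r) = f v" using fapp[OF uv(1) PT.ED(2)[OF e']] r by simp
    then have "v = u @ r" using injF[OF ur uv(2)] by simp
    then show "(u, v) \<in> forest_edges Tree A" using e' uv by (simp add: PT.forest_edges_T)
  qed
  have H: "hon A B (phi h A)"
    unfolding honest_aaut_def using A(1) cB dom bij edge the by simp
  obtain p where p: "p \<in> leaves Tree A" using ex_leaf by blast
  have "f p \<in> leaves Tree B" using p lB by blast
  then have "f p \<in> B" "f p \<noteq> []" using carriesD(2)[OF fl[OF p]] Nil_S by (auto simp: PT.leaf_iff)
  then have Bne: "B \<noteq> {[]}" by blast
  have "p \<in> S" using p A(2) by blast
  moreover have "p \<in> A" using p by (simp add: PT.leaf_iff)
  ultimately have "A \<noteq> {[]}" using Nil_S by blast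
  moreover have "\<forall>u\<in>Fv A. \<exists>v. phi h A u = Some v \<and> carries h u v"
    using fF by (simp add: phi_def f_def)
  moreover have "ecol (the (phi h A u), the (phi h A v)) = ecol (u, v)" if "(u, v) \<in> forest_edges Tree A" for u v
  proof -
    have e: "(u, v) \<in> PT.E" "u \<in> Fv A" "v \<in> Fv A" using that by (auto simp: PT.forest_edges_T)
    obtain r where r: "v = u @ r" "u @ r \<in> S" using E_append[OF e(1)] by blast
    note c = carriesD(1-3)[OF fF[OF e(2)]]
    have "f u @ r \<in> S" using sync_S[OF c r(2)] .
    then show ?thesis using the e(2,3) fapp[OF e(2) r(2)] ecol_eq[OF c(2,1) _ r(2), of r] c(3) r(1) by simp
  qed
  ultimately show ?thesis using H Bne by blast
qed

context
  assumes nc: "non_circular g"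
begin

lemma carrier_V:
  "Q \<in> carrier (V_group Tree [] col) \<longleftrightarrow> (\<exists>\<phi>0. (\<exists>A B. hon A B \<phi>0) \<and> Q = rel `` {\<phi>0}) \<and>
    (\<exists>\<phi>\<in>Q. \<exists>A B. A \<noteq> {[]} \<and> B \<noteq> {[]} \<and> hon A B \<phi> \<and>
      (\<forall>(u, v)\<in>forest_edges Tree A. ecol (the (\<phi> u), the (\<phi> v)) = ecol (u, v)))"
  unfolding V_group_def AAut_def quotient_def by simp

lemma realize_Phi:
  assumes h: "h \<in> prefix_maps" and A: "cmpl A" "leaves Tree A \<subseteq> S"
    and D: "\<And>p. p \<in> leaves Tree A \<Longrightarrow> \<exists>v. carries h p v"
  shows "\<exists>B. hon A B (phi h A) \<and> B \<noteq> {[]} \<and> A \<noteq> {[]} \<and> phi h A \<in> Phi h \<and>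
    (\<forall>u\<in>Fv A. \<exists>v. phi h A u = Some v \<and> carries h u v) \<and>
    (\<forall>(u, v)\<in>forest_edges Tree A. ecol (the (phi h A u), the (phi h A v)) = ecol (u, v))"
proof -
  obtain B where B: "hon A B (phi h A)" "B \<noteq> {[]}" "A \<noteq> {[]}"
    "\<forall>u\<in>Fv A. \<exists>v. phi h A u = Some v \<and> carries h u v"
    "\<forall>(u, v)\<in>forest_edges Tree A. ecol (the (phi h A u), the (phi h A v)) = ecol (u, v)"
    using realize[OF nc h A D] by blast
  obtain N where "\<forall>u\<in>S. N \<le> length u \<longrightarrow> u \<in> Fv A" using deep_forest[OF A(1)] by blast
  then have "\<forall>u\<in>S. N \<le> length u \<longrightarrow> (\<exists>v. phi h A u = Some v \<and> carries h u v)" using B(4) by simp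
  then have "phi h A \<in> Phi h" unfolding Phi_def using B(1) by blast
  then show ?thesis using B by blast
qed

lemma Phi_carrier:
  assumes h: "h \<in> prefix_maps" shows "Phi h \<in> carrier (V_group Tree [] col)" "\<exists>\<phi>. \<phi> \<in> Phi h"
proof -
  obtain L where L: "\<forall>u\<in>S. L \<le> length u \<longrightarrow> (\<exists>v. carries h u v \<and> length u \<le> length v + L)"
    using carries_exists[OF h] by blast
  have lS: "leaves Tree (level L) \<subseteq> S" using level_leaf(1) by blast
  have "\<exists>v. carries h p v" if "p \<in> leaves Tree (level L)" for p using L level_leaf[OF that] by blast
  from realize_Phi[OF h level_complete lS this]
  obtain B where B: "hon (level L) B (phi h (level L))" "B \<noteq> {[]}" "level L \<noteq> {[]}" "phi h (level L) \<in> Phi h"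
    "\<forall>(u, v)\<in>forest_edges Tree (level L). ecol (the (phi h (level L) u), the (phi h (level L) v)) = ecol (u, v)"
    by blast
  have "Phi h = rel `` {phi h (level L)}" using Phi_class[OF nc B(4)] by simp
  then show "Phi h \<in> carrier (V_group Tree [] col)" unfolding carrier_V using B by blast
  show "\<exists>\<phi>. \<phi> \<in> Phi h" using B(4) by blast
qed

text \<open>
  Every point has arbitrarily long prefixes that are vertices.
\<close>

lemma Phi_inj:
  assumes h: "h \<in> prefix_maps" "k \<in> prefix_maps" and e: "Phi h = Phi k" shows "h = k"
proof (rule prefix_maps_eqI[OF h])
  fix x assume x: "x \<in> Y"
  obtain \<phi> where p: "\<phi> \<in> Phi h" "\<phi> \<in> Phi k" using Phi_carrier(2)[OF h(1)] e by auto
  obtain L where L: "\<forall>u\<in>S. L \<le> length u \<longrightarrow> (\<exists>v. \<phi> u = Some v \<and> carries h u v)" using p(1) by (auto simp: Phi_def)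
  obtain M where M: "\<forall>u\<in>S. M \<le> length u \<longrightarrow> (\<exists>v. \<phi> u = Some v \<and> carries k u v)" using p(2) by (auto simp: Phi_def)
  obtain n where n: "max L M \<le> n" "map x [0..<n] \<in> S" using next_S[OF x] by blast
  let ?u = "map x [0..<n]"
  obtain v where v: "\<phi> ?u = Some v" "carries h ?u v" using L n by auto
  have "\<exists>v. \<phi> ?u = Some v \<and> carries k ?u v" using M n by simp
  then have v': "carries k ?u v" using v(1) by simp
  have xe: "x = pcat ?u (\<lambda>j. x (n + j))" by (rule pcat_map_tail)
  then have "pcat ?u (\<lambda>j. x (n + j)) \<in> Y" using x by argo
  then have "h (pcat ?u (\<lambda>j. x (n + j))) = k (pcat ?u (\<lambda>j. x (n + j)))"
    using carriesD(4)[OF v(2)] carriesD(4)[OF v'] by simp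
  then show "h x = k x" using xe by argo
qed

lemma honest_comp:
  assumes p: "hon A B \<phi>" and q: "hon A' B' \<psi>" and r: "ran \<psi> = dom \<phi>"
  shows "hon A' B (\<phi> \<circ>\<^sub>m \<psi>)"
proof -
  have P: "cmpl A" "cmpl B" "dom \<phi> = Fv A" "bij_betw (the \<circ> \<phi>) (Fv A) (Fv B)"
    "\<And>u v. u \<in> Fv A \<Longrightarrow> v \<in> Fv A \<Longrightarrow> (u, v) \<in> forest_edges Tree A \<longleftrightarrow> (the (\<phi> u), the (\<phi> v)) \<in> forest_edges Tree B"
    using p by (auto simp: honest_aaut_def)
  have Q: "cmpl A'" "cmpl B'" "dom \<psi> = Fv A'" "bij_betw (the \<circ> \<psi>) (Fv A') (Fv B')"
    "\<And>u v. u \<in> Fv A' \<Longrightarrow> v \<in> Fv A' \<Longrightarrow> (u, v) \<in> forest_edges Tree A' \<longleftrightarrow> (the (\<psi> u), the (\<psi> v)) \<in> forest_edges Tree B'"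
    using q by (auto simp: honest_aaut_def)
  have "ran \<psi> = (the \<circ> \<psi>) ` dom \<psi>" by (force simp: ran_def dom_def image_iff)
  then have F: "Fv B' = Fv A" using Q(3,4) P(3) r by (simp add: bij_betw_def)
  then have FE: "forest_edges Tree B' = forest_edges Tree A" by (simp add: forest_edges_def)
  have cmp: "(\<phi> \<circ>\<^sub>m \<psi>) u = \<phi> (the (\<psi> u))" if "u \<in> Fv A'" for u
    using that Q(3) by (auto simp: map_comp_def split: option.splits)
  have inF: "the (\<psi> u) \<in> Fv A" if "u \<in> Fv A'" for u using bij_betwE[OF Q(4)] that F by auto
  have "dom (\<phi> \<circ>\<^sub>m \<psi>) = Fv A'"
  proof
    show "dom (\<phi> \<circ>\<^sub>m \<psi>) \<subseteq> Fv A'" using Q(3) by (auto simp: map_comp_def split: option.splits)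
    show "Fv A' \<subseteq> dom (\<phi> \<circ>\<^sub>m \<psi>)"
    proof
      fix u assume u: "u \<in> Fv A'"
      then have "the (\<psi> u) \<in> dom \<phi>" using inF P(3) by simp
      then show "u \<in> dom (\<phi> \<circ>\<^sub>m \<psi>)" using cmp[OF u] by (simp add: dom_def)
    qed
  qed
  moreover have "bij_betw (the \<circ> (\<phi> \<circ>\<^sub>m \<psi>)) (Fv A') (Fv B)"
  proof -
    have "bij_betw ((the \<circ> \<phi>) \<circ> (the \<circ> \<psi>)) (Fv A') (Fv B)" using bij_betw_trans[OF Q(4)] P(4) F by simp
    then show ?thesis using bij_betw_cong[of "Fv A'" "(the \<circ> \<phi>) \<circ> (the \<circ> \<psi>)" "the \<circ> (\<phi> \<circ>\<^sub>m \<psi>)" "Fv B"] cmp by simp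
  qed
  ultimately show ?thesis
    unfolding honest_aaut_def using Q(1) P(2) Q(5) P(5) cmp inF FE by simp
qed

text \<open>
  A long prefix is carried by \<open>k\<close> to a prefix that is shorter by a bounded amount only, so that
  \<open>\<phi>\<close> follows \<open>h\<close> there.
\<close>

lemma Phi_comp:
  assumes h: "h \<in> prefix_maps" "k \<in> prefix_maps" and p: "\<phi> \<in> Phi h" "\<psi> \<in> Phi k" and r: "ran \<psi> = dom \<phi>"
  shows "\<phi> \<circ>\<^sub>m \<psi> \<in> Phi (compose Y h k)"
proof -
  obtain L where L: "\<forall>u\<in>S. L \<le> length u \<longrightarrow> (\<exists>v. \<phi> u = Some v \<and> carries h u v)" using p(1) by (auto simp: Phi_def)
  obtain M where M: "\<forall>u\<in>S. M \<le> length u \<longrightarrow> (\<exists>v. \<psi> u = Some v \<and> carries k u v)" using p(2) by (auto simp: Phi_def)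
  obtain N where N: "\<forall>u\<in>S. N \<le> length u \<longrightarrow> (\<exists>v. carries k u v \<and> length u \<le> length v + N)"
    using carries_exists[OF h(2)] by blast
  have "\<exists>t. (\<phi> \<circ>\<^sub>m \<psi>) u = Some t \<and> carries (compose Y h k) u t" if u: "u \<in> S" "L + M + N \<le> length u" for u
  proof -
    have "M \<le> length u" "N \<le> length u" using u(2) by auto
    then obtain v v' where v: "\<psi> u = Some v" "carries k u v" "carries k u v'" "length u \<le> length v' + N" using L M N u(1) by meson
    then have "v' = v" using carries_unique[OF nc] by blast
    then have "L \<le> length v" using v(4) u(2) by simp
    then obtain t where t: "\<phi> v = Some t" "carries h v t" using L carriesD(2)[OF v(2)] by blast
    then show ?thesis using carries_comp[OF v(2) t(2)] v(1) by simp
  qed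
  moreover have "\<exists>A B. hon A B (\<phi> \<circ>\<^sub>m \<psi>)" using p honest_comp[OF _ _ r] unfolding Phi_def by blast
  ultimately show ?thesis unfolding Phi_def by blast
qed

text \<open>
  Realise \<open>k\<close> on a level so deep that the leaves of the target subtree \<open>B\<close> are still long enough
  for \<open>h\<close>, and realise \<open>h\<close> on \<open>B\<close>.
\<close>

lemma Phi_composable:
  assumes h: "h \<in> prefix_maps" and k: "k \<in> prefix_maps"
  shows "\<exists>\<phi>\<in>Phi h. \<exists>\<psi>\<in>Phi k. ran \<psi> = dom \<phi>"
proof -
  obtain L where L: "\<forall>u\<in>S. L \<le> length u \<longrightarrow> (\<exists>v. carries h u v \<and> length u \<le> length v + L)"
    using carries_exists[OF h] by blast
  obtain M where M: "\<forall>u\<in>S. M \<le> length u \<longrightarrow> (\<exists>v. carries k u v \<and> length u \<le> length v + M)"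
    using carries_exists[OF k] by blast
  \<comment> \<open>A prefix loses at most \<open>M\<close> letters under \<open>k\<close>, so length \<open>L\<close> is left.\<close>
  let ?A = "level (L + M)"
  have lS: "leaves Tree ?A \<subseteq> S" using level_leaf(1) by blast
  have "\<exists>v. carries k p v" if p: "p \<in> leaves Tree ?A" for p
  proof -
    have "M \<le> length p" using level_leaf(2)[OF p] by simp
    then show ?thesis using M level_leaf(1)[OF p] by blast
  qed
  from realize_Phi[OF k level_complete lS this]
  obtain B where B: "hon ?A B (phi k ?A)" "B \<noteq> {[]}" "phi k ?A \<in> Phi k"
    "\<forall>u\<in>Fv ?A. \<exists>v. phi k ?A u = Some v \<and> carries k u v" by blast
  have cB: "cmpl B" and bB: "bij_betw (the \<circ> phi k ?A) (Fv ?A) (Fv B)" and dB: "dom (phi k ?A) = Fv ?A"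
    using B(1) by (auto simp: honest_aaut_def)
  have "\<exists>v. carries h q v" if q: "q \<in> leaves Tree B" for q
  proof -
    have qV: "q \<in> PT.V" using q PT.complete_V[OF cB] by (auto simp: PT.leaf_iff)
    have "q \<in> Fv B" unfolding PT.forest_T[OF cB] using qV q prefix_order.order_refl by blast
    then obtain u where u: "u \<in> Fv ?A" "q = the (phi k ?A u)" using bB unfolding bij_betw_def by fastforce
    then have c: "carries k u q" using B(4) by fastforce
    note u' = level_forest[OF u(1)]
    have "M \<le> length u" using u'(2) by simp
    then obtain v where v: "carries k u v" "length u \<le> length v + M" using M u'(1) by blast
    then have "q = v" using carries_unique[OF nc c] by blast
    then have "L \<le> length q" using v(2) u'(2) by simp
    then show ?thesis using L carriesD(2)[OF c] by blast
  qed
  from realize_Phi[OF h cB nonroot_leaves(1)[OF cB B(2)] this]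
  obtain C where C: "hon B C (phi h B)" "phi h B \<in> Phi h" by blast
  have "dom (phi h B) = Fv B" using C(1) by (auto simp: honest_aaut_def)
  moreover have "ran (phi k ?A) = (the \<circ> phi k ?A) ` dom (phi k ?A)" by (force simp: ran_def dom_def image_iff)
  ultimately have "ran (phi k ?A) = dom (phi h B)" using bB dB by (simp add: bij_betw_def)
  then show ?thesis using B(3) C(2) by blast
qed

lemma Phi_mult:
  assumes h: "h \<in> prefix_maps" and k: "k \<in> prefix_maps"
  shows "Phi (h \<otimes>\<^bsub>HH\<^esub> k) = Phi h \<otimes>\<^bsub>V_group Tree [] col\<^esub> Phi k"
proof -
  have hk: "h \<otimes>\<^bsub>HH\<^esub> k = compose Y h k" using prefix_maps_Bij h k by (simp add: BijGroup_def)
  have cls: "rel `` {\<phi> \<circ>\<^sub>m \<psi>} = Phi (compose Y h k)"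
    if "\<phi> \<in> Phi h" "\<psi> \<in> Phi k" "ran \<psi> = dom \<phi>" for \<phi> \<psi>
    using Phi_class[OF nc Phi_comp[OF h k that]] .
  have "Phi h \<otimes>\<^bsub>V_group Tree [] col\<^esub> Phi k =
    \<Union> {rel `` {\<phi> \<circ>\<^sub>m \<psi>} | \<phi> \<psi>. \<phi> \<in> Phi h \<and> \<psi> \<in> Phi k \<and> ran \<psi> = dom \<phi>}"
    by (simp add: V_group_def AAut_def)
  also have "\<dots> = Phi (compose Y h k)"
  proof
    show "\<Union> {rel `` {\<phi> \<circ>\<^sub>m \<psi>} | \<phi> \<psi>. \<phi> \<in> Phi h \<and> \<psi> \<in> Phi k \<and> ran \<psi> = dom \<phi>} \<subseteq> Phi (compose Y h k)"
      using cls by blast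
    obtain \<phi> \<psi> where *: "\<phi> \<in> Phi h" "\<psi> \<in> Phi k" "ran \<psi> = dom \<phi>" using Phi_composable[OF h k] by blast
    have "rel `` {\<phi> \<circ>\<^sub>m \<psi>} \<in> {rel `` {\<phi> \<circ>\<^sub>m \<psi>} | \<phi> \<psi>. \<phi> \<in> Phi h \<and> \<psi> \<in> Phi k \<and> ran \<psi> = dom \<phi>}" using * by blast
    then show "Phi (compose Y h k) \<subseteq> \<Union> {rel `` {\<phi> \<circ>\<^sub>m \<psi>} | \<phi> \<psi>. \<phi> \<in> Phi h \<and> \<psi> \<in> Phi k \<and> ran \<psi> = dom \<phi>}"
      unfolding cls[OF *] by (rule Union_upper)
  qed
  finally show ?thesis using hk by simp
qed

text \<open>
  A colour preserving isomorphism of forests preserves labels and appended words, since the colour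
  of an edge knows both. So it is determined by the images \<open>f p\<close> of the leaves, and \<open>p z \<mapsto> f p z\<close>
  defines a prefix replacement map of \<open>Y\<close>.
\<close>

lemma Phi_surj:
  assumes Q: "Q \<in> carrier (V_group Tree [] col)" shows "\<exists>h\<in>prefix_maps. Phi h = Q"
proof -
  obtain \<phi>0 \<phi> A B where *: "Q = rel `` {\<phi>0}" "\<phi> \<in> Q" "A \<noteq> {[]}" "B \<noteq> {[]}" "hon A B \<phi>"
    and colp: "\<forall>(u, v)\<in>forest_edges Tree A. ecol (the (\<phi> u), the (\<phi> v)) = ecol (u, v)"
    using Q unfolding carrier_V by blast
  have Q': "Q = rel `` {\<phi>}"
  proof -
    have r: "(\<phi>0, \<phi>) \<in> rel" using * by simp
    then obtain L where L: "\<forall>u\<in>S. L \<le> length u \<longrightarrow> \<phi>0 u = \<phi> u" unfolding rel_iff by blast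
    have "(\<phi>0, \<psi>) \<in> rel \<longleftrightarrow> (\<phi>, \<psi>) \<in> rel" for \<psi>
    proof -
      have "(\<exists>M. \<forall>u\<in>S. M \<le> length u \<longrightarrow> \<phi>0 u = \<psi> u) \<longleftrightarrow> (\<exists>M. \<forall>u\<in>S. M \<le> length u \<longrightarrow> \<phi> u = \<psi> u)"
        using L by (metis max.bounded_iff)
      then show ?thesis using r unfolding rel_iff by blast
    qed
    then show ?thesis using *(1) by blast
  qed
  have cA: "cmpl A" and cB: "cmpl B" and dA: "dom \<phi> = Fv A" and bA: "bij_betw (the \<circ> \<phi>) (Fv A) (Fv B)"
    and eA: "\<And>u v. u \<in> Fv A \<Longrightarrow> v \<in> Fv A \<Longrightarrow> (u, v) \<in> forest_edges Tree A \<longleftrightarrow> (the (\<phi> u), the (\<phi> v)) \<in> forest_edges Tree B"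
    using *(5) by (auto simp: honest_aaut_def)
  define f where "f u = the (\<phi> u)" for u
  note SA = nonroot_leaves[OF cA *(3)] and SB = nonroot_leaves[OF cB *(4)]
  have fB: "f u \<in> Fv B" if "u \<in> Fv A" for u using bij_betwE[OF bA] that by (auto simp: f_def)
  have finj: "u = v" if "u \<in> Fv A" "v \<in> Fv A" "f u = f v" for u v
    using inj_onD[OF bij_betw_imp_inj_on[OF bA]] that by (simp add: f_def)
  have fsurj: "\<exists>u\<in>Fv A. f u = v" if "v \<in> Fv B" for v
    using bij_betw_imp_surj_on[OF bA] that by (force simp: f_def image_iff)
  have FI: "u \<in> Fv C" if "cmpl C" "p \<in> leaves Tree C" "prefix p u" "u \<in> PT.V" for C p u
    unfolding PT.forest_T[OF that(1)] using that by blast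
  have leafF: "p \<in> Fv C" if "cmpl C" "p \<in> leaves Tree C" for C p
    using FI[OF that prefix_order.order_refl] that PT.complete_V by (auto simp: PT.leaf_iff)
  have Fleaf: "\<exists>p\<in>leaves Tree C. \<exists>r. u = p @ r" if "cmpl C" "u \<in> Fv C" for C u
    using that(2) unfolding PT.forest_T[OF that(1)] prefix_def by blast
  have Fup: "v \<in> Fv C" if "cmpl C" "u \<in> Fv C" "prefix u v" "v \<in> PT.V" for C u v
    using that(2) prefix_order.trans[OF _ that(3)] that(4) unfolding PT.forest_T[OF that(1)] by blast
  have edge: "lab (f u) = lab u \<and> (\<exists>r. f v = f u @ r \<and> v = u @ r)" if e: "(u, v) \<in> PT.E" and u: "u \<in> Fv A" for u v
  proof -
    have v: "v \<in> Fv A" using Fup[OF cA u PT.ED(5,3)[OF e]] .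
    then have fe: "(u, v) \<in> forest_edges Tree A" using e u by (simp add: PT.forest_edges_T)
    then have "(f u, f v) \<in> forest_edges Tree B" using eA[OF u v] by (simp add: f_def)
    then have e': "(f u, f v) \<in> PT.E" by (simp add: PT.forest_edges_T)
    have c: "ecol (f u, f v) = ecol (u, v)" using colp fe unfolding f_def by blast
    have "f u \<in> S" "u \<in> S" using fB[OF u] u SA SB by blast+
    from ecol_E_eq(1,2)[OF e' e this c] show ?thesis by simp
  qed
  have flab: "lab (f u) = lab u" if u: "u \<in> Fv A" for u
  proof -
    have "u \<in> PT.V" using u SA PT.SV by blast
    then obtain c where "(u, c) \<in> PT.E" using child_exists by blast
    then show ?thesis using edge u by blast
  qed
  have fapp: "f (u @ r) = f u @ r" if u: "u \<in> Fv A" "u @ r \<in> S" for u r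
    using u(2)
  proof (induction "length r" arbitrary: r rule: less_induct)
    case less
    show ?case
    proof (cases "r = []")
      case False
      obtain t where t: "(t, u @ r) \<in> PT.E" using PT.parent_ex[OF less.prems] by blast
      have uV: "u \<in> PT.V" using u SA PT.SV by blast
      have "prefix u t" using PT.below_parent[OF t uV] False by (simp add: strict_prefix_def)
      then obtain s where s: "t = u @ s" by (auto simp: prefix_def)
      have "t \<in> Fv A" using Fup[OF cA u(1) \<open>prefix u t\<close> PT.ED(1)[OF t]] .
      then obtain q where q: "f (u @ r) = f t @ q" "u @ r = t @ q" using edge[OF t] by blast
      have "length s < length r" using prefix_length_less[OF PT.ED(4)[OF t]] s by simp
      then have "f t = f u @ s" using less.hyps[of s] s \<open>t \<in> Fv A\<close> SA by blast
      then show ?thesis using q s by simp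
    qed simp
  qed
  have fS: "f u \<in> S" "u \<in> S" if "u \<in> Fv A" for u using fB[OF that] that SA SB by blast+
  have fleaf1: "\<exists>p\<in>leaves Tree A. f p = q" if q: "q \<in> leaves Tree B" for q
  proof -
    obtain u where u: "u \<in> Fv A" "f u = q" using fsurj[OF leafF[OF cB q]] by blast
    obtain p r where p: "p \<in> leaves Tree A" "u = p @ r" using Fleaf[OF cA u(1)] by blast
    note pF = leafF[OF cA p(1)]
    have fu: "q = f p @ r" using fapp[OF pF] fS(2)[OF u(1)] u(2) p(2) by simp
    obtain q' s where q': "q' \<in> leaves Tree B" "f p = q' @ s" using Fleaf[OF cB fB[OF pF]] by blast
    have "prefix q' q" using fu q'(2) by simp
    then have "q' = q" using PT.forest_leaf_unique[OF cB q'(1) q] prefix_order.order_refl by blast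
    then have "f p = q" using fu q'(2) by simp
    then show ?thesis using p(1) by blast
  qed
  have fleaf2: "f p \<in> leaves Tree B" if p: "p \<in> leaves Tree A" for p
  proof -
    note pF = leafF[OF cA p]
    obtain q s where q: "q \<in> leaves Tree B" "f p = q @ s" using Fleaf[OF cB fB[OF pF]] by blast
    obtain p' where p': "p' \<in> leaves Tree A" "f p' = q" using fleaf1[OF q(1)] by blast
    note pF' = leafF[OF cA p'(1)]
    have "p' @ s \<in> S" using sync_S[OF fS[OF pF'] flab[OF pF']] fS(1)[OF pF] q(2) p'(2) by simp
    moreover have "p' @ s \<in> Fv A" using Fup[OF cA pF', of "p' @ s"] PT.SV[OF calculation] by simp
    moreover have "f (p' @ s) = f p" using fapp[OF pF' calculation(1)] q(2) p'(2) by simp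
    ultimately have "p' @ s = p" using finj[OF _ pF] by blast
    then have "p' = p" using PT.forest_leaf_unique[OF cA p'(1) p, of p] by auto
    then show ?thesis using p'(2) q(1) by simp
  qed
  \<comment> \<open>Every point of \<open>Y\<close> starts with exactly one leaf of \<open>A\<close>, so this is well defined.\<close>
  define h where "h = (\<lambda>x\<in>Y. THE y. \<exists>p\<in>leaves Tree A. \<exists>z. x = pcat p z \<and> y = pcat (f p) z)"
  have hp: "h (pcat p z) = pcat (f p) z" if p: "p \<in> leaves Tree A" and z: "pcat p z \<in> Y" for p z
  proof -
    have "(THE y. \<exists>q\<in>leaves Tree A. \<exists>z'. pcat p z = pcat q z' \<and> y = pcat (f q) z') = pcat (f p) z"
    proof (rule the_equality)
      show "\<exists>q\<in>leaves Tree A. \<exists>z'. pcat p z = pcat q z' \<and> pcat (f p) z = pcat (f q) z'" using p by blast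
      fix y assume "\<exists>q\<in>leaves Tree A. \<exists>z'. pcat p z = pcat q z' \<and> y = pcat (f q) z'"
      then obtain q z' where q: "q \<in> leaves Tree A" "pcat p z = pcat q z'" "y = pcat (f q) z'" by blast
      have "p = q" using leaf_of_point_unique[OF cA p q(1,2)] .
      then show "y = pcat (f p) z" using q(2,3) pcat_inj by blast
    qed
    then show ?thesis using z by (simp add: h_def)
  qed
  have hY: "pcat (f u) z \<in> Y" if "u \<in> Fv A" "pcat u z \<in> Y" for u z
    using swap_Y[OF fS(2,1)[OF that(1)] flab[OF that(1), symmetric] that(2)] .
  have car: "carries h u (f u)" if u: "u \<in> Fv A" for u
    unfolding carries_def
  proof (intro conjI allI impI)
    show "u \<in> S" "f u \<in> S" "lab u = lab (f u)" using fS[OF u] flab[OF u] by simp_all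
    fix z assume z: "pcat u z \<in> Y"
    obtain p r where p: "p \<in> leaves Tree A" "u = p @ r" using Fleaf[OF cA u] by blast
    have "f u = f p @ r" using fapp[OF leafF[OF cA p(1)]] fS(2)[OF u] p(2) by simp
    then show "h (pcat u z) = pcat (f u) z" using hp[OF p(1), of "pcat r z"] z p(2) by (simp add: pcat_append)
  qed
  have hB: "h \<in> Bij Y"
  proof -
    have hI: "h x \<in> Y" if x: "x \<in> Y" for x
    proof -
      obtain p z where p: "p \<in> leaves Tree A" "x = pcat p z" using leaf_of_point[OF cA x] by blast
      show ?thesis using hp[OF p(1)] hY[OF leafF[OF cA p(1)]] p(2) x by simp
    qed
    have "inj_on h Y"
    proof (rule inj_onI)
      fix x y assume xy: "x \<in> Y" "y \<in> Y" "h x = h y"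
      obtain p z where p: "p \<in> leaves Tree A" "x = pcat p z" using leaf_of_point[OF cA xy(1)] by blast
      obtain q z' where q: "q \<in> leaves Tree A" "y = pcat q z'" using leaf_of_point[OF cA xy(2)] by blast
      have e: "pcat (f p) z = pcat (f q) z'" using hp[OF p(1)] hp[OF q(1)] p(2) q(2) xy by simp
      have "f p = f q" using leaf_of_point_unique[OF cB fleaf2[OF p(1)] fleaf2[OF q(1)] e] .
      then have "p = q" using finj leafF[OF cA] p(1) q(1) by blast
      then show "x = y" using e p(2) q(2) pcat_inj by blast
    qed
    moreover have "h ` Y = Y"
    proof
      show "h ` Y \<subseteq> Y" using hI by blast
      show "Y \<subseteq> h ` Y"
      proof
        fix y assume y: "y \<in> Y"
        obtain q z where q: "q \<in> leaves Tree B" "y = pcat q z" using leaf_of_point[OF cB y] by blast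
        obtain p where p: "p \<in> leaves Tree A" "f p = q" using fleaf1[OF q(1)] by blast
        note pF = leafF[OF cA p(1)]
        have "pcat p z \<in> Y" using swap_Y[OF fS[OF pF] flab[OF pF]] y q(2) p(2) by simp
        moreover have "h (pcat p z) = y" using hp[OF p(1) calculation] p(2) q(2) by simp
        ultimately show "y \<in> h ` Y" by (metis imageI)
      qed
    qed
    ultimately show ?thesis by (simp add: Bij_def bij_betw_def h_def)
  qed
  have "\<exists>a b. lp h x a b" if x: "x \<in> Y" for x
  proof -
    obtain p z where p: "p \<in> leaves Tree A" "x = pcat p z" using leaf_of_point[OF cA x] by blast
    have "lp h x (length p) (length (f p))"
      unfolding lp_def
    proof (intro ballI impI)
      fix y assume y: "y \<in> Y" "agree (length p) x y"
      have "map y [0..<length p] = p" using y(2) map_pcat[of p z] p(2) by (metis map_eq_agree)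
      then have ye: "y = pcat p (\<lambda>j. y (length p + j))" using pcat_map_tail[of y "length p"] by simp
      then have yY: "pcat p (\<lambda>j. y (length p + j)) \<in> Y" using y(1) by argo
      have hy: "h y = pcat (f p) (\<lambda>j. y (length p + j))" using hp[OF p(1) yY] ye by argo
      have hx: "h x = pcat (f p) z" using hp[OF p(1)] p(2) x by simp
      show "agree (length (f p)) (h x) (h y) \<and> (\<forall>j. h y (length (f p) + j) = y (length p + j))"
        unfolding hx hy by (simp add: agree_def pcat_def)
    qed
    then show ?thesis by blast
  qed
  then have hH: "h \<in> prefix_maps" using hB by (simp add: prefix_maps_def)
  obtain N where N: "\<forall>u\<in>S. N \<le> length u \<longrightarrow> u \<in> Fv A" using deep_forest[OF cA] by blast
  have "\<phi> u = Some (f u)" if "u \<in> Fv A" for u using dA that unfolding f_def by (metis domIff option.collapse)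
  then have "\<forall>u\<in>S. N \<le> length u \<longrightarrow> (\<exists>v. \<phi> u = Some v \<and> carries h u v)" using N car by blast
  then have "\<phi> \<in> Phi h" unfolding Phi_def using *(5) by blast
  then show ?thesis using hH Phi_class[OF nc] Q' by blast
qed

lemma full_group_iso: "HH \<cong> V_group Tree [] col"
proof -
  have "Phi \<in> hom HH (V_group Tree [] col)"
    by (rule homI) (use Phi_carrier(1) Phi_mult in auto)
  moreover have "bij_betw Phi (carrier HH) (carrier (V_group Tree [] col))"
    unfolding bij_betw_def
  proof
    show "inj_on Phi (carrier HH)" using Phi_inj by (auto intro: inj_onI)
    show "Phi ` carrier HH = carrier (V_group Tree [] col)"
      using Phi_surj Phi_carrier(1) by force
  qed
  ultimately have "Phi \<in> iso HH (V_group Tree [] col)" by (simp add: iso_def)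
  then show ?thesis by (rule is_isoI)
qed

end

end

section \<open>The completion and the patterning of a full group\<close>

theorem theorem4p3:
  fixes g :: "('v, 'e) pre_digraph"
    and Y :: "(nat \<Rightarrow> 'e) set"
    and P :: "nat set"
  assumes "fin_digraph g"
    and "diconnected g"
    and "non_circular g"
    and "clopenin (shift_top g) Y"
    and "Y \<noteq> {}"
    and "finite P"
    and "\<forall>p\<in>P. prime p"
  defines "H \<equiv> full_group (groupoid_restrict (shift_groupoid g) Y)"
  shows
    "(\<exists>(G :: ('e list \<rightharpoonup> 'e list) set monoid) TG \<phi>.
        tdlc_completion H (discrete_topology (carrier H)) G TG \<phi> \<and>
        lpc G TG = P \<and>
        (\<forall>U. compact_open_subgroup G TG U \<longrightarrow>
           commensurated H (\<phi> -` U \<inter> carrier H) \<and>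
           lpc_class H (commens_class H (\<phi> -` U \<inter> carrier H)) = P)) \<and>
     (\<exists>(T :: 'e list pair_pre_digraph) v0 (C :: ('e list, nat, nat) colouring)
        (F :: nat \<Rightarrow> (nat \<Rightarrow> nat) set).
        locally_finite_tree T v0 \<and>
        colouring_structure T v0 C \<and>
        H \<cong> V_group T v0 C \<and>
        patterning T v0 C F \<and>
        P = {p. prime p \<and> p dvd (\<Prod>l\<in>labels C. card (F l))})"
proof -
  interpret fin_digraph g by (rule assms(1))
  interpret sc: shift_clopen g Y by unfold_locales (rule assms(4))
  define m where "m = \<Prod>P"
  have m0: "0 < m" unfolding m_def using assms(6,7) by (auto intro!: prod_pos prime_gt_0_nat)
  have Pm: "P = {p. prime p \<and> p dvd m}"
  proof
    show "P \<subseteq> {p. prime p \<and> p dvd m}" using assms(6,7) by (auto simp: m_def intro: dvd_prodI)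
    show "{p. prime p \<and> p dvd m} \<subseteq> P"
    proof
      fix p assume "p \<in> {p. prime p \<and> p dvd m}"
      then have p: "prime p" "p dvd m" by auto
      then obtain q where q: "q \<in> P" "p dvd q" using prime_dvd_prod_iff[OF assms(6) p(1), of "\<lambda>x. x"] by (auto simp: m_def)
      then have "p = q" using primes_dvd_imp_eq p(1) assms(7) by blast
      then show "p \<in> P" using q(1) by simp
    qed
  qed
  obtain w and d :: "nat \<Rightarrow> 'e list" and \<mu> \<rho> l where
    d: "\<forall>i<m. awalk w (d i) w \<and> length (d i) = l \<and> take (length \<mu>) (d i) = \<mu> \<and> drop (l - length \<mu>) (d i) = \<rho>"
    and d': "inj_on d {..<m}" "0 < length \<mu>" "2 * length \<mu> \<le> l" "awalk w \<mu> w"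
      "\<forall>i<m. \<forall>x a b. occurs x a (d i) \<longrightarrow> occurs x b \<mu> \<longrightarrow> a \<le> b \<longrightarrow> b < a + l \<longrightarrow> b = a"
    using sc.digit_words[OF assms(2,3), of m] by blast
  \<comment> \<open>One digit for each residue modulo the product of the primes.\<close>
  interpret ds: digit_system g Y d \<mu> \<rho> l m w
    by unfold_locales (use assms(2,5) m0 d d' in blast)+
  obtain x where x: "x \<in> Y" using assms(5) by blast
  obtain y where y: "y \<in> Y" "y \<noteq> x" using ds.another_point[OF assms(3) x] by blast
  obtain j where j: "y j \<noteq> x j" using y(2) by (auto simp: fun_eq_iff)
  \<comment> \<open>Two points that differ at \<open>j\<close> give the root two children.\<close>
  have "\<not> agree (max (max sc.depth l) (Suc j)) x y" using j unfolding agree_def by (metis lessI max.strict_coboundedI2)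
  then interpret dt: digit_tree g Y d \<mu> \<rho> l m w "max (max sc.depth l) (Suc j)"
    by unfold_locales (use x y in auto)
  have H: "H = ds.HH" unfolding H_def by (rule sc.full_group_eq)
  have 1: "\<exists>(G :: ('e list \<rightharpoonup> 'e list) set monoid) TG \<phi>.
        tdlc_completion H (discrete_topology (carrier H)) G TG \<phi> \<and>
        lpc G TG = P \<and>
        (\<forall>U. compact_open_subgroup G TG U \<longrightarrow>
           commensurated H (\<phi> -` U \<inter> carrier H) \<and>
           lpc_class H (commens_class H (\<phi> -` U \<inter> carrier H)) = P)"
    unfolding H using ds.completion_part[OF assms(6) _ m_def] assms(7) by blast
  have "P = {p. prime p \<and> p dvd (\<Prod>l\<in>labels dt.col. card (dt.pat l))}" unfolding dt.pat_card by (rule Pm)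
  then have 2: "locally_finite_tree (prefix_tree.T dt.S) [] \<and> colouring_structure (prefix_tree.T dt.S) [] dt.col \<and>
      H \<cong> V_group (prefix_tree.T dt.S) [] dt.col \<and> patterning (prefix_tree.T dt.S) [] dt.col dt.pat \<and>
      P = {p. prime p \<and> p dvd (\<Prod>l\<in>labels dt.col. card (dt.pat l))}"
    unfolding H using dt.tree_locally_finite dt.colouring dt.full_group_iso[OF assms(3)] dt.pat_patterning by blast
  show ?thesis
  proof
    show "\<exists>(G :: ('e list \<rightharpoonup> 'e list) set monoid) TG \<phi>.
        tdlc_completion H (discrete_topology (carrier H)) G TG \<phi> \<and>
        lpc G TG = P \<and>
        (\<forall>U. compact_open_subgroup G TG U \<longrightarrow>
           commensurated H (\<phi> -` U \<inter> carrier H) \<and>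
           lpc_class H (commens_class H (\<phi> -` U \<inter> carrier H)) = P)" by (rule 1)
  qed (use 2 in blast)
qed

end
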